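(* Any homogeneous bihamiltonian structure is strictly Lenard-integrable on small open subsets; that is, if a bihamiltonian structure on $M$ is homogeneous, then it is strictly Lenard-integrable at every point $m_0\in M$.
   Context: A bihamiltonian structure is a ($C^\infty$ or analytic) manifold $M$ with two Poisson brackets $\{,\}_1,\{,\}_2$ which are compatible, i.e. $\lambda_1\{,\}_1+\lambda_2\{,\}_2$ is Poisson for all $\lambda_1,\lambda_2$. "On small open subsets" means on an appropriate neighbourhood of any given point. A function $F$ is Casimir for $\{,\}$ if $\{F,f\}=0$ for every function $f$. Each bracket induces on each cotangent space a skew-symmetric pairing $(df|_m,dg|_m)=\{f,g\}|_m$, so one gets a pair of skew-symmetric pairings on $T_m^*M\otimes\mathbb C$ (on $T_m^*M$ if $M$ is complex). Any pair of skew-symmetric pairings on a finite-dimensional complex vector space is a direct sum of indecomposable pairs, with types uniquely determined: Jordan blocks (even-dimensional), and Kronecker blocks $\mathcal K_{2k-1}$ (odd-dimensional): basis $\mathbf w_0,\dots,\mathbf w_{2k-2}$, the only nonzero pairings (up to skew-symmetry) being $(\mathbf w_{2l},\mathbf w_{2l+1})_1=1$, $(\mathbf w_{2l+1},\mathbf w_{2l+2})_2=1$, $0\le l\le k-2$. A bihamiltonian structure is homogeneous (of type $(2k_1-1,\dots,2k_s-1)$) if for every $m$ the pair of pairings on $T_m^*M\otimes\mathbb C$ is isomorphic to $\bigoplus_i\mathcal K_{2k_i-1}$, with $k_1,\dots,k_s$ independent of $m$. The action dimension of a complex vector space $V$ with two skew-symmetric pairings is $\frac{\dim V+s}{2}$,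 where $s$ is the number of Kronecker blocks of $V$. The action dimension of a bihamiltonian structure on $M$ at $m_0$ is the lower limit, as $m\to m_0$, of the action dimensions of $T_m^*M\otimes\mathbb C$. Functions on an open set $V$ are called (functionally) independent if their differentials are linearly independent at generic points (points of an open dense subset of $V$); a function depends functionally on a collection if at generic points its differential lies in the span of the differentials of the collection. Anchored Lenard scheme near $m_0$: on a neighbourhood $V$ of $m_0$ take a maximal independent collection $H_0^{(1)},\dots,H_0^{(r)}$ of Casimir functions for $\{,\}_1$, and for each $t$ solve the recurrence relations $\{H_i^{(t)},f\}_2=-\{H_{i+1}^{(t)},f\}_1$ for all functions $f$, until the new functions depend on the old ones; thus one obtains numbers $k_1,\dots,k_r$ and an independent collection $\{H_i^{(t)}\}$, $1\le t\le r$, $0\le i\le k_t$, on which all further functions $H_i^{(t)}$ depend functionally. The structure is Lenard-integrable at $m_0$ if the number $\sum_{t=1}^r(k_t+1)$ of independent functions provided by the anchored Lenard scheme in an appropriate neighbourhood of $m_0$ equals the action dimension of $M$ at $m_0$. It is strictly Lenard-integrable at $m_0$ if it is Lenard-integrable at $m_0$ and the sequences $H_i^{(t)}$ can be continued (satisfying the recurrence relations) for all $i>k_t$ as well. *)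

theory Defs
  imports "HOL-Analysis.Analysis" "HOL-Library.Function_Algebras"
begin

section \<open>Ground fields and regular functions on open subsets of coordinate space\<close>

class ground_field = real_normed_field +
  fixes to_complex :: "'a \<Rightarrow> complex"
  assumes to_complex_add: "to_complex (x + y) = to_complex x + to_complex y"
    and to_complex_mult: "to_complex (x * y) = to_complex x * to_complex y"
    and norm_to_complex: "norm (to_complex x) = norm x"

instantiation real :: ground_field
begin
definition to_complex_real :: "real \<Rightarrow> complex" where "to_complex_real = complex_of_real"
instance by standard (simp_all add: to_complex_real_def)
end

instantiation complex :: ground_field
begin
definition to_complex_complex :: "complex \<Rightarrow> complex" where "to_complex_complex = id"
instance by standard (simp_all add: to_complex_complex_def)
end

primrec times_differentiable_on ::
    "nat \<Rightarrow> (real ^ 'n::finite) set \<Rightarrow> (real ^ 'n \<Rightarrow> real) \<Rightarrow> bool" where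
  "times_differentiable_on 0 S f \<longleftrightarrow> continuous_on S f"
| "times_differentiable_on (Suc p) S f \<longleftrightarrow>
     (\<forall>x\<in>S. f differentiable at x) \<and>
     (\<forall>v. times_differentiable_on p S (\<lambda>x. frechet_derivative f (at x) v))"

definition smooth_fun_on :: "(real ^ 'n::finite) set \<Rightarrow> (real ^ 'n \<Rightarrow> real) \<Rightarrow> bool" where
  "smooth_fun_on S f \<longleftrightarrow> (\<forall>p. times_differentiable_on p S f)"

text \<open>Local power series expansions in several variables, indexed by multi-indices
  \<open>\<alpha> :: 'n \<Rightarrow> nat\<close>; real-analytic for real scalars, holomorphic for complex ones.\<close>
definition analytic_fun_on ::
    "('k::ground_field ^ 'n::finite) set \<Rightarrow> ('k ^ 'n \<Rightarrow> 'k) \<Rightarrow> bool" where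
  "analytic_fun_on S f \<longleftrightarrow>
     (\<forall>a\<in>S. \<exists>r>0. \<exists>c :: ('n \<Rightarrow> nat) \<Rightarrow> 'k. \<forall>x\<in>ball a r.
        ((\<lambda>\<alpha>. c \<alpha> * (\<Prod>i\<in>UNIV. (x $ i - a $ i) ^ \<alpha> i)) has_sum f x) UNIV)"

section \<open>Pairs of skew-symmetric pairings on complex vector spaces\<close>

definition fscale :: "'k::field \<Rightarrow> ('x \<Rightarrow> 'k) \<Rightarrow> 'x \<Rightarrow> 'k" where
  "fscale c f = (\<lambda>x. c * f x)"

interpretation fs: vector_space "fscale :: 'k::field \<Rightarrow> ('x \<Rightarrow> 'k) \<Rightarrow> 'x \<Rightarrow> 'k"
  by standard (auto simp: fscale_def algebra_simps)

text \<open>Linear independence of an indexed family (repeated members make it dependent).\<close>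
definition independent_family :: "'i set \<Rightarrow> ('i \<Rightarrow> 'x \<Rightarrow> 'k::field) \<Rightarrow> bool" where
  "independent_family I w \<longleftrightarrow> inj_on w I \<and> fs.independent (w ` I)"

definition bilinear_on ::
    "('x \<Rightarrow> complex) set \<Rightarrow> (('x \<Rightarrow> complex) \<Rightarrow> ('x \<Rightarrow> complex) \<Rightarrow> complex) \<Rightarrow> bool" where
  "bilinear_on V B \<longleftrightarrow>
     (\<forall>u\<in>V. \<forall>v\<in>V. \<forall>w\<in>V. \<forall>c.
        B (u + v) w = B u w + B v w \<and> B (fscale c u) w = c * B u w \<and>
        B w (u + v) = B w u + B w v \<and> B w (fscale c u) = c * B w u)"

text \<open>Indecomposable pairs: Jordan blocks of dimension \<open>2k\<close> with a finite or infinite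
  eigenvalue, and Kronecker blocks of dimension \<open>2k - 1\<close>, where \<open>k\<close> is positive.\<close>
datatype block = Jordan nat complex | Jordan_infinity nat | Kronecker nat

fun block_index :: "block \<Rightarrow> nat" where
  "block_index (Jordan k e) = k"
| "block_index (Jordan_infinity k) = k"
| "block_index (Kronecker k) = k"

fun block_dim :: "block \<Rightarrow> nat" where
  "block_dim (Jordan k e) = 2 * k"
| "block_dim (Jordan_infinity k) = 2 * k"
| "block_dim (Kronecker k) = 2 * k - 1"

fun is_Kronecker :: "block \<Rightarrow> bool" where
  "is_Kronecker (Kronecker k) = True"
| "is_Kronecker b = False"

text \<open>The skew form on a \<open>2k\<close>-dimensional space with Gram matrix \<open>((0, N), (-N\<^sup>T, 0))\<close>.\<close>
definition off_diagonal_form :: "nat \<Rightarrow> (nat \<Rightarrow> nat \<Rightarrow> complex) \<Rightarrow> nat \<Rightarrow> nat \<Rightarrow> complex" where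
  "off_diagonal_form k N a b =
     (if a < k \<and> k \<le> b then N a (b - k) else if b < k \<and> k \<le> a then - N b (a - k) else 0)"

definition jordan_matrix :: "complex \<Rightarrow> nat \<Rightarrow> nat \<Rightarrow> complex" where
  "jordan_matrix e a b = (if a = b then e else if b = Suc a then 1 else 0)"

definition identity_matrix :: "nat \<Rightarrow> nat \<Rightarrow> complex" where
  "identity_matrix a b = (if a = b then 1 else 0)"

fun block_form1 :: "block \<Rightarrow> nat \<Rightarrow> nat \<Rightarrow> complex" where
  "block_form1 (Jordan k e) a b = off_diagonal_form k (jordan_matrix e) a b"
| "block_form1 (Jordan_infinity k) a b = off_diagonal_form k identity_matrix a b"
| "block_form1 (Kronecker k) a b =
     (if even a \<and> b = Suc a then 1 else if even b \<and> a = Suc b then -1 else 0)"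

fun block_form2 :: "block \<Rightarrow> nat \<Rightarrow> nat \<Rightarrow> complex" where
  "block_form2 (Jordan k e) a b = off_diagonal_form k identity_matrix a b"
| "block_form2 (Jordan_infinity k) a b = off_diagonal_form k (jordan_matrix 0) a b"
| "block_form2 (Kronecker k) a b =
     (if odd a \<and> b = Suc a then 1 else if odd b \<and> a = Suc b then -1 else 0)"

text \<open>\<open>(V, B1, B2)\<close> is isomorphic to the direct sum of the blocks in the list \<open>bs\<close>: the vector
  \<open>w (i, a)\<close> is the \<open>a\<close>-th basis vector of the \<open>i\<close>-th block.\<close>
definition block_decomposition ::
    "('x \<Rightarrow> complex) set \<Rightarrow> (('x \<Rightarrow> complex) \<Rightarrow> ('x \<Rightarrow> complex) \<Rightarrow> complex) \<Rightarrow>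
     (('x \<Rightarrow> complex) \<Rightarrow> ('x \<Rightarrow> complex) \<Rightarrow> complex) \<Rightarrow> block list \<Rightarrow> bool" where
  "block_decomposition V B1 B2 bs \<longleftrightarrow>
     (\<forall>b\<in>set bs. 0 < block_index b) \<and>
     (\<exists>w :: nat \<times> nat \<Rightarrow> 'x \<Rightarrow> complex. let I = (SIGMA i:{..<length bs}. {..<block_dim (bs ! i)}) in
        independent_family I w \<and> fs.span (w ` I) = V \<and>
        (\<forall>(i, a)\<in>I. \<forall>(j, b)\<in>I.
           B1 (w (i, a)) (w (j, b)) = (if i = j then block_form1 (bs ! i) a b else 0) \<and>
           B2 (w (i, a)) (w (j, b)) = (if i = j then block_form2 (bs ! i) a b else 0)))"

text \<open>Well-defined for skew-symmetric pairings on a finite-dimensional space, since the blocks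
  of a decomposition are unique up to order.\<close>
definition kronecker_count ::
    "('x \<Rightarrow> complex) set \<Rightarrow> (('x \<Rightarrow> complex) \<Rightarrow> ('x \<Rightarrow> complex) \<Rightarrow> complex) \<Rightarrow>
     (('x \<Rightarrow> complex) \<Rightarrow> ('x \<Rightarrow> complex) \<Rightarrow> complex) \<Rightarrow> nat" where
  "kronecker_count V B1 B2 =
     (THE s. \<exists>bs. block_decomposition V B1 B2 bs \<and> s = length (filter is_Kronecker bs))"

definition action_dimension ::
    "('x \<Rightarrow> complex) set \<Rightarrow> (('x \<Rightarrow> complex) \<Rightarrow> ('x \<Rightarrow> complex) \<Rightarrow> complex) \<Rightarrow>
     (('x \<Rightarrow> complex) \<Rightarrow> ('x \<Rightarrow> complex) \<Rightarrow> complex) \<Rightarrow> real" where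
  "action_dimension V B1 B2 = (real (fs.dim V) + real (kronecker_count V B1 B2)) / 2"

section \<open>Manifolds and functions on them\<close>

type_synonym ('a, 'k, 'n) chart = "'a set \<times> ('a \<Rightarrow> 'k ^ 'n)"

text \<open>The parameter \<open>R S f\<close> says that \<open>f\<close> is regular (smooth or analytic) on the open set \<open>S\<close> of
  coordinate space. A real or complex manifold is then given by its topology and an atlas.\<close>
locale manifold =
  fixes R :: "('k::ground_field ^ 'n::finite) set \<Rightarrow> ('k ^ 'n \<Rightarrow> 'k) \<Rightarrow> bool"
    and X :: "'a topology"
    and A :: "('a, 'k, 'n) chart set"
  assumes Hausdorff: "Hausdorff_space X"
    and second_countable: "second_countable X"
    and chart_open: "(U, \<phi>) \<in> A \<Longrightarrow> openin X U \<and> open (\<phi> ` U)"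
    and chart_homeomorphic:
      "(U, \<phi>) \<in> A \<Longrightarrow> homeomorphic_map (subtopology X U) (top_of_set (\<phi> ` U)) \<phi>"
    and charts_cover: "(\<Union>(U, \<phi>)\<in>A. U) = topspace X"
    and transition_regular:
      "(U, \<phi>) \<in> A \<Longrightarrow> (W, \<psi>) \<in> A \<Longrightarrow> R (\<phi> ` (U \<inter> W)) (\<lambda>y. \<psi> (inv_into U \<phi> y) $ i)"
begin

definition regular_on :: "'a set \<Rightarrow> ('a \<Rightarrow> 'k) \<Rightarrow> bool" where
  "regular_on U f \<longleftrightarrow>
     openin X U \<and> (\<forall>(W, \<phi>)\<in>A. R (\<phi> ` (U \<inter> W)) (\<lambda>y. f (inv_into W \<phi> y)))"

definition regular_at :: "'a \<Rightarrow> ('a \<Rightarrow> 'k) \<Rightarrow> bool" where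
  "regular_at m f \<longleftrightarrow> (\<exists>U. m \<in> U \<and> regular_on U f)"

text \<open>Derivations of the algebra of germs at \<open>m\<close>, extended by zero to functions that are not
  regular near \<open>m\<close>.\<close>
definition tangent_space :: "'a \<Rightarrow> (('a \<Rightarrow> 'k) \<Rightarrow> 'k) set" where
  "tangent_space m = {v.
     (\<forall>f. \<not> regular_at m f \<longrightarrow> v f = 0) \<and>
     (\<forall>U f g. m \<in> U \<and> regular_on U f \<and> regular_on U g \<and> (\<forall>x\<in>U. f x = g x) \<longrightarrow> v f = v g) \<and>
     (\<forall>f g c. regular_at m f \<and> regular_at m g \<longrightarrow>
        v (f + g) = v f + v g \<and> v (fscale c f) = c * v f \<and> v (f * g) = v f * g m + f m * v g)}"

definition differential :: "'a \<Rightarrow> ('a \<Rightarrow> 'k) \<Rightarrow> (('a \<Rightarrow> 'k) \<Rightarrow> 'k) \<Rightarrow> 'k" where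
  "differential m f = (\<lambda>v. if v \<in> tangent_space m then v f else 0)"

definition complex_differential :: "'a \<Rightarrow> ('a \<Rightarrow> 'k) \<Rightarrow> (('a \<Rightarrow> 'k) \<Rightarrow> 'k) \<Rightarrow> complex" where
  "complex_differential m f = (\<lambda>v. to_complex (differential m f v))"

text \<open>For real scalars this is the complexification of the cotangent space, realised as
  complex-valued functionals on the tangent space; for complex scalars it is the cotangent space
  itself.\<close>
definition complex_cotangent_space :: "'a \<Rightarrow> ((('a \<Rightarrow> 'k) \<Rightarrow> 'k) \<Rightarrow> complex) set" where
  "complex_cotangent_space m = fs.span {complex_differential m f |f. regular_at m f}"

text \<open>A bracket of functions on open sets, compatible with restriction: the value of \<open>P f g\<close> at \<open>x\<close>
  depends only on the germs of \<open>f\<close> and \<open>g\<close> at \<open>x\<close>. Analytic manifolds may have too few global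
  functions, so the bracket has to be given on all open subsets.\<close>
definition poisson_bracket :: "(('a \<Rightarrow> 'k) \<Rightarrow> ('a \<Rightarrow> 'k) \<Rightarrow> 'a \<Rightarrow> 'k) \<Rightarrow> bool" where
  "poisson_bracket P \<longleftrightarrow>
     (\<forall>U f g. regular_on U f \<and> regular_on U g \<longrightarrow> regular_on U (P f g)) \<and>
     (\<forall>U f f' g g'. regular_on U f \<and> regular_on U f' \<and> regular_on U g \<and> regular_on U g' \<and>
        (\<forall>x\<in>U. f x = f' x \<and> g x = g' x) \<longrightarrow> (\<forall>x\<in>U. P f g x = P f' g' x)) \<and>
     (\<forall>U f g h c. regular_on U f \<and> regular_on U g \<and> regular_on U h \<longrightarrow>
        (\<forall>x\<in>U. P f g x = - P g f x \<and>
          P (f + g) h x = P f h x + P g h x \<and>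
          P (fscale c f) g x = c * P f g x \<and>
          P f (g * h) x = P f g x * h x + g x * P f h x \<and>
          P f (P g h) x + P g (P h f) x + P h (P f g) x = 0))"

definition casimir_on :: "(('a \<Rightarrow> 'k) \<Rightarrow> ('a \<Rightarrow> 'k) \<Rightarrow> 'a \<Rightarrow> 'k) \<Rightarrow> 'a set \<Rightarrow> ('a \<Rightarrow> 'k) \<Rightarrow> bool" where
  "casimir_on P V F \<longleftrightarrow>
     regular_on V F \<and> (\<forall>U f. U \<subseteq> V \<and> regular_on U f \<longrightarrow> (\<forall>x\<in>U. P F f x = 0))"

text \<open>The pairing \<open>(df, dg) = {f, g}(m)\<close>, extended complex-bilinearly. These conditions determine
  it on the cotangent space; its values elsewhere are irrelevant.\<close>
definition induced_pairing ::
    "(('a \<Rightarrow> 'k) \<Rightarrow> ('a \<Rightarrow> 'k) \<Rightarrow> 'a \<Rightarrow> 'k) \<Rightarrow> 'a \<Rightarrow>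
     ((('a \<Rightarrow> 'k) \<Rightarrow> 'k) \<Rightarrow> complex) \<Rightarrow> ((('a \<Rightarrow> 'k) \<Rightarrow> 'k) \<Rightarrow> complex) \<Rightarrow> complex" where
  "induced_pairing P m = (SOME B. bilinear_on (complex_cotangent_space m) B \<and>
     (\<forall>f g. regular_at m f \<and> regular_at m g \<longrightarrow>
        B (complex_differential m f) (complex_differential m g) = to_complex (P f g m)))"

definition open_dense_in :: "'a set \<Rightarrow> 'a set \<Rightarrow> bool" where
  "open_dense_in V D \<longleftrightarrow> openin X D \<and> D \<subseteq> V \<and> V \<subseteq> X closure_of D"

definition functionally_independent :: "'a set \<Rightarrow> 'i set \<Rightarrow> ('i \<Rightarrow> 'a \<Rightarrow> 'k) \<Rightarrow> bool" where
  "functionally_independent V I F \<longleftrightarrow>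
     (\<exists>D. open_dense_in V D \<and> (\<forall>x\<in>D. independent_family I (\<lambda>i. differential x (F i))))"

definition functionally_dependent_on ::
    "'a set \<Rightarrow> ('a \<Rightarrow> 'k) \<Rightarrow> 'i set \<Rightarrow> ('i \<Rightarrow> 'a \<Rightarrow> 'k) \<Rightarrow> bool" where
  "functionally_dependent_on V G I F \<longleftrightarrow>
     (\<exists>D. open_dense_in V D \<and>
        (\<forall>x\<in>D. differential x G \<in> fs.span ((\<lambda>i. differential x (F i)) ` I)))"

end

section \<open>Bihamiltonian structures and the anchored Lenard scheme\<close>

locale bihamiltonian = manifold R X A
  for R :: "('k::ground_field ^ 'n::finite) set \<Rightarrow> ('k ^ 'n \<Rightarrow> 'k) \<Rightarrow> bool"
    and X :: "'a topology"
    and A :: "('a, 'k, 'n) chart set" +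
  fixes P1 P2 :: "('a \<Rightarrow> 'k) \<Rightarrow> ('a \<Rightarrow> 'k) \<Rightarrow> 'a \<Rightarrow> 'k"
  assumes poisson1: "poisson_bracket P1"
    and poisson2: "poisson_bracket P2"
    and compatible: "poisson_bracket (\<lambda>f g x. c1 * P1 f g x + c2 * P2 f g x)"
begin

definition homogeneous :: bool where
  "homogeneous \<longleftrightarrow>
     (\<exists>ks. \<forall>m\<in>topspace X. block_decomposition (complex_cotangent_space m)
        (induced_pairing P1 m) (induced_pairing P2 m) (map Kronecker ks))"

definition action_dimension_at :: "'a \<Rightarrow> ereal" where
  "action_dimension_at m0 =
     Liminf (atin X m0) (\<lambda>m. ereal (action_dimension (complex_cotangent_space m)
        (induced_pairing P1 m) (induced_pairing P2 m)))"

definition lenard_step :: "'a set \<Rightarrow> ('a \<Rightarrow> 'k) \<Rightarrow> ('a \<Rightarrow> 'k) \<Rightarrow> bool" where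
  "lenard_step V F G \<longleftrightarrow>
     regular_on V F \<and> regular_on V G \<and>
     (\<forall>U f. U \<subseteq> V \<and> regular_on U f \<longrightarrow> (\<forall>x\<in>U. P2 F f x = - P1 G f x))"

text \<open>\<open>H t i\<close>, for \<open>t < r\<close> and \<open>i \<le> k t\<close>, are the independent functions obtained from the scheme
  on \<open>V\<close>. The last clause: whenever some sequence \<open>H t\<close> can be continued beyond \<open>k t\<close> by finitely many
  more solutions \<open>G\<close> of the recurrence relations, these depend on the functions already found.\<close>
definition anchored_lenard_scheme ::
    "'a set \<Rightarrow> nat \<Rightarrow> (nat \<Rightarrow> nat) \<Rightarrow> (nat \<Rightarrow> nat \<Rightarrow> 'a \<Rightarrow> 'k) \<Rightarrow> bool" where
  "anchored_lenard_scheme V r k H \<longleftrightarrow>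
     (\<forall>t<r. casimir_on P1 V (H t 0)) \<and>
     functionally_independent V {..<r} (\<lambda>t. H t 0) \<and>
     (\<forall>F. casimir_on P1 V F \<longrightarrow>
        \<not> functionally_independent V {..<Suc r} ((\<lambda>t. H t 0)(r := F))) \<and>
     (\<forall>t<r. \<forall>i<k t. lenard_step V (H t i) (H t (Suc i))) \<and>
     functionally_independent V (SIGMA t:{..<r}. {..k t}) (\<lambda>(t, i). H t i) \<and>
     (\<forall>t<r. \<forall>p. \<forall>G :: nat \<Rightarrow> 'a \<Rightarrow> 'k.
        G 0 = H t (k t) \<and> (\<forall>i<p. lenard_step V (G i) (G (Suc i))) \<longrightarrow>
        (\<forall>i\<le>p. functionally_dependent_on V (G i) (SIGMA t:{..<r}. {..k t}) (\<lambda>(t, i). H t i)))"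

definition lenard_integrable_by ::
    "'a \<Rightarrow> 'a set \<Rightarrow> nat \<Rightarrow> (nat \<Rightarrow> nat) \<Rightarrow> (nat \<Rightarrow> nat \<Rightarrow> 'a \<Rightarrow> 'k) \<Rightarrow> bool" where
  "lenard_integrable_by m0 V r k H \<longleftrightarrow>
     openin X V \<and> m0 \<in> V \<and> anchored_lenard_scheme V r k H \<and>
     ereal (real (\<Sum>t<r. k t + 1)) = action_dimension_at m0"

definition lenard_integrable :: "'a \<Rightarrow> bool" where
  "lenard_integrable m0 \<longleftrightarrow> (\<exists>V r k H. lenard_integrable_by m0 V r k H)"

definition strictly_lenard_integrable :: "'a \<Rightarrow> bool" where
  "strictly_lenard_integrable m0 \<longleftrightarrow>
     (\<exists>V r k H. lenard_integrable_by m0 V r k H \<and>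
        (\<forall>t<r. \<forall>i\<ge>k t. lenard_step V (H t i) (H t (Suc i))))"

end

end

(* In a sum of Kronecker blocks span(w_0, ..., w_(2k-2)) let W be the span of all vectors with even index. It contains
   ker (,)_1, is isotropic for both pairings, has dimension equal to the action dimension, and every u : W has a
   shift u' : W with (u, .)_2 = -(u', .)_1; moreover W is the least subspace containing ker (,)_1 and closed under shifts.
   Near m0 the rank of {,}_1 is constant, so the Frobenius theorem straightens its symplectic leaves. If dF is a section
   of W, the shift is an equation {G, .}_1 = -{F, .}_2 prescribing the derivatives of G along the leaves; compatibility
   together with {F, .}_1 = -{F', .}_2 for the preceding function F' makes this data closed on each leaf, so G exists and dG is again a
   section of W. Hence the recurrence can be continued forever from any Casimir function, and by minimality of W the
   differentials of finitely many members of the chains span W at m0, thus also nearby.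

   The Frobenius theorem and the Poincare lemma are used in the same regularity class as the brackets. Both follow from
   one ordinary differential equation, the backward radial flow Ph' = sum_i (x_i - p_i) Y_i(Ph), Ph(1, x) = x,
   whose time-0 map projects to a transversal; t * h(Ph(t, x)) is constant along it when E h = -h for E = sum_i (x_i - p_i) Y_i,
   which forces h = 0. *)
theory Submission
  imports Defs
begin

section \<open>Regular functions, flows and the Frobenius theorem\<close>

text \<open>Homogeneity enters through three constants: dim ker (,)_1 is the number s of blocks, W
  has dimension N (the sum of the k_i), and the lower limit in the action dimension is again N. The
  obstacle is regularity: infinitely many Lenard steps must be solved on one neighbourhood, in the
  class of the brackets. So the neighbourhood is fixed once by the flow, and each step is a
  quadrature over it. Time stays real in [0, 1] even over the complex numbers, so one argument
  serves the three classes and only the flow differs: smooth dependence comes from Picard iterates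
  all of whose derivatives converge geometrically, analytic dependence from the same iteration in
  weighted l1 norms. The fields Y_i are combinations of Hamiltonian fields normalised to be the unit
  vectors in the directions I; this turns involutivity into commutation, on which the radial flow
  relies. Linear algebra takes place over the complex numbers; a left inverse of the embedding of
  scalars, linear over the ground field (Re or the identity), brings linear relations back.\<close>

definition pd :: "'n::finite => ('k::real_normed_field^'n => 'k) => 'k^'n => 'k" where
 "pd i f x = frechet_derivative f (at x) (axis i 1)"

text \<open>\<open>has_derivative\<close> is real linear even over the complex numbers. A derivative
  of the shape \<open>SUM i:UNIV. q i*h$i\<close> is what encodes complex differentiability, and it
  makes \<open>pd\<close> the complex partial derivative.\<close>

lemma pd_eqI:
 assumes "(f has_derivative (%h. SUM i:UNIV. q i*h$i)) (at x)"
 shows "pd i f x = q i"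
proof -
 have "frechet_derivative f (at x) = (%h. SUM i:UNIV. q i*h$i)" using assms frechet_derivative_at by metis
 then show ?thesis by (simp add: pd_def axis_def if_distrib cong: if_cong)
qed

text \<open>Differentiability plays no part: functions that agree near \<open>x\<close> have the
  same derivatives there, so the choice inside \<open>frechet_derivative\<close> is the
  same.\<close>

lemma pd_cong:
 fixes f g :: "'k::real_normed_field^'n::finite => 'k"
 assumes "open S" "x:S" "!!y. y:S ==> f y = g y"
 shows "pd i f x = pd i g x"
proof -
 have "(f has_derivative D) (at x) \<longleftrightarrow> (g has_derivative D) (at x)" for D
  using has_derivative_transform_within_open[of f D x UNIV S g]
   has_derivative_transform_within_open[of g D x UNIV S f] assms by auto
 then show ?thesis by (simp add: pd_def frechet_derivative_def)
qed

lemma pd_const [simp]: "pd i (%x. c) x = 0" by (rule pd_eqI) (auto intro!: derivative_eq_intros)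

lemma pd_coord: "pd i (%x::'k::real_normed_field^'b::finite. x$j) x = (if i = j then 1 else 0)"
proof (rule pd_eqI)
 have "(%h::'k^'b. SUM i:UNIV. (if i = j then 1 else 0)*h$i) = (%h. h$j)"
  by (auto simp: if_distrib[of "%u. u*_"] cong: if_cong)
 then show "((%x::'k^'b::finite. x$j) has_derivative (%h. SUM i:UNIV. (if i = j then 1 else 0)*h$i)) (at x)"
  using bounded_linear_imp_has_derivative[OF bounded_linear_vec_nth] by simp
qed

lemma norm_vec_le_sum: "norm (x :: 'a::real_normed_vector^'n::finite) <= (SUM i:UNIV. norm (x$i))"
 unfolding norm_vec_def by (rule L2_set_le_sum) simp

lemma has_derivative_vecI:
 fixes f :: "'a::real_normed_vector => 'b::real_normed_vector^'n::finite"
 assumes "!!i. ((%x. f x$i) has_derivative (%h. f' h$i)) F"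
 shows "(f has_derivative f') F"
proof -
 have lin: "bounded_linear f'"
 proof -
  have b: "bounded_linear (%h. f' h$i)" for i using assms has_derivative_bounded_linear by blast
  have "ALL i. EX K. ALL h. norm (f' h$i) <= norm h*K" using bounded_linear.bounded[OF b] by blast
  then obtain K where K: "!!i h. norm (f' h$i) <= norm h*K i" unfolding choice_iff by blast
  show ?thesis
  proof (rule bounded_linear_intro[where K="SUM i:UNIV. K i"])
   show "f' (x + y) = f' x + f' y" for x y by (simp add: vec_eq_iff linear_add[OF bounded_linear.linear[OF b]])
   show "f' (r *\<^sub>R x) = r *\<^sub>R f' x" for r x by (simp add: vec_eq_iff linear_scale[OF bounded_linear.linear[OF b]])
   show "norm (f' x) <= norm x * sum K UNIV" for x
   proof -
    have "norm (f' x) <= (SUM i:UNIV. norm (f' x$i))" by (rule norm_vec_le_sum)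
    also have "... <= (SUM i:UNIV. norm x*K i)" by (rule sum_mono) (rule K)
    finally show ?thesis by (simp add: sum_distrib_left)
   qed
  qed
 qed
 \<comment> \<open>Over a general filter \<open>F\<close> the base point of
   \<open>has_derivative\<close> is \<open>Lim F (%x. x)\<close>, hence this form of the difference
   quotient.\<close>
 have "((%y. ((f y - f (Lim F (%x. x))) - f' (y - Lim F (%x. x))) /\<^sub>R norm (y - Lim F (%x. x))) \<longlongrightarrow> 0) F"
 proof (rule vec_tendstoI)
  fix i
  show "((%y. (((f y - f (Lim F (%x. x))) - f' (y - Lim F (%x. x))) /\<^sub>R norm (y - Lim F (%x. x)))$i) \<longlongrightarrow> 0$i) F"
   using assms[of i] by (simp add: has_derivative_def)
 qed
 then show ?thesis using lin by (simp add: has_derivative_def)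
qed

lemma has_vector_derivative_vecI:
 fixes f :: "real => 'b::real_normed_vector^'n::finite"
 assumes "!!i. ((%x. f x$i) has_vector_derivative f'$i) F"
 shows "(f has_vector_derivative f') F" unfolding has_vector_derivative_def
 by (rule has_derivative_vecI) (use assms in \<open>simp add: has_vector_derivative_def\<close>)

lemma has_vector_derivative_nth:
 fixes f :: "real => 'b::real_normed_vector^'n::finite"
 assumes "(f has_vector_derivative f') F"
 shows "((%x. f x$i) has_vector_derivative f'$i) F" using bounded_linear.has_vector_derivative[OF bounded_linear_vec_nth assms] .

section \<open>Lipschitz bounds and uniqueness of integral curves\<close>

lemma locally_Lipschitz:
 fixes f :: "'k::real_normed_field^'n::finite => 'k"
 assumes "open S" "p:S" and der: "!!x. x:S ==> (f has_derivative (%h. SUM i:UNIV. q i x*h$i)) (at x)"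
  and cont: "!!i. isCont (q i) p"
 shows "EX r>0. EX M>=0. ball p r <= S & (ALL x:ball p r. ALL y:ball p r. norm (f x - f y) <= M*norm (x - y))"
proof -
 have "ALL i. EX r>0. ALL x:ball p r. norm (q i x) <= norm (q i p) + 1"
 proof
  fix i
  from cont[of i] obtain r where r: "r > 0" "!!x. dist x p < r ==> dist (q i x) (q i p) < 1"
   unfolding continuous_at_eps_delta by (meson zero_less_one)
  have "norm (q i x) <= norm (q i p) + 1" if "x:ball p r" for x
   using r(2)[of x] that norm_triangle_ineq2[of "q i x" "q i p"] by (auto simp: dist_commute dist_norm norm_minus_commute)
  then show "EX r>0. ALL x:ball p r. norm (q i x) <= norm (q i p) + 1" using r(1) by blast
 qed
 then obtain r where r: "!!i. r i > 0" "!!i x. x:ball p (r i) ==> norm (q i x) <= norm (q i p) + 1"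
  unfolding choice_iff by blast
 obtain r0 where r0: "r0 > 0" "ball p r0 <= S" using assms openE by blast
 define r1 where "r1 = min r0 (Min (range r))"
 have r1: "r1 > 0" "ball p r1 <= S" "!!i x. x:ball p r1 ==> norm (q i x) <= norm (q i p) + 1"
 proof -
  show "r1 > 0" "ball p r1 <= S" using r0 r(1) by (auto simp: r1_def)
  fix i x assume "x:ball p r1"
  moreover have "r1 <= r i" unfolding r1_def by (intro min.coboundedI2 Min_le) auto
  ultimately show "norm (q i x) <= norm (q i p) + 1" by (intro r(2)) auto
 qed
 define M where "M = (SUM i:UNIV. norm (q i p) + 1)"
 have M0: "M >= 0" unfolding M_def by (intro sum_nonneg) auto
 have "norm (f x - f y) <= M*norm (x - y)" if "x:ball p r1" "y:ball p r1" for x y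
 proof (rule differentiable_bound[of "ball p r1" f "%x h. SUM i:UNIV. q i x*h$i"])
  show "(f has_derivative (%h. SUM i:UNIV. q i x*h$i)) (at x within ball p r1)" if "x:ball p r1" for x
   using der that r1(2) has_derivative_at_withinI by blast
  show "onorm (%h. SUM i:UNIV. q i x*h$i) <= M" if "x:ball p r1" for x
  proof (rule onorm_le)
   fix h :: "'k^'n"
   have "norm (SUM i:UNIV. q i x*h$i) <= (SUM i:UNIV. (norm (q i p) + 1)*norm h)"
   proof (rule sum_norm_le)
    fix i
    show "norm (q i x*h$i) <= (norm (q i p) + 1)*norm h"
     unfolding norm_mult by (rule mult_mono) (auto intro: r1(3)[OF that] Finite_Cartesian_Product.norm_nth_le)
   qed
   then show "norm (SUM i:UNIV. q i x*h$i) <= M*norm h" by (simp add: M_def sum_distrib_right)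
  qed
 qed (use that in auto)
 then show ?thesis using r1 M0 by blast
qed

text \<open>On a time interval of length 1 a field with Lipschitz constant 1/2 moves two solutions
  apart by at most half their maximal distance \<open>norm (d s)\<close>, so this maximum is 0. This
  takes the place of a Gronwall estimate.\<close>

lemma curve_unique:
 fixes g1 g2 :: "real => 'v::real_normed_vector"
 assumes d1: "!!t. t:{0..1} ==> (g1 has_vector_derivative F (g1 t)) (at t within {0..1})"
  and d2: "!!t. t:{0..1} ==> (g2 has_vector_derivative F (g2 t)) (at t within {0..1})"
  and B1: "!!t. t:{0..1} ==> g1 t:B" and B2: "!!t. t:{0..1} ==> g2 t:B"
  and lip: "!!x y. x:B ==> y:B ==> norm (F x - F y) <= norm (x - y)/2"
  and eq: "g1 1 = g2 1" and t: "t:{0..1}"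
 shows "g1 t = g2 t"
proof -
 define d where "d = (%t. g1 t - g2 t)"
 have der: "(d has_vector_derivative (F (g1 t) - F (g2 t))) (at t within {0..1})" if "t:{0..1}" for t
  unfolding d_def using d1[OF that] d2[OF that] by (rule has_vector_derivative_diff)
 have "continuous_on {0..1} (%t. norm (d t))" by (intro continuous_on_norm differentiable_imp_continuous_on)
   (meson der differentiable_on_def differentiableI has_vector_derivative_def)
 then obtain s where s: "s:{0..1}" "!!t. t:{0..1} ==> norm (d t) <= norm (d s)"
  using continuous_attains_sup[of "{0..1::real}" "%t. norm (d t)"] by auto
 have "norm (d s - d 1) <= norm (d s)/2*norm (s - 1)"
 proof (rule differentiable_bound[of "{0..1}" d "%t h. h *\<^sub>R (F (g1 t) - F (g2 t))"])
  show "onorm (%h. h *\<^sub>R (F (g1 x) - F (g2 x))) <= norm (d s)/2" if "x:{0..1}" for x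
  proof (rule onorm_le)
   fix h :: real
   have "norm (F (g1 x) - F (g2 x)) <= norm (d s)/2" using lip[OF B1 B2, OF that that] s(2)[OF that] by (simp add: d_def)
   from mult_left_mono[OF this, of "norm h"]
   show "norm (h *\<^sub>R (F (g1 x) - F (g2 x))) <= norm (d s)/2*norm h" by (simp add: mult.commute)
  qed
 qed (use der s in \<open>auto simp: has_vector_derivative_def\<close>)
 also have "... <= norm (d s)/2*1" using s(1) by (intro mult_left_mono) auto
 finally have "norm (d s) <= norm (d s)/2" by (simp add: d_def eq)
 then have "norm (d s) = 0" by (simp add: field_simps)
 then show ?thesis using s(2)[OF t] by (simp add: d_def)
qed

text \<open>A common interface for the smooth, real analytic and complex analytic classes: R S f says that f is regular on S, and
  RT V h that the family h t, with t in [0, 1], is regular on V together with its dependence on t.\<close>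
locale regularity =
 fixes R :: "('k::{ground_field,banach}^'n::finite) set => ('k^'n => 'k) => bool"
  and RT :: "('k^'n) set => (real => 'k^'n => 'k) => bool"
 assumes R_subset: "open S ==> R S f ==> open T ==> T <= S ==> R T f"
  and R_local: "open S ==> (!!x. x:S ==> EX U. open U & x:U & R U f) ==> R S f"
  and R_cong: "open S ==> R S f ==> (!!x. x:S ==> f x = g x) ==> R S g"
  and R_const: "open S ==> R S (%x. c)" and R_coord: "open S ==> R S (%x. x$i)"
  and R_add: "open S ==> R S f ==> R S g ==> R S (%x. f x + g x)"
  and R_mult: "open S ==> R S f ==> R S g ==> R S (%x. f x*g x)"
  and R_inverse: "open S ==> R S f ==> (!!x. x:S ==> f x ~= 0) ==> R S (%x. inverse (f x))"
  and R_deriv: "open S ==> R S f ==> x:S ==>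
   (f has_derivative (%h. SUM i:UNIV. pd i f x*h$i)) (at x)"
  and R_pd: "open S ==> R S f ==> R S (pd i f)"
  and R_compose: "open S ==> open T ==> R S f ==> (!!i. R T (%x. u x$i)) ==>
   (!!x. x:T ==> u x:S) ==> R T (%x. f (u x))"
  and RT_compose: "open S ==> open V ==> R S f ==> (!!i. RT V (%t x. ga t x$i)) ==>
   (!!t x. t:{0..1} ==> x:V ==> ga t x:S) ==> RT V (%t x. f (ga t x))"
  and RT_slice: "open V ==> RT V h ==> t:{0..1} ==> R V (h t)"
  and RT_integral: "open V ==> RT V h ==> R V (%x. integral {0..1} (%t. h t x))"
  and RT_cont: "open V ==> RT V h ==> continuous_on ({0..1} \<times> V) (%(t, x). h t x)"
  and RT_subset: "open V ==> RT V h ==> open U ==> U <= V ==> RT U h"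
  and RT_scaling: "open V ==> RT V (%t x. of_real t*(x$i - p$i) + p$i)"
  and flow: "open S ==> p:S ==> (!!i a. R S (Y i a)) ==>
   EX ro>0. EX Ph. (ALL a. RT (ball p ro) (%t x. Ph t x$a)) &
    (ALL x:ball p ro. Ph 1 x = x & (ALL t:{0..1}. Ph t x:S &
     ((%t. Ph t x) has_vector_derivative (\<chi> a. SUM i:I. (x$i - p$i)*Y i a (Ph t x)))
      (at t within {0..1})))"
begin

lemma R_isCont: "open S ==> R S f ==> x:S ==> isCont f x"
 using R_deriv has_derivative_continuous by blast

lemma R_sum: "open S ==> (!!i. i:A ==> R S (f i)) ==> R S (%x. SUM i:A. f i x)"
 by (induction A rule: infinite_finite_induct) (auto intro: R_const R_add)

lemma R_diff: "open S ==> R S f ==> R S g ==> R S (%x. f x - g x)"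
 using R_add[of S f "%x. (-1)*g x"] R_mult[of S "%_. -1" g] R_const[of S "-1"] by simp

lemma pd_add: "open S ==> R S f ==> R S g ==> x:S ==>
  pd i (%x. f x + g x) x = pd i f x + pd i g x" by (rule pd_eqI, rule has_derivative_eq_rhs[OF has_derivative_add[OF R_deriv R_deriv]])
  (auto simp: sum.distrib[symmetric] algebra_simps)

lemma pd_mult: "open S ==> R S f ==> R S g ==> x:S ==>
  pd i (%x. f x*g x) x = f x*pd i g x + pd i f x*g x"
 by (rule pd_eqI, rule has_derivative_eq_rhs[OF has_derivative_mult[OF R_deriv R_deriv]])
  (auto simp: sum.distrib sum_distrib_left sum_distrib_right algebra_simps)

lemma pd_sum:
 assumes "open S" "!!j. j:A ==> R S (f j)" "x:S"
 shows "pd i (%x. SUM j:A. f j x) x = (SUM j:A. pd i (f j) x)"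
proof (cases "finite A")
 case True
 then show ?thesis using assms(2)
 proof (induction A rule: finite_induct)
  case (insert a A)
  then show ?case using pd_add[OF assms(1) _ R_sum[OF assms(1)] assms(3), of "f a" A f] by simp
 qed simp
qed simp

lemma curve_chain:
 assumes "open S" "R S f" "ga t:S" "(ga has_vector_derivative v) (at t within T)"
 shows "((%t. f (ga t)) has_vector_derivative (SUM i:UNIV. pd i f (ga t) * v$i)) (at t within T)"
proof -
 have "((%t. f (ga t)) has_derivative ((%h. SUM i:UNIV. pd i f (ga t)*h$i) \<circ> (%h. h *\<^sub>R v))) (at t within T)"
  using diff_chain_within[OF assms(4)[unfolded has_vector_derivative_def]
    has_derivative_at_withinI[OF R_deriv[OF assms(1,2,3)]]] by (simp add: o_def)
 then show ?thesis unfolding has_vector_derivative_def o_def by (rule has_derivative_eq_rhs) (auto simp: scaleR_sum_right)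
qed

text \<open>Integrate the derivative along the segment from \<open>p\<close> to \<open>x\<close>:
  \<open>g i\<close> is the mean of \<open>pd i f\<close> over it, regular by
  \<open>RT_integral\<close>. Later this shows that a derivation at a point is determined by its
  values on the coordinates.\<close>

lemma hadamard:
 assumes "open S" "R S f" "p:S"
 shows "EX r>0. EX g. ball p r <= S & (ALL i. R (ball p r) (g i)) &
  (ALL x:ball p r. f x = f p + (SUM i:UNIV. (x$i - p$i)*g i x))"
proof -
 obtain r where r: "r > 0" "ball p r <= S" using assms openE by blast
 define ga where "ga = (%t (x::'k^'n). \<chi> i. of_real t*(x$i - p$i) + p$i)"
 define g where "g = (%i x. integral {0..1} (%t. pd i f (ga t x)))"
 have eq: "ga t x = p + t *\<^sub>R (x - p)" for t x by (simp add: ga_def vec_eq_iff) (simp add: scaleR_conv_of_real)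
 have mem: "ga t x:ball p r" if "t:{0..1}" "x:ball p r" for t x
 proof -
  have "norm (t *\<^sub>R (x - p)) <= norm (x - p)" using that mult_right_mono[of t 1 "norm (x - p)"] by auto
  then show ?thesis using that by (simp add: eq dist_norm norm_minus_commute)
 qed
 have RTp: "RT (ball p r) (%t x. pd i f (ga t x))" for i
 proof (rule RT_compose[of S])
  show "RT (ball p r) (%t x. ga t x$i)" for i by (simp add: ga_def RT_scaling)
 qed (use assms r mem R_pd in auto)
 have 1: "R (ball p r) (g i)" for i unfolding g_def by (rule RT_integral) (use RTp in auto)
 have 2: "f x = f p + (SUM i:UNIV. (x$i - p$i)*g i x)" if x: "x:ball p r" for x
 proof -
  have "((%t. f (ga t x)) has_vector_derivative (SUM i:UNIV. pd i f (ga t x)*(x - p)$i)) (at t within {0..1})"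
   if "t:{0..1}" for t by (rule curve_chain[OF assms(1,2)])
    (use mem[OF that x] r in \<open>auto simp: eq intro!: derivative_eq_intros\<close>)
  then have "((%t. SUM i:UNIV. pd i f (ga t x)*(x - p)$i) has_integral (f (ga 1 x) - f (ga 0 x))) {0..1}"
   by (intro fundamental_theorem_of_calculus) auto
  moreover have "((%t. SUM i:UNIV. pd i f (ga t x)*(x - p)$i) has_integral
    (SUM i:UNIV. g i x*(x - p)$i)) {0..1}"
  proof (intro has_integral_sum has_integral_mult_left)
   fix i
   have "continuous_on {0..1} ((%(t, x). pd i f (ga t x)) \<circ> (%t. (t, x)))" by (rule continuous_on_compose)
     (use x in \<open>auto intro!: continuous_intros continuous_on_subset[OF RT_cont[OF _ RTp[of i]]]\<close>)
   then show "((%t. pd i f (ga t x)) has_integral g i x) {0..1}"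
    unfolding g_def by (auto simp: o_def intro: integrable_continuous_interval)
  qed auto
  ultimately have "f (ga 1 x) - f (ga 0 x) = (SUM i:UNIV. g i x*(x - p)$i)" using has_integral_unique by blast
  then show ?thesis by (simp add: eq algebra_simps)
 qed
 show ?thesis using 1 2 r by blast
qed

section \<open>Derivations along vector fields, radial flow boxes and the Frobenius theorem\<close>

definition Yop :: "('n => 'n => 'k^'n => 'k) => 'n => ('k^'n => 'k) => 'k^'n => 'k" where
 "Yop C i f x = (SUM a:UNIV. C i a x*pd a f x)"

lemma R_Yop: "open S ==> (!!a. R S (C i a)) ==> R S f ==> R S (Yop C i f)"
 unfolding Yop_def by (intro R_sum R_mult R_pd)

lemma Yop_add: "open S ==> R S f ==> R S g ==> x:S ==>
  Yop C i (%x. f x + g x) x = Yop C i f x + Yop C i g x" by (simp add: Yop_def pd_add algebra_simps sum.distrib)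

lemma Yop_mult: "open S ==> R S f ==> R S g ==> x:S ==>
  Yop C i (%x. f x*g x) x = f x*Yop C i g x + Yop C i f x*g x" by (simp add: Yop_def pd_mult algebra_simps sum.distrib sum_distrib_left)

lemma Yop_const [simp]: "Yop C i (%x. c) x = 0" by (simp add: Yop_def)

lemma Yop_coord: "Yop C i (%x. x$j) x = C i j x" by (simp add: Yop_def pd_coord if_distrib[of "%u. _*u"] cong: if_cong)

lemma Yop_sum: "open S ==> (!!j. j:A ==> R S (f j)) ==> x:S ==>
  Yop C i (%x. SUM j:A. f j x) x = (SUM j:A. Yop C i (f j) x)"
 unfolding Yop_def by (subst sum.swap) (simp add: pd_sum sum_distrib_left)

lemma Yop_cong: "open S ==> x:S ==> (!!y. y:S ==> f y = g y) ==> Yop C i f x = Yop C i g x"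
 unfolding Yop_def using pd_cong[of S x f g] by (intro sum.cong) auto

text \<open>The point \<open>x\<close> enters the equation only through the factors
  \<open>x$i - p$i\<close>, \<open>i:I\<close>. By \<open>norml\<close> these shrink linearly along
  the solution, so restarting at \<open>Ph t x\<close> gives the same equation with time scaled by
  \<open>t\<close>: this is the semigroup law in \<open>s * t\<close>. Where all these factors
  vanish the field is zero and the flow stationary.\<close>

lemma flow_box:
 assumes S: "open S" "p:S" and C: "!!i a. R S (C i a)"
  and norml: "!!i l x. i:I ==> l:I ==> x:S ==> C i l x = (if i = l then 1 else 0)"
 obtains V Ph where "open V" "p:V" "V <= S" "!!a. RT V (%t x. Ph t x$a)"
  "!!x. x:V ==> Ph 1 x = x"
  "!!t x. t:{0..1} ==> x:V ==> Ph t x:V"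
  "!!t x. t:{0..1} ==> x:V ==>
    ((%t. Ph t x) has_vector_derivative (\<chi> a. SUM i:I. (x$i - p$i)*C i a (Ph t x))) (at t within {0..1})"
  "!!s t x. s:{0..1} ==> t:{0..1} ==> x:V ==> Ph s (Ph t x) = Ph (s * t) x"
  "!!t x i. t:{0..1} ==> x:V ==> i:I ==> Ph t x$i = p$i + of_real t*(x$i - p$i)"
  "!!t x. t:{0..1} ==> x:V ==> (!!i. i:I ==> x$i = p$i) ==> Ph t x = x"
proof -
 define N where "N = real CARD('n)"
 have N: "N >= 1" by (simp add: N_def Suc_le_eq)
 have "ALL i a. EX r M. r > 0 & M >= 0 & ball p r <= S &
  (ALL x:ball p r. ALL y:ball p r. norm (C i a x - C i a y) <= M*norm (x - y))"
 proof (intro allI)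
  fix i a
  have "EX r>0. EX M>=0. ball p r <= S &
    (ALL x:ball p r. ALL y:ball p r. norm (C i a x - C i a y) <= M*norm (x - y))"
   by (rule locally_Lipschitz[where q="%j. pd j (C i a)"]) (use S C in \<open>auto intro: R_deriv R_isCont R_pd\<close>)
  then show "EX r M. r > 0 & M >= 0 & ball p r <= S &
    (ALL x:ball p r. ALL y:ball p r. norm (C i a x - C i a y) <= M*norm (x - y))" by blast
 qed
 then obtain r M where rM: "!!i a. r i a > 0" "!!i a. ball p (r i a) <= S" "!!i a. M i a >= 0"
  "!!i a x y. x:ball p (r i a) ==> y:ball p (r i a) ==> norm (C i a x - C i a y) <= M i a*norm (x - y)"
  unfolding choice_iff by blast
 define r0 where "r0 = Min (range (%(i, a). r i a))"
 define M0 where "M0 = Max (range (%(i, a). M i a))"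
 have r0: "r0 > 0" "r0 <= r i a" for i a unfolding r0_def using rM(1) by (auto intro!: Min_le)
 have M0: "M i a <= M0" for i a unfolding M0_def by (rule Max_ge) auto
 have M0': "0 <= M0" using rM(3) M0 order_trans by blast
 have lip: "norm (C i a x - C i a y) <= M0*norm (x - y)" if "x:ball p r0" "y:ball p r0" for i a x y
  using rM(4)[of x i a y] that r0(2)[of i a] mult_right_mono[OF M0, of "norm (x - y)" i a] by auto
 have sub: "ball p r0 <= S" using rM(2) r0(2) by (meson subset_ball subset_trans)
 define F where "F = (%x y. (\<chi> a. SUM i:I. (x$i - p$i)*C i a y) :: 'k^'n)"
 \<comment> \<open>Small enough that the field \<open>F x\<close> has Lipschitz constant 1/2 on
   \<open>ball p r0\<close>, as \<open>curve_unique\<close> requires; one factor \<open>N\<close>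
   counts the summands, the other the components.\<close>
 define ro0 where "ro0 = min r0 (1/(2*N*N*(M0 + 1)))"
 have ro0: "ro0 > 0" "ro0 <= r0" using r0(1) N M0' by (auto simp: ro0_def)
 have "N*N*ro0*(M0 + 1) <= N*N*(1/(2*N*N*(M0 + 1)))*(M0 + 1)"
  using N M0' by (intro mult_right_mono mult_left_mono) (auto simp: ro0_def)
 also have "... = 1/2" using N M0' by simp
 finally have half: "N*N*ro0*(M0 + 1) <= 1/2" .
 have lipF: "norm (F x y - F x z) <= norm (y - z)/2"
  if x: "x:ball p ro0" and y: "y:ball p r0" and z: "z:ball p r0" for x y z
 proof -
  have "norm ((F x y - F x z)$a) <= N*ro0*(M0 + 1)*norm (y - z)" for a
  proof -
   have "norm ((F x y - F x z)$a) = norm (SUM i:I. (x$i - p$i)*(C i a y - C i a z))"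
    by (simp add: F_def sum_subtractf right_diff_distrib)
   also have "... <= (SUM i:I. ro0*((M0 + 1)*norm (y - z)))"
   proof (rule sum_norm_le)
    fix i
    have "norm (x$i - p$i) <= ro0" using x Finite_Cartesian_Product.norm_nth_le[of "x - p" i] by (simp add: dist_norm norm_minus_commute)
    moreover have "norm (C i a y - C i a z) <= (M0 + 1)*norm (y - z)" using lip[OF y z, of i a] by (simp add: algebra_simps add_increasing)
    ultimately show "norm ((x$i - p$i)*(C i a y - C i a z)) <= ro0*((M0 + 1)*norm (y - z))"
     unfolding norm_mult by (rule mult_mono) (use ro0 in auto)
   qed
   also have "... <= N*(ro0*((M0 + 1)*norm (y - z)))" using ro0 M0' by (auto simp: N_def card_mono intro!: mult_right_mono)
   finally show ?thesis by (simp add: mult.assoc)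
  qed
  then have "(SUM a:UNIV. norm ((F x y - F x z)$a)) <= (SUM a:(UNIV::'n set). N*ro0*(M0 + 1)*norm (y - z))"
   by (rule sum_mono)
  then have "norm (F x y - F x z) <= N*N*ro0*(M0 + 1)*norm (y - z)"
   using norm_vec_le_sum[of "F x y - F x z"] by (simp add: N_def mult.assoc)
  also have "... <= 1/2*norm (y - z)" by (rule mult_right_mono[OF half]) auto
  finally show ?thesis by simp
 qed
 \<comment> \<open>The flow is taken inside \<open>ball p r0\<close>, so that its orbits stay where
   the Lipschitz bound holds.\<close>
 have CB: "!!i a. R (ball p r0) (C i a)" by (rule R_subset[OF S(1) C _ sub]) simp
 obtain ro1 Ph where ro1: "ro1 > 0" and H1: "ALL a. RT (ball p ro1) (%t x. Ph t x$a)"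
  and H2: "ALL x:ball p ro1. Ph 1 x = x & (ALL t:{0..1}. Ph t x:ball p r0 &
    ((%t. Ph t x) has_vector_derivative F x (Ph t x)) (at t within {0..1}))"
  using flow[where Y=C and I=I, OF open_ball centre_in_ball[THEN iffD2, OF r0(1)] CB] unfolding F_def by blast
 have RT1: "!!a. RT (ball p ro1) (%t x. Ph t x$a)" using H1 by blast
 have Ph: "!!x. x:ball p ro1 ==> Ph 1 x = x"
   "!!x t. x:ball p ro1 ==> t:{0..1} ==> Ph t x:ball p r0"
   "!!x t. x:ball p ro1 ==> t:{0..1} ==>
    ((%t. Ph t x) has_vector_derivative F x (Ph t x)) (at t within {0..1})" using H2 by blast+
 define ro where "ro = min ro0 ro1"
 \<comment> \<open>Keeping only the points whose whole orbit stays in the ball makes the set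
   invariant under the flow; its openness then comes from compactness of the time interval.\<close>
 define V where "V = {x:ball p ro. ALL t:{0..1}. Ph t x:ball p ro}"
 have ro: "ro > 0" "ball p ro <= ball p ro1" "ball p ro <= ball p ro0" "ball p ro <= ball p r0"
  using ro0 ro1 by (auto simp: ro_def)
 have Vsub: "V <= ball p ro" by (auto simp: V_def)
 have V1: "x:ball p ro1" "x:ball p ro0" "x:ball p r0" if "x:V" for x using that Vsub ro by blast+
 have stat: "Ph t x = x" if x: "x:ball p ro" and t: "t:{0..1}" and "!!i. i:I ==> x$i = p$i" for t x
 proof -
  have F0: "F x y = 0" for y using that by (simp add: F_def vec_eq_iff)
  have "x:ball p ro1" using x ro(2) by blast
  then have "((%s. Ph s x) has_vector_derivative 0) (at s within {0..1})" if "s:{0..1}" for s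
   using Ph(3)[of x s] that by (simp add: F0)
  then obtain c where "!!s. s:{0..1} ==> Ph s x = c"
   using has_vector_derivative_zero_constant[of "{0..1}" "%s. Ph s x"] by auto
  then show ?thesis using t Ph(1)[of x] x ro(2) by force
 qed
 have semi: "Ph s (Ph t x) = Ph (s * t) x" and semi2: "i:I ==> Ph t x$i = p$i + of_real t*(x$i - p$i)"
  if s: "s:{0..1}" and t: "t:{0..1}" and x: "x:V" for s t x i
 proof -
  have xx: "x:ball p ro1" "x:ball p ro0" using V1 x by auto
  \<comment> \<open>For \<open>i:I\<close> component i of \<open>F x\<close> along the orbit is the
    constant \<open>x$i - p$i\<close>, by \<open>norml\<close>.\<close>
  have zc: "Ph t x$i = p$i + of_real t*(x$i - p$i)" if i: "i:I" for i
  proof -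
   have "((%t. Ph t x$i - of_real t*(x$i - p$i)) has_vector_derivative 0) (at t within {0..1})" if t: "t:{0..1}" for t
   proof -
    have "F x (Ph t x)$i = (SUM j:I. if j = i then x$i - p$i else 0)" unfolding F_def vec_lambda_beta
    proof (rule sum.cong)
     fix j assume "j:I"
     then show "(x$j - p$j)*C j i (Ph t x) = (if j = i then x$i - p$i else 0)"
      using norml[OF _ i, of j "Ph t x"] Ph(2)[OF xx(1) t] sub by auto
    qed simp
    then have "F x (Ph t x)$i = x$i - p$i" using i by simp
    moreover have "((%t. Ph t x$i) has_vector_derivative F x (Ph t x)$i) (at t within {0..1})"
     by (rule has_vector_derivative_nth[OF Ph(3)[OF xx(1) t]])
    moreover have "((%t. of_real t*(x$i - p$i)) has_vector_derivative (x$i - p$i)) (at t within {0..1})"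
     using has_vector_derivative_scaleR[OF DERIV_ident has_vector_derivative_const[of "x$i - p$i"], of t "{0..1}"]
     by (simp add: scaleR_conv_of_real)
    ultimately show ?thesis using has_vector_derivative_diff by fastforce
   qed
   then obtain c where c: "!!t. t:{0..1} ==> Ph t x$i - of_real t*(x$i - p$i) = c"
    using has_vector_derivative_zero_constant[of "{0..1}" "%t. Ph t x$i - of_real t*(x$i - p$i)"] by auto
   have "c = p$i" using c[of 1] Ph(1)[OF xx(1)] by simp
   then show ?thesis using c[OF t] by (simp add: algebra_simps)
  qed
  show "i:I ==> Ph t x$i = p$i + of_real t*(x$i - p$i)" by (rule zc)
  have y: "Ph t x:ball p ro" using x t by (auto simp: V_def)
  \<comment> \<open>By \<open>zc\<close> the factors at the restarted point are \<open>t\<close>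
    times the old ones.\<close>
  have Fsc: "F (Ph t x) z = t *\<^sub>R F x z" for z unfolding vec_eq_iff
  proof
   fix a
   have "F (Ph t x) z$a = (SUM i:I. t *\<^sub>R ((x$i - p$i)*C i a z))"
    unfolding F_def vec_lambda_beta by (rule sum.cong) (auto simp: zc scaleR_conv_of_real)
   then show "F (Ph t x) z$a = (t *\<^sub>R F x z)$a" by (simp add: F_def scaleR_sum_right)
  qed
  show "Ph s (Ph t x) = Ph (s * t) x"
  proof (rule curve_unique[of "%s. Ph s (Ph t x)" "F (Ph t x)" "%s. Ph (s * t) x" "ball p r0"])
   fix s :: real assume s: "s:{0..1}"
   have st: "s * t:{0..1}" using s t by (auto simp: mult_le_one)
   show "((%s. Ph s (Ph t x)) has_vector_derivative F (Ph t x) (Ph s (Ph t x))) (at s within {0..1})"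
    using Ph(3) y ro(2) s by blast
   have "((%t. Ph t x) has_vector_derivative F x (Ph (s * t) x)) (at (s * t) within (%s. s * t) ` {0..1})"
    by (rule has_vector_derivative_within_subset[OF Ph(3)[OF xx(1) st]]) (use t in \<open>auto simp: mult_le_one\<close>)
   then have "((%t. Ph t x) \<circ> (%s. s * t) has_vector_derivative t *\<^sub>R F x (Ph (s * t) x)) (at s within {0..1})"
    by (intro vector_diff_chain_within) (auto intro!: derivative_eq_intros)
   then show "((%s. Ph (s * t) x) has_vector_derivative F (Ph t x) (Ph (s * t) x)) (at s within {0..1})" by (simp add: Fsc o_def)
   show "Ph s (Ph t x):ball p r0" using Ph(2) y ro(2) s by blast
   show "Ph (s * t) x:ball p r0" using Ph(2) xx st by blast
  next
   show "norm (F (Ph t x) a - F (Ph t x) b) <= norm (a - b)/2" if "a:ball p r0" "b:ball p r0" for a b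
    using lipF that y ro(3) by blast
   show "Ph 1 (Ph t x) = Ph (1*t) x" using Ph(1) y ro(2) by auto
  qed (rule s)
 qed
 have inv: "Ph t x:V" if "t:{0..1}" "x:V" for t x
 proof -
  have "Ph s (Ph t x):ball p ro" if "s:{0..1}" for s
  proof -
   have "s * t:{0..1}" using that \<open>t:_\<close> by (auto simp: mult_le_one)
   then have "Ph (s * t) x:ball p ro" using \<open>x:V\<close> unfolding V_def by blast
   then show ?thesis using semi[OF that \<open>t:_\<close> \<open>x:V\<close>] by simp
  qed
  moreover have "Ph t x:ball p ro" using that unfolding V_def by blast
  ultimately show ?thesis unfolding V_def by blast
 qed
 have openV: "open V"
 proof -
  have cont: "continuous_on ({0..1} \<times> ball p ro) (%(t, x). Ph t x)"
  proof -
   have "continuous_on ({0..1} \<times> ball p ro) (%z. (%(t, x). Ph t x) z$a)" for a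
    using continuous_on_subset[OF RT_cont[OF open_ball RT1[of a]] Sigma_mono[OF order_refl ro(2)]] by (simp add: case_prod_unfold)
   then show ?thesis using continuous_on_vec_lambda[of "{0..1} \<times> ball p ro" "%a z. (%(t, x). Ph t x) z$a"] by simp
  qed
  have "EX T. open T & x0:T & T <= V" if x0: "x0:V" for x0
  proof -
   obtain W where W: "open W" "W \<inter> ({0..1} \<times> ball p ro) = (%(t, x). Ph t x) -` ball p ro \<inter> ({0..1} \<times> ball p ro)"
    using cont[unfolded continuous_on_open_invariant, rule_format, OF open_ball[of p ro]] by blast
   have W_iff: "(t, x):W \<longleftrightarrow> Ph t x:ball p ro" if "t:{0..1}" "x:ball p ro" for t x
    using that arg_cong[OF W(2), of "%A. (t, x):A"] by simp
   have sw: "open (prod.swap -` W)" by (rule open_vimage[OF W(1)]) (auto simp: prod.swap_def intro!: continuous_intros)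
   have "{x0} \<times> {0..1} <= prod.swap -` W" using x0 W_iff unfolding V_def by auto
   \<comment> \<open>The orbit condition holds at \<open>x0\<close> for all times in a compact
     interval, hence for all times at every nearby point as well.\<close>
   from Elementary_Topology.tube_lemma[OF compact_Icc sw this]
   obtain X where X: "open X" "x0:X" "X \<times> {0..1} <= prod.swap -` W" by auto
   have "X \<inter> ball p ro <= V"
   proof
    fix x assume x: "x:X \<inter> ball p ro"
    have "Ph t x:ball p ro" if "t:{0..1}" for t
    proof -
     have "(x, t):prod.swap -` W" using X(3) x that by blast
     then show ?thesis using x that W_iff[of t x] by simp
    qed
    then show "x:V" using x by (simp add: V_def)
   qed
   then show ?thesis using X x0 Vsub by (intro exI[of _ "X \<inter> ball p ro"]) auto
  qed
  then show ?thesis by (subst open_subopen) blast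
 qed
 show thesis
 proof (rule that[of V Ph])
  show "p:V" using stat[of p] ro(1) by (auto simp: V_def)
  show "V <= S" using V1 sub by auto
  show "RT V (%t x. Ph t x$a)" for a by (rule RT_subset[OF _ RT1]) (use openV V1 in auto)
  show "Ph t x = x" if "t:{0..1}" "x:V" "!!i. i:I ==> x$i = p$i" for t x using stat that Vsub by blast
  show "Ph 1 x = x" if "x:V" for x using Ph(1) V1 that by blast
  show "((%t. Ph t x) has_vector_derivative (\<chi> a. SUM i:I. (x$i - p$i)*C i a (Ph t x))) (at t within {0..1})"
   if "t:{0..1}" "x:V" for t x using Ph(3)[OF V1(1)[OF that(2)] that(1)] by (simp add: F_def)
 qed (use openV semi semi2 inv in auto)
qed

text \<open>Since the fields commute and are normalised on \<open>I\<close>, the radial field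
  satisfies [Y_i, E] = Y_i (\<open>EY\<close>). So a defect measured by Y_i, namely Y_i f or Y_i G -
  g_i, solves E h = - h as soon as E f = 0 or E G has the right value. A system of equations is
  thereby reduced to a single one along the radial orbits.\<close>

theorem frobenius:
 assumes S: "open S" "p:S" and C: "!!i a. R S (C i a)"
  and norml: "!!i l x. i:I ==> l:I ==> x:S ==> C i l x = (if i = l then 1 else 0)"
  and comm: "!!T f i j x. open T ==> T <= S ==> R T f ==> i:I ==> j:I ==> x:T ==>
   Yop C i (Yop C j f) x = Yop C j (Yop C i f) x"
 obtains V f where "open V" "p:V" "V <= S"
  "!!a. R V (f a)" "!!a i x. i:I ==> x:V ==> Yop C i (f a) x = 0"
  "!!a b. b ~: I ==> pd b (f a) p = (if a = b then 1 else 0)"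
  "!!g. (!!i. i:I ==> R V (g i)) ==>
   (!!i j x. i:I ==> j:I ==> x:V ==> Yop C i (g j) x = Yop C j (g i) x) ==>
   EX G. R V G & (ALL i:I. ALL x:V. Yop C i G x = g i x)"
proof -
 obtain V Ph where V: "open V" "p:V" "V <= S" and RTPh: "!!a. RT V (%t x. Ph t x$a)"
  and Ph1: "!!x. x:V ==> Ph 1 x = x"
  and inv: "!!t x. t:{0..1} ==> x:V ==> Ph t x:V"
  and der: "!!t x. t:{0..1} ==> x:V ==>
    ((%t. Ph t x) has_vector_derivative (\<chi> a. SUM i:I. (x$i - p$i)*C i a (Ph t x))) (at t within {0..1})"
  and semi: "!!s t x. s:{0..1} ==> t:{0..1} ==> x:V ==> Ph s (Ph t x) = Ph (s * t) x"
  and zc: "!!t x i. t:{0..1} ==> x:V ==> i:I ==> Ph t x$i = p$i + of_real t*(x$i - p$i)"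
  and stat: "!!t x. t:{0..1} ==> x:V ==> (!!i. i:I ==> x$i = p$i) ==> Ph t x = x"
  using flow_box[OF S C norml] by blast
 note CV = R_subset[OF S(1) C V(1,3)]
 define E where "E = (%f x. SUM i:I. (x$i - p$i)*Yop C i f x)"
 have R_xp: "R V (%x. x$i - p$i)" for i using V(1) by (intro R_diff R_coord R_const)
 have RY: "R V (Yop C i f)" if "R V f" for i f using R_Yop V(1) CV that by blast
 have chain: "((%t. f (Ph t x)) has_vector_derivative (SUM i:I. (x$i - p$i)*Yop C i f (Ph t x))) (at t within {0..1})"
  if f: "R V f" and x: "x:V" and t: "t:{0..1}" for f x t
 proof -
  have "(SUM a:UNIV. pd a f (Ph t x)*(\<chi> a. SUM i:I. (x$i - p$i)*C i a (Ph t x))$a)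
   = (SUM i:I. (x$i - p$i)*Yop C i f (Ph t x))" unfolding Yop_def sum_distrib_left vec_lambda_beta
   by (subst sum.swap) (simp add: algebra_simps)
  then show ?thesis using curve_chain[OF V(1) f inv[OF t x] der[OF t x]] by simp
 qed
 \<comment> \<open>At time 1, where the orbit is at \<open>x\<close> itself, only one-sided
   derivatives are available.\<close>
 have at1: "d = d'" if "(u has_vector_derivative d) (at 1 within {0..1})" "(u has_vector_derivative d') (at 1 within {0..1})"
  for u :: "real => 'k" and d d' using vector_derivative_unique_within_closed_interval[of 0 1 1 u d d'] that by simp
 have zero: "h x = 0" if h: "R V h" and Eh: "!!x. x:V ==> E h x = - h x" and x: "x:V" for h x
 proof -
  have "((%t. t *\<^sub>R h (Ph t x)) has_vector_derivative 0) (at t within {0..1})" if t: "t:{0..1}" for t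
  proof -
   have "((%t. t *\<^sub>R h (Ph t x)) has_vector_derivative
     t *\<^sub>R (SUM i:I. (x$i - p$i)*Yop C i h (Ph t x)) + 1 *\<^sub>R h (Ph t x)) (at t within {0..1})"
    by (rule has_vector_derivative_scaleR[OF DERIV_ident chain[OF h x t]])
   moreover have "t *\<^sub>R (SUM i:I. (x$i - p$i)*Yop C i h (Ph t x)) = E h (Ph t x)"
    unfolding E_def scaleR_sum_right using zc[OF t x] by (intro sum.cong) (auto simp: scaleR_conv_of_real)
   ultimately show ?thesis using Eh[OF inv[OF t x]] by simp
  qed
  then obtain c where c: "!!t. t:{0..1} ==> t *\<^sub>R h (Ph t x) = c"
   using has_vector_derivative_zero_constant[of "{0..1}" "%t. t *\<^sub>R h (Ph t x)"] by auto
  show ?thesis using c[of 0] c[of 1] Ph1[OF x] by simp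
 qed
 have Yk: "Yop C i (%x. SUM j:I. (x$j - p$j)*g j x) x = (SUM j:I. (x$j - p$j)*Yop C i (g j) x) + g i x"
  if g: "!!j. j:I ==> R V (g j)" and i: "i:I" and x: "x:V" for g i x
 proof -
  have c: "Yop C i (%x. x$j - p$j) x = (if i = j then 1 else 0)" if "j:I" for j
   using Yop_add[OF V(1) R_coord[OF V(1)] R_const[OF V(1)] x, of C i j "- p$j"] norml[OF i that, of x] x V(3) by (auto simp: Yop_coord)
  have "Yop C i (%x. SUM j:I. (x$j - p$j)*g j x) x = (SUM j:I. Yop C i (%x. (x$j - p$j)*g j x) x)"
   by (rule Yop_sum[OF V(1) _ x]) (intro R_mult R_xp V(1) g)
  also have "... = (SUM j:I. (x$j - p$j)*Yop C i (g j) x + (if i = j then g j x else 0))"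
   by (intro sum.cong) (auto simp: Yop_mult[OF V(1) R_xp g x] c)
  finally show ?thesis using i by (simp add: sum.distrib)
 qed
 have EY: "E (Yop C i f) x = Yop C i (E f) x - Yop C i f x" if f: "R V f" and i: "i:I" and x: "x:V" for f i x
 proof -
  have "Yop C i (E f) x = (SUM j:I. (x$j - p$j)*Yop C i (Yop C j f) x) + Yop C i f x"
   unfolding E_def by (rule Yk[OF _ i x]) (rule RY[OF f])
  also have "(SUM j:I. (x$j - p$j)*Yop C i (Yop C j f) x) = E (Yop C i f) x"
   unfolding E_def using comm[OF V(1,3) f i _ x] by (intro sum.cong) auto
  finally show ?thesis by simp
 qed
 \<comment> \<open>By the semigroup law the time-0 map is constant along each orbit; its components
   are the first integrals of the fields.\<close>
 define f where "f = (%a x. Ph 0 x$a)"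
 have Rf: "R V (f a)" for a unfolding f_def using RT_slice[OF V(1) RTPh] by simp
 have Ef: "E (f a) x = 0" if x: "x:V" for a x
 proof -
  have "((%t. f a (Ph t x)) has_vector_derivative 0) (at 1 within {0..1})"
   by (rule has_vector_derivative_transform[of _ _ _ "%t. f a x"]) (use semi x in \<open>auto simp: f_def\<close>)
  moreover have "((%t. f a (Ph t x)) has_vector_derivative E (f a) x) (at 1 within {0..1})"
   using chain[OF Rf x, of 1 a] Ph1[OF x] by (simp add: E_def)
  ultimately show ?thesis by (rule at1[symmetric])
 qed
 have Yf: "Yop C i (f a) x = 0" if i: "i:I" and x: "x:V" for a i x
 proof (rule zero[OF RY[OF Rf] _ x])
  fix x assume x: "x:V"
  have "Yop C i (E (f a)) x = Yop C i (%x. 0) x" by (rule Yop_cong[OF V(1) x]) (rule Ef)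
  then show "E (Yop C i (f a)) x = - Yop C i (f a) x" using EY[OF Rf i x] by simp
 qed
 have pdf: "pd b (f a) p = (if a = b then 1 else 0)" if b: "b ~: I" for a b
 proof -
  \<comment> \<open>An axis direction outside \<open>I\<close> leaves the coordinates in
    \<open>I\<close> at their values in \<open>p\<close>, where the flow is stationary and
    \<open>f a\<close> is coordinate \<open>a\<close>.\<close>
  define ga where "ga = (%t::real. p + t *\<^sub>R axis b (1::'k))"
  have ga: "(ga has_vector_derivative axis b 1) (at 0)" unfolding ga_def by (auto intro!: derivative_eq_intros)
  have "isCont ga 0" using ga has_vector_derivative_continuous by blast
  then have "\<forall>\<^sub>F t in at 0. ga t:V"
   using V topological_tendstoD[of ga "ga 0" "at 0" V] by (auto simp: isCont_def ga_def)
  then obtain e where e: "e > 0" "!!t. t ~= 0 ==> dist t 0 < e ==> ga t:V"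
   unfolding eventually_at by auto
  have eV: "ga t:V" if "t:ball 0 e" for t using e(2)[of t] that V(2) by (cases "t = 0") (auto simp: ga_def dist_commute)
  have val: "f a (ga t) = p$a + t *\<^sub>R (if a = b then 1 else 0)" if "t:ball 0 e" for t
  proof -
   have "Ph 0 (ga t) = ga t" by (rule stat) (use eV[OF that] b in \<open>auto simp: ga_def axis_def\<close>)
   then show ?thesis by (simp add: f_def ga_def axis_def)
  qed
  have "((%t. f a (ga t)) has_vector_derivative (if a = b then 1 else 0)) (at 0)"
   by (rule has_vector_derivative_transform_within_open[of "%t. p$a + t *\<^sub>R (if a = b then 1 else 0)" _ 0 "ball 0 e"])
    (use val e(1) in \<open>auto intro!: derivative_eq_intros\<close>)
  moreover have "((%t. f a (ga t)) has_vector_derivative (SUM i:UNIV. pd i (f a) (ga 0)*axis b 1$i)) (at 0)"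
   by (rule curve_chain[OF V(1) Rf _ ga]) (use V in \<open>simp add: ga_def\<close>)
  ultimately have "(if a = b then 1 else 0) = (SUM i:UNIV. pd i (f a) (ga 0)*axis b 1$i)" using vector_derivative_unique_at by blast
  then have "(if a = b then 1 else 0) = pd b (f a) p" by (simp add: ga_def axis_def if_distrib[of "%u. _*u"] cong: if_cong)
  then show ?thesis by simp
 qed
 have solve: "EX G. R V G & (ALL i:I. ALL x:V. Yop C i G x = g i x)"
  if g: "!!i. i:I ==> R V (g i)"
   and cl: "!!i j x. i:I ==> j:I ==> x:V ==> Yop C i (g j) x = Yop C j (g i) x" for g
 proof -
  \<comment> \<open>The homotopy operator of the Poincare lemma, with radial orbits in place of
    straight segments.\<close>
  define J where "J = (%i x. integral {0..1} (%t. g i (Ph t x)))"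
  define G where "G = (%x. SUM i:I. (x$i - p$i)*J i x)"
  have RTg: "RT V (%t x. g i (Ph t x))" if "i:I" for i by (rule RT_compose[OF V(1,1) g[OF that] RTPh]) (use inv in auto)
  have RJ: "R V (J i)" if "i:I" for i unfolding J_def by (rule RT_integral[OF V(1) RTg[OF that]])
  have RG: "R V G" unfolding G_def by (intro R_sum R_mult R_xp V(1) RJ)
  have cont: "continuous_on {0..1} (%t. g i (Ph t x))" if "i:I" "x:V" for i x
  proof -
   have "continuous_on {0..1} ((%(t, x). g i (Ph t x)) \<circ> (%t. (t, x)))" by (rule continuous_on_compose)
     (use that(2) in \<open>auto intro!: continuous_intros continuous_on_subset[OF RT_cont[OF V(1) RTg[OF that(1)]]]\<close>)
   then show ?thesis by (simp add: o_def)
  qed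
  define k where "k = (%x. SUM i:I. (x$i - p$i)*g i x)"
  \<comment> \<open>\<open>w\<close> integrates the one-form with components \<open>g i\<close>
    along the orbit of \<open>x\<close>. By the semigroup law and \<open>zc\<close> it equals
    \<open>G\<close> along this orbit, and its derivative at time 1 is \<open>k x\<close>.\<close>
  have EG: "E G x = k x" if x: "x:V" for x
  proof -
   define q where "q = (%t. SUM i:I. (x$i - p$i)*g i (Ph t x))"
   define w where "w = (%t. integral {0..t} q)"
   have contq: "continuous_on {0..1} q" unfolding q_def by (intro continuous_intros cont x)
   have w: "(w has_vector_derivative q t) (at t within {0..1})" if "t:{0..1}" for t
    unfolding w_def by (rule integral_has_vector_derivative[OF contq that])
   have Gw: "G (Ph ta x) = w ta" if ta: "ta:{0..1}" for ta
   proof -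
    have st: "s * ta:{0..1}" if "s:{0..1}" for s using that ta by (auto simp: mult_le_one)
    have "((%s. w (s * ta)) has_vector_derivative ta *\<^sub>R q (s * ta)) (at s within {0..1})" if s: "s:{0..1}" for s
    proof -
     have "(w has_vector_derivative q (s * ta)) (at (s * ta) within (%s. s * ta) ` {0..1})"
      by (rule has_vector_derivative_within_subset[OF w[OF st[OF s]]]) (use st in auto)
     then have "(w \<circ> (%s. s * ta) has_vector_derivative ta *\<^sub>R q (s * ta)) (at s within {0..1})"
      by (intro vector_diff_chain_within) (auto intro!: derivative_eq_intros)
     then show ?thesis by (simp add: o_def)
    qed
    then have "((%s. ta *\<^sub>R q (s * ta)) has_integral (w (1*ta) - w (0*ta))) {0..1}"
     by (intro fundamental_theorem_of_calculus) auto
    then have 1: "((%s. ta *\<^sub>R q (s * ta)) has_integral w ta) {0..1}" by (simp add: w_def)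
    have "((%s. SUM i:I. (Ph ta x$i - p$i)*g i (Ph s (Ph ta x))) has_integral G (Ph ta x)) {0..1}"
     unfolding G_def J_def
     by (intro has_integral_sum has_integral_mult_right integrable_integral integrable_continuous_interval cont inv[OF ta x])
      auto
    then have 2: "((%s. ta *\<^sub>R q (s * ta)) has_integral G (Ph ta x)) {0..1}" by (rule has_integral_eq[rotated])
      (auto simp: q_def semi[OF _ ta x] zc[OF ta x] sum_distrib_left scaleR_conv_of_real mult.assoc)
    show ?thesis by (rule has_integral_unique[OF 2 1])
   qed
   have "((%t. G (Ph t x)) has_vector_derivative q 1) (at 1 within {0..1})"
    by (rule has_vector_derivative_transform[OF _ _ w]) (use Gw in auto)
   moreover have "((%t. G (Ph t x)) has_vector_derivative E G x) (at 1 within {0..1})"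
    using chain[OF RG x, of 1] Ph1[OF x] by (simp add: E_def)
   ultimately have "E G x = q 1" by (rule at1[symmetric])
   then show ?thesis by (simp add: q_def k_def Ph1[OF x])
  qed
  have "Yop C i G x = g i x" if i: "i:I" and x: "x:V" for i x
  proof -
   have "Yop C i G x - g i x = 0"
   proof (rule zero[OF R_diff[OF V(1) RY[OF RG] g[OF i]] _ x])
    fix x assume x: "x:V"
    \<comment> \<open>Closedness \<open>cl\<close> exchanges the indices, so differentiating
      \<open>k\<close> gives E g_i + g_i; together with \<open>EY\<close> the defect satisfies E h =
      - h.\<close>
    have "Yop C i (E G) x = Yop C i k x" by (rule Yop_cong[OF V(1) x]) (rule EG)
    also have "... = (SUM j:I. (x$j - p$j)*Yop C i (g j) x) + g i x" unfolding k_def by (rule Yk[OF g i x])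
    also have "(SUM j:I. (x$j - p$j)*Yop C i (g j) x) = E (g i) x" unfolding E_def using cl[OF i _ x] by (intro sum.cong) auto
    finally have "E (Yop C i G) x = E (g i) x + g i x - Yop C i G x" using EY[OF RG i x] by simp
    moreover have "E (%x. Yop C i G x - g i x) x = E (Yop C i G) x - E (g i) x"
    proof -
     have "Yop C j (%x. Yop C i G x - g i x) x = Yop C j (Yop C i G) x - Yop C j (g i) x" for j
      using Yop_add[OF V(1) RY[OF RG] R_mult[OF V(1) R_const[OF V(1), of "-1"] g[OF i]] x, of C j i]
       Yop_mult[OF V(1) R_const[OF V(1), of "-1"] g[OF i] x, of C j] by simp
     then show ?thesis by (simp add: E_def right_diff_distrib sum_subtractf)
    qed
    ultimately show "E (%x. Yop C i G x - g i x) x = - (Yop C i G x - g i x)" by simp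
   qed
   then show ?thesis by simp
  qed
  then show ?thesis using RG by blast
 qed
 show thesis by (rule that[of V f]) (use V Rf Yf pdf solve in auto)
qed

end

section \<open>Smooth functions\<close>

lemma has_derivative_pd:
 fixes f :: "real^'n::finite => real"
 assumes "f differentiable at x"
 shows "(f has_derivative (%h. SUM i:UNIV. pd i f x*h$i)) (at x)"
proof -
 have d: "(f has_derivative frechet_derivative f (at x)) (at x)" using assms frechet_derivative_works by blast
 then have lin: "linear (frechet_derivative f (at x))" using has_derivative_linear by blast
 have "frechet_derivative f (at x) h = (SUM i:UNIV. pd i f x*h$i)" for h
 proof -
  have "frechet_derivative f (at x) h = frechet_derivative f (at x) (SUM i:UNIV. h$i *\<^sub>R axis i 1)"
   using basis_expansion[of h] by (simp add: scalar_mult_eq_scaleR)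
  also have "... = (SUM i:UNIV. h$i *\<^sub>R pd i f x)" by (simp add: linear_sum[OF lin] linear_scale[OF lin] pd_def o_def)
  finally show ?thesis by (simp add: mult.commute)
 qed
 then show ?thesis using has_derivative_eq_rhs[OF d, of "%h. SUM i:UNIV. pd i f x*h$i"] by auto
qed

lemma frechet_derivative_eq_pd:
 fixes f :: "real^'n::finite => real"
 assumes "f differentiable at x"
 shows "frechet_derivative f (at x) h = (SUM i:UNIV. pd i f x*h$i)"
 using fun_cong[OF frechet_derivative_at[OF has_derivative_pd[OF assms]], of h] by simp

text \<open>Picard iterates and their partial derivatives converge geometrically on compact sets. A sequence of
  class gcf p has this property for all its derivatives up to order p, so its limit is of class p; a constant sequence
  in gcf p is just a family of class p. The ratio 3/4 is larger than the contraction factor 1/2 in order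
  to absorb the inhomogeneous terms of the linear recursions satisfied by the derivatives.\<close>
definition gc0 :: "(real^'n::finite) set => (nat => real => real^'n => real) => bool" where
 "gc0 V f \<longleftrightarrow> (ALL m. continuous_on ({0..1} \<times> V) (%(t, x). f m t x)) &
   (ALL K. compact K & K <= V --> (EX C>=0. ALL m. ALL t:{0..1}. ALL x:K.
    \<bar>f m t x\<bar> <= C & \<bar>f (Suc m) t x - f m t x\<bar> <= C*(3/4)^m))"

primrec gcf :: "nat => (real^'n::finite) set => (nat => real => real^'n => real) => bool" where
 "gcf 0 V f \<longleftrightarrow> gc0 V f"
| "gcf (Suc p) V f \<longleftrightarrow> gc0 V f & (ALL m. ALL t:{0..1}. ALL x:V. f m t differentiable at x) &
   (ALL i. gcf p V (%m t. pd i (f m t)))"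

section \<open>Closure properties of geometrically convergent sequences\<close>

lemma gc0_contD: "gc0 V f ==> continuous_on ({0..1} \<times> V) (%(t, x). f m t x)" by (simp add: gc0_def)

lemma gc0_boundD:
 assumes "gc0 V f" "compact K" "K <= V"
 obtains C where "C >= 0" "!!m t x. t:{0..1} ==> x:K ==> \<bar>f m t x\<bar> <= C"
  "!!m t x. t:{0..1} ==> x:K ==> \<bar>f (Suc m) t x - f m t x\<bar> <= C*(3/4)^m"
proof -
 have "EX C>=0. ALL m. ALL t:{0..1}. ALL x:K. \<bar>f m t x\<bar> <= C & \<bar>f (Suc m) t x - f m t x\<bar> <= C*(3/4)^m"
  using assms unfolding gc0_def by simp
 then show ?thesis using that by blast
qed

lemma gc0_cong:
 assumes "gc0 V f" "!!m t x. t:{0..1} ==> x:V ==> f m t x = g m t x"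
 shows "gc0 V g" unfolding gc0_def
proof (intro conjI allI impI)
 show "continuous_on ({0..1} \<times> V) (%(t, x). g m t x)" for m
  by (rule continuous_on_eq[OF gc0_contD[OF assms(1)]]) (use assms(2) in auto)
 fix K assume K: "compact K & K <= V"
 then obtain C where C: "C >= 0" "!!m t x. t:{0..1} ==> x:K ==> \<bar>f m t x\<bar> <= C"
  "!!m t x. t:{0..1} ==> x:K ==> \<bar>f (Suc m) t x - f m t x\<bar> <= C*(3/4)^m"
  using gc0_boundD[OF assms(1)] by blast
 have "g m t x = f m t x" if "t:{0..1}" "x:K" for m t x using assms(2)[of t x m] that K by auto
 then show "EX C>=0. ALL m. ALL t:{0..1}. ALL x:K. \<bar>g m t x\<bar> <= C & \<bar>g (Suc m) t x - g m t x\<bar> <= C*(3/4)^m"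
  using C by (intro exI[of _ C]) simp
qed

lemma gcf_gc0: "gcf p V f ==> gc0 V f" by (cases p) auto

lemma gcf_cong:
 assumes V: "open V" and f: "gcf p V f" and eq: "!!m t x. t:{0..1} ==> x:V ==> f m t x = g m t x"
 shows "gcf p V g" using f eq
proof (induction p arbitrary: f g)
 case 0
 then show ?case using gc0_cong[of V f g] by simp
next
 case (Suc p)
 have "g m t differentiable at x" if "t:{0..1}" "x:V" for m t x
 proof -
  have "f m t differentiable at x" using Suc.prems(1) that by simp
  then obtain D where "(f m t has_derivative D) (at x)" unfolding differentiable_def by blast
  then have "(g m t has_derivative D) (at x)" using has_derivative_transform_within_open[of "f m t" D x UNIV V "g m t"] V that Suc.prems(2) by simp
  then show ?thesis by (rule differentiableI)
 qed
 moreover have "gcf p V (%m t. pd i (g m t))" for i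
 proof (rule Suc.IH[of "%m t. pd i (f m t)" "%m t. pd i (g m t)"])
  show "gcf p V (%m t. pd i (f m t))" using Suc.prems(1) by simp
  fix m t x assume tx: "t:{0..1::real}" "x:V"
  have "f m t y = g m t y" if "y:V" for y using Suc.prems(2) tx(1) that by blast
  then show "pd i (f m t) x = pd i (g m t) x" by (rule pd_cong[OF V tx(2)])
 qed
 moreover have "gc0 V g" by (rule gc0_cong[of V f]) (use Suc.prems in auto)
 ultimately show ?case unfolding gcf.simps by blast
qed

lemma gcf_SucD: "gcf (Suc p) V f ==> gcf p V f"
proof (induction p arbitrary: f)
 case (Suc p)
 have "gcf (Suc p) V (%m t. pd i (f m t))" for i using Suc.prems by simp
 then have "gcf p V (%m t. pd i (f m t))" for i by (rule Suc.IH)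
 then show ?case using Suc.prems by simp
qed simp

lemma gc0_const_seqI:
 assumes c: "continuous_on ({0..1} \<times> V) (%(t, x). f t x)"
 shows "gc0 V (%m. f)" unfolding gc0_def
proof (intro conjI allI impI)
 fix K assume "compact K & K <= V"
 then have "compact ((%(t, x). f t x) ` ({0..1} \<times> K))"
  by (intro compact_continuous_image continuous_on_subset[OF c] compact_Times) auto
 from compact_imp_bounded[OF this]
 obtain B where B: "ALL y:(%(t, x). f t x) ` ({0..1} \<times> K). norm y <= B" unfolding bounded_iff by blast
 have "\<bar>f t x\<bar> <= \<bar>B\<bar>" if "t:{0..1}" "x:K" for t x
 proof -
  have "norm (f t x) <= B" using B that by force
  then show ?thesis by simp
 qed
 then show "EX C>=0. ALL m::nat. ALL t:{0..1}. ALL x:K. \<bar>f t x\<bar> <= C & \<bar>f t x - f t x\<bar> <= C*(3/4)^m"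
  by (intro exI[of _ "\<bar>B\<bar>"]) auto
qed (rule c)

lemma gcf_time:
 assumes "continuous_on {0..1} c"
 shows "gcf p V (%m t x. c t)"
proof -
 have "continuous_on ({0..1} \<times> V) (%(t, x). c t)" if "continuous_on {0..1} c" for c :: "real => real"
  unfolding case_prod_unfold by (rule continuous_on_compose2[OF that continuous_on_fst[OF continuous_on_id]]) auto
 then have 0: "gc0 V (%m t x. c t)" if "continuous_on {0..1} c" for c using that by (intro gc0_const_seqI)
 have "pd i (%x. c :: real) = (%x. 0)" for c and i :: 'a by (rule ext) (rule pd_const)
 then show ?thesis using assms 0 by (induction p arbitrary: c) auto
qed

lemma gcf_const: "gcf p V (%m t x. c)" using gcf_time[of "%_. c"] by simp

lemma gcf_coord:
 assumes "open V"
 shows "gcf p V (%m t x. x$i)"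
proof -
 have 0: "gc0 V (%m t x. x$i)" by (rule gc0_const_seqI) (auto simp: case_prod_unfold intro!: continuous_intros)
 show ?thesis
 proof (cases p)
  case (Suc q)
  have "gcf q V (%m t. pd j (%x. x$i))" for j
   using gcf_cong[OF assms gcf_const[of q V "if j = i then 1 else 0"]] by (simp add: pd_coord)
  then show ?thesis using 0 Suc bounded_linear_imp_differentiable[OF bounded_linear_vec_nth] by auto
 qed (use 0 in simp)
qed

lemma gc0_add:
 assumes "gc0 V f" "gc0 V g"
 shows "gc0 V (%m t x. f m t x + g m t x)" unfolding gc0_def
proof (intro conjI allI impI)
 show "continuous_on ({0..1} \<times> V) (%(t, x). f m t x + g m t x)" for m
  using continuous_on_add[OF gc0_contD[OF assms(1)] gc0_contD[OF assms(2)], of m m] by (simp add: case_prod_unfold)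
 fix K assume K: "compact K & K <= V"
 obtain C where C: "C >= 0" "!!m t x. t:{0..1} ==> x:K ==> \<bar>f m t x\<bar> <= C"
  "!!m t x. t:{0..1} ==> x:K ==> \<bar>f (Suc m) t x - f m t x\<bar> <= C*(3/4)^m"
  using gc0_boundD[OF assms(1)] K by blast
 obtain D where D: "D >= 0" "!!m t x. t:{0..1} ==> x:K ==> \<bar>g m t x\<bar> <= D"
  "!!m t x. t:{0..1} ==> x:K ==> \<bar>g (Suc m) t x - g m t x\<bar> <= D*(3/4)^m"
  using gc0_boundD[OF assms(2)] K by blast
 have "\<bar>f m t x + g m t x\<bar> <= C + D &
   \<bar>f (Suc m) t x + g (Suc m) t x - (f m t x + g m t x)\<bar> <= (C + D)*(3/4)^m" if "t:{0..1}" "x:K" for m t x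
  using C(2,3)[OF that, of m] D(2,3)[OF that, of m] unfolding distrib_right by (intro conjI; linarith)
 then show "EX C>=0. ALL m. ALL t:{0..1}. ALL x:K. \<bar>f m t x + g m t x\<bar> <= C &
   \<bar>f (Suc m) t x + g (Suc m) t x - (f m t x + g m t x)\<bar> <= C*(3/4)^m" using C(1) D(1) by (intro exI[of _ "C + D"]) auto
qed

lemma gc0_mult:
 assumes "gc0 V f" "gc0 V g"
 shows "gc0 V (%m t x. f m t x*g m t x)" unfolding gc0_def
proof (intro conjI allI impI)
 show "continuous_on ({0..1} \<times> V) (%(t, x). f m t x*g m t x)" for m
  using continuous_on_mult[OF gc0_contD[OF assms(1)] gc0_contD[OF assms(2)], of m m] by (simp add: case_prod_unfold)
 fix K assume K: "compact K & K <= V"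
 obtain C where C: "C >= 0" "!!m t x. t:{0..1} ==> x:K ==> \<bar>f m t x\<bar> <= C"
  "!!m t x. t:{0..1} ==> x:K ==> \<bar>f (Suc m) t x - f m t x\<bar> <= C*(3/4)^m"
  using gc0_boundD[OF assms(1)] K by blast
 obtain D where D: "D >= 0" "!!m t x. t:{0..1} ==> x:K ==> \<bar>g m t x\<bar> <= D"
  "!!m t x. t:{0..1} ==> x:K ==> \<bar>g (Suc m) t x - g m t x\<bar> <= D*(3/4)^m"
  using gc0_boundD[OF assms(2)] K by blast
 \<comment> \<open>The values need C*D and the increments C*D + C*D, so 2*C*D covers both.\<close>
 have "\<bar>f m t x*g m t x\<bar> <= 2*C*D &
   \<bar>f (Suc m) t x*g (Suc m) t x - f m t x*g m t x\<bar> <= (2*C*D)*(3/4)^m" if tx: "t:{0..1}" "x:K" for m t x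
 proof
  have "\<bar>f m t x*g m t x\<bar> <= C*D" unfolding abs_mult by (rule mult_mono) (use C(1,2) D(2) tx in auto)
  moreover have "0 <= C*D" using C(1) D(1) by simp
  ultimately show "\<bar>f m t x*g m t x\<bar> <= 2*C*D" by linarith
  have "f (Suc m) t x*g (Suc m) t x - f m t x*g m t x =
   f (Suc m) t x*(g (Suc m) t x - g m t x) + (f (Suc m) t x - f m t x)*g m t x" by (simp add: algebra_simps)
  moreover have "\<bar>f (Suc m) t x*(g (Suc m) t x - g m t x)\<bar> <= C*(D*(3/4)^m)"
   unfolding abs_mult by (rule mult_mono) (use C(1,2) D(3) tx in auto)
  moreover have "\<bar>(f (Suc m) t x - f m t x)*g m t x\<bar> <= (C*(3/4)^m)*D"
   unfolding abs_mult by (rule mult_mono) (use C(1,3) D(2) tx in auto)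
  ultimately show "\<bar>f (Suc m) t x*g (Suc m) t x - f m t x*g m t x\<bar> <= (2*C*D)*(3/4)^m" by (simp add: algebra_simps)
 qed
 then show "EX C>=0. ALL m. ALL t:{0..1}. ALL x:K. \<bar>f m t x*g m t x\<bar> <= C &
   \<bar>f (Suc m) t x*g (Suc m) t x - f m t x*g m t x\<bar> <= C*(3/4)^m" using C(1) D(1) by (intro exI[of _ "2*C*D"]) auto
qed

lemma gcf_add:
 assumes "open V" "gcf p V f" "gcf p V g"
 shows "gcf p V (%m t x. f m t x + g m t x)" using assms(2,3)
proof (induction p arbitrary: f g)
 case (Suc p)
 have "gcf p V (%m t. pd i (%x. f m t x + g m t x))" for i
 proof (rule gcf_cong[OF assms(1) Suc.IH])
  show "gcf p V (%m t. pd i (f m t))" "gcf p V (%m t. pd i (g m t))" using Suc.prems by auto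
  fix m t x assume "t:{0..1::real}" "x:V"
  then have "((%x. f m t x + g m t x) has_derivative
    (%h. SUM i:UNIV. (pd i (f m t) x + pd i (g m t) x)*h$i)) (at x)"
   using has_derivative_add[OF has_derivative_pd has_derivative_pd, of "f m t" x "g m t"] Suc.prems by (simp add: sum.distrib distrib_right)
  then show "pd i (f m t) x + pd i (g m t) x = pd i (%x. f m t x + g m t x) x" by (rule pd_eqI[symmetric])
 qed
 then show ?case using Suc.prems gc0_add[of V f g] by simp
qed (simp add: gc0_add)

lemma gcf_mult:
 assumes "open V" "gcf p V f" "gcf p V g"
 shows "gcf p V (%m t x. f m t x*g m t x)" using assms(2,3)
proof (induction p arbitrary: f g)
 case (Suc p)
 have "gcf p V (%m t. pd i (%x. f m t x*g m t x))" for i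
 proof (rule gcf_cong[OF assms(1)])
  show "gcf p V (%m t x. f m t x*pd i (g m t) x + pd i (f m t) x*g m t x)"
   by (intro gcf_add[OF assms(1)] Suc.IH) (use Suc.prems gcf_SucD in auto)
  fix m t x assume "t:{0..1::real}" "x:V"
  then have "f m t differentiable at x" "g m t differentiable at x" using Suc.prems by auto
  then have "((%x. f m t x*g m t x) has_derivative
    (%h. SUM i:UNIV. (f m t x*pd i (g m t) x + pd i (f m t) x*g m t x)*h$i)) (at x)"
   by (intro has_derivative_eq_rhs[OF has_derivative_mult[OF has_derivative_pd has_derivative_pd]])
    (auto simp: fun_eq_iff sum.distrib sum_distrib_left sum_distrib_right algebra_simps)
  then show "f m t x*pd i (g m t) x + pd i (f m t) x*g m t x = pd i (%x. f m t x*g m t x) x" by (rule pd_eqI[symmetric])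
 qed
 then show ?case using Suc.prems gc0_mult[of V f g] by simp
qed (simp add: gc0_mult)

lemma gcf_sum:
 assumes "open V" "!!a. a:A ==> gcf p V (f a)"
 shows "gcf p V (%m t x. SUM a:A. f a m t x)" using assms(2)
proof (induction A rule: infinite_finite_induct)
 case (insert a A)
 have "gcf p V (%m t x. f a m t x + (SUM a:A. f a m t x))" using insert.prems insert.IH by (intro gcf_add[OF assms(1)]) auto
 then show ?case using insert.hyps by simp
qed (simp_all add: gcf_const)

lemma gcf_diff:
 assumes "open V" "gcf p V f" "gcf p V g"
 shows "gcf p V (%m t x. f m t x - g m t x)" using gcf_add[OF assms(1,2) gcf_mult[OF assms(1) gcf_const[of p V "-1"] assms(3)]] by simp

lemma gc0_subset:
 assumes "gc0 V f" "U <= V" shows "gc0 U f"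
proof -
 have "continuous_on ({0..1} \<times> U) (%(t, x). f m t x)" for m
  by (rule continuous_on_subset[OF gc0_contD[OF assms(1)]]) (use assms(2) in auto)
 then show ?thesis using assms unfolding gc0_def by blast
qed

lemma gcf_subset: "gcf p V f ==> U <= V ==> gcf p U f"
proof (induction p arbitrary: f)
 case (Suc p)
 have "gcf p U (%m t. pd i (f m t))" for i by (rule Suc.IH) (use Suc.prems in auto)
 moreover have "gc0 U f" by (rule gc0_subset[of V]) (use Suc.prems in auto)
 ultimately show ?case using Suc.prems by auto
qed (simp add: gc0_subset)

lemma smooth_differentiable:
 assumes "smooth_fun_on S k" "x:S" shows "k differentiable at x"
proof -
 have "times_differentiable_on (Suc 0) S k" using assms(1) unfolding smooth_fun_on_def by (rule spec)
 then show ?thesis using assms(2) by simp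
qed

lemma smooth_pd:
 assumes "smooth_fun_on S k" shows "smooth_fun_on S (pd i k)"
proof -
 have "times_differentiable_on (Suc p) S k" for p using assms unfolding smooth_fun_on_def by (rule spec)
 then show ?thesis by (simp add: smooth_fun_on_def pd_def[abs_def])
qed

lemma smooth_continuous:
 assumes "smooth_fun_on S k" shows "continuous_on S k"
proof -
 have "times_differentiable_on 0 S k" using assms unfolding smooth_fun_on_def by (rule spec)
 then show ?thesis by simp
qed

text \<open>Order 0 is the hypothesis \<open>base\<close>, for every smooth \<open>k\<close>:
  composition keeps geometric convergence where \<open>k\<close> has a Lipschitz bound, and this
  depends on where the values lie. Higher orders follow from the chain rule, whose outer factors
  \<open>pd j k\<close> are again smooth.\<close>

lemma gcf_compose:
 assumes V: "open V" and k: "smooth_fun_on S k" and u: "!!j. gcf p V (%m t x. u m t x$j)"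
  and S: "!!m t x. t:{0..1} ==> x:V ==> u m t x:S"
  and base: "!!k. smooth_fun_on S k ==> gc0 V (%m t x. k (u m t x))"
 shows "gcf p V (%m t x. k (u m t x))" using k u
proof (induction p arbitrary: k)
 case (Suc p)
 have der: "((%x. k (u m t x)) has_derivative
    (%h. SUM i:UNIV. (SUM j:UNIV. pd j k (u m t x)*pd i (%x. u m t x$j) x)*h$i)) (at x)"
  if tx: "t:{0..1}" "x:V" for m t x
 proof -
  have du: "(u m t has_derivative (%h. \<chi> j. SUM i:UNIV. pd i (%x. u m t x$j) x*h$i)) (at x)"
  proof (rule has_derivative_vecI)
   fix j
   have "(%x. u m t x$j) differentiable at x" using Suc.prems(2)[of j] tx by simp
   then show "((%x. u m t x$j) has_derivative (%h. (\<chi> j. SUM i:UNIV. pd i (%x. u m t x$j) x*h$i)$j)) (at x)"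
    using has_derivative_pd by simp
  qed
  have "((%x. k (u m t x)) has_derivative
    (%h. SUM j:UNIV. pd j k (u m t x)*(\<chi> j. SUM i:UNIV. pd i (%x. u m t x$j) x*h$i)$j)) (at x)"
   by (rule has_derivative_compose[OF du has_derivative_pd[OF smooth_differentiable[OF Suc.prems(1) S[OF tx]]]])
  then show ?thesis by (rule has_derivative_eq_rhs)
    (auto simp: fun_eq_iff sum_distrib_left sum_distrib_right mult.assoc intro: sum.swap)
 qed
 have "gcf p V (%m t. pd i (%x. k (u m t x)))" for i
 proof (rule gcf_cong[OF V])
  have IH: "gcf p V (%m t x. pd j k (u m t x))" for j by (rule Suc.IH[OF smooth_pd[OF Suc.prems(1)] gcf_SucD[OF Suc.prems(2)]])
  show "gcf p V (%m t x. SUM j:UNIV. pd j k (u m t x)*pd i (%x. u m t x$j) x)"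
   by (intro gcf_sum gcf_mult V IH) (use Suc.prems(2) in simp)
 qed (rule pd_eqI[symmetric], rule der)
 moreover have "(%x. k (u m t x)) differentiable at x" if "t:{0..1}" "x:V" for m t x using der[OF that] by (rule differentiableI)
 ultimately show ?case using base[OF Suc.prems(1)] by simp
qed (use base in simp)

lemma gc0_smooth: "smooth_fun_on S k ==> gc0 S (%m t. k)" unfolding case_prod_unfold
 by (intro gc0_const_seqI, unfold case_prod_unfold,
   rule continuous_on_compose2[OF smooth_continuous continuous_on_snd[OF continuous_on_id]]) auto

text \<open>A function is a sequence constant in \<open>m\<close> and in \<open>t\<close>, so smooth
  functions inherit the closure properties of \<open>gcf\<close>. The work lies in passing between
  derivatives in all directions and partial derivatives.\<close>

lemma smooth_gcf:
 assumes "open S"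
 shows "smooth_fun_on S k \<longleftrightarrow> (ALL p. gcf p S (%m t. k))"
proof
 assume "smooth_fun_on S k"
 have "gcf p S (%m t. k)" for p using \<open>smooth_fun_on S k\<close>
 proof (induction p arbitrary: k)
  case 0
  then show ?case using gc0_smooth by simp
 next
  case (Suc p)
  have "gcf p S (%m t. pd i k)" for i by (rule Suc.IH[OF smooth_pd[OF Suc.prems]])
  then show ?case using gc0_smooth[OF Suc.prems] smooth_differentiable[OF Suc.prems] by simp
 qed
 then show "ALL p. gcf p S (%m t. k)" by blast
next
 assume *: "ALL p. gcf p S (%m t. k)"
 have "times_differentiable_on p S k" if "gcf p S (%m t. k)" for p using that
 proof (induction p arbitrary: k)
  case 0
  then have "continuous_on ({0..1} \<times> S) (%(t::real, x). k x)" using gc0_contD[of S "%m t. k" 0] by simp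
  then have "continuous_on S ((%(t, x). k x) \<circ> (%x. (0::real, x)))"
   by (intro continuous_on_compose) (auto intro!: continuous_intros elim: continuous_on_subset)
  then show ?case by (simp add: o_def)
 next
  case (Suc p)
  have d: "k differentiable at x" if "x:S" for x
  proof -
   have "ALL t:{0..1::real}. ALL x:S. k differentiable at x" using Suc.prems by simp
   from bspec[OF bspec[OF this, of 0] that] show ?thesis by simp
  qed
  have "times_differentiable_on p S (%x. frechet_derivative k (at x) v)" for v
  proof (rule Suc.IH, rule gcf_cong[OF assms])
   show "gcf p S (%m t x. SUM i:UNIV. pd i k x * v$i)" by (intro gcf_sum gcf_mult assms gcf_const) (use Suc.prems in auto)
   show "(SUM i:UNIV. pd i k x * v$i) = frechet_derivative k (at x) v" if "x:S" for x
    by (rule frechet_derivative_eq_pd[OF d[OF that], symmetric])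
  qed
  then show ?case using d by simp
 qed
 then show "smooth_fun_on S k" using*by (simp add: smooth_fun_on_def)
qed

section \<open>Integrals depending on a parameter\<close>

lemma continuous_slice:
 assumes "continuous_on (T \<times> V) (%(t, x). f t x)" "x:V"
 shows "continuous_on T (%t. f t x)"
proof -
 have "continuous_on T (%t. (t, x))" by (intro continuous_intros)
 then have "continuous_on T (%t. (%(t, x). f t x) (t, x))" by (rule continuous_on_compose2[OF assms(1)]) (use assms(2) in auto)
 then show ?thesis by simp
qed

text \<open>Moves the variable lower limit into the integrand, so that joint continuity in the limit
  and the parameter becomes continuity of an integral over a fixed interval.\<close>

lemma integral_rescale:
 fixes g :: "real => real"
 assumes "continuous_on {t..1} g" "t <= 1"
 shows "integral {t..1} g = (1 - t)*integral {0..1} (%s. g (t + (1 - t) * s))"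
proof -
 define W where "W = (%u. integral {t..u} g)"
 have W: "(W has_vector_derivative g u) (at u within {t..1})" if "u:{t..1}" for u
  unfolding W_def by (rule integral_has_vector_derivative[OF assms(1) that])
 have mem: "t + (1 - t) * s:{t..1}" if "s:{0..1}" for s using that assms(2) mult_left_le[of s "1 - t"] by auto
 have "((%s. W (t + (1 - t) * s)) has_vector_derivative (1 - t)*g (t + (1 - t) * s)) (at s within {0..1})" if s: "s:{0..1}" for s
 proof -
  have "(W has_vector_derivative g (t + (1 - t) * s)) (at (t + (1 - t) * s) within (%s. t + (1 - t) * s) ` {0..1})"
   by (rule has_vector_derivative_within_subset[OF W[OF mem[OF s]]]) (use mem in blast)
  then have "(W \<circ> (%s. t + (1 - t) * s) has_vector_derivative (1 - t) *\<^sub>R g (t + (1 - t) * s)) (at s within {0..1})"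
   by (intro vector_diff_chain_within) (auto intro!: derivative_eq_intros)
  then show ?thesis by (simp add: o_def)
 qed
 then have "((%s. (1 - t)*g (t + (1 - t) * s)) has_integral W (t + (1 - t)*1) - W (t + (1 - t)*0)) {0..1}"
  by (intro fundamental_theorem_of_calculus) auto
 then have "((%s. (1 - t)*g (t + (1 - t) * s)) has_integral W 1) {0..1}" by (simp add: W_def)
 from integral_unique[OF this] show ?thesis by (simp add: W_def)
qed

lemma integral_continuous_joint:
 fixes f :: "real => real^'n::finite => real"
 assumes c: "continuous_on ({0..1} \<times> V) (%(t, x). f t x)"
 shows "continuous_on ({0..1} \<times> V) (%(t, x). integral {t..1} (%s. f s x))"
proof -
 have sub: "t + (1 - t) * s:{0..1}" if "t:{0..1}" "s:{0..1}" for s t :: real using that mult_left_le[of s "1 - t"] by auto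
 have "continuous_on (({0..1} \<times> V) \<times> cbox 0 1) (%(z, s). f (fst z + (1 - fst z) * s) (snd z))"
 proof -
  have "continuous_on (({0..1} \<times> V) \<times> cbox 0 1)
    (%y. (%(t, x). f t x) (fst (fst y) + (1 - fst (fst y)) * snd y, snd (fst y)))"
   by (rule continuous_on_compose2[OF c]) (auto intro!: continuous_intros simp del: atLeastAtMost_iff intro: sub)
  then show ?thesis by (simp add: case_prod_unfold)
 qed
 from integral_continuous_on_param[OF this]
 have "continuous_on ({0..1} \<times> V) (%z. (1 - fst z)*integral {0..1} (%s. f (fst z + (1 - fst z) * s) (snd z)))"
  by (intro continuous_on_mult) (auto intro!: continuous_intros)
 then show ?thesis
 proof (rule continuous_on_eq)
  fix z :: "real \<times> (real^'n)" assume z: "z:{0..1} \<times> V"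
  then have "continuous_on {0..1} (%t. f t (snd z))" using continuous_slice[OF c] by auto
  then have "continuous_on {fst z..1} (%t. f t (snd z))" by (rule continuous_on_subset) (use z in auto)
  from integral_rescale[OF this] z
  show "(1 - fst z)*integral {0..1} (%s. f (fst z + (1 - fst z) * s) (snd z)) =
    (case z of (t, x) => integral {t..1} (%s. f s x))" by (auto simp: case_prod_unfold)
 qed
qed

lemma integral_has_derivative_param:
 fixes f :: "real => real^'n::finite => real"
 assumes V: "open V" "x:V" and t: "t:{0..1}" and c: "continuous_on ({0..1} \<times> V) (%(t, x). f t x)"
  and d: "!!s y. s:{0..1} ==> y:V ==> f s differentiable at y"
  and cp: "!!i. continuous_on ({0..1} \<times> V) (%(t, x). pd i (f t) x)"
 shows "((%x. integral {t..1} (%s. f s x)) has_derivative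
   (%h. SUM i:UNIV. integral {t..1} (%s. pd i (f s) x)*h$i)) (at x)"
proof -
 obtain r where r: "r > 0" "ball x r <= V" using V openE by blast
 have sub: "{t..1} <= {0..1}" using t by auto
 \<comment> \<open>\<open>leibniz_rule\<close> asks for the derivative as a continuous family of
   bounded linear maps.\<close>
 define fx where "fx = (%y s. SUM i:UNIV. pd i (f s) y *\<^sub>R Blinfun (%h::real^'n. h$i))"
 have fx: "blinfun_apply (fx y s) h = (SUM i:UNIV. pd i (f s) y*h$i)" for y s h
  by (simp add: fx_def blinfun.sum_left blinfun.scaleR_left bounded_linear_Blinfun_apply bounded_linear_vec_nth)
 have sl: "continuous_on {t..1} (%s. f s y)" "continuous_on {t..1} (%s. pd i (f s) y)" if "y:ball x r" for y i
  using continuous_on_subset[OF continuous_slice[OF c] sub] continuous_on_subset[OF continuous_slice[OF cp] sub]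
   that r(2) by blast+
 have cfx: "continuous_on (ball x r \<times> cbox t 1) (%(y, s). fx y s)"
 proof -
  have "continuous_on (ball x r \<times> cbox t 1) (%z. (%(t, x). pd i (f t) x) (snd z, fst z))" for i
   by (rule continuous_on_compose2[OF cp]) (use sub r in \<open>auto intro!: continuous_intros\<close>)
  then show ?thesis unfolding fx_def case_prod_unfold by (intro continuous_intros) simp
 qed
 have D: "((%y. integral (cbox t 1) (%s. f s y)) has_derivative integral (cbox t 1) (fx x)) (at x within ball x r)"
 proof (rule leibniz_rule[OF _ _ cfx])
  fix y s assume y: "y:ball x r" "s:cbox t 1"
  have "(f s has_derivative (%h. SUM i:UNIV. pd i (f s) y*h$i)) (at y)" by (rule has_derivative_pd, rule d) (use y sub r in auto)
  then have "(f s has_derivative blinfun_apply (fx y s)) (at y)" by (rule has_derivative_eq_rhs) (simp add: fx fun_eq_iff)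
  then show "((%y. f s y) has_derivative blinfun_apply (fx y s)) (at y within ball x r)" using has_derivative_at_withinI by blast
 next
  fix y assume "y:ball x r"
  then show "(%s. f s y) integrable_on cbox t 1" using integrable_continuous_interval[OF sl(1)] by simp
 qed (use r in auto)
 have A: "blinfun_apply (integral (cbox t 1) (fx x)) h = (SUM i:UNIV. integral {t..1} (%s. pd i (f s) x)*h$i)" for h
 proof -
  have x: "x:ball x r" using r by simp
  have "continuous_on (cbox t 1) (%s. (%(y, s). fx y s) (x, s))"
   by (rule continuous_on_compose2[OF cfx]) (use x in \<open>auto intro!: continuous_intros\<close>)
  then have "fx x integrable_on cbox t 1" using integrable_continuous[of t 1 "fx x"] by simp
  then have "blinfun_apply (integral (cbox t 1) (fx x)) h = integral (cbox t 1) (%s. blinfun_apply (fx x s) h)"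
   by (rule blinfun_apply_integral)
  also have "... = integral {t..1} (%s. SUM i:UNIV. pd i (f s) x*h$i)" by (simp add: fx)
  also have "... = (SUM i:UNIV. integral {t..1} (%s. pd i (f s) x*h$i))"
   by (rule integral_sum) (auto intro!: integrable_continuous_interval continuous_on_mult sl(2)[OF x])
  finally show ?thesis by (simp add: integral_mult_left)
 qed
 have "((%y. integral {t..1} (%s. f s y)) has_derivative
   (%h. SUM i:UNIV. integral {t..1} (%s. pd i (f s) x)*h$i)) (at x within ball x r)"
  by (rule has_derivative_eq_rhs[OF D[unfolded cbox_interval]], rule ext) (simp only: A[unfolded cbox_interval])
 moreover have xb: "x:ball x r" using r(1) by simp
 ultimately show ?thesis using at_within_open[OF xb open_ball] by simp
qed

lemma integral_abs_le:
 fixes g :: "real => real"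
 assumes "t:{0..1}" "continuous_on {0..1} g" "!!s. s:{0..1} ==> \<bar>g s\<bar> <= C"
 shows "\<bar>integral {t..1} g\<bar> <= C"
proof -
 have "continuous_on {t..1} g" by (rule continuous_on_subset[OF assms(2)]) (use assms(1) in auto)
 then have "norm (integral {t..1} g) <= C*(1 - t)" by (intro integral_bound) (use assms in auto)
 also have "... <= C*1"
 proof (rule mult_left_mono)
  show "0 <= C" using assms(3)[of 1] by (auto intro: order_trans[OF abs_ge_zero])
 qed (use assms(1) in auto)
 finally show ?thesis by simp
qed

lemma gc0_integral:
 assumes "gc0 V f"
 shows "gc0 V (%m t x. integral {t..1} (%s. f m s x))" unfolding gc0_def
proof (intro conjI allI impI)
 show "continuous_on ({0..1} \<times> V) (%(t, x). integral {t..1} (%s. f m s x))" for m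
  by (rule integral_continuous_joint[OF gc0_contD[OF assms]])
 fix K assume K: "compact K & K <= V"
 obtain C where C: "C >= 0" "!!m t x. t:{0..1} ==> x:K ==> \<bar>f m t x\<bar> <= C"
  "!!m t x. t:{0..1} ==> x:K ==> \<bar>f (Suc m) t x - f m t x\<bar> <= C*(3/4)^m"
  using gc0_boundD[OF assms] K by blast
 have "\<bar>integral {t..1} (%s. f m s x)\<bar> <= C &
  \<bar>integral {t..1} (%s. f (Suc m) s x) - integral {t..1} (%s. f m s x)\<bar> <= C*(3/4)^m"
  if tx: "t:{0..1}" "x:K" for m t x
 proof
  have c: "continuous_on {0..1} (%s. f m s x)" for m using continuous_slice[OF gc0_contD[OF assms]] K tx(2) by blast
  have i: "(%s. f m s x) integrable_on {t..1}" for m by (intro integrable_continuous_interval continuous_on_subset[OF c]) (use tx in auto)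
  show "\<bar>integral {t..1} (%s. f m s x)\<bar> <= C" by (rule integral_abs_le[OF tx(1) c]) (rule C(2)[OF _ tx(2)])
  have "\<bar>integral {t..1} (%s. f (Suc m) s x - f m s x)\<bar> <= C*(3/4)^m"
   by (rule integral_abs_le[OF tx(1) continuous_on_diff[OF c c]]) (rule C(3)[OF _ tx(2)])
  then show "\<bar>integral {t..1} (%s. f (Suc m) s x) - integral {t..1} (%s. f m s x)\<bar> <= C*(3/4)^m"
   by (simp add: integral_diff[OF i i])
 qed
 then show "EX C>=0. ALL m. ALL t:{0..1}. ALL x:K. \<bar>integral {t..1} (%s. f m s x)\<bar> <= C &
  \<bar>integral {t..1} (%s. f (Suc m) s x) - integral {t..1} (%s. f m s x)\<bar> <= C*(3/4)^m" using C(1) by blast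
qed

lemma gcf_pd_cont: "gcf (Suc p) V f ==> continuous_on ({0..1} \<times> V) (%(t, x). pd i (f m t) x)"
proof -
 assume "gcf (Suc p) V f"
 then have "gcf p V (%m t. pd i (f m t))" by simp
 from gc0_contD[OF gcf_gc0[OF this]] show ?thesis .
qed

lemma gcf_integral_has_derivative:
 assumes "open V" "gcf (Suc p) V f" "t:{0..1}" "x:V"
 shows "((%x. integral {t..1} (%s. f m s x)) has_derivative
   (%h. SUM i:UNIV. integral {t..1} (%s. pd i (f m s) x)*h$i)) (at x)"
proof (rule integral_has_derivative_param[OF assms(1,4,3)])
 show "continuous_on ({0..1} \<times> V) (%(t, x). f m t x)" by (rule gc0_contD[OF gcf_gc0[OF assms(2)]])
 show "f m s differentiable at y" if "s:{0..1}" "y:V" for s y using assms(2) that by simp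
 show "continuous_on ({0..1} \<times> V) (%(t, x). pd i (f m t) x)" for i by (rule gcf_pd_cont[OF assms(2)])
qed

lemma gcf_integral:
 assumes "open V" "gcf p V f"
 shows "gcf p V (%m t x. integral {t..1} (%s. f m s x))" using assms(2)
proof (induction p arbitrary: f)
 case (Suc p)
 note der = gcf_integral_has_derivative[OF assms(1) Suc.prems]
 have "gcf p V (%m t. pd i (%x. integral {t..1} (%s. f m s x)))" for i
 proof (rule gcf_cong[OF assms(1)])
  show "gcf p V (%m t x. integral {t..1} (%s. pd i (f m s) x))" by (rule Suc.IH) (use Suc.prems in simp)
 qed (rule pd_eqI[symmetric], rule der)
 moreover have "(%x. integral {t..1} (%s. f m s x)) differentiable at x" if "t:{0..1}" "x:V" for m t x
  using der[OF that] by (rule differentiableI)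
 moreover have "gc0 V (%m t x. integral {t..1} (%s. f m s x))" using gc0_integral gcf_gc0[OF Suc.prems] by blast
 ultimately show ?case by simp
qed (simp add: gc0_integral)

section \<open>Limits of geometrically convergent sequences\<close>

lemma geometric_null: "(%m. C*(3/4)^m :: real) \<longlonglongrightarrow> 0"
proof -
 have "(%m. C*(3/4)^m) \<longlonglongrightarrow> C*0" by (intro tendsto_intros LIMSEQ_power_zero) auto
 then show ?thesis by simp
qed

lemma geometric_limit:
 fixes a :: "nat => real"
 assumes "!!m. \<bar>a (Suc m) - a m\<bar> <= C*(3/4)^m"
 shows "a \<longlonglongrightarrow> lim a" "\<bar>lim a - a m\<bar> <= 4*C*(3/4)^m"
proof -
 have C: "C >= 0" using assms[of 0] by (auto intro: order_trans[OF abs_ge_zero])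
 \<comment> \<open>4 is 1/(1 - 3/4); the factor \<open>1 - (3/4)^k\<close> is the exact partial
   geometric sum, with which the induction closes.\<close>
 have b: "\<bar>a (m + k) - a m\<bar> <= 4*C*(3/4)^m*(1 - (3/4)^k)" for m k
 proof (induction k)
  case (Suc k)
  have "\<bar>a (m + Suc k) - a m\<bar> <= \<bar>a (Suc (m + k)) - a (m + k)\<bar> + \<bar>a (m + k) - a m\<bar>" by simp
  also have "... <= C*(3/4)^(m + k) + 4*C*(3/4)^m*(1 - (3/4)^k)" using assms[of "m + k"] Suc by linarith
  also have "... = 4*C*(3/4)^m*(1 - (3/4)^Suc k)" by (simp add: power_add algebra_simps)
  finally show ?case .
 qed simp
 have b': "\<bar>a (m + k) - a m\<bar> <= 4*C*(3/4)^m" for m k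
 proof -
  have "4*C*(3/4)^m*(1 - (3/4)^k) <= 4*C*(3/4)^m*1" by (rule mult_left_mono) (use C in auto)
  then show ?thesis using b[where m=m and k=k] by linarith
 qed
 have "Cauchy a"
 proof (rule CauchyI')
  fix e :: real assume "e > 0"
  from order_tendstoD(2)[OF geometric_null this]
  have "\<forall>\<^sub>F m in sequentially. 4*C*(3/4)^m < e" .
  then obtain M where M: "4*C*(3/4)^m < e" if "m >= M" for m unfolding eventually_sequentially by blast
  have "dist (a m) (a n) < e" if "m >= M" "m < n" for m n
  proof -
   have "\<bar>a (m + (n - m)) - a m\<bar> < e" using b'[where m=m and k="n-m"] M[OF that(1)] by linarith
   then show ?thesis using that(2) by (simp add: dist_real_def abs_minus_commute)
  qed
  then show "EX M. ALL m>=M. ALL n>m. dist (a m) (a n) < e" by blast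
 qed
 then have conv: "convergent a" by (simp add: Cauchy_convergent_iff)
 then show l: "a \<longlonglongrightarrow> lim a" by (simp add: convergent_LIMSEQ_iff)
 have "(%k. a (k + m) - a m) \<longlonglongrightarrow> lim a - a m" by (intro tendsto_intros LIMSEQ_ignore_initial_segment[OF l])
 then have "(%k. \<bar>a (m + k) - a m\<bar>) \<longlonglongrightarrow> \<bar>lim a - a m\<bar>" using tendsto_rabs by (simp add: add.commute)
 then show "\<bar>lim a - a m\<bar> <= 4*C*(3/4)^m" by (rule LIMSEQ_le_const2) (use b' in blast)
qed

lemma gc0_limit:
 fixes f :: "nat => real => real^'n::finite => real"
 assumes V: "open V" and f: "gc0 V f"
 shows "!!t x. t:{0..1} ==> x:V ==> (%m. f m t x) \<longlonglongrightarrow> lim (%m. f m t x)"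
  and "!!K. compact K ==> K <= V ==> uniform_limit ({0..1} \<times> K) (%m (t, x). f m t x) (%(t, x). lim (%m. f m t x)) sequentially"
  and "gc0 V (%_ t x. lim (%m. f m t x))"
proof -
 have U: "uniform_limit ({0..1} \<times> K) (%m (t, x). f m t x) (%(t, x). lim (%m. f m t x)) sequentially"
  and L: "!!t x. t:{0..1} ==> x:K ==> (%m. f m t x) \<longlonglongrightarrow> lim (%m. f m t x)"
  if K: "compact K" "K <= V" for K
 proof -
  obtain C where "C >= 0" "!!m t x. t:{0..1} ==> x:K ==> \<bar>f m t x\<bar> <= C"
   and C: "!!m t x. t:{0..1} ==> x:K ==> \<bar>f (Suc m) t x - f m t x\<bar> <= C*(3/4)^m"
   using gc0_boundD[OF f K] by blast
  note gl = geometric_limit[of "%m. f m t x" C for t x, OF C]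
  show "!!t x. t:{0..1} ==> x:K ==> (%m. f m t x) \<longlonglongrightarrow> lim (%m. f m t x)" by (rule gl(1))
  show "uniform_limit ({0..1} \<times> K) (%m (t, x). f m t x) (%(t, x). lim (%m. f m t x)) sequentially"
  proof (rule uniform_limitI)
   fix e :: real assume "e > 0"
   then have "\<forall>\<^sub>F m in sequentially. 4*C*(3/4)^m < e" using order_tendstoD(2)[OF geometric_null] by blast
   then show "\<forall>\<^sub>F m in sequentially. ALL z:{0..1} \<times> K. dist (case z of (t, x) => f m t x) (case z of (t, x) => lim (%m. f m t x)) < e"
   proof (rule eventually_mono)
    fix m assume m: "4*C*(3/4)^m < e"
    show "ALL z:{0..1} \<times> K. dist (case z of (t, x) => f m t x) (case z of (t, x) => lim (%m. f m t x)) < e"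
    proof clarify
     fix t x assume "t:{0..1::real}" "x:K"
     from gl(2)[OF this, of m] m show "dist (f m t x) (lim (%m. f m t x)) < e" by (simp add: dist_real_def abs_minus_commute)
    qed
   qed
  qed
 qed
 show "(%m. f m t x) \<longlonglongrightarrow> lim (%m. f m t x)" if "t:{0..1}" "x:V" for t x
  using L[of "{x}" t x] that by simp
 show "uniform_limit ({0..1} \<times> K) (%m (t, x). f m t x) (%(t, x). lim (%m. f m t x)) sequentially"
  if "compact K" "K <= V" for K using U[OF that] .
 show "gc0 V (%_ t x. lim (%m. f m t x))"
 proof (rule gc0_const_seqI)
  show "continuous_on ({0..1} \<times> V) (%(t, x). lim (%m. f m t x))" unfolding continuous_on_eq_continuous_within
  proof
   fix z :: "real \<times> (real^'n)" assume z: "z:{0..1} \<times> V"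
   then have "snd z:V" by auto
   \<comment> \<open>Continuity is local, so uniform convergence on a compact ball around each point
     suffices.\<close>
   then obtain r where r: "r > 0" "cball (snd z) r <= V" using V open_contains_cball by blast
   have "continuous_on ({0..1} \<times> cball (snd z) r) (%(t, x). lim (%m. f m t x))"
   proof (rule uniform_limit_theorem[OF _ U[OF compact_cball r(2)]])
    show "\<forall>\<^sub>F m in sequentially. continuous_on ({0..1} \<times> cball (snd z) r) (%(t, x). f m t x)"
     by (intro always_eventually allI continuous_on_subset[OF gc0_contD[OF f]]) (use r(2) in auto)
   qed simp
   then have "continuous_on ({0..1} \<times> ball (snd z) r) (%(t, x). lim (%m. f m t x))"
    by (rule continuous_on_subset) (use ball_subset_cball in blast)
   moreover have zb: "z:{0..1} \<times> ball (snd z) r" using z r by (cases z) auto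
   ultimately have "continuous (at z within {0..1} \<times> ball (snd z) r) (%(t, x). lim (%m. f m t x))"
    unfolding continuous_on_eq_continuous_within by blast
   moreover have "at z within {0..1} \<times> V = at z within {0..1} \<times> ball (snd z) r"
   proof (rule at_within_nhd[of _ "UNIV \<times> ball (snd z) r"])
    have "ball (snd z) r <= V" using r(2) ball_subset_cball by blast
    then show "({0..1} \<times> V) \<inter> (UNIV \<times> ball (snd z) r) - {z} = ({0..1} \<times> ball (snd z) r) \<inter> (UNIV \<times> ball (snd z) r) - {z}"
     by blast
   qed (use zb in \<open>auto intro: open_Times\<close>)
   ultimately show "continuous (at z within {0..1} \<times> V) (%(t, x). lim (%m. f m t x))" by simp
  qed
 qed
qed

text \<open>The partial derivatives converge uniformly on small balls, so their limits are the
  partial derivatives of the limit. These limits are again limits of sequences of lower class, which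
  drives the induction.\<close>

lemma gcf_limit:
 assumes V: "open V" and "gcf p V f"
 shows "gcf p V (%_ t x. lim (%m. f m t x))" using assms(2)
proof (induction p arbitrary: f)
 case 0
 then have "gc0 V f" by simp
 from gc0_limit(3)[OF V this] show ?case by simp
next
 case (Suc p)
 note f0 = gcf_gc0[OF Suc.prems]
 have pf: "gcf p V (%m t. pd i (f m t))" for i using Suc.prems by simp
 note pf0 = gcf_gc0[OF pf]
 define q where "q = (%i t x. lim (%m. pd i (f m t) x))"
 have der: "((%x. lim (%m. f m t x)) has_derivative (%h. SUM i:UNIV. q i t x*h$i)) (at x)"
  if t: "t:{0..1}" and x: "x:V" for t x
 proof -
  obtain r where r: "r > 0" "cball x r <= V" using V x open_contains_cball by blast
  have bV: "ball x r <= V" using r(2) ball_subset_cball by blast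
  have "EX g. ALL y:ball x r. (%m. f m t y) \<longlonglongrightarrow> g y & (g has_derivative (%h. SUM i:UNIV. q i t y*h$i)) (at y within ball x r)"
  proof (rule has_derivative_sequence[where f'="%m y h. SUM i:UNIV. pd i (f m t) y*h$i" and ?x0.0=x])
   show "(f m t has_derivative (%h. SUM i:UNIV. pd i (f m t) y*h$i)) (at y within ball x r)" if "y:ball x r" for m y
   proof (rule has_derivative_at_withinI[OF has_derivative_pd])
    have "y:V" using that bV by blast
    then show "f m t differentiable at y" using Suc.prems t by simp
   qed
   fix e :: real assume e: "e > 0"
   define N where "N = real CARD('a)"
   have N: "N > 0" by (simp add: N_def)
   have "\<forall>\<^sub>F m in sequentially. ALL z:{0..1} \<times> cball x r.
     dist (case z of (t, x) => pd i (f m t) x) (case z of (t, x) => q i t x) < e/N" for i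
    using uniform_limitD[OF gc0_limit(2)[OF V pf0 compact_cball r(2)], of "e/N" i] e N unfolding q_def by simp
   then have "\<forall>\<^sub>F m in sequentially. ALL i. ALL z:{0..1} \<times> cball x r.
     dist (case z of (t, x) => pd i (f m t) x) (case z of (t, x) => q i t x) < e/N" by (rule eventually_all_finite)
   then show "\<forall>\<^sub>F m in sequentially. ALL y:ball x r. ALL h. norm ((SUM i:UNIV. pd i (f m t) y*h$i) - (SUM i:UNIV. q i t y*h$i)) <= e*norm h"
   proof (rule eventually_mono, intro ballI allI)
    fix m y h
    assume H: "ALL i. ALL z:{0..1} \<times> cball x r.
     dist (case z of (t, x) => pd i (f m t) x) (case z of (t, x) => q i t x) < e/N" and y: "y:ball x r"
    have d: "\<bar>pd i (f m t) y - q i t y\<bar> <= e/N" for i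
    proof -
     have "(t, y):{0..1} \<times> cball x r" using t y by auto
     from bspec[OF spec[OF H, of i] this] show ?thesis by (simp add: dist_real_def)
    qed
    have "norm ((SUM i:UNIV. pd i (f m t) y*h$i) - (SUM i:UNIV. q i t y*h$i)) =
      norm (SUM i:UNIV. (pd i (f m t) y - q i t y)*h$i)" by (simp add: sum_subtractf left_diff_distrib)
    also have "... <= (SUM i:(UNIV::'a set). e/N*norm h)"
    proof (rule sum_norm_le)
     fix i
     show "norm ((pd i (f m t) y - q i t y)*h$i) <= e/N*norm h" unfolding norm_mult
      by (rule mult_mono) (use d e N Finite_Cartesian_Product.norm_nth_le[of h i] in auto)
    qed
    also have "... = e*norm h" using N by (simp add: N_def)
    finally show "norm ((SUM i:UNIV. pd i (f m t) y*h$i) - (SUM i:UNIV. q i t y*h$i)) <= e*norm h" .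
   qed
  next
   show "(%m. f m t x) \<longlonglongrightarrow> lim (%m. f m t x)" by (rule gc0_limit(1)[OF V f0 t x])
  qed (use r in auto)
  then obtain g where g: "!!y. y:ball x r ==> (%m. f m t y) \<longlonglongrightarrow> g y"
   "!!y. y:ball x r ==> (g has_derivative (%h. SUM i:UNIV. q i t y*h$i)) (at y within ball x r)" by blast
  have xb: "x:ball x r" using r(1) by simp
  have "(g has_derivative (%h. SUM i:UNIV. q i t x*h$i)) (at x)" using g(2)[OF xb] unfolding at_within_open[OF xb open_ball] .
  then show ?thesis by (rule has_derivative_transform_within_open[OF _ open_ball xb]) (rule limI[OF g(1), symmetric])
 qed
 have "gcf p V (%_ t. pd i (%x. lim (%m. f m t x)))" for i
 proof (rule gcf_cong[OF V Suc.IH[OF pf]])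
  show "lim (%m. pd i (f m t) x) = pd i (%x. lim (%m. f m t x)) x" if "t:{0..1}" "x:V" for t x
   using pd_eqI[OF der[OF that]] by (simp add: q_def)
 qed
 moreover have "(%x. lim (%m. f m t x)) differentiable at x" if "t:{0..1}" "x:V" for t x
  using der[OF that] by (rule differentiableI)
 ultimately show ?case using gc0_limit(3)[OF V f0] by simp
qed

lemma gcf_fix: "gcf p V f ==> gcf p V (%_. f m)"
proof (induction p arbitrary: f)
 case 0
 then show ?case using gc0_const_seqI[OF gc0_contD] by simp
next
 case (Suc p)
 have "gc0 V (%_. f m)" by (rule gc0_const_seqI[OF gc0_contD[OF gcf_gc0[OF Suc.prems]]])
 moreover have "gcf p V (%_ t. pd i (f m t))" for i using Suc.IH[of "%m t. pd i (f m t)"] Suc.prems by simp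
 ultimately show ?case using Suc.prems by simp
qed

section \<open>Linear recursions for derivatives and the smooth flow\<close>

lemma finite_bound:
 fixes P :: "'a::finite => real => bool"
 assumes "!!a. EX C>=0. P a C" "!!a C D. P a C ==> C <= D ==> P a D"
 shows "EX C>=0. ALL a. P a C"
proof -
 have "ALL a. EX C. C >= 0 & P a C" using assms(1) by blast
 then obtain c where c: "!!a. c a >= 0" "!!a. P a (c a)" unfolding choice_iff by blast
 have "P a (SUM a:UNIV. c a)" for a by (rule assms(2)[OF c(2)]) (use c(1) in \<open>auto intro: member_le_sum\<close>)
 then show ?thesis using c(1) by (intro exI[of _ "SUM a:UNIV. c a"]) (auto intro: sum_nonneg)
qed

text \<open>The integral operator halves differences (\<open>small\<close>), while \<open>A\<close>
  and \<open>b\<close> change by multiples of (3/4)^m. As 3/4 exceeds 1/2, the increments of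
  \<open>w\<close> still decay like (3/4)^m.\<close>

lemma linear_recursion_gc0:
 fixes w b :: "'c::finite => nat => real => real^'n::finite => real"
 assumes w: "!!a m. gc0 V (%_. w a m)" and rec: "!!a m t x. t:{0..1} ==> x:V ==>
   w a (Suc m) t x = b a m t x + integral {t..1} (%s. SUM c:UNIV. A a c m s x*w c m s x)"
  and A: "!!a c. gc0 V (A a c)" and b: "!!a. gc0 V (b a)"
  and small: "!!a m t x. t:{0..1} ==> x:V ==> (SUM c:UNIV. \<bar>A a c m t x\<bar>) <= 1/2"
 shows "gc0 V (w a)" unfolding gc0_def
proof (intro conjI allI impI)
 show "continuous_on ({0..1} \<times> V) (%(t, x). w a m t x)" for m by (rule gc0_contD[OF w])
 fix K assume "compact K & K <= V"
 then have K: "compact K" "K <= V" by auto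
 have mono: "C*(3/4)^m <= D*(3/4)^m" if "C <= D" for C D :: real and m :: nat by (rule mult_right_mono[OF that]) simp
 have bnd: "EX C>=0. ALL m. ALL t:{0..1}. ALL x:K. \<bar>f m t x\<bar> <= C & \<bar>f (Suc m) t x - f m t x\<bar> <= C*(3/4)^m"
  if "gc0 V f" for f using that K unfolding gc0_def by blast
 have "EX C>=0. ALL a. ALL m. ALL t:{0..1}. ALL x:K. \<bar>b a m t x\<bar> <= C & \<bar>b a (Suc m) t x - b a m t x\<bar> <= C*(3/4)^m"
  by (rule finite_bound[OF bnd[OF b]]) (meson mono order_trans)
 then obtain C1 where C1: "C1 >= 0" "!!a m t x. t:{0..1} ==> x:K ==> \<bar>b a m t x\<bar> <= C1"
  "!!a m t x. t:{0..1} ==> x:K ==> \<bar>b a (Suc m) t x - b a m t x\<bar> <= C1*(3/4)^m" by blast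
 have "EX C>=0. ALL ac. ALL m. ALL t:{0..1}. ALL x:K. \<bar>A (fst ac) (snd ac) m t x\<bar> <= C &
   \<bar>A (fst ac) (snd ac) (Suc m) t x - A (fst ac) (snd ac) m t x\<bar> <= C*(3/4)^m"
  by (rule finite_bound[OF bnd[OF A]]) (meson mono order_trans)
 then obtain C2 where C2: "C2 >= 0"
  "!!a c m t x. t:{0..1} ==> x:K ==> \<bar>A a c (Suc m) t x - A a c m t x\<bar> <= C2*(3/4)^m" by fastforce
 have "EX C>=0. ALL a. ALL m::nat. ALL t:{0..1}. ALL x:K. \<bar>w a 0 t x\<bar> <= C & \<bar>w a 0 t x - w a 0 t x\<bar> <= C*(3/4)^m"
  by (rule finite_bound[OF bnd[OF w]]) (meson mono order_trans)
 then obtain C3 where C3: "C3 >= 0" "!!a t x. t:{0..1} ==> x:K ==> \<bar>w a 0 t x\<bar> <= C3" by blast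
 define N where "N = real CARD('c)"
 have N: "N >= 0" by (simp add: N_def)
 \<comment> \<open>Chosen with C1 + B/2 <= B and C3 <= B, so that the bound passes from each iterate
   to the next and holds for the initial one.\<close>
 define B where "B = 2*C1 + C3"
 \<comment> \<open>The first summand gives C1 + N*C2*B + D/2 <= 3/4*D; the second covers the
   increment from iterate 0 to iterate 1, which is at most 2*B.\<close>
 define D where "D = 4*(C1 + N*C2*B) + 2*B"
 have B: "B >= 0" using C1(1) C3(1) by (simp add: B_def)
 have NCB: "N*C2*B >= 0" using N C2(1) B by simp
 have D: "D >= 0" "2*B <= D" using C1(1) NCB B by (auto simp: D_def)
 have cw: "continuous_on {0..1} (%s. w a m s x)" and cA: "continuous_on {0..1} (%s. A a c m s x)" if "x:K" for a c m x
  using continuous_slice[OF gc0_contD[OF w]] continuous_slice[OF gc0_contD[OF A]] that K(2) by blast+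
 have ci: "continuous_on {0..1} (%s. SUM c:UNIV. A a c m s x*w c m s x)" if "x:K" for a m x
  by (intro continuous_on_sum continuous_on_mult cw cA that)
 have wB: "\<bar>w a m t x\<bar> <= B" if "t:{0..1}" and x: "x:K" for a m t x using that(1)
 proof (induction m arbitrary: a t)
  case 0
  then show ?case using C3(2)[OF 0 x, of a] C1(1) by (simp add: B_def)
 next
  case (Suc m)
  have "\<bar>SUM c:UNIV. A a c m s x*w c m s x\<bar> <= B/2" if s: "s:{0..1}" for s
  proof -
   have "\<bar>SUM c:UNIV. A a c m s x*w c m s x\<bar> <= (SUM c:UNIV. \<bar>A a c m s x\<bar>*B)"
    by (rule order_trans[OF sum_abs sum_mono]) (simp add: abs_mult mult_left_mono Suc.IH[OF s])
   also have "... = (SUM c:UNIV. \<bar>A a c m s x\<bar>)*B" by (simp add: sum_distrib_right)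
   also have "... <= 1/2*B" by (rule mult_right_mono[OF small]) (use s x K B in auto)
   finally show ?thesis by simp
  qed
  then have "\<bar>integral {t..1} (%s. SUM c:UNIV. A a c m s x*w c m s x)\<bar> <= B/2"
   by (rule integral_abs_le[OF Suc.prems ci[OF x]])
  moreover have "x:V" using x K(2) by blast
  ultimately show ?case using rec[OF Suc.prems \<open>x:V\<close>, of a m] C1(2)[OF Suc.prems x, of a m] C3(1) by (simp add: B_def)
 qed
 have wD: "\<bar>w a (Suc m) t x - w a m t x\<bar> <= D*(3/4)^m" if "t:{0..1}" and x: "x:K" for a m t x using that(1)
 proof (induction m arbitrary: a t)
  case 0
  then show ?case using wB[OF 0 x, of a 0] wB[OF 0 x, of a "Suc 0"] D(2) by simp
 next
  case (Suc m)
  have xV: "x:V" using x K(2) by blast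
  define E where "E = (N*C2*B + D/2)*(3/4)^m"
  have i: "(%s. SUM c:UNIV. A a c m s x*w c m s x) integrable_on {t..1}" for m
   by (intro integrable_continuous_interval continuous_on_subset[OF ci[OF x]]) (use Suc.prems in auto)
  have "\<bar>(SUM c:UNIV. A a c (Suc m) s x*w c (Suc m) s x) - (SUM c:UNIV. A a c m s x*w c m s x)\<bar> <= E"
   if s: "s:{0..1}" for s
  proof -
   have "(SUM c:UNIV. A a c (Suc m) s x*w c (Suc m) s x) - (SUM c:UNIV. A a c m s x*w c m s x) =
    (SUM c:UNIV. (A a c (Suc m) s x - A a c m s x)*w c (Suc m) s x) +
    (SUM c:UNIV. A a c m s x*(w c (Suc m) s x - w c m s x))"
    unfolding sum.distrib[symmetric] sum_subtractf[symmetric] by (rule sum.cong) (auto simp: algebra_simps)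
   moreover have "\<bar>SUM c:UNIV. (A a c (Suc m) s x - A a c m s x)*w c (Suc m) s x\<bar> <= (SUM c:(UNIV::'c set). C2*(3/4)^m*B)"
   proof (rule order_trans[OF sum_abs sum_mono])
    fix c
    show "\<bar>(A a c (Suc m) s x - A a c m s x)*w c (Suc m) s x\<bar> <= C2*(3/4)^m*B"
     unfolding abs_mult by (rule mult_mono[OF C2(2)[OF s x] wB[OF s x]]) (use C2(1) in auto)
   qed
   moreover have "(SUM c:(UNIV::'c set). C2*(3/4)^m*B) = N*C2*B*(3/4)^m" by (simp add: N_def)
   moreover have "\<bar>SUM c:UNIV. A a c m s x*(w c (Suc m) s x - w c m s x)\<bar> <= 1/2*(D*(3/4)^m)"
   proof -
    have "\<bar>SUM c:UNIV. A a c m s x*(w c (Suc m) s x - w c m s x)\<bar> <= (SUM c:UNIV. \<bar>A a c m s x\<bar>*(D*(3/4)^m))"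
     by (rule order_trans[OF sum_abs sum_mono]) (simp add: abs_mult mult_left_mono Suc.IH[OF s])
    also have "... = (SUM c:UNIV. \<bar>A a c m s x\<bar>)*(D*(3/4)^m)" by (simp add: sum_distrib_right)
    also have "... <= 1/2*(D*(3/4)^m)" by (rule mult_right_mono[OF small[OF s xV]]) (use D in auto)
    finally show ?thesis .
   qed
   ultimately show ?thesis unfolding E_def distrib_right by linarith
  qed
  then have "\<bar>integral {t..1} (%s. (SUM c:UNIV. A a c (Suc m) s x*w c (Suc m) s x) - (SUM c:UNIV. A a c m s x*w c m s x))\<bar> <= E"
   by (rule integral_abs_le[OF Suc.prems continuous_on_diff[OF ci[OF x] ci[OF x]]])
  then have 1: "\<bar>integral {t..1} (%s. SUM c:UNIV. A a c (Suc m) s x*w c (Suc m) s x) -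
    integral {t..1} (%s. SUM c:UNIV. A a c m s x*w c m s x)\<bar> <= E" by (simp only: integral_diff[OF i i])
  have "C1*(3/4)^m + E = (C1 + N*C2*B + D/2)*(3/4)^m" by (simp add: E_def algebra_simps)
  also have "... <= (D*(3/4))*(3/4)^m" by (rule mult_right_mono) (use B in \<open>auto simp: D_def\<close>)
  finally have "C1*(3/4)^m + E <= D*(3/4)^Suc m" by (simp add: mult.assoc)
  then show ?case using 1 rec[OF Suc.prems xV, of a m] rec[OF Suc.prems xV, of a "Suc m"] C1(3)[OF Suc.prems x, of a m] by linarith
 qed
 have BD: "B <= D" using D B by linarith
 show "EX C>=0. ALL m. ALL t:{0..1}. ALL x:K. \<bar>w a m t x\<bar> <= C & \<bar>w a (Suc m) t x - w a m t x\<bar> <= C*(3/4)^m"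
  using D(1) wD order_trans[OF wB BD] by blast
qed

text \<open>Differentiating the recursion in \<open>x\<close> reproduces it for the derivatives with
  the same kernel \<open>A\<close>. The new source is the derivative of \<open>b\<close> plus the
  integral of the derivative of \<open>A\<close> times \<open>w\<close>, of class \<open>p\<close>
  by the induction hypothesis, so the orders can be treated one after another.\<close>

lemma linear_recursion:
 fixes w b :: "'c::finite => nat => real => real^'n::finite => real"
 assumes V: "open V" and w: "!!a m q. gcf q V (%_. w a m)"
  and rec: "!!a m t x. t:{0..1} ==> x:V ==>
   w a (Suc m) t x = b a m t x + integral {t..1} (%s. SUM c:UNIV. A a c m s x*w c m s x)"
  and A: "!!a c. gcf p V (A a c)" and b: "!!a. gcf p V (b a)"
  and small: "!!a m t x. t:{0..1} ==> x:V ==> (SUM c:UNIV. \<bar>A a c m t x\<bar>) <= 1/2"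
 shows "gcf p V (w a)" using w rec A b
proof (induction p arbitrary: w b a)
 case 0
 have "gc0 V (w a)"
 proof (rule linear_recursion_gc0[where w=w and b=b and A=A and V=V, OF _ 0(2) _ _ small])
  show "gc0 V (%_. w a m)" for a m using 0(1)[of 0 a m] by simp
  show "gc0 V (A a c)" for a c using 0(3)[of a c] by simp
  show "gc0 V (b a)" for a using 0(4)[of a] by simp
 qed
 then show ?case by simp
next
 case (Suc p)
 have wp: "gcf p V (w a)" for a
 proof (rule Suc.IH[of w b, OF Suc.prems(1) Suc.prems(2)])
  show "gcf p V (A a c)" for a c by (rule gcf_SucD[OF Suc.prems(3)])
  show "gcf p V (b a)" for a by (rule gcf_SucD[OF Suc.prems(4)])
 qed
 have wd: "w a m t differentiable at x" if "t:{0..1}" "x:V" for a m t x using Suc.prems(1)[of "Suc 0" a m] that by simp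
 have "gcf p V (%m t. pd l (w a m t))" for l a
 proof (rule Suc.IH[of "%a m t. pd l (w a m t)"
    "%a m t x. pd l (b a m t) x + integral {t..1} (%s. SUM c:UNIV. pd l (A a c m s) x*w c m s x)"])
  show "gcf q V (%_ t. pd l (w a m t))" for a m q using Suc.prems(1)[of "Suc q" a m] by simp
  show "gcf p V (A a c)" for a c by (rule gcf_SucD[OF Suc.prems(3)])
  have pA: "gcf p V (%m t. pd l (A a c m t))" for a c using Suc.prems(3)[of a c] by simp
  have pb: "gcf p V (%m t. pd l (b a m t))" for a using Suc.prems(4)[of a] by simp
  show "gcf p V (%m t x. pd l (b a m t) x + integral {t..1} (%s. SUM c:UNIV. pd l (A a c m s) x*w c m s x))" for a
   by (intro gcf_add gcf_integral gcf_sum gcf_mult V pA pb wp)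
  fix a m t x assume t: "t:{0..1::real}" and x: "x:V"
  define u where "u = (%s x. SUM c:UNIV. A a c m s x*w c m s x)"
  have gu: "gcf (Suc p) V (%_. u)" unfolding u_def by (intro gcf_sum gcf_mult V gcf_fix[OF Suc.prems(3)] Suc.prems(1))
  have Ad: "A a c m s differentiable at x" if "s:{0..1}" for s c using Suc.prems(3)[of a c] that x by simp
  have pu: "pd l (u s) x = (SUM c:UNIV. pd l (A a c m s) x*w c m s x) + (SUM c:UNIV. A a c m s x*pd l (w c m s) x)"
   if s: "s:{0..1}" for s
  proof (rule pd_eqI)
   have "(u s has_derivative (%h. SUM c:UNIV. A a c m s x*(SUM l:UNIV. pd l (w c m s) x*h$l) +
     (SUM l:UNIV. pd l (A a c m s) x*h$l)*w c m s x)) (at x)" unfolding u_def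
    by (intro has_derivative_sum has_derivative_mult has_derivative_pd wd Ad s x)
   then show "(u s has_derivative (%h. SUM l:UNIV. ((SUM c:UNIV. pd l (A a c m s) x*w c m s x) +
     (SUM c:UNIV. A a c m s x*pd l (w c m s) x))*h$l)) (at x)"
   proof (rule has_derivative_eq_rhs)
    show "(%h. SUM c:UNIV. A a c m s x*(SUM l:UNIV. pd l (w c m s) x*h$l) +
     (SUM l:UNIV. pd l (A a c m s) x*h$l)*w c m s x) =
     (%h. SUM l:UNIV. ((SUM c:UNIV. pd l (A a c m s) x*w c m s x) +
     (SUM c:UNIV. A a c m s x*pd l (w c m s) x))*h$l)" unfolding sum_distrib_left sum_distrib_right distrib_right sum.distrib
     by (rule ext, subst (1 2) sum.swap) (simp add: algebra_simps)
   qed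
  qed
  have "((%x. b a m t x + integral {t..1} (%s. u s x)) has_derivative
    (%h. (SUM l:UNIV. pd l (b a m t) x*h$l) + (SUM l:UNIV. integral {t..1} (%s. pd l (u s) x)*h$l))) (at x)"
  proof (intro has_derivative_add has_derivative_pd)
   show "b a m t differentiable at x" using Suc.prems(4)[of a] t x by simp
   show "((%x. integral {t..1} (%s. u s x)) has_derivative
     (%h. SUM l:UNIV. integral {t..1} (%s. pd l (u s) x)*h$l)) (at x)" by (rule gcf_integral_has_derivative[OF V gu t x])
  qed
  then have "((%x. b a m t x + integral {t..1} (%s. u s x)) has_derivative
    (%h. SUM l:UNIV. (pd l (b a m t) x + integral {t..1} (%s. pd l (u s) x))*h$l)) (at x)"
   by (simp add: sum.distrib distrib_right)
  then have "pd l (%x. b a m t x + integral {t..1} (%s. u s x)) x = pd l (b a m t) x + integral {t..1} (%s. pd l (u s) x)"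
   by (rule pd_eqI)
  moreover have "pd l (w a (Suc m) t) x = pd l (%x. b a m t x + integral {t..1} (%s. u s x)) x"
   by (rule pd_cong[OF V x]) (simp add: Suc.prems(2)[OF t] u_def)
  moreover have "integral {t..1} (%s. pd l (u s) x) =
    integral {t..1} (%s. (SUM c:UNIV. pd l (A a c m s) x*w c m s x) + (SUM c:UNIV. A a c m s x*pd l (w c m s) x))"
   by (rule integral_cong) (use t pu in auto)
  moreover have "... = integral {t..1} (%s. SUM c:UNIV. pd l (A a c m s) x*w c m s x) +
    integral {t..1} (%s. SUM c:UNIV. A a c m s x*pd l (w c m s) x)"
  proof (rule integral_add; rule integrable_continuous_interval, rule continuous_on_subset[of "{0..1}"])
   have c1: "continuous_on {0..1} (%s. w c m s x)" "continuous_on {0..1} (%s. A a c m s x)"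
    "continuous_on {0..1} (%s. pd l (A a c m s) x)" for c
    using continuous_slice[OF gc0_contD[OF gcf_gc0[OF wp]] x] continuous_slice[OF gc0_contD[OF gcf_gc0[OF Suc.prems(3)]] x]
     continuous_slice[OF gcf_pd_cont[OF Suc.prems(3)] x] by auto
   have c2: "continuous_on {0..1} (%s. pd l (w c m s) x)" for c using continuous_slice[OF gcf_pd_cont[OF Suc.prems(1)] x] .
   show "continuous_on {0..1} (%s. SUM c:UNIV. pd l (A a c m s) x*w c m s x)"
    "continuous_on {0..1} (%s. SUM c:UNIV. A a c m s x*pd l (w c m s) x)" by (intro continuous_on_sum continuous_on_mult c1 c2)+
  qed (use t in auto)
  ultimately show "pd l (w a (Suc m) t) x = pd l (b a m t) x +
    integral {t..1} (%s. SUM c:UNIV. pd l (A a c m s) x*w c m s x) +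
    integral {t..1} (%s. SUM c:UNIV. A a c m s x*pd l (w c m s) x)" by simp
 qed
 then show ?case using gcf_gc0[OF wp] wd by simp
qed

text \<open>Smoothness is in \<open>x\<close> alone, with all derivatives jointly continuous in time
  and space; in \<open>t\<close> no derivative is taken.\<close>

definition smooth_family_on :: "(real^'n::finite) set => (real => real^'n => real) => bool" where
 "smooth_family_on V f \<longleftrightarrow> (ALL p. gcf p V (%_. f))"

lemma smooth_family_compose:
 assumes V: "open V" and k: "smooth_fun_on S k" and u: "!!j. smooth_family_on V (%t x. ga t x$j)"
  and S: "!!t x. t:{0..1} ==> x:V ==> ga t x:S"
 shows "smooth_family_on V (%t x. k (ga t x))" unfolding smooth_family_on_def
proof (intro allI gcf_compose[OF V k])
 fix p
 show "gcf p V (%m t x. ga t x$j)" for j using u by (simp add: smooth_family_on_def)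
 show "gc0 V (%m t x. k (ga t x))" if k: "smooth_fun_on S k" for k
 proof (rule gc0_const_seqI)
  have "gcf 0 V (%_ t x. ga t x$j)" for j using u unfolding smooth_family_on_def by blast
  then have "continuous_on ({0..1} \<times> V) (%(t, x). ga t x$j)" for j
   using gc0_contD[of V "%_ t x. ga t x$j" 0] by simp
  then have "continuous_on ({0..1} \<times> V) (%z. \<chi> j. (%(t, x). ga t x$j) z)" by (rule continuous_on_vec_lambda)
  then have c: "continuous_on ({0..1} \<times> V) (%z. ga (fst z) (snd z))" by (simp add: case_prod_unfold)
  show "continuous_on ({0..1} \<times> V) (%(t, x). k (ga t x))" unfolding case_prod_unfold
   by (rule continuous_on_compose2[OF smooth_continuous[OF k] c]) (auto simp: S)
 qed
qed (use S in auto)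

lemma smooth_family_const: "open S ==> smooth_fun_on S k \<longleftrightarrow> smooth_family_on S (%_. k)"
 by (simp add: smooth_gcf smooth_family_on_def)

lemma smooth_fun_subset: "open S ==> smooth_fun_on S k ==> open T ==> T <= S ==> smooth_fun_on T k"
 unfolding smooth_gcf using gcf_subset by blast

lemma smooth_bounds:
 fixes k :: "real^'n::finite => real"
 assumes k: "smooth_fun_on S k" and r: "cball p r <= S"
 shows "EX M>=0. (ALL x:cball p r. \<bar>k x\<bar> <= M & (ALL i. \<bar>pd i k x\<bar> <= M)) &
  (ALL x:cball p r. ALL y:cball p r. \<bar>k x - k y\<bar> <= M*norm (x - y))"
proof -
 have bnd: "EX C>=0. ALL x:cball p r. \<bar>k x\<bar> <= C" if k: "smooth_fun_on S k" for k :: "real^'n => real"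
 proof -
  have "compact (k ` cball p r)" by (intro compact_continuous_image continuous_on_subset[OF smooth_continuous[OF k] r]) simp
  from compact_imp_bounded[OF this] obtain C where "ALL y:k ` cball p r. norm y <= C" unfolding bounded_iff by blast
  then show ?thesis by (intro exI[of _ "\<bar>C\<bar>"]) force
 qed
 obtain C1 where C1: "C1 >= 0" "!!x. x:cball p r ==> \<bar>k x\<bar> <= C1" using bnd[OF k] by blast
 have "EX C>=0. ALL i. ALL x:cball p r. \<bar>pd i k x\<bar> <= C"
  by (rule finite_bound[OF bnd[OF smooth_pd[OF k]]]) (meson order_trans)
 then obtain C2 where C2: "C2 >= 0" "!!i x. x:cball p r ==> \<bar>pd i k x\<bar> <= C2" by blast
 define N where "N = real CARD('n)"
 have N: "N >= 1" by (simp add: N_def Suc_le_eq)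
 have lip: "norm (k x - k y) <= N*C2*norm (x - y)" if "x:cball p r" "y:cball p r" for x y
 proof (rule differentiable_bound[of "cball p r" k "%x h. SUM i:UNIV. pd i k x*h$i"])
  show "(k has_derivative (%h. SUM i:UNIV. pd i k x*h$i)) (at x within cball p r)" if "x:cball p r" for x
   by (rule has_derivative_at_withinI[OF has_derivative_pd[OF smooth_differentiable[OF k]]]) (use that r in blast)
  show "onorm (%h. SUM i:UNIV. pd i k x*h$i) <= N*C2" if "x:cball p r" for x
  proof (rule onorm_le)
   fix h :: "real^'n"
   have "norm (SUM i:UNIV. pd i k x*h$i) <= (SUM i:(UNIV::'n set). C2*norm h)"
   proof (rule sum_norm_le)
    fix i
    show "norm (pd i k x*h$i) <= C2*norm h" unfolding norm_mult
     by (rule mult_mono) (use C2 that Finite_Cartesian_Product.norm_nth_le[of h i] in auto)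
   qed
   then show "norm (SUM i:UNIV. pd i k x*h$i) <= N*C2*norm h" by (simp add: N_def mult.assoc)
  qed
 qed (use that in auto)
 define M where "M = C1 + N*C2"
 have "C2 <= N*C2" "0 <= N*C2" using mult_right_mono[OF N C2(1)] N C2(1) by auto
 then have M: "M >= 0" "C1 <= M" "C2 <= M" "N*C2 <= M" using C1(1) C2(1) by (auto simp: M_def)
 have "\<bar>k x - k y\<bar> <= M*norm (x - y)" if "x:cball p r" "y:cball p r" for x y
  using lip[OF that] mult_right_mono[OF M(4), of "norm (x - y)"] by simp
 moreover have "\<bar>k x\<bar> <= M" "\<bar>pd i k x\<bar> <= M" if "x:cball p r" for x i
  using C1(2)[OF that] C2(2)[OF that, of i] M by auto
 ultimately show ?thesis using M(1) by blast
qed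

lemma smooth_chain:
 fixes u :: "real^'n::finite => real^'n"
 assumes k: "smooth_fun_on S k" and d: "!!j. (%x. u x$j) differentiable at x" and S: "u x:S"
 shows "((%x. k (u x)) has_derivative (%h. SUM i:UNIV. (SUM j:UNIV. pd j k (u x)*pd i (%x. u x$j) x)*h$i)) (at x)"
proof -
 have du: "(u has_derivative (%h. \<chi> j. SUM i:UNIV. pd i (%x. u x$j) x*h$i)) (at x)"
  by (rule has_derivative_vecI) (simp add: has_derivative_pd[OF d])
 show ?thesis by (rule has_derivative_eq_rhs[OF has_derivative_compose[OF du has_derivative_pd[OF smooth_differentiable[OF k S]]]])
   (auto simp: fun_eq_iff sum_distrib_left sum_distrib_right mult.assoc intro: sum.swap)
qed

lemma integral_from_has_vector_derivative:
 fixes g :: "real => real"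
 assumes g: "continuous_on {0..1} g" and t: "t:{0..1}"
 shows "((%t. integral {t..1} g) has_vector_derivative - g t) (at t within {0..1})"
proof -
 have i: "g integrable_on {0..1}" using g by (rule integrable_continuous_interval)
 have e: "integral {s..1} g = integral {0..1} g - integral {0..s} g" if "s:{0..1}" for s
  using Henstock_Kurzweil_Integration.integral_combine[of 0 s 1 g] i that by auto
 have "((%t. integral {0..1} g - integral {0..t} g) has_vector_derivative 0 - g t) (at t within {0..1})"
  by (rule has_vector_derivative_diff[OF has_vector_derivative_const integral_has_vector_derivative[OF g t]])
 then show ?thesis by (intro has_vector_derivative_transform[OF t e, of _ "- g t"]) auto
qed

text \<open>Backward Picard iteration from time 1. The iterates converge by contraction; their
  derivatives obey a linear recursion with coefficients of total size at most 1/2, hence converge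
  too, and the limit depends smoothly on the initial point.\<close>

theorem smooth_flow:
 fixes Y :: "'n::finite => 'n => real^'n => real"
 assumes S: "open S" "p:S" and Y: "!!i a. smooth_fun_on S (Y i a)"
 shows "EX ro>0. EX Ph. (ALL a. smooth_family_on (ball p ro) (%t x. Ph t x$a)) &
    (ALL x:ball p ro. Ph 1 x = x & (ALL t:{0..1}. Ph t x:S &
     ((%t. Ph t x) has_vector_derivative (\<chi> a. SUM i:I. (x$i - p$i)*Y i a (Ph t x)))
      (at t within {0..1})))"
proof -
 obtain r where r: "r > 0" "cball p r <= S" using S open_contains_cball by blast
 define N where "N = real CARD('n)"
 have N: "N >= 1" by (simp add: N_def Suc_le_eq)
 have "EX M>=0. ALL ia. (ALL x:cball p r. \<bar>Y (fst ia) (snd ia) x\<bar> <= M & (ALL c. \<bar>pd c (Y (fst ia) (snd ia)) x\<bar> <= M)) &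
  (ALL x:cball p r. ALL y:cball p r. \<bar>Y (fst ia) (snd ia) x - Y (fst ia) (snd ia) y\<bar> <= M*norm (x - y))"
 proof (rule finite_bound[OF smooth_bounds[OF Y r(2)]])
  fix ia :: "'n \<times> 'n" and C D :: real
  assume H: "(ALL x:cball p r. \<bar>Y (fst ia) (snd ia) x\<bar> <= C & (ALL c. \<bar>pd c (Y (fst ia) (snd ia)) x\<bar> <= C)) &
  (ALL x:cball p r. ALL y:cball p r. \<bar>Y (fst ia) (snd ia) x - Y (fst ia) (snd ia) y\<bar> <= C*norm (x - y))" and "C <= D"
  have "C*norm (x - y) <= D*norm (x - y)" for x y :: "real^'n" by (rule mult_right_mono[OF \<open>C <= D\<close>]) simp
  then show "(ALL x:cball p r. \<bar>Y (fst ia) (snd ia) x\<bar> <= D & (ALL c. \<bar>pd c (Y (fst ia) (snd ia)) x\<bar> <= D)) &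
  (ALL x:cball p r. ALL y:cball p r. \<bar>Y (fst ia) (snd ia) x - Y (fst ia) (snd ia) y\<bar> <= D*norm (x - y))"
   using H \<open>C <= D\<close> order_trans by blast
 qed
 then obtain M where M: "M >= 0" "!!i a x. x:cball p r ==> \<bar>Y i a x\<bar> <= M"
   "!!i a c x. x:cball p r ==> \<bar>pd c (Y i a) x\<bar> <= M"
   "!!i a x y. x:cball p r ==> y:cball p r ==> \<bar>Y i a x - Y i a y\<bar> <= M*norm (x - y)"
  by fastforce
 \<comment> \<open>The bound r/2 on N*N*ro*M keeps iterates that start within r/2 of
   \<open>p\<close> inside \<open>cball p r\<close>; the bound 1/2 makes the iteration a
   contraction.\<close>
 define ro where "ro = min (r/2) (min (r/2) (1/2)/(N*N*(M + 1)))"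
 have ro: "ro > 0" "ro <= r/2" using r(1) N M(1) by (auto simp: ro_def)
 have "N*N*(ro * M) <= N*N*(ro * (M + 1))" using ro(1) N by (intro mult_left_mono) auto
 also have "... = ro * (N*N*(M + 1))" by simp
 also have "... <= min (r/2) (1/2)/(N*N*(M + 1))*(N*N*(M + 1))"
  by (rule mult_right_mono) (use N M(1) in \<open>auto simp: ro_def\<close>)
 also have "... = min (r/2) (1/2)" using N M(1) by simp
 finally have small: "N*(N*(ro * M)) <= r/2" "N*(N*(ro * M)) <= 1/2" by (auto simp: mult.assoc)
 define V where "V = ball p ro"
 have V: "open V" by (simp add: V_def)
 define F where "F = (%x y a. SUM i:I. (x$i - p$i)*Y i a y)"
 have comp: "\<bar>x$i - p$i\<bar> <= ro" if "x:V" for x i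
  using that component_le_norm_cart[of "x - p" i] by (simp add: V_def dist_norm norm_minus_commute)
 have sumI: "\<bar>SUM i:I. (x$i - p$i)*z i\<bar> <= N*(ro * B)"
  if x: "x:V" and z: "!!i. i:I ==> \<bar>z i\<bar> <= B" and B: "B >= 0" for x z B
 proof -
  have "\<bar>SUM i:I. (x$i - p$i)*z i\<bar> <= (SUM i:I. ro * B)"
  proof (rule order_trans[OF sum_abs sum_mono])
   fix i assume "i:I"
   then show "\<bar>(x$i - p$i)*z i\<bar> <= ro * B" unfolding abs_mult by (intro mult_mono comp x z) (use ro in auto)
  qed
  also have "... <= N*(ro * B)" using ro(1) B by (auto simp: N_def card_mono intro!: mult_right_mono)
  finally show ?thesis .
 qed
 have FB: "\<bar>F x y a\<bar> <= N*(ro * M)" if "x:V" "y:cball p r" for x y a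
  unfolding F_def by (rule sumI[OF that(1) M(2)[OF that(2)] M(1)])
 have FL: "\<bar>F x y a - F x z a\<bar> <= N*(ro * (M*norm (y - z)))" if "x:V" "y:cball p r" "z:cball p r" for x y z a
 proof -
  have "F x y a - F x z a = (SUM i:I. (x$i - p$i)*(Y i a y - Y i a z))" by (simp add: F_def sum_subtractf right_diff_distrib)
  then show ?thesis using sumI[OF that(1) M(4)[OF that(2,3)]] M(1) by simp
 qed
 define Ph where "Ph = rec_nat (%(t::real) (x::real^'n). x)
  (%(m::nat) ph t x. \<chi> a. x$a - integral {t..1} (%s. F x (ph s x) a))"
 have Ph0: "Ph 0 t x = x" and PhSuc: "Ph (Suc m) t x$a = x$a - integral {t..1} (%s. F x (Ph m s x) a)" for m t x a
  by (simp_all add: Ph_def)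
 have R_F: "smooth_family_on V (%t x. F x (ga t x) a)"
  if "!!j. smooth_family_on V (%t x. ga t x$j)" "!!t x. t:{0..1} ==> x:V ==> ga t x:S" for ga a
  using smooth_family_compose[OF V Y that] unfolding F_def smooth_family_on_def by (intro allI gcf_sum gcf_mult gcf_diff V gcf_coord gcf_const) auto
 have main: "(ALL a. smooth_family_on V (%t x. Ph m t x$a)) & (ALL t:{0..1}. ALL x:V. Ph m t x:cball p r)" for m
 proof (induction m)
  case 0
  show ?case using ro r(1) by (auto simp: Ph0 smooth_family_on_def gcf_coord[OF open_ball] V_def)
 next
  case (Suc m)
  have RF: "smooth_family_on V (%t x. F x (Ph m t x) a)" for a by (rule R_F) (use Suc r(2) in auto)
  have "smooth_family_on V (%t x. Ph (Suc m) t x$a)" for a unfolding PhSuc smooth_family_on_def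
   by (intro allI gcf_diff V gcf_coord gcf_integral[of V _ "%_ s x. F x (Ph m s x) a"])
    (use RF in \<open>simp add: smooth_family_on_def\<close>)
  moreover have "Ph (Suc m) t x:cball p r" if t: "t:{0..1}" and x: "x:V" for t x
  proof -
   have "gcf 0 V (%_ t x. F x (Ph m t x) a)" for a using RF unfolding smooth_family_on_def by blast
   then have c: "continuous_on {0..1} (%s. F x (Ph m s x) a)" for a
    using continuous_slice[OF gc0_contD[of V "%_ t x. F x (Ph m t x) a"] x] by simp
   have "\<bar>(Ph (Suc m) t x - x)$a\<bar> <= N*(ro * M)" for a
   proof -
    have "\<bar>integral {t..1} (%s. F x (Ph m s x) a)\<bar> <= N*(ro * M)"
     by (rule integral_abs_le[OF t c]) (use Suc x FB in blast)
    then show ?thesis by (simp add: PhSuc)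
   qed
   then have "(SUM a:UNIV. norm ((Ph (Suc m) t x - x)$a)) <= (SUM a:(UNIV::'n set). N*(ro * M))" by (intro sum_mono) simp
   then have "norm (Ph (Suc m) t x - x) <= N*(N*(ro * M))" using norm_vec_le_sum[of "Ph (Suc m) t x - x"] by (simp add: N_def)
   then have "norm (Ph (Suc m) t x - x) <= r/2" using small(1) by simp
   moreover have "norm (x - p) <= r/2" using x ro(2) by (simp add: V_def dist_norm norm_minus_commute)
   ultimately have "norm (Ph (Suc m) t x - p) <= r" using norm_triangle_ineq[of "Ph (Suc m) t x - x" "x - p"] by simp
   then show ?thesis by (simp add: dist_norm norm_minus_commute)
  qed
  ultimately show ?case by blast
 qed
 have sm: "smooth_family_on V (%t x. Ph m t x$a)" and inb: "t:{0..1} ==> x:V ==> Ph m t x:cball p r" for m a t x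
  using main by blast+
 have inS: "t:{0..1} ==> x:V ==> Ph m t x:S" for m t x using inb r(2) by blast
 have RF: "smooth_family_on V (%t x. F x (Ph m t x) a)" for a m by (rule R_F[OF sm inS])
 have cF: "continuous_on {0..1} (%s. F x (Ph m s x) a)" if x: "x:V" for a m x
 proof -
  have "gcf 0 V (%_ t x. F x (Ph m t x) a)" using RF unfolding smooth_family_on_def by blast
  then show ?thesis using continuous_slice[OF gc0_contD[of V "%_ t x. F x (Ph m t x) a"] x] by simp
 qed
 have step: "norm (Ph (Suc m) t x - Ph m t x) <= r*(1/2)^m" if t: "t:{0..1}" and x: "x:V" for m t x using t
 proof (induction m arbitrary: t)
  case 0
  have "norm (Ph (Suc 0) t x - p) <= r" using inb[OF 0 x, of "Suc 0"] by (simp add: dist_norm norm_minus_commute)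
  have "\<bar>(Ph (Suc 0) t x - x)$a\<bar> <= N*(ro * M)" for a
  proof -
   have "\<bar>integral {t..1} (%s. F x (Ph 0 s x) a)\<bar> <= N*(ro * M)"
    by (rule integral_abs_le[OF 0 cF[OF x]]) (use inb x FB in blast)
   then show ?thesis by (simp add: PhSuc)
  qed
  then have "(SUM a:UNIV. norm ((Ph (Suc 0) t x - x)$a)) <= (SUM a:(UNIV::'n set). N*(ro * M))" by (intro sum_mono) simp
  then have "norm (Ph (Suc 0) t x - x) <= N*(N*(ro * M))" using norm_vec_le_sum[of "Ph (Suc 0) t x - x"] by (simp add: N_def)
  then show ?case using small(1) r(1) by (simp add: Ph0)
 next
  case (Suc m)
  have "\<bar>(Ph (Suc (Suc m)) t x - Ph (Suc m) t x)$a\<bar> <= N*(ro * (M*(r*(1/2)^m)))" for a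
  proof -
   have i: "(%s. F x (Ph m s x) a) integrable_on {t..1}" for m
    by (intro integrable_continuous_interval continuous_on_subset[OF cF[OF x]]) (use Suc.prems in auto)
   have "\<bar>integral {t..1} (%s. F x (Ph (Suc m) s x) a - F x (Ph m s x) a)\<bar> <= N*(ro * (M*(r*(1/2)^m)))"
   proof (rule integral_abs_le[OF Suc.prems continuous_on_diff[OF cF[OF x] cF[OF x]]])
    fix s :: real assume s: "s:{0..1}"
    have "\<bar>F x (Ph (Suc m) s x) a - F x (Ph m s x) a\<bar> <= N*(ro * (M*norm (Ph (Suc m) s x - Ph m s x)))"
     by (rule FL[OF x inb[OF s x] inb[OF s x]])
    also have "... <= N*(ro * (M*(r*(1/2)^m)))" by (intro mult_left_mono Suc.IH s) (use N ro M in auto)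
    finally show "\<bar>F x (Ph (Suc m) s x) a - F x (Ph m s x) a\<bar> <= N*(ro * (M*(r*(1/2)^m)))" .
   qed
   then show ?thesis by (simp add: PhSuc integral_diff[OF i i] abs_minus_commute)
  qed
  then have "(SUM a:UNIV. norm ((Ph (Suc (Suc m)) t x - Ph (Suc m) t x)$a)) <=
    (SUM a:(UNIV::'n set). N*(ro * (M*(r*(1/2)^m))))" by (intro sum_mono) simp
  then have "norm (Ph (Suc (Suc m)) t x - Ph (Suc m) t x) <= N*(N*(ro * (M*(r*(1/2)^m))))"
   using norm_vec_le_sum[of "Ph (Suc (Suc m)) t x - Ph (Suc m) t x"] by (simp add: N_def)
  also have "... = (N*(N*(ro * M)))*(r*(1/2)^m)" by simp
  also have "... <= 1/2*(r*(1/2)^m)" by (rule mult_right_mono[OF small(2)]) (use r(1) in simp)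
  finally show ?case by simp
 qed
 have step': "norm (Ph (Suc m) t x - Ph m t x) <= r*(3/4)^m" if "t:{0..1}" "x:V" for m t x
 proof -
  have "r*(1/2)^m <= r*(3/4 :: real)^m" by (intro mult_left_mono power_mono) (use r(1) in auto)
  then show ?thesis using step[OF that, of m] by linarith
 qed
 \<comment> \<open>A Lipschitz bound for \<open>k\<close> on the closed ball turns geometric
   convergence of the iterates into that of the values, as \<open>gcf_compose\<close> requires at
   order 0.\<close>
 have base: "gc0 V (%m t x. k (Ph m t x))" if k: "smooth_fun_on S k" for k unfolding gc0_def
 proof (intro conjI allI impI)
  fix m
  have "gcf 0 V (%_ t x. k (Ph m t x))" using smooth_family_compose[OF V k sm inS] unfolding smooth_family_on_def by blast
  then show "continuous_on ({0..1} \<times> V) (%(t, x). k (Ph m t x))" using gc0_contD[of V "%_ t x. k (Ph m t x)"] by simp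
 next
  fix K assume K: "compact K & K <= V"
  obtain C where C: "C >= 0" "!!x. x:cball p r ==> \<bar>k x\<bar> <= C"
   "!!x y. x:cball p r ==> y:cball p r ==> \<bar>k x - k y\<bar> <= C*norm (x - y)"
   using smooth_bounds[OF k r(2)] by blast
  have "\<bar>k (Ph m t x)\<bar> <= C*(r + 1) & \<bar>k (Ph (Suc m) t x) - k (Ph m t x)\<bar> <= C*(r + 1)*(3/4)^m"
   if t: "t:{0..1}" and xK: "x:K" for m t x
  proof
   have x: "x:V" using xK K by blast
   have "0 <= C*r" using C(1) r(1) by simp
   then show "\<bar>k (Ph m t x)\<bar> <= C*(r + 1)" using C(2)[OF inb[OF t x], of m] by (simp add: distrib_left)
   have "\<bar>k (Ph (Suc m) t x) - k (Ph m t x)\<bar> <= C*norm (Ph (Suc m) t x - Ph m t x)"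
    by (rule C(3)[OF inb[OF t x] inb[OF t x]])
   also have "... <= C*(r*(3/4)^m)" by (rule mult_left_mono[OF step'[OF t x] C(1)])
   also have "... <= C*((r + 1)*(3/4)^m)" by (intro mult_left_mono mult_right_mono) (use C(1) in auto)
   finally show "\<bar>k (Ph (Suc m) t x) - k (Ph m t x)\<bar> <= C*(r + 1)*(3/4)^m" by (simp add: mult.assoc)
  qed
  then show "EX C>=0. ALL m. ALL t:{0..1}. ALL x:K. \<bar>k (Ph m t x)\<bar> <= C & \<bar>k (Ph (Suc m) t x) - k (Ph m t x)\<bar> <= C*(3/4)^m"
   using C(1) r(1) by (intro exI[of _ "C*(r + 1)"]) auto
 qed
 have scoord: "smooth_fun_on S (%x. x$a)" for a by (simp add: smooth_gcf[OF S(1)] gcf_coord[OF S(1)])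
 have dPhi: "(%x. Ph m t x$a) differentiable at x" if "t:{0..1}" "x:V" for m t x a
 proof -
  have "gcf (Suc 0) V (%_ t x. Ph m t x$a)" using sm unfolding smooth_family_on_def by blast
  then show ?thesis using that by simp
 qed
 have conv: "gcf q V (%m t x. Ph m t x$a)" for q a
 proof (induction q arbitrary: a)
  case 0
  show ?case using base[OF scoord] by simp
 next
  case (Suc q)
  have kq: "gcf q V (%m t x. k (Ph m t x))" if "smooth_fun_on S k" for k by (rule gcf_compose[OF V that Suc.IH inS base])
  have "gcf q V (%m t. pd l (%x. Ph m t x$a))" for l a
  \<comment> \<open>\<open>A\<close> comes from differentiating the field in its moving argument;
    \<open>b\<close> collects the derivative of the starting point and those of the factors
    \<open>x$i - p$i\<close>.\<close>
  proof (rule linear_recursion[where w="%a m t. pd l (%x. Ph m t x$a)"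
     and b="%a m t x. (if l = a then 1 else 0) - (if l:I then integral {t..1} (%s. Y l a (Ph m s x)) else 0)"
     and A="%a c m t x. - (SUM i:I. (x$i - p$i)*pd c (Y i a) (Ph m t x))", OF V])
   fix a c :: 'n
   show "gcf q' V (%_ t. pd l (%x. Ph m t x$a))" for m q'
   proof -
    have "gcf (Suc q') V (%_ t x. Ph m t x$a)" using sm unfolding smooth_family_on_def by blast
    then show ?thesis by simp
   qed
   have "gcf q V (%m t x. 0 - (SUM i:I. (x$i - p$i)*pd c (Y i a) (Ph m t x)))"
    by (intro gcf_diff gcf_sum gcf_mult V gcf_const gcf_coord kq smooth_pd Y)
   then show "gcf q V (%m t x. - (SUM i:I. (x$i - p$i)*pd c (Y i a) (Ph m t x)))" by simp
   show "gcf q V (%m t x. (if l = a then 1 else 0) - (if l:I then integral {t..1} (%s. Y l a (Ph m s x)) else 0))"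
    by (cases "l:I") (simp_all add: gcf_diff gcf_const V gcf_integral[OF V kq[OF Y]])
  next
   fix a :: 'n and m t x assume t: "t:{0..1::real}" and x: "x:V"
   let ?J = "%c s. SUM i:I. (x$i - p$i)*pd c (Y i a) (Ph m s x)" and ?U = "%l s. if l:I then Y l a (Ph m s x) else 0" and ?D = "%l c s. pd l (%x. Ph m s x$c) x"
   have "(SUM c:UNIV. \<bar>- (SUM i:I. (x$i - p$i)*pd c (Y i a) (Ph m t x))\<bar>) <= (SUM c:(UNIV::'n set). N*(ro * M))"
    by (rule sum_mono) (simp add: sumI[OF x M(3)[OF inb[OF t x]] M(1)])
   also have "... <= 1/2" using small(2) by (simp add: N_def)
   finally show "(SUM c:UNIV. \<bar>- (SUM i:I. (x$i - p$i)*pd c (Y i a) (Ph m t x))\<bar>) <= 1/2" .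
   have gF: "gcf (Suc 0) V (%_ t x. F x (Ph m t x) a)" using RF unfolding smooth_family_on_def by blast
   have pF: "pd l (%x. F x (Ph m s x) a) x = ?U l s +
     (SUM c:UNIV. ?J c s * ?D l c s)" if s: "s:{0..1}" for s
   proof (rule pd_eqI)
    note ch = smooth_chain[OF Y dPhi[OF s x] inS[OF s x]]
    have "((%x. F x (Ph m s x) a) has_derivative
     (%h. SUM i:I. (x$i - p$i)*(SUM l:UNIV. (SUM c:UNIV. pd c (Y i a) (Ph m s x)*?D l c s)*h$l)
      + h$i*Y i a (Ph m s x))) (at x)" unfolding F_def by (intro has_derivative_sum has_derivative_mult ch)
      (auto intro!: derivative_eq_intros bounded_linear_imp_has_derivative bounded_linear_vec_nth)
    moreover have "(SUM i:I. (x$i - p$i)*(SUM l:UNIV. (SUM c:UNIV. pd c (Y i a) (Ph m s x)*?D l c s)*h$l)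
      + h$i*Y i a (Ph m s x)) = (SUM l:UNIV. (?U l s +
     (SUM c:UNIV. ?J c s * ?D l c s))*h$l)" for h :: "real^'n"
    proof -
     have 1: "(SUM i:I. h$i*Y i a (Ph m s x)) = (SUM l:UNIV. ?U l s * h$l)"
     proof -
      have "(SUM l:UNIV. ?U l s * h$l) = (SUM l:UNIV. if l:I then Y l a (Ph m s x)*h$l else 0)" by (rule sum.cong) auto
      also have "... = (SUM l:UNIV \<inter> I. Y l a (Ph m s x)*h$l)" by (subst sum.inter_restrict) auto
      finally show ?thesis by (simp add: mult.commute)
     qed
     have 2: "(SUM i:I. (x$i - p$i)*(SUM l:UNIV. (SUM c:UNIV. pd c (Y i a) (Ph m s x)*?D l c s)*h$l))
      = (SUM l:UNIV. (SUM c:UNIV. ?J c s * ?D l c s)*h$l)"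
     proof -
      have "(SUM i:I. (x$i - p$i)*(SUM l:UNIV. (SUM c:UNIV. pd c (Y i a) (Ph m s x)*?D l c s)*h$l))
       = (SUM i:I. SUM l:UNIV. SUM c:UNIV. (x$i - p$i)*pd c (Y i a) (Ph m s x)*?D l c s * h$l)"
       by (simp add: sum_distrib_left sum_distrib_right mult.assoc)
      also have "... = (SUM l:UNIV. SUM i:I. SUM c:UNIV. (x$i - p$i)*pd c (Y i a) (Ph m s x)*?D l c s * h$l)"
       by (rule sum.swap)
      also have "... = (SUM l:UNIV. SUM c:UNIV. SUM i:I. (x$i - p$i)*pd c (Y i a) (Ph m s x)*?D l c s * h$l)"
       by (intro sum.cong refl sum.swap)
      finally show ?thesis by (simp add: sum_distrib_right)
     qed
     show ?thesis unfolding sum.distrib distrib_right using 1 2 by simp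
    qed
    ultimately show "((%x. F x (Ph m s x) a) has_derivative (%h. SUM l:UNIV. (?U l s +
     (SUM c:UNIV. ?J c s * ?D l c s))*h$l)) (at x)" by simp
   qed
   have "((%x. x$a - integral {t..1} (%s. F x (Ph m s x) a)) has_derivative
    (%h. (SUM l:UNIV. (if l = a then 1 else 0)*h$l) - (SUM l:UNIV. integral {t..1} (%s. pd l (%x. F x (Ph m s x) a) x)*h$l))) (at x)"
   proof (rule has_derivative_diff)
    show "((%x. x$a) has_derivative (%h. SUM l:UNIV. (if l = a then 1 else 0)*h$l)) (at x)"
     using has_derivative_pd[OF smooth_differentiable[OF scoord inS[OF t x]], of a m]
      has_derivative_pd[OF bounded_linear_imp_differentiable[OF bounded_linear_vec_nth], of a x] by (simp add: pd_coord)
    show "((%x. integral {t..1} (%s. F x (Ph m s x) a)) has_derivative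
      (%h. SUM l:UNIV. integral {t..1} (%s. pd l (%x. F x (Ph m s x) a) x)*h$l)) (at x)"
     by (rule gcf_integral_has_derivative[OF V gF t x])
   qed
   then have D: "((%x. x$a - integral {t..1} (%s. F x (Ph m s x) a)) has_derivative
    (%h. SUM l:UNIV. ((if l = a then 1 else 0) - integral {t..1} (%s. pd l (%x. F x (Ph m s x) a) x))*h$l)) (at x)"
    by (simp add: sum_subtractf left_diff_distrib)
   have "pd l (%x. Ph (Suc m) t x$a) x = (if l = a then 1 else 0) - integral {t..1} (%s. pd l (%x. F x (Ph m s x) a) x)"
    unfolding PhSuc by (rule pd_eqI[OF D])
   also have "integral {t..1} (%s. pd l (%x. F x (Ph m s x) a) x) = integral {t..1} (%s. ?U l s +
     (SUM c:UNIV. ?J c s * ?D l c s))" by (rule integral_cong) (use t pF in auto)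
   also have "... = integral {t..1} (%s. if l:I then Y l a (Ph m s x) else 0) +
     integral {t..1} (%s. SUM c:UNIV. ?J c s * ?D l c s)"
   proof (rule integral_add; rule integrable_continuous_interval, rule continuous_on_subset[of "{0..1}"])
    have ck: "continuous_on {0..1} (%s. k (Ph m s x))" if "smooth_fun_on S k" for k
     using continuous_slice[OF gc0_contD[OF base[OF that]] x] .
    have cp: "continuous_on {0..1} (%s. ?D l c s)" for c
    proof -
     have "gcf (Suc 0) V (%_ t x. Ph m t x$c)" using sm unfolding smooth_family_on_def by blast
     from continuous_slice[OF gcf_pd_cont[OF this] x] show ?thesis .
    qed
    show "continuous_on {0..1} (%s. if l:I then Y l a (Ph m s x) else 0)" by (cases "l:I") (simp_all add: ck[OF Y])
    show "continuous_on {0..1} (%s. SUM c:UNIV. ?J c s * ?D l c s)"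
     by (intro continuous_on_sum continuous_on_mult continuous_on_const ck[OF smooth_pd[OF Y]] cp)
   qed (use t in auto)
   finally show "pd l (%x. Ph (Suc m) t x$a) x =
    ((if l = a then 1 else 0) - (if l:I then integral {t..1} (%s. Y l a (Ph m s x)) else 0)) +
    integral {t..1} (%s. SUM c:UNIV. - ?J c s * ?D l c s)" by (auto simp: sum_negf)
  qed
  then show ?case using base[OF scoord] dPhi by simp
 qed
 define Ps where "Ps = (%t x. \<chi> a. lim (%m. Ph m t x$a))"
 have sPsi: "smooth_family_on V (%t x. Ps t x$a)" for a unfolding smooth_family_on_def Ps_def using gcf_limit[OF V conv] by simp
 have lim: "(%m. Ph m t x$a) \<longlonglongrightarrow> Ps t x$a" "\<bar>Ps t x$a - Ph m t x$a\<bar> <= 4*r*(3/4)^m"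
  if tx: "t:{0..1}" "x:V" for t x a m
 proof -
  have "\<bar>Ph (Suc m) t x$a - Ph m t x$a\<bar> <= r*(3/4)^m" for m
   using step'[OF tx, of m] component_le_norm_cart[of "Ph (Suc m) t x - Ph m t x" a] by simp
  from geometric_limit[of "%m. Ph m t x$a", OF this]
  show "(%m. Ph m t x$a) \<longlonglongrightarrow> Ps t x$a" "\<bar>Ps t x$a - Ph m t x$a\<bar> <= 4*r*(3/4)^m"
   by (simp_all add: Ps_def)
 qed
 have Psib: "Ps t x:cball p r" if tx: "t:{0..1}" "x:V" for t x
 proof -
  have "(%m. Ph m t x) \<longlonglongrightarrow> Ps t x" by (rule vec_tendstoI) (rule lim(1)[OF tx])
  with inb[OF tx] show ?thesis by (rule closed_sequentially[OF closed_cball])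
 qed
 have cFP: "continuous_on {0..1} (%s. F x (Ps s x) a)" if x: "x:V" for a x
 proof -
  have "smooth_family_on V (%t x. F x (Ps t x) a)" by (rule R_F[OF sPsi]) (use Psib r(2) in blast)
  then have "gcf 0 V (%_ t x. F x (Ps t x) a)" unfolding smooth_family_on_def by blast
  then show ?thesis using continuous_slice[OF gc0_contD[of V "%_ t x. F x (Ps t x) a"] x] by simp
 qed
 have eqn: "Ps t x$a = x$a - integral {t..1} (%s. F x (Ps s x) a)" if t: "t:{0..1}" and x: "x:V" for t x a
 proof -
  \<comment> \<open>The next iterate is the right-hand side applied to the present one, whose
    components are within 4*r*(3/4)^m of the limit; the Lipschitz bound of \<open>F\<close> converts
    this into B*(3/4)^m.\<close>
  define B where "B = N*(ro * (M*(N*(4*r))))"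
  have bd: "\<bar>(x$a - integral {t..1} (%s. F x (Ps s x) a)) - Ph (Suc m) t x$a\<bar> <= B*(3/4)^m" for m
  proof -
   have i: "(%s. F x (Ph m s x) a) integrable_on {t..1}" "(%s. F x (Ps s x) a) integrable_on {t..1}"
    by (intro integrable_continuous_interval continuous_on_subset[OF cF[OF x]] continuous_on_subset[OF cFP[OF x]], use t in auto)+
   have "\<bar>integral {t..1} (%s. F x (Ph m s x) a - F x (Ps s x) a)\<bar> <= B*(3/4)^m"
   proof (rule integral_abs_le[OF t continuous_on_diff[OF cF[OF x] cFP[OF x]]])
    fix s :: real assume s: "s:{0..1}"
    have "(SUM b:UNIV. norm ((Ph m s x - Ps s x)$b)) <= (SUM b:(UNIV::'n set). 4*r*(3/4)^m)"
     by (rule sum_mono) (use lim(2)[OF s x, where m=m] in \<open>simp add: abs_minus_commute\<close>)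
    then have n: "norm (Ph m s x - Ps s x) <= N*(4*r*(3/4)^m)"
     using norm_vec_le_sum[of "Ph m s x - Ps s x"] by (simp add: N_def)
    have "\<bar>F x (Ph m s x) a - F x (Ps s x) a\<bar> <= N*(ro * (M*norm (Ph m s x - Ps s x)))"
     by (rule FL[OF x inb[OF s x] Psib[OF s x]])
    also have "... <= N*(ro * (M*(N*(4*r*(3/4)^m))))" by (intro mult_left_mono n) (use N ro M in auto)
    finally show "\<bar>F x (Ph m s x) a - F x (Ps s x) a\<bar> <= B*(3/4)^m" by (simp add: B_def mult.assoc)
   qed
   then show ?thesis by (simp add: PhSuc integral_diff[OF i])
  qed
  have "(%m. (x$a - integral {t..1} (%s. F x (Ps s x) a)) - Ph (Suc m) t x$a) \<longlonglongrightarrow> 0"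
   by (rule Lim_null_comparison[OF always_eventually geometric_null[of B]]) (use bd in auto)
  moreover have "(%m. (x$a - integral {t..1} (%s. F x (Ps s x) a)) - Ph (Suc m) t x$a) \<longlonglongrightarrow>
    (x$a - integral {t..1} (%s. F x (Ps s x) a)) - Ps t x$a"
   by (rule tendsto_diff[OF tendsto_const LIMSEQ_Suc[OF lim(1)[OF t x]]])
  ultimately have "(x$a - integral {t..1} (%s. F x (Ps s x) a)) - Ps t x$a = 0" using LIMSEQ_unique by blast
  then show ?thesis by simp
 qed
 have ode: "((%t. Ps t x) has_vector_derivative (\<chi> a. SUM i:I. (x$i - p$i)*Y i a (Ps t x))) (at t within {0..1})"
  if t: "t:{0..1}" and x: "x:V" for t x
 proof (rule has_vector_derivative_vecI)
  fix a
  have D: "((%t. x$a - integral {t..1} (%s. F x (Ps s x) a)) has_vector_derivative 0 - - F x (Ps t x) a) (at t within {0..1})"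
   by (rule has_vector_derivative_diff[OF has_vector_derivative_const integral_from_has_vector_derivative[OF cFP[OF x] t]])
  have "((%t. Ps t x$a) has_vector_derivative 0 - - F x (Ps t x) a) (at t within {0..1})"
   by (rule has_vector_derivative_transform[OF t _ D]) (rule eqn[OF _ x])
  then show "((%t. Ps t x$a) has_vector_derivative (\<chi> a. SUM i:I. (x$i - p$i)*Y i a (Ps t x))$a) (at t within {0..1})"
   by (simp add: F_def)
 qed
 have one: "Ps 1 x = x" if "x:V" for x using eqn[OF _ that, of 1] by (simp add: vec_eq_iff)
 have "Ps t x:S" if "t:{0..1}" "x:V" for t x using Psib[OF that] r(2) by blast
 then show ?thesis using ro(1) sPsi one ode unfolding V_def by blast
qed

lemma gcf_slice:
 assumes V: "open V" and "gcf p V (%_. h)" and t: "t:{0..1}"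
 shows "gcf p V (%_ _. h t)" using assms(2)
proof (induction p arbitrary: h)
 case 0
 have "continuous_on ({0..1} \<times> V) (%z. (%(t, x). h t x) (t, snd z))"
  by (rule continuous_on_compose2[OF gc0_contD[of V "%_. h" 0]])
   (use 0 t in \<open>auto intro!: continuous_intros\<close>)
 then show ?case by (auto intro!: gc0_const_seqI simp: case_prod_unfold)
next
 case (Suc p)
 have "continuous_on ({0..1} \<times> V) (%z. (%(t, x). h t x) (t, snd z))"
  by (rule continuous_on_compose2[OF gc0_contD[OF gcf_gc0[OF Suc.prems]]])
   (use t in \<open>auto intro!: continuous_intros\<close>)
 then have "gc0 V (%_ _. h t)" by (intro gc0_const_seqI) (simp add: case_prod_unfold)
 moreover have "gcf p V (%_ _. pd i (h t))" for i using Suc.IH[of "%t. pd i (h t)"] Suc.prems by simp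
 ultimately show ?case using Suc.prems t by simp
qed

lemma times_differentiable_local:
 assumes "!!x. x:S ==> EX U. open U & x:U & times_differentiable_on p U f"
 shows "times_differentiable_on p S f" using assms
proof (induction p arbitrary: f)
 case 0
 have "isCont f x" if x: "x:S" for x
 proof -
  obtain U where "open U" "x:U" "times_differentiable_on 0 U f" using 0 x by blast
  then show ?thesis using continuous_on_eq_continuous_at by auto
 qed
 then show ?case by (simp add: continuous_at_imp_continuous_on)
next
 case (Suc p)
 have "f differentiable at x" if x: "x:S" for x using Suc.prems[OF x] by auto
 moreover have "times_differentiable_on p S (%x. frechet_derivative f (at x) v)" for v
 proof (rule Suc.IH)
  fix x assume "x:S"
  from Suc.prems[OF this]
  show "EX U. open U & x:U & times_differentiable_on p U (%x. frechet_derivative f (at x) v)" by auto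
 qed
 ultimately show ?case by simp
qed

lemma gcf_inverse:
 assumes V: "open V" and f: "gcf p V (%_. f)" and nz: "!!t x. t:{0..1} ==> x:V ==> f t x ~= 0"
 shows "gcf p V (%_ t x. inverse (f t x))" using f
proof (induction p)
 case 0
 have "continuous_on ({0..1} \<times> V) (%z. inverse ((%(t, x). f t x) z))"
  by (intro continuous_on_inverse gc0_contD[of V "%_. f" 0]) (use 0 nz in auto)
 then have "gc0 V (%_ t x. inverse (f t x))" by (intro gc0_const_seqI) (simp add: case_prod_unfold)
 then show ?case by simp
next
 case (Suc p)
 have IH: "gcf p V (%_ t x. inverse (f t x))" by (rule Suc.IH[OF gcf_SucD[OF Suc.prems]])
 have fd: "f t differentiable at x" if "t:{0..1}" "x:V" for t x using Suc.prems that by simp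
 have der: "((%x. inverse (f t x)) has_derivative
   (%h. SUM i:UNIV. (- 1*(inverse (f t x)*pd i (f t) x*inverse (f t x)))*h$i)) (at x)"
  if tx: "t:{0..1}" "x:V" for t x
  by (rule has_derivative_eq_rhs[OF Deriv.has_derivative_inverse[OF nz[OF tx] has_derivative_pd[OF fd[OF tx]]]])
   (simp add: fun_eq_iff sum_distrib_left sum_distrib_right sum_negf mult.assoc mult.commute mult.left_commute)
 have "gcf p V (%_ t. pd i (%x. inverse (f t x)))" for i
 proof (rule gcf_cong[OF V])
  show "gcf p V (%_ t x. - 1*(inverse (f t x)*pd i (f t) x*inverse (f t x)))" by (intro gcf_mult V IH gcf_const) (use Suc.prems in simp)
 qed (rule pd_eqI[symmetric], rule der)
 moreover have "(%x. inverse (f t x)) differentiable at x" if "t:{0..1}" "x:V" for t x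
  using der[OF that] by (rule differentiableI)
 ultimately show ?case using gcf_gc0[OF IH] by simp
qed

theorem smooth_regularity:
 "regularity (smooth_fun_on :: (real^'n::finite) set => _) smooth_family_on"
proof
 fix S T V U :: "(real^'n) set" and f g :: "real^'n => real" and h :: "real => real^'n => real"
  and i :: 'n and p x :: "real^'n" and c t :: real
 note sg = smooth_gcf
 show "smooth_fun_on T f" if "open S" "smooth_fun_on S f" "open T" "T <= S" using smooth_fun_subset that by blast
 show "smooth_fun_on S f" if "open S" "!!x. x:S ==> EX U. open U & x:U & smooth_fun_on U f"
  unfolding smooth_fun_on_def
 proof
  fix p
  show "times_differentiable_on p S f"
  proof (rule times_differentiable_local)
   fix x assume "x:S"
   from that(2)[OF this] show "EX U. open U & x:U & times_differentiable_on p U f" unfolding smooth_fun_on_def by blast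
  qed
 qed
 show "smooth_fun_on S g" if S: "open S" and f: "smooth_fun_on S f" and "!!x. x:S ==> f x = g x"
 proof -
  have "gcf p S (%_ _. g)" for p by (rule gcf_cong[OF S, of p "%_ _. f"]) (use f that in \<open>auto simp: sg[OF S]\<close>)
  then show ?thesis by (simp add: sg[OF S])
 qed
 show "smooth_fun_on S (%x. c)" if S: "open S" by (simp add: sg[OF S] gcf_const)
 show "smooth_fun_on S (%x. x$i)" if S: "open S" by (simp add: sg[OF S] gcf_coord[OF S])
 show "smooth_fun_on S (%x. f x + g x)" if S: "open S" and "smooth_fun_on S f" "smooth_fun_on S g"
  using that by (simp add: sg[OF S] gcf_add[OF S])
 show "smooth_fun_on S (%x. f x*g x)" if S: "open S" and "smooth_fun_on S f" "smooth_fun_on S g"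
  using that by (simp add: sg[OF S] gcf_mult[OF S])
 show "smooth_fun_on S (%x. inverse (f x))" if S: "open S" and "smooth_fun_on S f" "!!x. x:S ==> f x ~= 0"
  using that gcf_inverse[OF S, of _ "%_. f"] by (simp add: sg[OF S])
 show "(f has_derivative (%h. SUM i:UNIV. pd i f x*h$i)) (at x)" if "open S" "smooth_fun_on S f" "x:S"
  by (rule has_derivative_pd[OF smooth_differentiable[OF that(2,3)]])
 show "smooth_fun_on S (pd i f)" if "open S" "smooth_fun_on S f" by (rule smooth_pd[OF that(2)])
 show "smooth_fun_on T (%x. f (u x))" if S: "open S" and T: "open T" and "smooth_fun_on S f" "!!i. smooth_fun_on T (%x. u x$i)"
  "!!x. x:T ==> u x:S" for u :: "real^'n => real^'n" unfolding smooth_family_const[OF T]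
  by (rule smooth_family_compose[OF T that(3)]) (use that smooth_family_const[OF T] in auto)
 show "smooth_family_on V (%t x. f (ga t x))" if "open S" "open V" "smooth_fun_on S f"
  "!!i. smooth_family_on V (%t x. ga t x$i)" "!!t x. t:{0..1} ==> x:V ==> ga t x:S"
  for ga :: "real => real^'n => real^'n" by (rule smooth_family_compose[OF that(2,3,4,5)])
 show sl: "smooth_fun_on V (h t)" if V: "open V" and "smooth_family_on V h" "t:{0..1}" for t h V
  using that gcf_slice[OF V] by (simp add: sg[OF V] smooth_family_on_def)
 show "smooth_fun_on V (%x. integral {0..1} (%t. h t x))" if V: "open V" and "smooth_family_on V h"
 proof -
  have "smooth_family_on V (%t x. integral {t..1} (%s. h s x))"
   using that(2) gcf_integral[OF V, of _ "%_. h"] by (simp add: smooth_family_on_def)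
  from sl[OF V this, of 0] show ?thesis by simp
 qed
 show "continuous_on ({0..1} \<times> V) (%(t, x). h t x)" if "open V" "smooth_family_on V h"
 proof -
  have "gcf 0 V (%_. h)" using that(2) unfolding smooth_family_on_def by blast
  then show ?thesis using gc0_contD[of V "%_. h" 0] by simp
 qed
 show "smooth_family_on U h" if "open V" "smooth_family_on V h" "open U" "U <= V"
  using that gcf_subset[of _ V "%_. h" U] by (simp add: smooth_family_on_def)
 show "smooth_family_on V (%t x. of_real t*(x$i - p$i) + p$i)" if V: "open V" unfolding smooth_family_on_def
  by (intro allI gcf_add gcf_mult gcf_diff V gcf_coord gcf_const gcf_time) (auto intro!: continuous_intros)
 show "EX ro>0. EX Ph. (ALL a. smooth_family_on (ball p ro) (%t x. Ph t x$a)) &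
    (ALL x:ball p ro. Ph 1 x = x & (ALL t:{0..1}. Ph t x:S &
     ((%t. Ph t x) has_vector_derivative (\<chi> a. SUM i:I. (x$i - p$i)*Y i a (Ph t x)))
      (at t within {0..1})))"
  if "open S" "p:S" "!!i a. smooth_fun_on S (Y i a)" for Y :: "'n => 'n => real^'n => real" and I
  by (rule smooth_flow[OF that])
qed

section \<open>Analytic functions\<close>

definition mpow :: "('i::finite => 'a::comm_monoid_mult) => ('i => nat) => 'a" where
 "mpow x al = (PROD i:UNIV. x i^al i)"

lemma mpow_add: "mpow x (%i. al i + be i) = mpow x al*mpow x be" by (simp add: mpow_def power_add prod.distrib)

lemma norm_mpow: "norm (mpow x al) = mpow (%i. norm (x i :: 'k::real_normed_field)) al"
 by (simp add: mpow_def prod_norm[symmetric] norm_power)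

lemma mpow_mono: "(!!i. 0 <= x i) ==> (!!i. x i <= y i) ==> mpow x al <= mpow (y :: _ => real) al"
 unfolding mpow_def by (intro prod_mono) (auto intro: power_mono)

lemma mpow_pos: "(!!i. 0 < x i) ==> 0 < mpow (x :: _ => real) al" unfolding mpow_def by (intro prod_pos) auto

lemma mpow_nonneg: "(!!i. 0 <= x i) ==> 0 <= mpow (x :: _ => real) al"
 unfolding mpow_def by (intro prod_nonneg) auto

lemma mpow_zero [simp]: "mpow x (%_. 0) = 1" by (simp add: mpow_def)

lemma mpow_unit: "mpow x (%j. if j = i then 1 else 0) = x i"
proof -
 have "mpow x (%j. if j = i then 1 else 0) = (PROD j:UNIV. if j = i then x j else 1)" unfolding mpow_def by (rule prod.cong) auto
 then show ?thesis by simp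
qed

lemma mpow_scale: "mpow (%i. c*x i) al = c^(SUM i:UNIV. al i)*mpow x al"
 by (simp add: mpow_def power_mult_distrib prod.distrib power_sum)

lemma norm_mpow_le:
 assumes "!!i. norm (x i :: 'k::real_normed_field) <= r i"
 shows "norm (mpow x al) <= mpow r al" unfolding norm_mpow by (rule mpow_mono) (use assms in auto)

text \<open>f is the sum of a power series whose weighted l1 norm with radii r is at most M. These norms are
  submultiplicative, so the Picard iteration can be run in them.\<close>
definition wn :: "('i::finite => real) => real => (('i => 'k) => 'k::{real_normed_field,banach}) => bool" where
 "wn r M f \<longleftrightarrow> (EX c S. S <= M & ((%al. norm (c al)*mpow r al) has_sum S) UNIV &
   (ALL x. (ALL i. norm (x i) <= r i) --> ((%al. c al*mpow x al) has_sum f x) UNIV))"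

lemma wnE:
 assumes "wn r M f"
 obtains c S where "S <= M" "((%al. norm (c al)*mpow r al) has_sum S) UNIV"
  "ALL x. (ALL i. norm (x i) <= r i) --> ((%al. c al*mpow x al) has_sum f x) UNIV"
 using assms unfolding wn_def by blast

lemma wnI:
 assumes "S <= M" "((%al. norm (c al)*mpow r al) has_sum S) UNIV"
  "!!x. (!!i. norm (x i) <= r i) ==> ((%al. c al*mpow x al) has_sum f x) UNIV"
 shows "wn r M f" using assms unfolding wn_def by blast

lemma wn_mono: "wn r M f ==> M <= M' ==> wn r M' f" unfolding wn_def by (blast intro: order_trans)

lemma wn_cong:
 fixes f g :: "('i::finite => 'k::{real_normed_field,banach}) => 'k"
 assumes f: "wn r M f" and eq: "!!x. (!!i. norm (x i) <= r i) ==> f x = g x"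
 shows "wn r M g"
proof -
 obtain c S where c: "S <= M" "((%al. norm (c al)*mpow r al) has_sum S) UNIV"
  "ALL x. (ALL i. norm (x i) <= r i) --> ((%al. c al*mpow x al) has_sum f x) UNIV"
  by (rule wnE[OF f])
 show ?thesis
 proof (rule wnI[OF c(1,2)])
  fix x :: "'i => 'k" assume x: "!!i. norm (x i) <= r i"
  show "((%al. c al*mpow x al) has_sum g x) UNIV" using c(3)[rule_format, OF x] eq[OF x] by simp
 qed
qed

lemma has_sum_fibers:
 fixes h :: "'j => 'b::{topological_comm_monoid_add,t3_space}"
 assumes "(h has_sum S) UNIV" "!!ga. (h has_sum g ga) {j. a j = ga}"
 shows "(g has_sum S) UNIV"
proof -
 have bij: "bij_betw (%j. (a j, j)) UNIV (SIGMA ga:UNIV. {j. a j = ga})" by (rule bij_betwI[where g=snd]) auto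
 have "((%(ga, j). h j) has_sum S) (SIGMA ga:UNIV. {j. a j = ga})"
  using has_sum_reindex_bij_betw[OF bij, of "%(ga, j). h j" S] assms(1) by simp
 then show ?thesis by (rule has_sum_SigmaD) (use assms(2) in auto)
qed

text \<open>The workhorse for sums, products and compositions: a series over any index type, with
  exponent \<open>a j\<close> at index \<open>j\<close>, is collected by exponents. Collecting can
  only lower the weighted norm, by the triangle inequality in each fibre.\<close>

lemma wn_reindex:
 fixes e :: "'j => 'k::{real_normed_field,banach}" and a :: "'j => 'i::finite => nat"
 assumes r: "!!i. 0 < r i" and S: "((%j. norm (e j)*mpow r (a j)) has_sum S) UNIV" "S <= M"
  and f: "!!x. (!!i. norm (x i) <= r i) ==> ((%j. e j*mpow x (a j)) has_sum f x) UNIV"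
 shows "wn r M f"
proof -
 define A where "A = (%ga. {j. a j = ga})"
 have pos: "mpow r ga > 0" for ga using mpow_pos[of r] r by blast
 have sm: "(%j. norm (e j)) summable_on A ga" for ga
 proof -
  have "(%j. norm (e j)*mpow r (a j)) summable_on A ga" using summable_on_subset_banach[OF has_sum_imp_summable[OF S(1)]] by blast
  moreover have "(%j. norm (e j)*mpow r (a j)) summable_on A ga \<longleftrightarrow> (%j. norm (e j)*mpow r ga) summable_on A ga"
   by (rule summable_on_cong) (auto simp: A_def)
  ultimately have "(%j. norm (e j)*mpow r ga) summable_on A ga" by simp
  then have "(%j. (norm (e j)*mpow r ga)*inverse (mpow r ga)) summable_on A ga" by (rule summable_on_cmult_left)
  then show ?thesis using pos[of ga] by (simp add: mult.assoc)
 qed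
 have es: "e summable_on A ga" for ga using abs_summable_summable[OF sm] .
 define c where "c = (%ga. infsum e (A ga))"
 define N where "N = (%ga. infsum (%j. norm (e j)) (A ga))"
 have hs: "((%ga. N ga*mpow r ga) has_sum S) UNIV"
 proof (rule has_sum_fibers[OF S(1)])
  fix ga
  have "((%j. norm (e j)*mpow r ga) has_sum N ga*mpow r ga) (A ga)"
   unfolding N_def by (intro has_sum_cmult_left has_sum_infsum sm)
  moreover have "((%j. norm (e j)*mpow r (a j)) has_sum N ga*mpow r ga) (A ga) \<longleftrightarrow>
    ((%j. norm (e j)*mpow r ga) has_sum N ga*mpow r ga) (A ga)" by (rule has_sum_cong) (auto simp: A_def)
  ultimately show "((%j. norm (e j)*mpow r (a j)) has_sum N ga*mpow r ga) {j. a j = ga}" by (simp add: A_def)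
 qed
 have cN: "norm (c ga)*mpow r ga <= N ga*mpow r ga" for ga
  unfolding c_def N_def by (rule mult_right_mono[OF norm_infsum_bound[OF sm]]) (use pos[of ga] in simp)
 have csum: "(%ga. norm (c ga)*mpow r ga) summable_on UNIV"
 proof (rule summable_on_comparison_test[OF has_sum_imp_summable[OF hs]])
  show "norm (c ga)*mpow r ga <= N ga*mpow r ga" for ga by (rule cN)
  show "0 <= norm (c ga)*mpow r ga" for ga using pos[of ga] by simp
 qed
 show ?thesis
 proof (rule wnI)
  show "((%ga. norm (c ga)*mpow r ga) has_sum infsum (%ga. norm (c ga)*mpow r ga) UNIV) UNIV"
   by (rule has_sum_infsum[OF csum])
  show "infsum (%ga. norm (c ga)*mpow r ga) UNIV <= M"
   using has_sum_mono[OF has_sum_infsum[OF csum] hs cN] S(2) by simp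
  fix x :: "'i => 'k" assume x: "!!i. norm (x i) <= r i"
  show "((%ga. c ga*mpow x ga) has_sum f x) UNIV"
  proof (rule has_sum_fibers[OF f[OF x]])
   fix ga
   have "((%j. e j*mpow x ga) has_sum c ga*mpow x ga) (A ga)"
    unfolding c_def by (intro has_sum_cmult_left has_sum_infsum es)
   moreover have "((%j. e j*mpow x (a j)) has_sum c ga*mpow x ga) (A ga) \<longleftrightarrow>
     ((%j. e j*mpow x ga) has_sum c ga*mpow x ga) (A ga)" by (rule has_sum_cong) (auto simp: A_def)
   ultimately show "((%j. e j*mpow x (a j)) has_sum c ga*mpow x ga) {j. a j = ga}" by (simp add: A_def)
  qed
 qed
qed

section \<open>The algebra of weighted power series\<close>

lemma wn_summable:
 assumes "((%al. norm (c al)*mpow r al) has_sum S) UNIV" "!!i. norm (x i :: 'k::{real_normed_field,banach}) <= r i"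
 shows "(%al. norm (c al*mpow x al)) summable_on UNIV"
proof (rule summable_on_comparison_test[OF has_sum_imp_summable[OF assms(1)]])
 show "norm (c al*mpow x al) <= norm (c al)*mpow r al" for al
  unfolding norm_mult by (rule mult_left_mono[OF norm_mpow_le]) (use assms(2) in auto)
qed auto

lemma wn_bound:
 assumes "wn r M f" "!!i. norm (x i) <= r i"
 shows "norm (f x) <= M"
proof -
 obtain c S where c: "S <= M" "((%al. norm (c al)*mpow r al) has_sum S) UNIV"
  "ALL x. (ALL i. norm (x i) <= r i) --> ((%al. c al*mpow x al) has_sum f x) UNIV"
  by (rule wnE[OF assms(1)])
 note sm = wn_summable[OF c(2) assms(2)]
 have "norm (f x) <= infsum (%al. norm (c al*mpow x al)) UNIV"
  by (rule norm_has_sum_bound[OF has_sum_infsum[OF sm] c(3)[rule_format, OF assms(2)]])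
 also have "... <= S"
 proof (rule has_sum_mono[OF has_sum_infsum[OF sm] c(2)])
  show "norm (c al*mpow x al) <= norm (c al)*mpow r al" for al
   unfolding norm_mult by (rule mult_left_mono[OF norm_mpow_le]) (use assms(2) in auto)
 qed
 finally show ?thesis using c(1) by simp
qed

lemma wn_nonneg:
 assumes "wn r M f" "!!i. 0 <= r i" shows "0 <= M"
proof -
 have "norm (f (%_. 0)) <= M" by (rule wn_bound[OF assms(1)]) (simp add: assms(2))
 then show ?thesis using norm_ge_zero order_trans by blast
qed

lemma wn_monomial:
 fixes e :: "'k::{real_normed_field,banach}"
 assumes "!!i. 0 < r i"
 shows "wn r (norm e*mpow r al) (%x. e*mpow x al)"
 by (rule wn_reindex[of r "%_::unit. e" "%_. al", OF assms]) (auto intro!: has_sum_finiteI)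

lemma wn_const: "(!!i. 0 < r i) ==> wn r (norm e) (%x. e)" using wn_monomial[of r e "%_. 0"] by simp

lemma wn_coord: "(!!i. 0 < r i) ==> wn r (r i) (%x. x i)"
 using wn_monomial[of r 1 "%j. if j = i then 1 else 0"] by (simp add: mpow_unit)

text \<open>The double series over pairs of an index and an exponent is absolutely summable, with
  norm at most the sum of the \<open>M j\<close>, so it may be collected by exponents.\<close>

lemma wn_infsum:
 fixes f :: "'j => ('i::finite => 'k) => 'k::{real_normed_field,banach}"
 assumes r: "!!i. 0 < r i" and f: "!!j. wn r (M j) (f j)" and M: "(M has_sum T) UNIV" "T <= B"
  and g: "!!x. (!!i. norm (x i) <= r i) ==> ((%j. f j x) has_sum g x) UNIV"
 shows "wn r B g"
proof -
 have "ALL j. EX c S. S <= M j & ((%al. norm (c al)*mpow r al) has_sum S) UNIV &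
   (ALL x. (ALL i. norm (x i) <= r i) --> ((%al. c al*mpow x al) has_sum f j x) UNIV)"
  using f unfolding wn_def by blast
 then obtain c S where c: "!!j. S j <= M j" "!!j. ((%al. norm (c j al)*mpow r al) has_sum S j) UNIV"
  "!!j x. (!!i. norm (x i) <= r i) ==> ((%al. c j al*mpow x al) has_sum f j x) UNIV"
  unfolding choice_iff by blast
 have pos: "mpow r ga > 0" for ga using mpow_pos[of r] r by blast
 have S0: "0 <= S j" for j by (rule has_sum_nonneg[OF c(2)]) (use pos less_imp_le in \<open>auto intro!: mult_nonneg_nonneg\<close>)
 have Ssum: "S summable_on UNIV" by (rule summable_on_comparison_test[OF has_sum_imp_summable[OF M(1)]]) (use c(1) S0 in auto)
 have sm: "(%(j, al). norm (c j al)*mpow r al) summable_on (SIGMA j:UNIV. UNIV)"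
  by (rule summable_on_SigmaI[where g=S]) (use c(2) Ssum pos less_imp_le in \<open>auto intro!: mult_nonneg_nonneg\<close>)
 have hs: "((%(j, al). norm (c j al)*mpow r al) has_sum infsum S UNIV) (SIGMA j:UNIV. UNIV)"
  by (rule has_sum_SigmaI[OF _ has_sum_infsum[OF Ssum] sm]) (use c(2) in auto)
 have TB: "infsum S UNIV <= B" using has_sum_mono[OF has_sum_infsum[OF Ssum] M(1)] c(1) M(2) by auto
 show ?thesis
 proof (rule wn_reindex[of r "%(j, al). c j al" snd "infsum S UNIV"])
  show "((%jal. norm (case jal of (j, al) => c j al)*mpow r (snd jal)) has_sum infsum S UNIV) UNIV"
   using hs by (simp add: case_prod_unfold)
  fix x :: "'i => 'k" assume x: "!!i. norm (x i) <= r i"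
  have "(%jal. norm (c (fst jal) (snd jal)*mpow x (snd jal))) summable_on UNIV"
  proof (rule summable_on_comparison_test)
   show "(%jal. norm (c (fst jal) (snd jal))*mpow r (snd jal)) summable_on UNIV"
    using sm by (simp add: case_prod_unfold)
   show "norm (c (fst jal) (snd jal)*mpow x (snd jal)) <= norm (c (fst jal) (snd jal))*mpow r (snd jal)" for jal
    unfolding norm_mult by (rule mult_left_mono[OF norm_mpow_le]) (use x in auto)
  qed auto
  from abs_summable_summable[OF this]
  have "(%jal. c (fst jal) (snd jal)*mpow x (snd jal)) summable_on (SIGMA j:UNIV. UNIV)" by simp
  then have "((%jal. c (fst jal) (snd jal)*mpow x (snd jal)) has_sum g x) (SIGMA j:UNIV. UNIV)"
   by (intro has_sum_SigmaI[OF _ g[OF x]]) (use c(3) x in auto)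
  then show "((%jal. (case jal of (j, al) => c j al)*mpow x (snd jal)) has_sum g x) UNIV"
   by (simp add: case_prod_unfold)
 qed (use r TB in auto)
qed

lemma wn_mult_monomial:
 assumes r: "!!i. 0 < r i" and f: "wn r M f"
 shows "wn r (norm e*mpow r be*M) (%x. e*mpow x be*f x)"
proof -
 obtain c S where c: "S <= M" "((%al. norm (c al)*mpow r al) has_sum S) UNIV"
  "ALL x. (ALL i. norm (x i) <= r i) --> ((%al. c al*mpow x al) has_sum f x) UNIV"
  by (rule wnE[OF f])
 have pos: "0 <= norm e*mpow r be" using mpow_nonneg[of r be] r less_imp_le by (intro mult_nonneg_nonneg) auto
 show ?thesis
 proof (rule wn_reindex[of r "%al. e*c al" "%al i. be i + al i" "(norm e*mpow r be)*S", OF r])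
  have "((%al. (norm e*mpow r be)*(norm (c al)*mpow r al)) has_sum (norm e*mpow r be)*S) UNIV"
   by (rule has_sum_cmult_right[OF c(2)])
  then show "((%al. norm (e*c al)*mpow r (%i. be i + al i)) has_sum (norm e*mpow r be)*S) UNIV"
   by (simp add: mpow_add norm_mult algebra_simps)
  show "norm e*mpow r be*S <= norm e*mpow r be*M" by (rule mult_left_mono[OF c(1) pos])
  fix x :: "'a => 'b" assume x: "!!i. norm (x i) <= r i"
  have "((%al. (e*mpow x be)*(c al*mpow x al)) has_sum (e*mpow x be)*f x) UNIV"
   by (rule has_sum_cmult_right[OF c(3)[rule_format, OF x]])
  then show "((%al. e*c al*mpow x (%i. be i + al i)) has_sum e*mpow x be*f x) UNIV"
   by (simp add: mpow_add algebra_simps)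
 qed
qed

lemma wn_cmult: "(!!i. 0 < r i) ==> wn r M f ==> wn r (norm e*M) (%x. e*f x)"
 using wn_mult_monomial[of r M f e "%_. 0"] by simp

text \<open>Only \<open>f\<close> is expanded: the product is the sum of the monomials of
  \<open>f\<close> times \<open>g\<close>.\<close>

lemma wn_mult:
 assumes r: "!!i. 0 < r i" and f: "wn r M f" and g: "wn r N g"
 shows "wn r (M*N) (%x. f x*g x)"
proof -
 obtain c S where c: "S <= M" "((%al. norm (c al)*mpow r al) has_sum S) UNIV"
  "ALL x. (ALL i. norm (x i) <= r i) --> ((%al. c al*mpow x al) has_sum f x) UNIV"
  by (rule wnE[OF f])
 have N: "0 <= N" using wn_nonneg[OF g] r less_imp_le by blast
 show ?thesis
 proof (rule wn_infsum[OF r])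
  show "wn r (norm (c al)*mpow r al*N) (%x. c al*mpow x al*g x)" for al
   by (rule wn_mult_monomial[OF r g])
  show "((%al. norm (c al)*mpow r al*N) has_sum S*N) UNIV" by (rule has_sum_cmult_left[OF c(2)])
  show "S*N <= M*N" by (rule mult_right_mono[OF c(1) N])
  show "((%al. c al*mpow x al*g x) has_sum f x*g x) UNIV" if "!!i. norm (x i) <= r i" for x
   by (rule has_sum_cmult_left[OF c(3)[rule_format, OF that]])
 qed
qed

text \<open>The two summands form a series indexed by \<open>bool\<close>, to which
  \<open>wn_infsum\<close> applies.\<close>

lemma wn_add:
 assumes r: "!!i. 0 < r i" and f: "wn r M f" and g: "wn r N g"
 shows "wn r (M + N) (%x. f x + g x)"
proof (rule wn_infsum[where M="%b. if b then M else N" and f="%b. if b then f else g", OF r])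
 show "wn r (if b then M else N) (if b then f else g)" for b using f g by simp
 show "((%b. if b then M else N) has_sum M + N) UNIV" by (rule has_sum_finiteI) (auto simp: UNIV_bool)
 show "((%b. (if b then f else g) x) has_sum f x + g x) UNIV" for x by (rule has_sum_finiteI) (auto simp: UNIV_bool)
qed simp

lemma wn_diff:
 assumes r: "!!i. 0 < r i" and f: "wn r M f" and g: "wn r N g"
 shows "wn r (M + N) (%x. f x - g x)" using wn_add[OF r f wn_cmult[where e="-1", OF r g]] by simp

lemma wn_sum:
 assumes r: "!!i. 0 < r i" and f: "!!a. a:A ==> wn r (M a) (f a)"
 shows "wn r (SUM a:A. M a) (%x. SUM a:A. f a x)" using f
proof (induction A rule: infinite_finite_induct)
 case (insert a A)
 then have "wn r (M a + (SUM a:A. M a)) (%x. f a x + (SUM a:A. f a x))" by (intro wn_add[OF r]) auto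
 then show ?case using insert.hyps by simp
qed (use wn_const[where e=0, OF r] in auto)

lemma wn_power:
 assumes r: "!!i. 0 < r i" and f: "wn r M f"
 shows "wn r (M^n) (%x. f x^n)"
proof (induction n)
 case 0
 show ?case using wn_const[where e=1, OF r] by simp
next
 case (Suc n)
 show ?case using wn_mult[OF r f Suc] by simp
qed

lemma wn_prod:
 assumes r: "!!i. 0 < r i" and f: "!!a. a:A ==> wn r (M a) (f a)"
 shows "wn r (PROD a:A. M a) (%x. PROD a:A. f a x)" using f
proof (induction A rule: infinite_finite_induct)
 case (insert a A)
 then have "wn r (M a*(PROD a:A. M a)) (%x. f a x*(PROD a:A. f a x))" by (intro wn_mult[OF r]) auto
 then show ?case using insert.hyps by simp
qed (use wn_const[where e=1, OF r] in auto)

lemma wn_mpow: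
 fixes h :: "'j::finite => ('i::finite => 'k::{real_normed_field,banach}) => 'k"
 assumes r: "!!i. 0 < r i" and h: "!!j. wn r (H j) (h j)"
 shows "wn r (mpow H al) (%x. mpow (%j. h j x) al)" unfolding mpow_def by (intro wn_prod[OF r] wn_power[OF r] h)

text \<open>Each monomial of \<open>g\<close> turns into a product of the \<open>h j\<close> whose
  norm is at most the weight of the monomial at the radii \<open>R\<close>, so the norm of
  \<open>g\<close> bounds the composition.\<close>

lemma wn_compose:
 fixes g :: "('j::finite => 'k::{real_normed_field,banach}) => 'k" and h :: "'j => ('i::finite => 'k) => 'k"
 assumes r: "!!i. 0 < r i" and g: "wn R M g" and h: "!!j. wn r (H j) (h j)" and H: "!!j. H j <= R j"
 shows "wn r M (%x. g (%j. h j x))"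
proof -
 obtain c S where c: "S <= M" "((%al. norm (c al)*mpow R al) has_sum S) UNIV"
  "ALL x. (ALL i. norm (x i) <= R i) --> ((%al. c al*mpow x al) has_sum g x) UNIV"
  by (rule wnE[OF g])
 have H0: "0 <= H j" for j using wn_nonneg[OF h] r less_imp_le by blast
 show ?thesis
 proof (rule wn_infsum[OF r _ c(2,1)])
  show "wn r (norm (c al)*mpow R al) (%x. c al*mpow (%j. h j x) al)" for al
   by (rule wn_mono[OF wn_cmult[OF r wn_mpow[OF r h]]])
    (intro mult_left_mono mpow_mono H0 H norm_ge_zero)
  show "((%al. c al*mpow (%j. h j x) al) has_sum g (%j. h j x)) UNIV" if "!!i. norm (x i) <= r i" for x
   by (rule c(3)[rule_format]) (rule order_trans[OF wn_bound[OF h that] H])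
 qed
qed

lemma wn_restrict:
 assumes "!!i. 0 < r i" "!!i. r i <= R i" "wn R M f"
 shows "wn r M f" using wn_compose[OF assms(1,3) wn_coord[OF assms(1)] assms(2)] .

text \<open>Without a constant term each monomial carries at least one factor
  \<open>s\<close>.\<close>

lemma wn_shrink:
 assumes ro: "0 < ro" and f: "wn (%_. ro) M f" "f (%_. 0) = 0" and s: "0 < s" "s <= 1"
 shows "wn (%_. s * ro) (s * M) f"
proof -
 obtain c S where c: "S <= M" "((%al. norm (c al)*mpow (%_. ro) al) has_sum S) UNIV"
  "ALL x. (ALL i. norm (x i) <= ro) --> ((%al. c al*mpow x al) has_sum f x) UNIV"
  by (rule wnE[OF f(1)])
 have z: "mpow (%_. 0::'b) al = 0" if "al ~= (%_. 0)" for al :: "'a => nat"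
 proof -
  from that obtain i where "al i ~= 0" by auto
  then show ?thesis unfolding mpow_def by (intro prod_zero[of UNIV]) (auto intro!: exI[of _ i] bexI[of _ i])
 qed
 have "((%al. c al*mpow (%_. 0) al) has_sum 0) UNIV" using c(3)[rule_format, of "%_. 0"] f(2) ro by simp
 moreover have "((%al. c al*mpow (%_. 0) al) has_sum c (%_. 0)) UNIV"
  by (rule has_sum_finite_neutralI[of "{%_. 0}"]) (auto simp: z)
 ultimately have c0: "c (%_. 0) = 0" using has_sum_unique by blast
 have le: "norm (c al)*mpow (%_. s * ro) al <= s * (norm (c al)*mpow (%_. ro) al)" for al
 proof (cases "al = (%_. 0)")
  case False
  then obtain i where "al i ~= 0" by auto
  then have "(SUM i:UNIV. al i) ~= 0" by auto
  then obtain k where k: "(SUM i:UNIV. al i) = Suc k" using not0_implies_Suc by blast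
  have "s^Suc k <= s" using s power_le_one[of s k] mult_left_mono[of "s^k" 1 s] by simp
  moreover have "mpow (%_. s * ro) al = s^Suc k*mpow (%_. ro) al"
   using mpow_scale[of s "%_. ro" al] by (simp add: k)
  moreover have "0 <= norm (c al)*mpow (%_. ro) al" using mpow_nonneg[of "%_. ro" al] ro by (intro mult_nonneg_nonneg) auto
  ultimately show ?thesis using mult_right_mono[of "s^Suc k" s "norm (c al)*mpow (%_. ro) al"]
   by (simp add: algebra_simps)
 qed (simp add: c0)
 have sr: "s * ro <= ro" using s ro by simp
 have hs: "((%al. s * (norm (c al)*mpow (%_. ro) al)) has_sum s * S) UNIV"
  by (rule has_sum_cmult_right[OF c(2)])
 have sm: "(%al. norm (c al)*mpow (%_. s * ro) al) summable_on UNIV"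
 proof (rule summable_on_comparison_test[OF has_sum_imp_summable[OF hs]])
  show "0 <= norm (c al)*mpow (%_. s * ro) al" for al :: "'a => nat"
   using mpow_nonneg[of "%_. s * ro" al] ro s by (intro mult_nonneg_nonneg) auto
 qed (rule le)
 have "infsum (%al. norm (c al)*mpow (%_. s * ro) al) UNIV <= s * S"
  by (rule has_sum_mono[OF has_sum_infsum[OF sm] hs]) (rule le)
 also have "... <= s * M" by (rule mult_left_mono[OF c(1)]) (use s in simp)
 finally show ?thesis by (rule wnI[OF _ has_sum_infsum[OF sm]]) (rule c(3)[rule_format], meson order_trans sr)
qed

lemma wn_shrink_to:
 assumes "0 < ro" "wn (%_. ro) M f" "f (%_. 0) = 0" "0 < e"
 shows "EX d>0. d <= ro & (ALL d'>0. d' <= d --> wn (%_. d') e f)"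
proof -
 have M: "0 <= M" using wn_nonneg[OF assms(2)] assms(1) by simp
 define s where "s = min 1 (e/(M + 1))"
 have s: "0 < s" "s <= 1" using assms(4) M by (auto simp: s_def)
 have "s * M <= e/(M + 1)*(M + 1)" by (rule mult_mono) (use M assms(4) in \<open>auto simp: s_def\<close>)
 also have "... = e" using M by simp
 finally have w: "wn (%_. s * ro) e f" using wn_mono[OF wn_shrink[OF assms(1-3) s]] by blast
 have "wn (%_. d') e f" if "d' > 0" "d' <= s * ro" for d' by (rule wn_restrict[OF _ _ w]) (use that in auto)
 then show ?thesis using s assms(1) by (intro exI[of _ "s * ro"]) auto
qed

text \<open>\<open>D\<close> is the distance of \<open>u\<close> and \<open>v\<close> in units of
  their common bound \<open>H\<close>, which keeps the powers of \<open>H\<close> homogeneous in the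
  telescoping.\<close>

lemma wn_power_diff:
 assumes r: "!!i. 0 < r i" and u: "wn r H u" and v: "wn r H v" and d: "wn r (H*D) (%x. v x - u x)"
 shows "wn r (real n*H^n*D) (%x. v x^n - u x^n)"
proof (induction n)
 case 0
 show ?case using wn_const[where e=0, OF r] by simp
next
 case (Suc n)
 have "wn r (H*(real n*H^n*D) + (H*D)*H^n) (%x. v x*(v x^n - u x^n) + (v x - u x)*u x^n)"
  by (intro wn_add wn_mult r v Suc d wn_power u)
 then show ?case by (simp add: algebra_simps)
qed

lemma wn_prod_diff:
 assumes r: "!!i. 0 < r i" and u: "!!j. wn r H (u j)" and v: "!!j. wn r H (v j)"
  and d: "!!j. wn r (H*D) (%x. v j x - u j x)" and A: "finite A"
 shows "wn r (real (SUM j:A. al j)*H^(SUM j:A. al j)*D) (%x. (PROD j:A. v j x^al j) - (PROD j:A. u j x^al j))"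
 using A
proof (induction A rule: finite_induct)
 case empty
 show ?case using wn_const[where e=0, OF r] by simp
next
 case (insert j A)
 have up: "wn r (H^(SUM j:A. al j)) (%x. PROD j:A. u j x^al j)"
  unfolding power_sum by (intro wn_prod[OF r] wn_power[OF r] u)
 have "wn r (H^al j*(real (SUM j:A. al j)*H^(SUM j:A. al j)*D) + (real (al j)*H^al j*D)*H^(SUM j:A. al j))
   (%x. v j x^al j*((PROD j:A. v j x^al j) - (PROD j:A. u j x^al j)) + (v j x^al j - u j x^al j)*(PROD j:A. u j x^al j))"
  by (intro wn_add wn_mult r insert.IH wn_power v up wn_power_diff[OF r u v d])
 then show ?case using insert.hyps by (simp add: algebra_simps power_add)
qed

text \<open>On arguments of norm R/2 a monomial of degree n changes by at most n (R/2)^n D with D =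
  2 de/R, and n <= 2^n makes this at most R^n D. Halving the radius pays for the derivative.\<close>

lemma wn_lipschitz:
 fixes g :: "('j::finite => 'k::{real_normed_field,banach}) => 'k" and u v :: "'j => ('i::finite => 'k) => 'k"
 assumes r: "!!i. 0 < r i" and R: "0 < R" and g: "wn (%_. R) M g"
  and u: "!!j. wn r (R/2) (u j)" and v: "!!j. wn r (R/2) (v j)" and d: "!!j. wn r de (%x. v j x - u j x)"
 shows "wn r (M*(2*de/R)) (%x. g (%j. v j x) - g (%j. u j x))"
proof -
 obtain c S where c: "S <= M" "((%al. norm (c al)*mpow (%_. R) al) has_sum S) UNIV"
  "ALL x. (ALL i. norm (x i) <= R) --> ((%al. c al*mpow x al) has_sum g x) UNIV"
  by (rule wnE[OF g])
 define D where "D = 2*de/R"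
 have de: "0 <= de" using wn_nonneg[OF d] r less_imp_le by blast
 then have D: "0 <= D" using R by (simp add: D_def)
 have d': "wn r (R/2*D) (%x. v j x - u j x)" for j using d[of j] R by (simp add: D_def)
 have mR: "mpow (%_. R) al = R^(SUM j:UNIV. al j)" for al :: "'j => nat" by (simp add: mpow_def power_sum)
 show ?thesis unfolding D_def[symmetric]
 proof (rule wn_infsum[OF r])
  fix al :: "'j => nat"
  define n where "n = (SUM j:UNIV. al j)"
  have "real n <= 2^n" by (simp add: of_nat_less_two_power less_imp_le)
  then have "real n*(R/2)^n <= 2^n*(R/2)^n" using R by (intro mult_right_mono) auto
  also have "... = R^n" by (simp add: power_mult_distrib[symmetric])
  finally have le: "real n*(R/2)^n*D <= R^n*D" by (rule mult_right_mono[OF _ D])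
  have "wn r (real n*(R/2)^n*D) (%x. mpow (%j. v j x) al - mpow (%j. u j x) al)"
   unfolding n_def mpow_def by (rule wn_prod_diff[OF r u v d']) simp
  from wn_cmult[OF r wn_mono[OF this le], of "c al"]
  show "wn r (norm (c al)*mpow (%_. R) al*D) (%x. c al*mpow (%j. v j x) al - c al*mpow (%j. u j x) al)"
   by (simp add: mR n_def right_diff_distrib mult.assoc)
  show "((%al. norm (c al)*mpow (%_. R) al*D) has_sum S*D) UNIV" by (rule has_sum_cmult_left[OF c(2)])
  show "S*D <= M*D" by (rule mult_right_mono[OF c(1) D])
  fix x :: "'i => 'k" assume x: "!!i. norm (x i) <= r i"
  have b: "norm (u j x) <= R" "norm (v j x) <= R" for j using wn_bound[OF u x, of j] wn_bound[OF v x, of j] R by auto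
  have "((%al. c al*mpow (%j. v j x) al + - (c al*mpow (%j. u j x) al)) has_sum g (%j. v j x) + - g (%j. u j x)) UNIV"
   by (intro has_sum_add has_sum_uminusI c(3)[rule_format] b)
  then show "((%al. c al*mpow (%j. v j x) al - c al*mpow (%j. u j x) al) has_sum g (%j. v j x) - g (%j. u j x)) UNIV"
   by simp
 qed
qed

lemma mpow_option: "mpow (case_option ta x) be = ta^be None*mpow x (%i. be (Some i))"
proof -
 have "(PROD j:UNIV. (case_option ta x j)^be j) = ta^be None*(PROD j:range Some. (case_option ta x j)^be j)"
  unfolding UNIV_option_conv by (subst prod.insert) auto
 also have "(PROD j:range Some. (case_option ta x j)^be j) = mpow x (%i. be (Some i))"
  unfolding mpow_def by (subst prod.reindex) (auto simp: o_def)
 finally show ?thesis by (simp add: mpow_def)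
qed

lemma option_split: "(r :: _ option => 'x) = case_option (r None) (%i. r (Some i))" by (rule ext) (simp split: option.split)

text \<open>\<open>F1\<close> collects the terms of degree 1 in the variable \<open>None\<close>;
  those of higher degree in it leave the quadratic error. In this way the derivative in one
  direction is isolated, again as a power series.\<close>

lemma wn_extract:
 fixes F :: "('i::finite option => 'k::{real_normed_field,banach}) => 'k"
 assumes r: "!!i. 0 < r i" and F: "wn r M F"
 shows "EX F1. wn (%i. r (Some i)) (M/r None) F1 & (ALL x ta. (ALL i. norm (x i) <= r (Some i)) --> norm ta <= r None -->
  norm (F (case_option ta x) - F (case_option 0 x) - ta*F1 x) <= M*(norm ta/r None)^2)"
proof -
 obtain c S where c: "S <= M" "((%al. norm (c al)*mpow r al) has_sum S) UNIV"
  "ALL x. (ALL i. norm (x i) <= r i) --> ((%al. c al*mpow x al) has_sum F x) UNIV"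
  by (rule wnE[OF F])
 define r0 where "r0 = r None"
 define r' where "r' = (%i. r (Some i))"
 have r0: "0 < r0" and r': "!!i. 0 < r' i" using r by (auto simp: r0_def r'_def)
 have mr: "mpow r be = r0^be None*mpow r' (%i. be (Some i))" for be
  unfolding r0_def r'_def by (subst option_split[of r], rule mpow_option)
 define e where "e = (%be::'i option => nat. if be None = 1 then c be else 0)"
 have pos: "0 <= mpow r' al" for al using mpow_nonneg[of r' al] r' less_imp_le by blast
 have pos': "0 <= mpow r al" for al using mpow_nonneg[of r al] r less_imp_le by blast
 have le: "norm (e be)*mpow r' (%i. be (Some i)) <= (norm (c be)*mpow r be)*(1/r0)" for be
  using r0 pos by (auto simp: e_def mr)
 have hs: "((%be. (norm (c be)*mpow r be)*(1/r0)) has_sum S*(1/r0)) UNIV" by (rule has_sum_cmult_left[OF c(2)])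
 have sm: "(%be. norm (e be)*mpow r' (%i. be (Some i))) summable_on UNIV"
 proof (rule summable_on_comparison_test[OF has_sum_imp_summable[OF hs]])
  show "0 <= norm (e be)*mpow r' (%i. be (Some i))" for be by (intro mult_nonneg_nonneg pos) simp
 qed (rule le)
 define F1 where "F1 = (%x. infsum (%be. e be*mpow x (%i. be (Some i))) UNIV)"
 have F1: "((%be. e be*mpow x (%i. be (Some i))) has_sum F1 x) UNIV" if x: "!!i. norm (x i) <= r' i" for x
  unfolding F1_def
 proof (rule has_sum_infsum[OF abs_summable_summable], rule summable_on_comparison_test[OF sm])
  show "norm (e be*mpow x (%i. be (Some i))) <= norm (e be)*mpow r' (%i. be (Some i))" for be
   unfolding norm_mult by (rule mult_left_mono[OF norm_mpow_le]) (use x in auto)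
 qed auto
 have "wn r' (M/r0) F1"
 proof (rule wn_reindex[OF r' has_sum_infsum[OF sm] _ F1])
  have "infsum (%be. norm (e be)*mpow r' (%i. be (Some i))) UNIV <= S*(1/r0)"
   by (rule has_sum_mono[OF has_sum_infsum[OF sm] hs]) (rule le)
  also have "... <= M*(1/r0)" by (rule mult_right_mono[OF c(1)]) (use r0 in simp)
  finally show "infsum (%be. norm (e be)*mpow r' (%i. be (Some i))) UNIV <= M/r0" by simp
 qed
 moreover have "norm (F (case_option ta x) - F (case_option 0 x) - ta*F1 x) <= M*(norm ta/r0)^2"
  if x: "!!i. norm (x i) <= r' i" and ta: "norm ta <= r0" for x ta
 proof -
  have b: "norm (case_option ta x i) <= r i" "norm (case_option 0 x i) <= r i" for i
   using x ta r0 by (auto simp: r0_def r'_def split: option.split)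
  define q where "q = (%be. c be*mpow (case_option ta x) be + - (c be*mpow (case_option 0 x) be) + - (ta*(e be*mpow x (%i. be (Some i)))))"
  have q: "(q has_sum F (case_option ta x) + - F (case_option 0 x) + - (ta*F1 x)) UNIV" unfolding q_def
   by (intro has_sum_add has_sum_uminusI has_sum_cmult_right c(3)[rule_format] b F1 x)
  have qle: "norm (q be) <= (norm (c be)*mpow r be)*(norm ta/r0)^2" for be
  proof -
   consider "be None = 0" | "be None = 1" | k where "be None = Suc (Suc k)" by (metis One_nat_def not0_implies_Suc)
   then show ?thesis
   proof cases
    case 3
    have "norm (q be) = norm (c be)*(norm ta^Suc (Suc k)*norm (mpow x (%i. be (Some i))))"
     using 3 by (simp add: q_def mpow_option e_def norm_mult norm_power)
    also have "... <= norm (c be)*(norm ta^Suc (Suc k)*mpow r' (%i. be (Some i)))"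
     by (intro mult_left_mono norm_mpow_le x) auto
    also have "... <= norm (c be)*((norm ta^2*r0^k)*mpow r' (%i. be (Some i)))"
    proof (intro mult_left_mono mult_right_mono pos)
     have "norm ta^k <= r0^k" by (rule power_mono[OF ta]) simp
     then have "norm ta^2*norm ta^k <= norm ta^2*r0^k" by (rule mult_left_mono) simp
     then show "norm ta^Suc (Suc k) <= norm ta^2*r0^k" by (simp add: power2_eq_square mult.assoc)
    qed simp
    also have "... = (norm (c be)*mpow r be)*(norm ta/r0)^2" using 3 r0 by (simp add: mr field_simps power2_eq_square)
    finally show ?thesis .
   qed (use pos' in \<open>auto simp: q_def mpow_option e_def algebra_simps\<close>)
  qed
  have hq: "((%be. (norm (c be)*mpow r be)*(norm ta/r0)^2) has_sum S*(norm ta/r0)^2) UNIV"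
   by (rule has_sum_cmult_left[OF c(2)])
  have sq: "(%be. norm (q be)) summable_on UNIV"
   by (rule summable_on_comparison_test[OF has_sum_imp_summable[OF hq]]) (use qle in auto)
  have "norm (F (case_option ta x) + - F (case_option 0 x) + - (ta*F1 x)) <= infsum (%be. norm (q be)) UNIV"
   by (rule norm_has_sum_bound[OF has_sum_infsum[OF sq] q])
  also have "... <= S*(norm ta/r0)^2" by (rule has_sum_mono[OF has_sum_infsum[OF sq] hq]) (rule qle)
  also have "... <= M*(norm ta/r0)^2" by (rule mult_right_mono[OF c(1)]) simp
  finally show ?thesis by simp
 qed
 ultimately show ?thesis unfolding r0_def r'_def by blast
qed

text \<open>Terms of degree at least 2 scale like (s/ro)^2; the exponents of degree 0 and 1 form the
  set \<open>B\<close> of the proof.\<close>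

lemma wn_first_order:
 fixes f :: "('i::finite => 'k::{real_normed_field,banach}) => 'k"
 assumes ro: "0 < ro" and f: "wn (%_. ro) M f"
 shows "EX p. ALL x s. (ALL i. norm (x i) <= s) --> s <= ro -->
  norm (f x - f (%_. 0) - (SUM i:UNIV. p i*x i)) <= M*(s/ro)^2"
proof -
 obtain c S where c: "S <= M" "((%al. norm (c al)*mpow (%_. ro) al) has_sum S) UNIV"
  "ALL x. (ALL i. norm (x i) <= ro) --> ((%al. c al*mpow x al) has_sum f x) UNIV"
  by (rule wnE[OF f])
 define e where "e = (%i j :: 'i. if j = i then 1 else 0 :: nat)"
 have inje: "inj e"
 proof (rule injI)
  fix i k assume "e i = e k"
  from fun_cong[OF this, of i] show "i = k" by (simp add: e_def split: if_splits)
 qed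
 define B where "B = insert (%_. 0) (range e)"
 have e0: "(%_. 0) ~: range e"
 proof
  assume "(%_. 0):range e"
  then obtain i where "(%_. 0) = e i" by auto
  from fun_cong[OF this, of i] show False by (simp add: e_def)
 qed
 have low: "al:B" if "(SUM i:UNIV. al i) < 2" for al
 proof (cases "al = (%_. 0)")
  case False
  then obtain i where i: "al i ~= 0" by auto
  have s: "(SUM i:UNIV. al i) = al i + (SUM j:UNIV - {i}. al j)" by (simp add: sum.remove)
  have a: "al i = 1" "(SUM j:UNIV - {i}. al j) = 0" using i that s by linarith+
  then have "al j = 0" if "j ~= i" for j using that by (simp add: sum_eq_0_iff)
  then have "al = e i" using a by (auto simp: e_def fun_eq_iff)
  then show ?thesis by (simp add: B_def)
 qed (simp add: B_def)
 define p where "p = (%i. c (e i))"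
 have ev: "((%al. if al:B then c al*mpow x al else 0) has_sum c (%_. 0) + (SUM i:UNIV. p i*x i)) UNIV" for x
 proof (rule has_sum_finite_neutralI[of B])
  show "c (%_. 0) + (SUM i:UNIV. p i*x i) = (SUM al:B. if al:B then c al*mpow x al else 0)"
  proof -
   have "(SUM al:B. if al:B then c al*mpow x al else 0) = (SUM al:B. c al*mpow x al)" by (rule sum.cong) auto
   also have "... = c (%_. 0) + (SUM al:range e. c al*mpow x al)" unfolding B_def using e0 by (subst sum.insert) auto
   also have "(SUM al:range e. c al*mpow x al) = (SUM i:UNIV. p i*x i)"
    by (subst sum.reindex[OF inje]) (simp add: p_def e_def mpow_unit)
   finally show ?thesis by simp
  qed
 qed (auto simp: B_def)
 have "((%al. c al*mpow (%_. 0) al) has_sum c (%_. 0)) UNIV"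
 proof (rule has_sum_finite_neutralI[of "{%_. 0}"])
  fix al :: "'i => nat" assume "al:UNIV - {%_. 0}"
  then obtain i where "al i ~= 0" by auto
  then have "mpow (%_. 0::'k) al = 0" unfolding mpow_def by (intro prod_zero[of UNIV]) (auto intro!: bexI[of _ i])
  then show "c al*mpow (%_. 0) al = 0" by simp
 qed auto
 moreover have "((%al. c al*mpow (%_. 0) al) has_sum f (%_. 0)) UNIV"
  by (rule c(3)[rule_format]) (use ro in simp)
 ultimately have c0: "c (%_. 0) = f (%_. 0)" using has_sum_unique by blast
 have "norm (f x - f (%_. 0) - (SUM i:UNIV. p i*x i)) <= M*(s/ro)^2"
  if x: "!!i. norm (x i) <= s" and s: "s <= ro" for x s
 proof -
  have s0: "0 <= s" using x[of undefined] norm_ge_zero order_trans by blast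
  define q where "q = (%al. c al*mpow x al + - (if al:B then c al*mpow x al else 0))"
  have q: "(q has_sum f x + - (c (%_. 0) + (SUM i:UNIV. p i*x i))) UNIV" unfolding q_def
   by (intro has_sum_add has_sum_uminusI c(3)[rule_format] ev) (use x s order_trans in blast)
  have qle: "norm (q al) <= (norm (c al)*mpow (%_. ro) al)*(s/ro)^2" for al
  proof (cases "al:B")
   case True
   then show ?thesis using mpow_nonneg[of "%_. ro" al] ro by (auto simp: q_def)
  next
   case False
   define n where "n = (SUM i:UNIV. al i)"
   have "2 <= n" using low[of al] False not_less unfolding n_def by blast
   then have k: "n = (n - 2) + 2" by simp
   define k where "k = n - 2"
   note k = k[folded k_def]
   have m: "mpow (%_. y) al = y^n" for y :: real by (simp add: mpow_def n_def power_sum)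
   have "norm (q al) = norm (c al)*norm (mpow x al)" using False by (simp add: q_def norm_mult)
   also have "... <= norm (c al)*(s^k * s^2)"
    using norm_mpow_le[of x "%_. s" al] x by (intro mult_left_mono) (auto simp: m k power_add power2_eq_square algebra_simps)
   also have "... <= norm (c al)*(ro^k * s^2)" by (intro mult_left_mono mult_right_mono power_mono) (use s s0 in auto)
   also have "... = (norm (c al)*mpow (%_. ro) al)*(s/ro)^2"
    using ro by (simp add: m k power_add power_divide power2_eq_square)
   finally show ?thesis .
  qed
  have hq: "((%al. (norm (c al)*mpow (%_. ro) al)*(s/ro)^2) has_sum S*(s/ro)^2) UNIV"
   by (rule has_sum_cmult_left[OF c(2)])
  have sq: "(%al. norm (q al)) summable_on UNIV"
   by (rule summable_on_comparison_test[OF has_sum_imp_summable[OF hq]]) (use qle in auto)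
  have "norm (f x + - (c (%_. 0) + (SUM i:UNIV. p i*x i))) <= infsum (%al. norm (q al)) UNIV"
   by (rule norm_has_sum_bound[OF has_sum_infsum[OF sq] q])
  also have "... <= S*(s/ro)^2" by (rule has_sum_mono[OF has_sum_infsum[OF sq] hq]) (rule qle)
  also have "... <= M*(s/ro)^2" by (rule mult_right_mono[OF c(1)]) simp
  finally show ?thesis by (simp add: c0 algebra_simps)
 qed
 then show ?thesis by blast
qed

lemma wn_continuous:
 assumes f: "wn r M f" and ga: "!!i. continuous_on T (%t. ga t i)" and b: "!!t i. t:T ==> norm (ga t i) <= r i"
 shows "continuous_on T (%t. f (ga t))"
proof -
 obtain c S where c: "S <= M" "((%al. norm (c al)*mpow r al) has_sum S) UNIV"
  "ALL x. (ALL i. norm (x i) <= r i) --> ((%al. c al*mpow x al) has_sum f x) UNIV"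
  by (rule wnE[OF f])
 have "uniform_limit T (%X t. SUM al:X. c al*mpow (ga t) al) (%t. f (ga t)) (finite_subsets_at_top UNIV)"
 proof (rule Weierstrass_m_test_general'[OF _ _ has_sum_imp_summable[OF c(2)]])
  show "norm (c al*mpow (ga t) al) <= norm (c al)*mpow r al" if "t:T" for al t
   unfolding norm_mult by (rule mult_left_mono[OF norm_mpow_le]) (use b that in auto)
  show "((%al. c al*mpow (ga t) al) has_sum f (ga t)) UNIV" if "t:T" for t
   by (rule c(3)[rule_format]) (rule b[OF that])
 qed
 moreover have "continuous_on T (%t. SUM al:X. c al*mpow (ga t) al)" for X
  unfolding mpow_def by (intro continuous_intros ga)
 ultimately show ?thesis by (intro uniform_limit_theorem[OF always_eventually]) auto
qed

text \<open>The summable bounds \<open>B\<close> give uniform convergence, hence integration term by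
  term.\<close>

lemma has_sum_integral:
 fixes g :: "'j => real => 'k::banach"
 assumes c: "!!j. continuous_on {a..b} (g j)" and B: "!!j s. s:{a..b} ==> norm (g j s) <= B j"
  and s: "B summable_on UNIV" and G: "!!s. s:{a..b} ==> ((%j. g j s) has_sum G s) UNIV"
 shows "continuous_on {a..b} G" "((%j. integral {a..b} (g j)) has_sum integral {a..b} G) UNIV"
proof -
 have u: "uniform_limit {a..b} (%X s. SUM j:X. g j s) G (finite_subsets_at_top UNIV)"
  by (rule Weierstrass_m_test_general'[OF _ G s]) (rule B)
 show "continuous_on {a..b} G" by (rule uniform_limit_theorem[OF always_eventually u]) (auto intro!: continuous_intros c)
 obtain I J where IJ: "!!X. ((%s. SUM j:X. g j s) has_integral I X) {a..b}" "(G has_integral J) {a..b}"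
  "(I \<longlongrightarrow> J) (finite_subsets_at_top UNIV)" using uniform_limit_integral[OF u] by (auto intro!: continuous_intros c)
 have "I X = (SUM j:X. integral {a..b} (g j))" if "finite X" for X
  using integral_unique[OF IJ(1)[of X]] integral_sum[OF that, of g "{a..b}"] integrable_continuous_interval[OF c] by simp
 then have "((%X. SUM j:X. integral {a..b} (g j)) \<longlongrightarrow> J) (finite_subsets_at_top UNIV)"
  using IJ(3) by (subst tendsto_cong[OF eventually_finite_subsets_at_top_weakI, of _ _ I]) auto
 then show "((%j. integral {a..b} (g j)) has_sum integral {a..b} G) UNIV" by (simp add: has_sum_def integral_unique[OF IJ(2)])
qed

text \<open>h is given by a convergent power series in the displacements d z, restricted to D; for families, d also
  records the displacement in time.\<close>
definition locan :: "'p set => ('p => 'j::finite => 'k::{real_normed_field,banach}) => ('p => 'k) => bool" where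
 "locan D d h \<longleftrightarrow> (EX ro>0. EX M F. wn (%_. ro) M F & (ALL z:D. (ALL j. norm (d z j) <= ro) --> h z = F (d z)))"

section \<open>Germs given by power series\<close>

lemma locanI:
 "0 < ro ==> wn (%_. ro) M F ==> (!!z. z:D ==> (!!j. norm (d z j) <= ro) ==> h z = F (d z)) ==> locan D d h"
 unfolding locan_def by blast

lemma locanE:
 assumes "locan D d h"
 obtains ro M F where "0 < ro" "wn (%_. ro) M F" "ALL z:D. (ALL j. norm (d z j) <= ro) --> h z = F (d z)"
 using assms unfolding locan_def by blast

lemma locan_common:
 fixes h :: "'n::finite => 'p => 'k::{real_normed_field,banach}"
 assumes "!!i. locan D d (h i)"
 obtains ro M F where "0 < ro" "ALL i. wn (%_. ro) (M i) (F i)"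
  "ALL i. ALL z:D. (ALL j. norm (d z j) <= ro) --> h i z = F i (d z)"
proof -
 have "ALL i. EX ro M F. 0 < ro & wn (%_. ro) M F & (ALL z:D. (ALL j. norm (d z j) <= ro) --> h i z = F (d z))"
  using assms unfolding locan_def by blast
 then obtain r M F where r: "!!i. 0 < r i" "!!i. wn (%_. r i) (M i) (F i)"
  "!!i. ALL z:D. (ALL j. norm (d z j) <= r i) --> h i z = F i (d z)" unfolding choice_iff by blast
 define ro where "ro = Min (range r)"
 have ro: "0 < ro" "ro <= r i" for i using r(1) by (auto simp: ro_def)
 show thesis
 proof (rule that[OF ro(1)]; intro allI ballI impI)
  show "wn (%_. ro) (M i) (F i)" for i by (rule wn_restrict[OF _ _ r(2)]) (use ro in auto)
  fix i z assume z: "z:D" "ALL j. norm (d z j) <= ro"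
  have "norm (d z j) <= r i" for j by (rule order_trans[OF z(2)[rule_format] ro(2)])
  then show "h i z = F i (d z)" using r(3)[rule_format, OF z(1)] by simp
 qed
qed

lemma locan_cong: "locan D d h ==> (!!z. z:D ==> h z = g z) ==> locan D d g"
 unfolding locan_def by fastforce

lemma locan_const: "locan D d (%_. c)" by (rule locanI[of 1 "norm c" "%_. c"]) (auto intro: wn_const)

lemma locan_disp: "locan D d (%z. d z j)" by (rule locanI[of 1 1 "%x. x j"]) (use wn_coord[of "%_. 1"] in auto)

lemma locan_add:
 assumes "locan D d f" "locan D d g"
 shows "locan D d (%z. f z + g z)"
proof -
 have "locan D d (if b then f else g)" for b using assms by simp
 then obtain ro M F where F: "0 < ro" "ALL b. wn (%_. ro) (M b) (F b)"
  "ALL b. ALL z:D. (ALL j. norm (d z j) <= ro) --> (if b then f else g) z = F b (d z)" by (rule locan_common)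
 show ?thesis
 proof (rule locanI[OF F(1)])
  show "wn (%_. ro) (M True + M False) (%x. F True x + F False x)" by (rule wn_add[OF F(1) F(2)[rule_format] F(2)[rule_format]])
  show "f z + g z = F True (d z) + F False (d z)" if "z:D" "!!j. norm (d z j) <= ro" for z
   using F(3)[rule_format, of z True] F(3)[rule_format, of z False] that by simp
 qed
qed

lemma locan_mult:
 assumes "locan D d f" "locan D d g"
 shows "locan D d (%z. f z*g z)"
proof -
 have "locan D d (if b then f else g)" for b using assms by simp
 then obtain ro M F where F: "0 < ro" "ALL b. wn (%_. ro) (M b) (F b)"
  "ALL b. ALL z:D. (ALL j. norm (d z j) <= ro) --> (if b then f else g) z = F b (d z)" by (rule locan_common)
 show ?thesis
 proof (rule locanI[OF F(1)])
  show "wn (%_. ro) (M True*M False) (%x. F True x*F False x)" by (rule wn_mult[OF F(1) F(2)[rule_format] F(2)[rule_format]])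
  show "f z*g z = F True (d z)*F False (d z)" if "z:D" "!!j. norm (d z j) <= ro" for z
   using F(3)[rule_format, of z True] F(3)[rule_format, of z False] that by simp
 qed
qed

definition disp :: "'k^'n => 'k^'n => 'n::finite => 'k::{real_normed_field,banach}" where
 "disp a x i = x$i - a$i"

text \<open>Subtracting the value at the centre removes the constant term, so shrinking the polydisc
  brings the inner functions below any radius \<open>R\<close> (\<open>wn_shrink_to\<close>), and
  substitution becomes possible.\<close>

lemma locan_compose_wn:
 fixes h :: "'n::finite => 'p => 'k::{real_normed_field,banach}"
 assumes R: "0 < R" and K: "wn (%_. R) M K" and h: "!!i. locan D d (h i)" and z0: "z0:D" "!!j. d z0 j = 0"
 shows "locan D d (%z. K (%i. h i z - h i z0))"
  and "EX ro>0. ALL z:D. (ALL j. norm (d z j) <= ro) --> (ALL i. norm (h i z - h i z0) <= R)"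
proof -
 obtain ro N F where F: "0 < ro" "ALL i. wn (%_. ro) (N i) (F i)"
  "ALL i. ALL z:D. (ALL j. norm (d z j) <= ro) --> h i z = F i (d z)" by (rule locan_common[OF h])
 define G where "G = (%i x. F i x - h i z0)"
 have dz0: "d z0 = (%_. 0)" using z0(2) by auto
 have G0: "G i (%_. 0) = 0" for i using F(3)[rule_format, OF z0(1), of i] F(1) by (simp add: G_def dz0)
 have W: "wn (%_. ro) (N i + norm (h i z0)) (G i)" for i unfolding G_def by (rule wn_diff[OF F(1) F(2)[rule_format] wn_const[OF F(1)]])
 have "EX e. 0 < e & e <= ro & (ALL d'>0. d' <= e --> wn (%_. d') R (G i))" for i
  using wn_shrink_to[OF F(1) W[of i] G0[of i] R] by blast
 then have "ALL i. EX e. 0 < e & e <= ro & (ALL d'>0. d' <= e --> wn (%_. d') R (G i))" by blast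
 then obtain e where e: "!!i. 0 < e i" "!!i. e i <= ro" "!!i d'. 0 < d' ==> d' <= e i ==> wn (%_. d') R (G i)"
  unfolding choice_iff by blast
 define de where "de = Min (range e)"
 have de: "0 < de" "de <= e i" for i using e(1) by (auto simp: de_def)
 have wG: "wn (%_. de) R (G i)" for i by (rule e(3)[OF de])
 have hG: "h i z - h i z0 = G i (d z)" if "z:D" "ALL j. norm (d z j) <= de" for i z
 proof -
  have "norm (d z j) <= ro" for j by (rule order_trans[OF that(2)[rule_format] order_trans[OF de(2) e(2)]])
  then show ?thesis using F(3)[rule_format, OF that(1), of i] by (simp add: G_def)
 qed
 show "locan D d (%z. K (%i. h i z - h i z0))"
 proof (rule locanI[OF de(1)])
  show "wn (%_. de) M (%x. K (%i. G i x))" by (rule wn_compose[OF de(1) K wG]) simp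
  show "K (%i. h i z - h i z0) = K (%i. G i (d z))" if "z:D" "!!j. norm (d z j) <= de" for z using hG that by simp
 qed
 show "EX ro>0. ALL z:D. (ALL j. norm (d z j) <= ro) --> (ALL i. norm (h i z - h i z0) <= R)"
 proof (intro exI conjI ballI impI allI)
  show "0 < de" by (rule de(1))
  show "norm (h i z - h i z0) <= R" if "z:D" "ALL j. norm (d z j) <= de" for z i
   unfolding hG[OF that] by (rule wn_bound[OF wG]) (use that(2) in blast)
 qed
qed

lemma locan_local:
 assumes "locan D d f" "0 < ro" "!!z. z:D ==> ALL j. norm (d z j) <= ro ==> f z = g z"
 shows "locan D d g"
proof -
 obtain r M F where F: "0 < r" "wn (%_. r) M F" "ALL z:D. (ALL j. norm (d z j) <= r) --> f z = F (d z)"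
  by (rule locanE[OF assms(1)])
 show ?thesis
 proof (rule locanI[of "min r ro"])
  show "wn (%_. min r ro) M F" by (rule wn_restrict[OF _ _ F(2)]) (use F(1) assms(2) in auto)
  show "g z = F (d z)" if "z:D" "!!j. norm (d z j) <= min r ro" for z
  proof -
   have "norm (d z j) <= r" "norm (d z j) <= ro" for j using that(2)[of j] by auto
   then show ?thesis using F(3)[rule_format, OF that(1)] assms(3)[OF that(1)] by simp
  qed
 qed (use F(1) assms(2) in auto)
qed

lemma locan_compose:
 fixes u :: "'p => 'k::{real_normed_field,banach}^'n::finite"
 assumes k: "locan UNIV (disp (u z0)) k" and u: "!!i. locan D d (%z. u z$i)" and z0: "z0:D" "!!j. d z0 j = 0"
 shows "locan D d (%z. k (u z))"
proof -
 obtain R M K where K: "0 < R" "wn (%_. R) M K" "ALL y:UNIV. (ALL j. norm (disp (u z0) y j) <= R) --> k y = K (disp (u z0) y)"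
  by (rule locanE[OF k])
 note c = locan_compose_wn[where h="%i z. u z$i", OF K(1,2) u z0]
 obtain ro where ro: "0 < ro" "ALL z:D. (ALL j. norm (d z j) <= ro) --> (ALL i. norm (u z$i - u z0$i) <= R)"
  using c(2) by (elim exE conjE)
 show ?thesis
 proof (rule locan_local[OF c(1) ro(1)])
  fix z assume z: "z:D" "ALL j. norm (d z j) <= ro"
  have "disp (u z0) (u z) = (%i. u z$i - u z0$i)" by (simp add: disp_def fun_eq_iff)
  moreover have "norm (disp (u z0) (u z) j) <= R" for j using ro(2) z by (simp add: disp_def)
  ultimately show "K (%i. u z$i - u z0$i) = k (u z)" using K(3)[rule_format, of "u z"] by simp
 qed
qed

text \<open>The geometric series in - x/a on the disc of radius |a|/2, where its ratio is at most
  1/2. The single variable is indexed by \<open>unit\<close>.\<close>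

lemma wn_inverse:
 fixes a :: "'k::{real_normed_field,banach}"
 assumes a: "a ~= 0"
 shows "wn (%_::unit. norm a/2) (2/norm a) (%x. inverse (a + x ()))"
proof (rule wn_infsum[where M="%k. inverse (norm a)*(1/2)^k" and f="%k x. inverse a*(- inverse a*x ())^k" and T="inverse (norm a)*2"])
 have pos: "0 < norm a/2" using a by simp
 have c: "wn (%_::unit. norm a/2) (norm a/2) (%x. x () :: 'k)"
  using wn_coord[where i="()" and r="%_. norm a/2", OF pos] .
 have h: "norm (- inverse a)*(norm a/2) = 1/2" using a by (simp add: norm_inverse)
 show "wn (%_::unit. norm a/2) (inverse (norm a)*(1/2)^k) (%x. inverse a*(- inverse a*x ())^k)" for k
  using wn_cmult[where e="inverse a", OF pos wn_power[where n=k, OF pos wn_cmult[where e="- inverse a", OF pos c]]] unfolding h norm_inverse .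
 show "0 < norm a/2" by (rule pos)
 show "inverse (norm a)*2 <= 2/norm a" by (simp add: divide_inverse)
 show "((%k. inverse (norm a)*(1/2)^k) has_sum inverse (norm a)*2) UNIV"
  by (intro has_sum_cmult_right norm_summable_imp_has_sum) (use geometric_sums[of "1/2 :: real"] in \<open>auto simp: norm_power\<close>)
 fix x :: "unit => 'k" assume x: "!!i. norm (x i) <= norm a/2"
 define q where "q = - inverse a*x ()"
 have "norm q = norm (inverse a)*norm (x ())" by (simp only: q_def norm_mult norm_minus_cancel)
 also have "... <= norm (inverse a)*(norm a/2)" by (rule mult_left_mono[OF x]) simp
 finally have "norm q <= norm (inverse a)*(norm a/2)" .
 then have q: "norm q <= 1/2" using a by (simp add: norm_inverse)
 then have q1: "norm q < 1" by simp
 have "((%k. q^k) has_sum 1/(1 - q)) UNIV"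
  by (rule norm_summable_imp_has_sum[OF _ geometric_sums[OF q1]]) (use q1 in \<open>simp add: norm_power\<close>)
 from has_sum_cmult_right[OF this, of "inverse a"]
 have "((%k. inverse a*q^k) has_sum inverse a*(1/(1 - q))) UNIV" .
 moreover have "inverse a*(1/(1 - q)) = inverse (a + x ())"
 proof -
  have "a*(1 - q) = a + x ()" using a by (simp add: q_def algebra_simps)
  then show ?thesis by (simp add: divide_inverse flip: inverse_mult_distrib)
 qed
 ultimately show "((%k. inverse a*(- inverse a*x ())^k) has_sum inverse (a + x ())) UNIV" by (simp add: q_def)
qed

lemma locan_inverse:
 assumes h: "locan D d h" and z0: "z0:D" "!!j. d z0 j = 0" and nz: "h z0 ~= 0"
 shows "locan D d (%z. inverse (h z))" using locan_compose_wn(1)[OF _ wn_inverse[OF nz], of D d "%_. h" z0] h z0 nz by simp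

text \<open>In a general Banach space unconditional summability need not be absolute; here the
  isometric embedding into the complex numbers makes it so.\<close>

lemma abs_summable_ground_field:
 fixes f :: "'j => 'k::ground_field"
 assumes "(f has_sum s) A"
 shows "(%x. norm (f x)) summable_on A"
proof -
 have add: "Modules.additive (to_complex :: 'k => complex)" by (simp add: Modules.additive_def to_complex_add)
 have "dist (to_complex x) (to_complex y) = dist x y" for x y :: 'k
  using Modules.additive.diff[OF add, of x y] norm_to_complex[of "x - y"] by (simp add: dist_norm)
 then have "isCont (to_complex :: 'k => complex) s" unfolding continuous_at_eps_delta by auto
 then have "((to_complex \<circ> f) has_sum to_complex s) A" by (intro has_sum_comm_additive[OF add _ assms]) (simp add: isCont_def)
 then have "(to_complex \<circ> f) summable_on A" by (rule has_sum_imp_summable)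
 then show ?thesis unfolding summable_on_iff_abs_summable_on_complex by (simp add: norm_to_complex)
qed

lemma analytic_iff_locan:
 fixes f :: "'k::{ground_field,banach}^'n::finite => 'k"
 shows "analytic_fun_on S f \<longleftrightarrow> (ALL a:S. locan UNIV (disp a) f)" unfolding analytic_fun_on_def
proof (intro ball_cong refl iffI)
 fix a
 assume "EX r>0. EX c. ALL x:ball a r. ((%al. c al*(PROD i:UNIV. (x$i - a$i)^al i)) has_sum f x) UNIV"
 then obtain r c where r: "r > 0" and c: "!!x. x:ball a r ==> ((%al. c al*mpow (disp a x) al) has_sum f x) UNIV"
  unfolding mpow_def disp_def by blast
 define N where "N = real CARD('n)"
 have N: "N >= 1" by (simp add: N_def Suc_le_eq)
 \<comment> \<open>The closed polydisc of this radius lies in \<open>ball a r\<close>.\<close>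
 define ro where "ro = r/(2*N)"
 have ro: "0 < ro" "N*ro < r" using r N by (auto simp: ro_def)
 have inb: "x:ball a r" if "!!i. norm (disp a x i) <= ro" for x
 proof -
  have "norm (x - a) <= (SUM i:UNIV. norm ((x - a)$i))" by (rule norm_vec_le_sum)
  also have "... <= (SUM i:(UNIV::'n set). ro)" by (rule sum_mono) (use that in \<open>simp add: disp_def\<close>)
  also have "... < r" using ro(2) by (simp add: N_def)
  finally show ?thesis by (simp add: dist_norm norm_minus_commute)
 qed
 \<comment> \<open>All displacements of this point equal the real number \<open>ro\<close>, so
   absolute summability there is finiteness of the weighted norm.\<close>
 define y where "y = (\<chi> i. a$i + of_real ro)"
 have dy: "disp a y = (%i. of_real ro)" by (simp add: y_def disp_def fun_eq_iff)
 have "((%al. c al*mpow (%i. of_real ro) al) has_sum f y) UNIV"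
  using c[OF inb, of y] ro(1) by (simp add: dy)
 from abs_summable_ground_field[OF this]
 have sm: "(%al. norm (c al)*mpow (%_. ro) al) summable_on UNIV"
  using ro(1) by (simp add: norm_mult norm_mpow)
 show "locan UNIV (disp a) f"
 proof (rule locanI[OF ro(1)])
  show "wn (%_. ro) (infsum (%al. norm (c al)*mpow (%_. ro) al) UNIV) (%x. f (\<chi> i. a$i + x i))"
  proof (rule wnI[OF order_refl has_sum_infsum[OF sm]])
   fix x :: "'n => 'k" assume x: "!!i. norm (x i) <= ro"
   have "disp a (\<chi> i. a$i + x i) = x" by (simp add: disp_def fun_eq_iff)
   then show "((%al. c al*mpow x al) has_sum f (\<chi> i. a$i + x i)) UNIV"
    using c[OF inb, of "\<chi> i. a$i + x i"] x by simp
  qed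
 qed (simp add: disp_def)
next
 fix a assume "locan UNIV (disp a) f"
 then obtain ro M F where F: "0 < ro" "wn (%_. ro) M F" "ALL x:UNIV. (ALL j. norm (disp a x j) <= ro) --> f x = F (disp a x)"
  by (rule locanE)
 obtain c S where c: "S <= M" "((%al. norm (c al)*mpow (%_. ro) al) has_sum S) UNIV"
  "ALL x. (ALL i. norm (x i) <= ro) --> ((%al. c al*mpow x al) has_sum F x) UNIV"
  by (rule wnE[OF F(2)])
 have "((%al. c al*(PROD i:UNIV. (x$i - a$i)^al i)) has_sum f x) UNIV" if x: "x:ball a ro" for x
 proof -
  have "norm (disp a x i) <= ro" for i
   using x Finite_Cartesian_Product.norm_nth_le[of "x - a" i] by (simp add: disp_def dist_norm norm_minus_commute)
  then have "((%al. c al*mpow (disp a x) al) has_sum f x) UNIV" using F(3) c(3) by simp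
  then show ?thesis by (simp add: mpow_def disp_def)
 qed
 then show "EX r>0. EX c. ALL x:ball a r. ((%al. c al*(PROD i:UNIV. (x$i - a$i)^al i)) has_sum f x) UNIV"
  using F(1) by blast
qed

section \<open>Derivatives of functions given by power series\<close>

lemma disp_self [simp]: "disp a a j = 0" by (simp add: disp_def)

lemma locan_coord: "locan UNIV (disp a) (%x. x$i)"
proof (rule locan_cong)
 show "locan UNIV (disp a) (%x. a$i + disp a x i)" by (intro locan_add locan_const locan_disp)
qed (simp add: disp_def)

lemma bounded_linear_coords: "bounded_linear (%h::'k::real_normed_field^'n::finite. SUM i:UNIV. p i*h$i)"
 by (intro bounded_linear_sum bounded_linear_compose[OF bounded_linear_mult_right bounded_linear_vec_nth])

lemma locan_has_derivative:
 fixes f :: "'k::{real_normed_field,banach}^'n::finite => 'k"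
 assumes "locan UNIV (disp a) f"
 shows "(f has_derivative (%h. SUM i:UNIV. pd i f a*h$i)) (at a)"
proof -
 obtain ro M F where F: "0 < ro" "wn (%_. ro) M F" "ALL x:UNIV. (ALL j. norm (disp a x j) <= ro) --> f x = F (disp a x)"
  by (rule locanE[OF assms])
 obtain p where p: "!!x s. (ALL i. norm (x i) <= s) ==> s <= ro ==>
  norm (F x - F (%_. 0) - (SUM i:UNIV. p i*x i)) <= M*(s/ro)^2" using wn_first_order[OF F(1,2)] by blast
 have "(f has_derivative (%h. SUM i:UNIV. p i*h$i)) (at a)"
 proof (rule has_derivativeI_sandwich[where e=ro and H="%y. M/ro^2*norm (y - a)"])
  have "((%y. M/ro^2*norm (y - a)) \<longlongrightarrow> M/ro^2*norm (a - a)) (at a)" by (intro tendsto_intros)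
  then show "((%y. M/ro^2*norm (y - a)) \<longlongrightarrow> 0) (at a)" by simp
  fix y assume y: "y ~= a" "dist y a < ro"
  have n: "ALL i. norm (disp a y i) <= norm (y - a)" using Finite_Cartesian_Product.norm_nth_le[of "y - a"] by (simp add: disp_def)
  have le: "norm (y - a) <= ro" using y(2) by (simp add: dist_norm)
  have "f y = F (disp a y)" using F(3) n le order_trans by blast
  moreover have "f a = F (%_. 0)" using F(3)[rule_format, of a] F(1) by (simp add: disp_def[abs_def])
  ultimately have "norm (f y - f a - (SUM i:UNIV. p i*(y - a)$i)) <= M*(norm (y - a)/ro)^2"
   using p[of "disp a y", OF n le] by (simp add: disp_def)
  then have "norm (f y - f a - (SUM i:UNIV. p i*(y - a)$i))/norm (y - a) <= M*(norm (y - a)/ro)^2/norm (y - a)"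
   by (rule divide_right_mono) simp
  also have "... = M/ro^2*norm (y - a)" using y(1) by (simp add: power2_eq_square)
  finally show "norm (f y - f a - (SUM i:UNIV. p i*(y - a)$i))/norm (y - a) <= M/ro^2*norm (y - a)" .
 qed (use F(1) bounded_linear_coords in auto)
 moreover from this have "pd i f a = p i" for i by (rule pd_eqI)
 ultimately show ?thesis by simp
qed

text \<open>Re-expansion about \<open>b\<close> is substitution of the translation by
  \<open>disp a b\<close>, possible on half of the radius.\<close>

lemma locan_recentre:
 fixes f :: "'k::{real_normed_field,banach}^'n::finite => 'k"
 assumes "locan UNIV (disp a) f"
 shows "EX e>0. ALL b. (ALL i. norm (disp a b i) <= e) --> locan UNIV (disp b) f"
proof -
 obtain ro M F where F: "0 < ro" "wn (%_. ro) M F" "ALL x:UNIV. (ALL j. norm (disp a x j) <= ro) --> f x = F (disp a x)"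
  by (rule locanE[OF assms])
 have "locan UNIV (disp b) f" if b: "ALL i. norm (disp a b i) <= ro/2" for b
 proof (rule locanI[of "ro/2"])
  show "wn (%_. ro/2) M (%x. F (%i. disp a b i + x i))"
  proof (rule wn_compose[OF _ F(2)])
   show "wn (%_. ro/2) (norm (disp a b i) + ro/2) (%x. disp a b i + x i)" for i
    using F(1) by (intro wn_add wn_const wn_coord) auto
   show "norm (disp a b i) + ro/2 <= ro" for i using b[rule_format, of i] by linarith
  qed (use F(1) in simp)
  fix x assume x: "!!i. norm (disp b x i) <= ro/2"
  have e: "disp a x i = disp a b i + disp b x i" for i by (simp add: disp_def)
  have "norm (disp a x i) <= ro" for i
   using norm_triangle_ineq[of "disp a b i" "disp b x i"] b[rule_format, of i] x[of i] unfolding e by linarith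
  then have "f x = F (disp a x)" using F(3) by blast
  also have "disp a x = (%i. disp a b i + disp b x i)" using e by auto
  finally show "f x = F (%i. disp a b i + disp b x i)" .
 qed (use F(1) in simp)
 then show ?thesis using F(1) by (intro exI[of _ "ro/2"]) auto
qed

text \<open>A displacement along axis \<open>i\<close> is added as an extra variable
  \<open>None\<close>; the coefficient of its first power is a power series in the old variables,
  and it is the derivative. This replaces termwise differentiation.\<close>

lemma locan_pd:
 fixes f :: "'k::{real_normed_field,banach}^'n::finite => 'k"
 assumes f: "locan UNIV (disp a) f"
 shows "locan UNIV (disp a) (pd i f)"
proof -
 obtain ro M F where F: "0 < ro" "wn (%_. ro) M F" "ALL x:UNIV. (ALL j. norm (disp a x j) <= ro) --> f x = F (disp a x)"
  by (rule locanE[OF f])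
 obtain e where e: "e > 0" "!!b. (ALL i. norm (disp a b i) <= e) ==> locan UNIV (disp b) f"
  using locan_recentre[OF f] by blast
 define s where "s = ro/2"
 have s: "0 < s" "s + s = ro" using F(1) by (auto simp: s_def)
 define F2 where "F2 = (%z :: 'n option => 'k. F (%j. z (Some j) + (if j = i then 1 else 0)*z None))"
 have cw: "wn (%_. s) s (%z :: 'n option => 'k. z j)" for j using wn_coord[of "%_. s" j] s(1) by simp
 have "wn (%_. s) M F2" unfolding F2_def
 proof (rule wn_compose[OF _ F(2)])
  show "wn (%_. s) (s + norm (if j = i then 1 else 0 :: 'k) * s) (%z :: 'n option => 'k. z (Some j) + (if j = i then 1 else 0)*z None)" for j
   by (intro wn_add wn_cmult cw s(1))
  show "s + norm (if j = i then 1 else 0 :: 'k) * s <= ro" for j using s by auto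
 qed (use s in simp)
 from wn_extract[OF _ this] s(1) obtain F1 where F1: "wn (%_. s) (M/s) F1"
  "!!x ta. (ALL i. norm (x i) <= s) ==> norm ta <= s ==>
   norm (F2 (case_option ta x) - F2 (case_option 0 x) - ta*F1 x) <= M*(norm ta/s)^2" by blast
 show ?thesis
 proof (rule locanI[of "min s e"])
  show "wn (%_. min s e) (M/s) F1" by (rule wn_restrict[OF _ _ F1(1)]) (use s e in auto)
  fix y assume y: "!!j. norm (disp a y j) <= min s e"
  define g where "g = (%ta::real. y + ta *\<^sub>R axis i (1::'k))"
  have dg: "disp a (g ta) = (%j. disp a y j + (if j = i then 1 else 0) * of_real ta)" for ta
  proof
   fix j
   have "(ta *\<^sub>R axis i (1::'k))$j = (if j = i then 1 else 0) * of_real ta" by (simp add: axis_def) (simp add: scaleR_conv_of_real)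
   then show "disp a (g ta) j = disp a y j + (if j = i then 1 else 0) * of_real ta" by (simp add: g_def disp_def)
  qed
  have fg: "f (g ta) = F2 (case_option (of_real ta) (disp a y))" if "\<bar>ta\<bar> <= s" for ta
  proof -
   have "norm (disp a (g ta) j) <= ro" for j
   proof -
    have "norm ((if j = i then 1 else 0) * of_real ta :: 'k) <= s" using that s(1) by auto
    then show ?thesis using norm_triangle_ineq[of "disp a y j" "(if j = i then 1 else 0) * of_real ta"] y[of j] s(2) unfolding dg by auto
   qed
   then show ?thesis using F(3) by (simp add: F2_def dg)
  qed
  have gd: "(g has_vector_derivative axis i 1) (at 0)" unfolding g_def by (auto intro!: derivative_eq_intros)
  have "locan UNIV (disp y) f" using e(2)[of y] y by simp
  from locan_has_derivative[OF this]
  have "((%ta. f (g ta)) has_derivative (%h. SUM j:UNIV. pd j f y*(h *\<^sub>R axis i (1::'k))$j)) (at 0)"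
   using has_derivative_compose[OF gd[unfolded has_vector_derivative_def], of f "%h. SUM j:UNIV. pd j f y*h$j"] by (simp add: g_def)
  moreover have "(SUM j:UNIV. pd j f y*(h *\<^sub>R axis i (1::'k))$j) = h *\<^sub>R pd i f y" for h
  proof -
   have "(SUM j:UNIV. pd j f y*(h *\<^sub>R axis i (1::'k))$j) = (SUM j:UNIV. if j = i then h *\<^sub>R pd j f y else 0)"
    by (rule sum.cong) (auto simp: axis_def)
   then show ?thesis by simp
  qed
  ultimately have d1: "((%ta. f (g ta)) has_vector_derivative pd i f y) (at 0)" by (simp add: has_vector_derivative_def)
  have d2: "((%ta. f (g ta)) has_vector_derivative F1 (disp a y)) (at 0)" unfolding has_vector_derivative_def
  proof (rule has_derivativeI_sandwich[where e=s and H="%ta. M/s^2*\<bar>ta\<bar>"])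
   have "((%ta. M/s^2*\<bar>ta\<bar>) \<longlongrightarrow> M/s^2*\<bar>0\<bar>) (at 0)" by (intro tendsto_intros)
   then show "((%ta. M/s^2*\<bar>ta\<bar>) \<longlongrightarrow> 0) (at 0)" by simp
   fix ta :: real assume ta: "ta ~= 0" "dist ta 0 < s"
   have "norm (f (g ta) - f (g 0) - of_real ta*F1 (disp a y)) <= M*(\<bar>ta\<bar>/s)^2"
    using F1(2)[of "disp a y" "of_real ta"] y ta s(1) by (simp add: fg dist_real_def)
   then have "norm (f (g ta) - f (g 0) - (ta - 0) *\<^sub>R F1 (disp a y))/norm (ta - 0) <= M*(\<bar>ta\<bar>/s)^2/\<bar>ta\<bar>"
    by (simp add: scaleR_conv_of_real divide_right_mono)
   also have "... = M/s^2*\<bar>ta\<bar>"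
   proof -
    have "M*(v/s)^2/v = M/s^2 * v" if "v ~= 0" for v :: real using that by (simp add: power2_eq_square)
    then show ?thesis using ta(1) by simp
   qed
   finally show "norm (f (g ta) - f (g 0) - (ta - 0) *\<^sub>R F1 (disp a y))/norm (ta - 0) <= M/s^2*\<bar>ta\<bar>" .
  qed (use s(1) bounded_linear_scaleR_left in auto)
  \<comment> \<open>Both are the derivative along the line \<open>g\<close>: one by the chain rule,
    the other by the quadratic error bound.\<close>
  show "pd i f y = F1 (disp a y)" by (rule vector_derivative_unique_at[OF d1 d2])
 qed (use s e in auto)
qed

section \<open>Families analytic in time and space\<close>

definition tdisp :: "real => 'k^'n => real \<times> ('k^'n) => 'n::finite option => 'k::{real_normed_field,banach}" where
 "tdisp t0 x0 z = case_option (of_real (fst z - t0)) (disp x0 (snd z))"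

text \<open>The variable \<open>None\<close> is the time displacement, embedded into the scalars by
  \<open>of_real\<close>. Restricting to times in [0, 1] lets the expansions about the end points be
  one-sided.\<close>

definition analytic_family_on :: "('k::{real_normed_field,banach}^'n::finite) set => (real => 'k^'n => 'k) => bool" where
 "analytic_family_on V h \<longleftrightarrow> (ALL t0:{0..1}. ALL x0:V. locan ({0..1} \<times> UNIV) (tdisp t0 x0) (%z. h (fst z) (snd z)))"

lemma tdisp_self [simp]: "tdisp t x (t, x) j = 0" by (cases j) (auto simp: tdisp_def)

lemma analytic_family_slice:
 assumes h: "locan ({0..1} \<times> UNIV) (tdisp t0 x0) (%z. h (fst z) (snd z))" and t0: "t0:{0..1}"
 shows "locan UNIV (disp x0) (h t0)"
proof -
 obtain ro M F where F: "0 < ro" "wn (%_. ro) M F"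
  "ALL z:{0..1} \<times> UNIV. (ALL j. norm (tdisp t0 x0 z j) <= ro) --> h (fst z) (snd z) = F (tdisp t0 x0 z)"
  by (rule locanE[OF h])
 show ?thesis
 proof (rule locanI[OF F(1)])
  show "wn (%_. ro) M (%x. F (%j. case_option 0 x j))"
  proof (rule wn_compose[OF F(1) F(2)])
   show "wn (%_. ro) ro (%x. case_option 0 x j)" for j
    using wn_mono[OF wn_const[where e=0 and r="%_. ro", OF F(1)], of ro] wn_coord[where r="%_. ro", OF F(1)] F(1)
    by (cases j) auto
  qed simp
  fix x assume x: "!!j. norm (disp x0 x j) <= ro"
  have e: "tdisp t0 x0 (t0, x) = case_option 0 (disp x0 x)" by (simp add: tdisp_def)
  have "norm (tdisp t0 x0 (t0, x) j) <= ro" for j unfolding e using x F(1) by (cases j) auto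
  then show "h t0 x = F (%j. case_option 0 (disp x0 x) j)" using F(3)[rule_format, of "(t0, x)"] t0 by (simp add: e)
 qed
qed

lemma analytic_family_near:
 assumes F: "0 < ro" and x: "x:ball x0 ro" and t: "\<bar>t - t0\<bar> <= ro"
 shows "norm (tdisp t0 x0 (t, x) j) <= ro"
proof (cases j)
 case None
 then show ?thesis using t by (simp add: tdisp_def flip: of_real_diff)
next
 case (Some i)
 then show ?thesis using x Finite_Cartesian_Product.norm_nth_le[of "x - x0" i] by (simp add: tdisp_def disp_def dist_norm norm_minus_commute)
qed

lemma analytic_family_continuous:
 assumes V: "open V" and h: "analytic_family_on V h"
 shows "continuous_on ({0..1} \<times> V) (%(t, x). h t x)" unfolding continuous_on_eq_continuous_within
proof
 fix z :: "real \<times> ('a^'b)" assume z: "z:{0..1} \<times> V"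
 define t0 x0 where "t0 = fst z" and "x0 = snd z"
 have z': "t0:{0..1}" "x0:V" "z = (t0, x0)" using z by (auto simp: t0_def x0_def)
 then have "locan ({0..1} \<times> UNIV) (tdisp t0 x0) (%z. h (fst z) (snd z))" using h unfolding analytic_family_on_def by blast
 then obtain ro M F where F: "0 < ro" "wn (%_. ro) M F"
  "ALL z:{0..1} \<times> UNIV. (ALL j. norm (tdisp t0 x0 z j) <= ro) --> h (fst z) (snd z) = F (tdisp t0 x0 z)"
  by (rule locanE)
 define W where "W = ball t0 ro \<times> ball x0 ro"
 have W: "open W" "z:W" using F(1) z' by (auto simp: W_def open_Times)
 have n: "norm (tdisp t0 x0 y j) <= ro" if "y:W" for y j using analytic_family_near[OF F(1), of "snd y" x0 "fst y" t0 j] that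
  by (auto simp: W_def dist_real_def abs_minus_commute)
 have "continuous_on (({0..1} \<times> V) \<inter> W) (%y. F (tdisp t0 x0 y))"
 proof (rule wn_continuous[OF F(2)])
  show "continuous_on (({0..1} \<times> V) \<inter> W) (%y. tdisp t0 x0 y i)" for i
   by (cases i) (auto simp: tdisp_def disp_def intro!: continuous_intros)
 qed (use n in blast)
 then have "continuous_on (({0..1} \<times> V) \<inter> W) (%(t, x). h t x)"
 proof (rule continuous_on_eq)
  fix y assume y: "y:({0..1} \<times> V) \<inter> W"
  then have "h (fst y) (snd y) = F (tdisp t0 x0 y)" using F(3) n[of y] by blast
  then show "F (tdisp t0 x0 y) = (case y of (t, x) => h t x)" by (simp add: case_prod_beta)
 qed
 moreover have "z:({0..1} \<times> V) \<inter> W" using z W by blast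
 ultimately have "continuous (at z within ({0..1} \<times> V) \<inter> W) (%(t, x). h t x)"
  unfolding continuous_on_eq_continuous_within by blast
 moreover have "at z within ({0..1} \<times> V) \<inter> W = at z within {0..1} \<times> V" by (rule at_within_nhd[OF W(2,1)]) blast
 ultimately show "continuous (at z within {0..1} \<times> V) (%(t, x). h t x)" by simp
qed

lemma has_integral_power_01: "((%x::real. x^k) has_integral 1/real (Suc k)) {0..1}"
proof -
 have "((%x::real. x^Suc k/real (Suc k)) has_real_derivative x^k) (at x within {0..1})" for x
  by (rule derivative_eq_intros refl | simp)+
 then have "((%x::real. x^k) has_integral 1^Suc k/real (Suc k) - 0^Suc k/real (Suc k)) {0..1}"
  by (intro fundamental_theorem_of_calculus) (auto simp: has_real_derivative_iff_has_vector_derivative)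
 then show ?thesis by simp
qed

text \<open>The time variable is integrated term by term. The integral of (s - t0)^k has norm at
  most (b - a) ro^k, so the norm is multiplied by b - a at most.\<close>

lemma wn_local_integral:
 fixes F :: "('n::finite option => 'k::{real_normed_field,banach}) => 'k"
 assumes ro: "0 < ro" and F: "wn (%_. ro) M F" and ab: "a <= b" "!!s. s:{a..b} ==> \<bar>s - t0\<bar> <= ro"
 shows "EX G. wn (%_. ro) ((b - a)*M) G & (ALL x. (ALL i. norm (x i) <= ro) -->
  ((%s. F (case_option (of_real (s - t0)) x)) has_integral G x) {a..b})"
proof -
 obtain c S where c: "S <= M" "((%al. norm (c al)*mpow (%_. ro) al) has_sum S) UNIV"
  "ALL x. (ALL i. norm (x i) <= ro) --> ((%al. c al*mpow x al) has_sum F x) UNIV"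
  by (rule wnE[OF F])
 define I where "I = (%k. integral {a..b} (%s. of_real (s - t0)^k :: 'k))"
 define e where "e = (%be::'n option => nat. c be*I (be None))"
 have mr: "mpow (%_. ro) be = ro^be None*mpow (%_. ro) (%i. be (Some i))" for be :: "'n option => nat"
  by (subst option_split[of "%_. ro"], rule mpow_option)
 have In: "norm (I k) <= ro^k*(b - a)" for k unfolding I_def
 proof (rule integral_bound[OF ab(1)])
  show "continuous_on {a..b} (%s. of_real (s - t0)^k :: 'k)" by (intro continuous_intros)
  show "norm (of_real (s - t0)^k :: 'k) <= ro^k" if "s:{a..b}" for s
   using ab(2)[OF that] by (simp add: norm_power power_mono flip: of_real_diff)
 qed
 have le: "norm (e be)*mpow (%_. ro) (%i. be (Some i)) <= (b - a)*(norm (c be)*mpow (%_. ro) be)" for be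
 proof -
  have "norm (e be)*mpow (%_. ro) (%i. be (Some i)) <= (norm (c be)*(ro^be None*(b - a)))*mpow (%_. ro) (%i. be (Some i))"
   unfolding e_def norm_mult by (intro mult_right_mono mult_left_mono In mpow_nonneg) (use ro in auto)
  then show ?thesis by (simp add: mr algebra_simps)
 qed
 have hs: "((%be. (b - a)*(norm (c be)*mpow (%_. ro) be)) has_sum (b - a)*S) UNIV"
  by (rule has_sum_cmult_right[OF c(2)])
 have sm: "(%be. norm (e be)*mpow (%_. ro) (%i. be (Some i))) summable_on UNIV"
 proof (rule summable_on_comparison_test[OF has_sum_imp_summable[OF hs]])
  show "0 <= norm (e be)*mpow (%_. ro) (%i. be (Some i))" for be
   by (intro mult_nonneg_nonneg mpow_nonneg) (use ro in auto)
 qed (rule le)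
 define G where "G = (%x. integral {a..b} (%s. F (case_option (of_real (s - t0)) x)))"
 have main: "continuous_on {a..b} (%s. F (case_option (of_real (s - t0)) x))"
  "((%be. e be*mpow x (%i. be (Some i))) has_sum G x) UNIV" if x: "!!i. norm (x i) <= ro" for x
 proof -
  define g where "g = (%be s. c be*mpow (case_option (of_real (s - t0)) x) be)"
  have b: "norm (case_option (of_real (s - t0)) x j) <= ro" if "s:{a..b}" for s j
   using x ab(2)[OF that] by (cases j) (auto simp flip: of_real_diff)
  note hsi = has_sum_integral[where g=g and G="%s. F (case_option (of_real (s - t0)) x)" and a=a and b=b, OF _ _ has_sum_imp_summable[OF c(2)]]
  have 1: "continuous_on {a..b} (g be)" for be unfolding g_def mpow_option by (intro continuous_intros)
  have 2: "norm (g be s) <= norm (c be)*mpow (%_. ro) be" if "s:{a..b}" for be s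
   unfolding g_def norm_mult by (rule mult_left_mono[OF norm_mpow_le]) (use b[OF that] in auto)
  have 3: "((%be. g be s) has_sum F (case_option (of_real (s - t0)) x)) UNIV" if "s:{a..b}" for s
   unfolding g_def by (rule c(3)[rule_format]) (rule b[OF that])
  show "continuous_on {a..b} (%s. F (case_option (of_real (s - t0)) x))" by (rule hsi(1)[OF 1 2 3])
  have "integral {a..b} (g be) = e be*mpow x (%i. be (Some i))" for be
  proof -
   have "g be = (%s. (c be*mpow x (%i. be (Some i))) * of_real (s - t0)^be None)"
    by (auto simp: g_def mpow_option)
   then have "integral {a..b} (g be) = (c be*mpow x (%i. be (Some i)))*I (be None)" by (simp add: I_def)
   then show ?thesis by (simp add: e_def)
  qed
  then show "((%be. e be*mpow x (%i. be (Some i))) has_sum G x) UNIV" unfolding G_def using hsi(2)[OF 1 2 3] by simp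
 qed
 have "wn (%_. ro) ((b - a)*M) G"
 proof (rule wn_reindex[OF ro has_sum_infsum[OF sm]])
  have "infsum (%be. norm (e be)*mpow (%_. ro) (%i. be (Some i))) UNIV <= (b - a)*S"
   by (rule has_sum_mono[OF has_sum_infsum[OF sm] hs]) (rule le)
  also have "... <= (b - a)*M" by (rule mult_left_mono[OF c(1)]) (use ab(1) in simp)
  finally show "infsum (%be. norm (e be)*mpow (%_. ro) (%i. be (Some i))) UNIV <= (b - a)*M" .
 qed (rule main(2))
 moreover have "((%s. F (case_option (of_real (s - t0)) x)) has_integral G x) {a..b}" if "ALL i. norm (x i) <= ro" for x
  unfolding G_def using that by (intro integrable_integral integrable_continuous_interval main(1)) auto
 ultimately show ?thesis by blast
qed

text \<open>A single expansion in time covers a short interval. Bisection (\<open>Bolzano\<close>)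
  reduces the claim to short intervals and to gluing two adjacent ones, where the smaller of the two
  radii in \<open>x\<close> is kept.\<close>

lemma analytic_family_integral:
 assumes h: "analytic_family_on V h" and x0: "x0:V"
 shows "locan UNIV (disp x0) (%x. integral {0..1} (%t. h t x))"
proof -
 define P where "P = (%a b. a:{0..1} --> b:{0..1} --> (EX ro>0. EX M F. wn (%_. ro) M F &
  (ALL x. (ALL i. norm (disp x0 x i) <= ro) --> ((%t. h t x) has_integral F (disp x0 x)) {a..b})))"
 have "P 0 1"
 proof (rule Bolzano[of 0 1 P], goal_cases le trans local)
  case (trans a b c)
  show ?case unfolding P_def
  proof (intro impI)
   assume ac: "a:{0..1}" "c:{0..1}"
   then have b: "b:{0..1}" using trans by auto
   obtain ro1 M1 F1 where 1: "0 < ro1" "wn (%_. ro1) M1 F1"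
    "ALL x. (ALL i. norm (disp x0 x i) <= ro1) --> ((%t. h t x) has_integral F1 (disp x0 x)) {a..b}"
    using trans(1) ac b unfolding P_def by blast
   obtain ro2 M2 F2 where 2: "0 < ro2" "wn (%_. ro2) M2 F2"
    "ALL x. (ALL i. norm (disp x0 x i) <= ro2) --> ((%t. h t x) has_integral F2 (disp x0 x)) {b..c}"
    using trans(2) ac b unfolding P_def by blast
   define ro where "ro = min ro1 ro2"
   have ro: "0 < ro" "ro <= ro1" "ro <= ro2" using 1(1) 2(1) by (auto simp: ro_def)
   have "wn (%_. ro) (M1 + M2) (%x. F1 x + F2 x)"
    by (intro wn_add ro(1) wn_restrict[OF ro(1) ro(2) 1(2)] wn_restrict[OF ro(1) ro(3) 2(2)])
   moreover have "((%t. h t x) has_integral F1 (disp x0 x) + F2 (disp x0 x)) {a..c}" if x: "ALL i. norm (disp x0 x i) <= ro" for x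
   proof (rule has_integral_combine[OF trans(3,4)])
    show "((%t. h t x) has_integral F1 (disp x0 x)) {a..b}" using 1(3) x ro(2) order_trans by blast
    show "((%t. h t x) has_integral F2 (disp x0 x)) {b..c}" using 2(3) x ro(3) order_trans by blast
   qed
   ultimately show "EX ro>0. EX M F. wn (%_. ro) M F &
    (ALL x. (ALL i. norm (disp x0 x i) <= ro) --> ((%t. h t x) has_integral F (disp x0 x)) {a..c})"
    using ro(1) by (intro exI[of _ ro] exI[of _ "M1 + M2"] exI[of _ "%x. F1 x + F2 x"] conjI) auto
  qed
 next
  case (local t0)
  then have "locan ({0..1} \<times> UNIV) (tdisp t0 x0) (%z. h (fst z) (snd z))" using h x0 unfolding analytic_family_on_def by auto
  then obtain ro M F where F: "0 < ro" "wn (%_. ro) M F"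
   "ALL z:{0..1} \<times> UNIV. (ALL j. norm (tdisp t0 x0 z j) <= ro) --> h (fst z) (snd z) = F (tdisp t0 x0 z)"
   by (rule locanE)
  have "P a b" if ab: "a <= t0 & t0 <= b & b - a < ro" for a b unfolding P_def
  proof (intro impI)
   assume ab01: "a:{0..1}" "b:{0..1}"
   have s: "\<bar>s - t0\<bar> <= ro" if "s:{a..b}" for s using that ab by auto
   have "a <= b" using ab by simp
   from wn_local_integral[OF F(1,2) this s] obtain G where G: "wn (%_. ro) ((b - a)*M) G"
    "!!x. (ALL i. norm (x i) <= ro) ==> ((%s. F (case_option (of_real (s - t0)) x)) has_integral G x) {a..b}" by blast
   have "((%t. h t x) has_integral G (disp x0 x)) {a..b}" if x: "ALL i. norm (disp x0 x i) <= ro" for x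
   proof (rule has_integral_eq[OF _ G(2)[OF x]])
    fix t assume t: "t:{a..b}"
    have e: "tdisp t0 x0 (t, x) = case_option (of_real (t - t0)) (disp x0 x)" by (simp add: tdisp_def)
    have "norm (tdisp t0 x0 (t, x) j) <= ro" for j unfolding e using x s[OF t] by (cases j) (auto simp flip: of_real_diff)
    then show "F (case_option (of_real (t - t0)) (disp x0 x)) = h t x" using F(3)[rule_format, of "(t, x)"] t ab01 by (simp add: e)
   qed
   then show "EX ro>0. EX M F. wn (%_. ro) M F &
    (ALL x. (ALL i. norm (disp x0 x i) <= ro) --> ((%t. h t x) has_integral F (disp x0 x)) {a..b})"
    using F(1) G(1) by blast
  qed
  then show ?case using F(1) by blast
 qed simp
 then obtain ro M F where F: "0 < ro" "wn (%_. ro) M F"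
  "ALL x. (ALL i. norm (disp x0 x i) <= ro) --> ((%t. h t x) has_integral F (disp x0 x)) {0..1}"
  unfolding P_def by auto
 show ?thesis by (rule locanI[OF F(1,2)]) (use F(3) integral_unique in blast)
qed

section \<open>Picard iteration for power series and the analytic flow\<close>

definition radial_primitive :: "(('n option => 'k) => 'k) => ('n option => 'k::{real_normed_field,banach}) => 'k" where
 "radial_primitive F z = z None*integral {0..1} (%si. F (case_option (of_real si*z None) (%i. z (Some i))))"

lemma radial_point_bound:
 assumes "!!j. norm (z j :: 'k::{real_normed_field,banach}) <= r j" "si:{0..1}"
 shows "norm (case_option (of_real si*z None) (%i. z (Some i)) j) <= r j"
proof (cases j)
 case None
 have "\<bar>si\<bar>*norm (z None) <= 1*norm (z None)" using assms(2) by (intro mult_right_mono) auto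
 then show ?thesis using None assms(1)[of None] by (simp add: norm_mult)
qed (use assms(1) in auto)

lemma radial_continuous:
 fixes F :: "('n::finite option => 'k::{real_normed_field,banach}) => 'k"
 assumes F: "wn r M F" and z: "!!j. norm (z j) <= r j"
 shows "continuous_on {0..1} (%si. F (case_option (of_real si*z None) (%i. z (Some i))))"
proof (rule wn_continuous[OF F])
 show "continuous_on {0..1} (%si. case_option (of_real si*z None) (%i. z (Some i)) j)" for j
  by (cases j) (auto intro!: continuous_intros)
qed (rule radial_point_bound[OF z])

text \<open>\<open>radial_primitive F\<close> is the primitive of \<open>F\<close> in the variable
  \<open>None\<close> that vanishes at 0, written as a real integral so that this variable may be
  complex. A term of degree n in \<open>None\<close> is divided by n + 1, so the norm is multiplied
  by \<open>r None\<close> at most.\<close>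

lemma wn_radial_primitive:
 fixes F :: "('n::finite option => 'k::{real_normed_field,banach}) => 'k"
 assumes r: "!!j. 0 < r j" and F: "wn r M F"
 shows "wn r (r None*M) (radial_primitive F)"
proof -
 obtain c S where c: "S <= M" "((%al. norm (c al)*mpow r al) has_sum S) UNIV"
  "ALL x. (ALL i. norm (x i) <= r i) --> ((%al. c al*mpow x al) has_sum F x) UNIV"
  by (rule wnE[OF F])
 define e where "e = (%be::'n option => nat. (1/real (Suc (be None))) *\<^sub>R c be)"
 define a where "a = (%(be::'n option => nat) j. (if j = None then 1 else 0) + be j)"
 have ma: "mpow x (a be) = x None*mpow x be" for be and x :: "'n option => 'y::comm_monoid_mult"
  unfolding a_def by (simp add: mpow_add mpow_unit)
 have pos: "0 <= mpow r be" for be using mpow_nonneg[of r be] r less_imp_le by blast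
 have le: "norm (e be)*mpow r (a be) <= r None*(norm (c be)*mpow r be)" for be
 proof -
  have "norm (e be) <= 1*norm (c be)" unfolding e_def norm_scaleR by (rule mult_right_mono) auto
  then have "norm (e be)*(r None*mpow r be) <= norm (c be)*(r None*mpow r be)"
   using r[of None] pos by (intro mult_right_mono) auto
  then show ?thesis by (simp add: ma algebra_simps)
 qed
 have hs: "((%be. r None*(norm (c be)*mpow r be)) has_sum r None*S) UNIV" by (rule has_sum_cmult_right[OF c(2)])
 have sm: "(%be. norm (e be)*mpow r (a be)) summable_on UNIV"
 proof (rule summable_on_comparison_test[OF has_sum_imp_summable[OF hs]])
  show "0 <= norm (e be)*mpow r (a be)" for be using pos r[of None] by (simp add: ma)
 qed (rule le)
 show ?thesis
 proof (rule wn_reindex[OF r has_sum_infsum[OF sm]])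
  have "infsum (%be. norm (e be)*mpow r (a be)) UNIV <= r None*S"
   by (rule has_sum_mono[OF has_sum_infsum[OF sm] hs]) (rule le)
  also have "... <= r None*M" by (rule mult_left_mono[OF c(1)]) (use r[of None] in simp)
  finally show "infsum (%be. norm (e be)*mpow r (a be)) UNIV <= r None*M" .
  fix z :: "'n option => 'k" assume z: "!!j. norm (z j) <= r j"
  define y where "y = (%si::real. case_option (of_real si*z None) (%i. z (Some i)))"
  define g where "g = (%be si. c be*mpow (y si) be)"
  have geq: "g be si = si^be None *\<^sub>R (c be*mpow z be)" for be si
  proof -
   have "mpow z be = z None^be None*mpow (%i. z (Some i)) (%i. be (Some i))"
    by (subst option_split[of z], rule mpow_option)
   then show ?thesis by (simp add: g_def y_def mpow_option power_mult_distrib scaleR_conv_of_real)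
  qed
  have yb: "norm (y si j) <= r j" if "si:{0..1}" for si j unfolding y_def by (rule radial_point_bound[OF z that])
  have 1: "continuous_on {0..1} (g be)" for be unfolding geq[abs_def] by (intro continuous_intros)
  have 2: "norm (g be si) <= norm (c be)*mpow r be" if "si:{0..1}" for be si
   unfolding g_def norm_mult by (rule mult_left_mono[OF norm_mpow_le]) (use yb[OF that] in auto)
  have 3: "((%be. g be si) has_sum F (y si)) UNIV" if "si:{0..1}" for si
   unfolding g_def by (rule c(3)[rule_format]) (rule yb[OF that])
  have "((%be. integral {0..1} (g be)) has_sum integral {0..1} (%si. F (y si))) UNIV"
   by (rule has_sum_integral(2)[where G="%si. F (y si)", OF 1 2 has_sum_imp_summable[OF c(2)] 3])
  then have "((%be. z None*integral {0..1} (g be)) has_sum radial_primitive F z) UNIV"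
   unfolding radial_primitive_def y_def by (rule has_sum_cmult_right)
  moreover have "z None*integral {0..1} (g be) = e be*mpow z (a be)" for be
  proof -
   have "((%si. si^be None *\<^sub>R (c be*mpow z be)) has_integral (1/real (Suc (be None))) *\<^sub>R (c be*mpow z be)) {0..1}"
    by (rule has_integral_scaleR_left[OF has_integral_power_01])
   then have "integral {0..1} (g be) = (1/real (Suc (be None))) *\<^sub>R (c be*mpow z be)"
    unfolding geq[abs_def] by (rule integral_unique)
   then show ?thesis by (simp add: e_def ma)
  qed
  ultimately show "((%be. e be*mpow z (a be)) has_sum radial_primitive F z) UNIV" by simp
 qed
qed

lemma radial_primitive_diff:
 fixes F G :: "('n::finite option => 'k::{real_normed_field,banach}) => 'k"
 assumes "wn r M F" "wn r N G" and z: "!!j. norm (z j) <= r j"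
 shows "radial_primitive (%z. F z - G z) z = radial_primitive F z - radial_primitive G z" unfolding radial_primitive_def
 by (subst integral_diff)
  (auto intro!: integrable_continuous_interval radial_continuous[OF assms(1) z] radial_continuous[OF assms(2) z] simp: right_diff_distrib)

lemma wn_uminus: "(!!i. 0 < r i) ==> wn r M f ==> wn r M (%x. - f x)" using wn_cmult[of r M f "-1"] by simp

text \<open>The contraction argument in weighted norms. The time variable has radius 2 and not 1, so
  that the solution can later be re-expanded about every time in [0, 1] with a radius up to
  1.\<close>

lemma analytic_picard:
 fixes K :: "'n => 'n => ('n::finite => 'k::{real_normed_field,banach}) => 'k"
 assumes R: "0 < R" and K: "!!i a. wn (%_. R) M (K i a)"
 shows "EX ro>0. EX U. ALL a. wn (case_option 2 (%_. ro)) (R/2) (U a) &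
  (ALL z. (ALL j. norm (z j) <= case_option 2 (%_. ro) j) -->
   U a z = z (Some a) - radial_primitive (%z. SUM i:I. z (Some i)*K i a (%c. U c z)) z)"
proof -
 define N where "N = real CARD('n)"
 have N: "0 < N" unfolding N_def by simp
 have cI: "real (card I) <= N" unfolding N_def by (simp add: card_mono)
 have M: "0 <= M" using wn_nonneg[OF K] R by simp
 \<comment> \<open>With these bounds the map \<open>T\<close> below sends functions of norm R/2 to
   norm at most R/8 + R/8 (\<open>Tb\<close>), and it halves distances (\<open>Td\<close>).\<close>
 define ro where "ro = min (R/8) (R/(16*N*(M + 1)))"
 have ro: "0 < ro" "ro <= R/8" using R N M by (auto simp: ro_def)
 have "ro * (16*N*(M + 1)) <= R/(16*N*(M + 1))*(16*N*(M + 1))"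
  by (rule mult_right_mono) (use N M in \<open>auto simp: ro_def\<close>)
 also have "... = R" using N M by simp
 finally have "16*(N*ro * M) + 16*(N*ro) <= R" by (simp add: algebra_simps)
 moreover have "0 <= N*ro" using N ro(1) by simp
 ultimately have small: "16*(N*ro * M) <= R" by linarith
 define r where "r = case_option 2 (%_::'n. ro)"
 have r: "0 < r j" for j using ro(1) by (cases j) (auto simp: r_def)
 have rN: "r None = 2" and rS: "r (Some i) = ro" for i by (auto simp: r_def)
 define Q where "Q = (%w a (z::'n option => 'k). SUM i:I. z (Some i)*K i a (%c. w c z))"
 define T where "T = (%w a z. z (Some a) - radial_primitive (Q w a) z)"
 have co: "wn r ro (%z::'n option => 'k. z (Some i))" for i using wn_coord[of r "Some i", OF r] by (simp add: rS)
 have sumI: "wn r (N*ro * L) (%z. SUM i:I. z (Some i)*F i z)"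
  if F: "!!i. wn r L (F i)" and L: "0 <= L" for L and F :: "'n => ('n option => 'k) => 'k"
 proof (rule wn_mono[OF wn_sum[OF r wn_mult[OF r co F]]])
  have "real (card I)*(ro * L) <= N*(ro * L)" by (rule mult_right_mono[OF cI]) (use ro(1) L in simp)
  then show "(SUM a:I. ro * L) <= N*ro * L" by simp
 qed
 have Qb: "wn r (N*ro * M) (Q w a)" if w: "!!c. wn r (R/2) (w c)" for w a
  unfolding Q_def by (rule sumI[OF wn_compose[OF r K w] M]) (use R in simp)
 have Tb: "wn r (R/4) (T w a)" if w: "!!c. wn r (R/2) (w c)" for w a unfolding T_def
  by (rule wn_mono[OF wn_diff[OF r co wn_radial_primitive[OF r Qb[OF w]]]]) (use small ro(2) in \<open>simp add: rN\<close>)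
 have Td: "wn r (de/2) (%z. T v a z - T w a z)" if w: "!!c. wn r (R/2) (w c)" and v: "!!c. wn r (R/2) (v c)"
   and d: "!!c. wn r de (%z. v c z - w c z)" and de: "0 <= de" for w v de a
 proof -
  have d': "wn r de (%z. w c z - v c z)" for c using wn_uminus[OF r d[of c]] by simp
  have "wn r (N*ro * (M*(2*de/R))) (%z. SUM i:I. z (Some i)*(K i a (%c. w c z) - K i a (%c. v c z)))"
   by (rule sumI[OF wn_lipschitz[OF r R K v w d']]) (use M R de in simp)
  then have "wn r (N*ro * (M*(2*de/R))) (%z. Q w a z - Q v a z)" by (simp add: Q_def sum_subtractf right_diff_distrib)
  from wn_radial_primitive[OF r this]
  have J: "wn r (2*(N*ro * (M*(2*de/R)))) (radial_primitive (%z. Q w a z - Q v a z))" by (simp add: rN)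
  have "2*(N*ro * (M*(2*de/R))) = (N*ro * M)*(4*de/R)" by simp
  also have "... <= (R/16)*(4*de/R)" by (rule mult_right_mono) (use small R de in auto)
  also have "... <= de/2" using R de by simp
  finally have J2: "wn r (de/2) (radial_primitive (%z. Q w a z - Q v a z))" by (rule wn_mono[OF J])
  show ?thesis
  proof (rule wn_cong[OF J2])
   fix x :: "'n option => 'k" assume "!!i. norm (x i) <= r i"
   then show "radial_primitive (%z. Q w a z - Q v a z) x = T v a x - T w a x"
    using radial_primitive_diff[OF Qb[OF w] Qb[OF v]] by (simp add: T_def)
  qed
 qed
 define u where "u = rec_nat (%a (z::'n option => 'k). z (Some a)) (%_ w. T w)"
 have u0: "u 0 = (%a z. z (Some a))" and uS: "u (Suc m) = T (u m)" for m by (auto simp: u_def)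
 have ub: "wn r (R/4) (u m a)" for m a
 proof (induction m arbitrary: a)
  case 0
  show ?case unfolding u0 by (rule wn_mono[OF co]) (use ro(2) R in simp)
 next
  case (Suc m)
  show ?case unfolding uS by (rule Tb, rule wn_mono[OF Suc]) (use R in simp)
 qed
 have ub2: "wn r (R/2) (u m a)" for m a by (rule wn_mono[OF ub]) (use R in simp)
 have du: "wn r (R*(1/2)^m) (%z. u (Suc m) a z - u m a z)" for m a
 proof (induction m arbitrary: a)
  case 0
  show ?case by (rule wn_mono[OF wn_diff[OF r ub ub]]) (use R in simp)
 next
  case (Suc m)
  have "wn r ((R*(1/2)^m)/2) (%z. T (u (Suc m)) a z - T (u m) a z)" by (rule Td[OF ub2 ub2 Suc]) (use R in simp)
  then show ?case by (simp add: uS)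
 qed
 \<comment> \<open>The tail of the telescoping series from iterate k on; it is again a power series,
   of norm at most 2*R*(1/2)^k.\<close>
 define E where "E = (%k a z. \<Sum>\<^sub>\<infinity>m. u (Suc (m + k)) a z - u (m + k) a z)"
 have geo: "((%m. R*(1/2::real)^(m + k)) has_sum 2*R*(1/2)^k) UNIV" for k
 proof (rule norm_summable_imp_has_sum)
  show "summable (%m. norm (R*(1/2::real)^(m + k)))" using summable_mult2[OF summable_geometric[of "1/2::real"], of "R*(1/2)^k"] R
   by (simp add: power_add algebra_simps abs_mult)
  have "(%m. (1/2::real)^m*(R*(1/2)^k)) sums (1/(1 - 1/2)*(R*(1/2)^k))" by (intro sums_mult2 geometric_sums) simp
  then show "(%m. R*(1/2::real)^(m + k)) sums (2*R*(1/2)^k)" by (simp add: power_add algebra_simps)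
 qed
 have hs: "((%m. u (Suc (m + k)) a z - u (m + k) a z) has_sum E k a z) UNIV" if z: "!!j. norm (z j) <= r j" for k a z
 proof -
  have "(%m. norm (u (Suc (m + k)) a z - u (m + k) a z)) summable_on UNIV"
   by (rule summable_on_comparison_test[OF has_sum_imp_summable[OF geo[of k]]])
    (use wn_bound[OF du z] in auto)
  then show ?thesis unfolding E_def by (rule has_sum_infsum[OF abs_summable_summable])
 qed
 have Eb: "wn r (2*R*(1/2)^k) (E k a)" for k a by (rule wn_infsum[OF r du geo order_refl hs])
 have Estep: "E k a z = (u (Suc k) a z - u k a z) + E (Suc k) a z" if z: "!!j. norm (z j) <= r j" for k a z
 proof -
  have "(%m. u (Suc (m + k)) a z - u (m + k) a z) sums E k a z" by (rule has_sum_imp_sums[OF hs[OF z]])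
  then have "(%m. u (Suc (Suc m + k)) a z - u (Suc m + k) a z) sums (E k a z - (u (Suc (0 + k)) a z - u (0 + k) a z))"
   by (subst sums_Suc_iff) simp
  moreover have "(%m. u (Suc (Suc m + k)) a z - u (Suc m + k) a z) sums E (Suc k) a z"
   using has_sum_imp_sums[OF hs[OF z, of "Suc k" a]] by simp
  ultimately have "E k a z - (u (Suc (0 + k)) a z - u (0 + k) a z) = E (Suc k) a z" by (rule sums_unique2)
  then show ?thesis by (simp add: algebra_simps)
 qed
 define U where "U = (%a z. u 0 a z + E 0 a z)"
 have Uk: "U a z = u k a z + E k a z" if z: "!!j. norm (z j) <= r j" for k a z
 proof (induction k)
  case (Suc k)
  then show ?case using Estep[OF z, of k a] by simp
 qed (simp add: U_def)
 have Ub: "wn r (R/2) (U a)" for a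
 proof (rule wn_cong)
  \<comment> \<open>R/4 for iterate 3 plus 2*R/8 for the tail after it; the same estimate from an
    earlier iterate would exceed R/2.\<close>
  show "wn r (R/2) (%z. u 3 a z + E 3 a z)" by (rule wn_mono[OF wn_add[OF r ub Eb]]) (simp add: power3_eq_cube)
 qed (simp add: Uk[of _ _ 3])
 have Ud: "wn r (2*R*(1/2)^k) (%z. U a z - u k a z)" for a k by (rule wn_cong[OF Eb[of k a]]) (simp add: Uk[of _ _ k])
 have fp: "U a z = T U a z" if z: "!!j. norm (z j) <= r j" for a z
 proof -
  have "norm (U a z - T U a z) <= 2*R*(1/2)^k" for k
  proof -
   have 1: "norm (U a z - u (Suc k) a z) <= 2*R*(1/2)^Suc k" by (rule wn_bound[OF Ud z])
   have "wn r ((2*R*(1/2)^k)/2) (%z. T U a z - T (u k) a z)" by (rule Td[OF ub2 Ub Ud]) (use R in simp)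
   from wn_bound[OF this z] have 2: "norm (T U a z - u (Suc k) a z) <= R*(1/2)^k" by (simp add: uS)
   have "norm (U a z - T U a z) <= norm (U a z - u (Suc k) a z) + norm (T U a z - u (Suc k) a z)"
    using norm_triangle_ineq4[of "U a z - u (Suc k) a z" "T U a z - u (Suc k) a z"] by simp
   then show ?thesis using 1 2 by simp
  qed
  moreover have "(%k. 2*R*(1/2::real)^k) \<longlonglongrightarrow> 2*R*0"
   by (intro tendsto_mult tendsto_const LIMSEQ_realpow_zero) auto
  ultimately have "norm (U a z - T U a z) <= 0" by (intro LIMSEQ_le_const[of "%k. 2*R*(1/2::real)^k"]) auto
  then show ?thesis by simp
 qed
 show ?thesis using ro(1) Ub fp unfolding r_def T_def Q_def by (intro exI[of _ ro] exI[of _ U] conjI allI impI) auto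
qed

lemma scaled_integral:
 fixes g :: "real => 'k::banach"
 assumes g: "continuous_on {0..1} g" and s: "s:{0..1}"
 shows "s *\<^sub>R integral {0..1} (%si. g (si * s)) = integral {0..s} g"
proof -
 define H where "H = (%s. integral {0..s} g)"
 have im: "(%si. si * s) ` {0..1} <= {0..1}" using s by (auto simp: mult_le_one)
 have "((%si. H (si * s)) has_vector_derivative s *\<^sub>R g (si * s)) (at si within {0..1})" if si: "si:{0..1}" for si
 proof -
  have "((%si. si * s) has_vector_derivative s) (at si within {0..1})" by (auto intro!: derivative_eq_intros)
  moreover have "(H has_vector_derivative g (si * s)) (at (si * s) within (%si. si * s) ` {0..1})" unfolding H_def
   by (rule has_vector_derivative_within_subset[OF integral_has_vector_derivative[OF g] im]) (use si im in blast)
  ultimately show ?thesis using vector_diff_chain_within[of "%si. si * s" s si "{0..1}" H "g (si * s)"]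
   by (simp add: o_def)
 qed
 then have "((%si. s *\<^sub>R g (si * s)) has_integral H (1 * s) - H (0 * s)) {0..1}"
  by (intro fundamental_theorem_of_calculus) auto
 from integral_unique[OF this] show ?thesis by (simp add: H_def)
qed

lemma open_disp:
 fixes a :: "'k::{real_normed_field,banach}^'n::finite"
 assumes "open S" "a:S"
 obtains ro where "0 < ro" "ALL x. (ALL j. norm (disp a x j) <= ro) --> x:S"
proof -
 obtain e where e: "e > 0" "ball a e <= S" using assms openE by blast
 define N where "N = real CARD('n)"
 have N: "0 < N" by (simp add: N_def)
 show thesis
 proof (rule that[of "e/(2*N)"])
  show "ALL x. (ALL j. norm (disp a x j) <= e/(2*N)) --> x:S"
  proof (intro allI impI)
   fix x assume x: "ALL j. norm (disp a x j) <= e/(2*N)"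
   have "norm (x - a) <= (SUM j:UNIV. norm ((x - a)$j))" by (rule norm_vec_le_sum)
   also have "... <= (SUM j:(UNIV::'n set). e/(2*N))" using x by (intro sum_mono) (simp add: disp_def)
   also have "... = e/2" using N by (simp add: N_def)
   finally have "x:ball a e" using e(1) by (simp add: dist_norm norm_minus_commute)
   then show "x:S" using e(2) by blast
  qed
 qed (use e(1) N in simp)
qed

text \<open>The series of \<open>analytic_picard\<close> runs in the reversed time 1 - t, so that
  the initial point sits at time 0, where \<open>radial_primitive\<close> vanishes.\<close>

lemma analytic_flow:
 fixes Y :: "'n::finite => 'n => 'k::{real_normed_field,banach}^'n => 'k"
 assumes S: "open S" "p:S" and Y: "!!i a. locan UNIV (disp p) (Y i a)"
 shows "EX ro>0. EX Ph. (ALL a. analytic_family_on (ball p ro) (%t x. Ph t x$a)) &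
    (ALL x:ball p ro. Ph 1 x = x & (ALL t:{0..1}. Ph t x:S &
     ((%t. Ph t x) has_vector_derivative (\<chi> a. SUM i:I. (x$i - p$i)*Y i a (Ph t x)))
      (at t within {0..1})))"
proof -
 obtain R1 M1 K1 where K1: "0 < R1" "ALL q. wn (%_. R1) (M1 q) (K1 q)"
  "ALL q. ALL x:UNIV. (ALL j. norm (disp p x j) <= R1) --> Y (fst q) (snd q) x = K1 q (disp p x)"
  by (rule locan_common[where h="%q. Y (fst q) (snd q)", OF Y])
 obtain R2 where R2: "0 < R2" "ALL x. (ALL j. norm (disp p x j) <= R2) --> x:S" by (rule open_disp[OF S])
 define R where "R = min R1 R2"
 define M where "M = (SUM q:UNIV. M1 q)"
 define K where "K = (%i a. K1 (i, a))"
 have R: "0 < R" "R <= R1" "R <= R2" using K1(1) R2(1) by (auto simp: R_def)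
 have M1: "0 <= M1 q" for q using wn_nonneg[OF K1(2)[rule_format]] K1(1) by simp
 have K: "wn (%_. R) M (K i a)" for i a unfolding K_def M_def
  by (rule wn_mono[OF wn_restrict[OF _ _ K1(2)[rule_format]]]) (use R in \<open>auto intro!: member_le_sum M1\<close>)
 have YK: "Y i a x = K i a (disp p x)" if "!!j. norm (disp p x j) <= R" for i a x
  using K1(3)[rule_format, of x "(i, a)"] order_trans[OF that R(2)] by (simp add: K_def)
 obtain ro U where ro: "0 < ro" and U: "ALL a. wn (case_option 2 (%_. ro)) (R/2) (U a) &
  (ALL z. (ALL j. norm (z j) <= case_option 2 (%_. ro) j) -->
   U a z = z (Some a) - radial_primitive (%z. SUM i:I. z (Some i)*K i a (%c. U c z)) z)"
  using analytic_picard[where K=K and I=I, OF R(1) K] by blast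
 define r where "r = case_option 2 (%_::'n. ro)"
 have r: "0 < r j" for j using ro(1) by (cases j) (auto simp: r_def)
 have Ub: "wn r (R/2) (U a)" for a using U by (simp add: r_def)
 define Q where "Q = (%a (z::'n option => 'k). SUM i:I. z (Some i)*K i a (%c. U c z))"
 have Ueq: "U a z = z (Some a) - radial_primitive (Q a) z" if "!!j. norm (z j) <= r j" for a z using U that by (simp add: r_def Q_def)
 have Qb: "wn r (SUM i:I. ro * M) (Q a)" for a unfolding Q_def
 proof (intro wn_sum r wn_mult)
  show "wn r ro (%z. z (Some i))" for i using wn_coord[of r "Some i", OF r] by (simp add: r_def)
  show "wn r M (%z. K i a (%c. U c z))" for i by (rule wn_compose[OF r K Ub]) (use R in simp)
 qed
 define ze where "ze = (%ta::real. %x. case_option (of_real ta) (disp p x))"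
 have zeb: "norm (ze ta x j) <= r j" if "ta:{0..1}" "x:ball p ro" for ta x j
  using that Finite_Cartesian_Product.norm_nth_le[of "x - p"]
  by (cases j) (auto simp: ze_def r_def disp_def dist_norm norm_minus_commute intro: order_trans less_imp_le)
 define Ph where "Ph = (%t x. \<chi> a. p$a + U a (ze (1 - t) x))"
 have dU: "disp p (Ph t x) = (%c. U c (ze (1 - t) x))" for t x by (auto simp: disp_def Ph_def)
 have dR: "norm (disp p (Ph t x) j) <= R/2" if "t:{0..1}" "x:ball p ro" for t x j
  unfolding dU by (rule wn_bound[OF Ub zeb]) (use that in auto)
 have dR': "norm (disp p (Ph t x) j) <= R" if "t:{0..1}" "x:ball p ro" for t x j using dR[OF that, of j] R(1) by simp
 have at1: "Ph 1 x = x" if x: "x:ball p ro" for x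
 proof -
  have "U a (ze 0 x) = x$a - p$a" for a using Ueq[OF zeb[of 0 x], of a] x by (simp add: radial_primitive_def ze_def disp_def)
  then show ?thesis by (simp add: Ph_def vec_eq_iff)
 qed
 have ode: "((%t. Ph t x) has_vector_derivative (\<chi> a. SUM i:I. (x$i - p$i)*Y i a (Ph t x))) (at t within {0..1})"
  if x: "x:ball p ro" and t: "t:{0..1}" for x t
 proof (rule has_vector_derivative_vecI)
  fix a
  define g where "g = (%ta. Q a (ze ta x))"
  have g: "continuous_on {0..1} g" unfolding g_def
  proof (rule wn_continuous[OF Qb])
   show "continuous_on {0..1} (%ta. ze ta x j)" for j by (cases j) (auto simp: ze_def intro!: continuous_intros)
  qed (rule zeb[OF _ x])
  have eq: "U a (ze (1 - t) x) = disp p x a - integral {0..1 - t} g" if t: "t:{0..1}" for t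
  proof -
   have "radial_primitive (Q a) (ze (1 - t) x) = of_real (1 - t)*integral {0..1} (%si. g (si*(1 - t)))"
    by (simp add: radial_primitive_def g_def ze_def)
   also have "... = integral {0..1 - t} g" using scaled_integral[OF g, of "1 - t"] t by (simp add: scaleR_conv_of_real)
   finally show ?thesis using Ueq[OF zeb[of "1 - t" x], of a] t x by (simp add: ze_def)
  qed
  have "((%t. integral {0..1 - t} g) has_vector_derivative - g (1 - t)) (at t within {0..1})"
  proof -
   have "((%t::real. 1 - t) has_vector_derivative -1) (at t within {0..1})" by (auto intro!: derivative_eq_intros)
   moreover have "((%u. integral {0..u} g) has_vector_derivative g (1 - t)) (at (1 - t) within (%t. 1 - t) ` {0..1})"
    by (rule has_vector_derivative_within_subset[OF integral_has_vector_derivative[OF g]]) (use t in auto)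
   ultimately show ?thesis using vector_diff_chain_within[of "%t. 1 - t" "-1" t "{0..1}" "%u. integral {0..u} g" "g (1 - t)"]
    by (simp add: o_def)
  qed
  then have "((%t. p$a + (disp p x a - integral {0..1 - t} g)) has_vector_derivative 0 + (0 - - g (1 - t))) (at t within {0..1})"
   by (intro has_vector_derivative_add has_vector_derivative_diff has_vector_derivative_const)
  moreover have "g (1 - t) = (SUM i:I. (x$i - p$i)*Y i a (Ph t x))"
   unfolding g_def Q_def YK[OF dR'[OF t x]] dU by (simp add: ze_def disp_def)
  ultimately have "((%t. p$a + (disp p x a - integral {0..1 - t} g)) has_vector_derivative
   (\<chi> a. SUM i:I. (x$i - p$i)*Y i a (Ph t x))$a) (at t within {0..1})" by simp
  then show "((%t. Ph t x$a) has_vector_derivative (\<chi> a. SUM i:I. (x$i - p$i)*Y i a (Ph t x))$a) (at t within {0..1})"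
   by (rule has_vector_derivative_transform[OF t, rotated]) (simp add: Ph_def eq)
 qed
 have fam: "analytic_family_on (ball p ro) (%t x. Ph t x$a)" for a unfolding analytic_family_on_def
 proof (intro ballI)
  fix t0 :: real and x0 assume t0: "t0:{0..1}" and x0: "x0:ball p ro"
  \<comment> \<open>The room around \<open>(t0, x0)\<close> inside the polydisc of \<open>U\<close>:
    the reversed time stays below 2 in norm and the displacements from \<open>p\<close> stay below
    \<open>ro\<close>.\<close>
  define ep where "ep = min 1 (ro - dist p x0)"
  have ep: "0 < ep" "ep <= 1" "ep <= ro - dist p x0" using x0 by (auto simp: ep_def)
  define h :: "'n option => ('n option => 'k) => 'k"
   where "h = (%j w. case_option (of_real (1 - t0) - w None) (%i. disp p x0 i + w (Some i)) j)"
  have h: "wn (%_. ep) (r j) (h j)" for j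
  proof (cases j)
   case None
   have "wn (%_. ep) (norm (of_real (1 - t0) :: 'k) + ep) (%w::'n option => 'k. of_real (1 - t0) - w None)"
    using ep(1) by (intro wn_diff wn_const wn_coord) auto
   moreover have "norm (of_real (1 - t0) :: 'k) + ep <= 2" unfolding norm_of_real using t0 ep(2) by auto
   ultimately have "wn (%_. ep) 2 (%w::'n option => 'k. of_real (1 - t0) - w None)" by (rule wn_mono)
   then show ?thesis using None by (simp add: h_def r_def)
  next
   case (Some i)
   have "wn (%_. ep) (norm (disp p x0 i) + ep) (%w. disp p x0 i + w (Some i))"
    using ep(1) by (intro wn_add wn_const wn_coord) auto
   moreover have "norm (disp p x0 i) + ep <= ro" using ep(3) Finite_Cartesian_Product.norm_nth_le[of "x0 - p" i]
    by (simp add: disp_def dist_norm norm_minus_commute)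
   ultimately have "wn (%_. ep) ro (%w. disp p x0 i + w (Some i))" by (rule wn_mono)
   then show ?thesis using Some by (simp add: h_def r_def)
  qed
  have "wn (%_. ep) (norm (p$a) + R/2) (%w. p$a + U a (%j. h j w))"
   using ep(1) by (intro wn_add wn_const wn_compose[OF _ Ub h]) auto
  then show "locan ({0..1} \<times> UNIV) (tdisp t0 x0) (%z. Ph (fst z) (snd z)$a)"
  proof (rule locanI[OF ep(1)])
   fix z :: "real \<times> ('k^'n)"
   have "ze (1 - fst z) (snd z) = (%j. h j (tdisp t0 x0 z))"
   proof
    show "ze (1 - fst z) (snd z) j = h j (tdisp t0 x0 z)" for j by (cases j) (auto simp: ze_def h_def tdisp_def disp_def)
   qed
   then show "Ph (fst z) (snd z)$a = p$a + U a (%j. h j (tdisp t0 x0 z))" by (simp add: Ph_def)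
  qed
 qed
 have inS: "Ph t x:S" if "t:{0..1}" "x:ball p ro" for t x using R2(2) order_trans[OF dR'[OF that] R(3)] by blast
 show ?thesis using ro fam at1 inS ode by (intro exI[of _ ro] exI[of _ Ph] conjI allI ballI) blast+
qed

theorem analytic_regularity:
 "regularity (analytic_fun_on :: ('k::{ground_field,banach}^'n::finite) set => _) analytic_family_on"
proof
 fix S T V U :: "('k^'n) set" and f g :: "'k^'n => 'k" and h :: "real => 'k^'n => 'k"
  and i :: 'n and p x :: "'k^'n" and c :: 'k and t :: real
 note aiff = analytic_iff_locan
 show "analytic_fun_on T f" if "open S" "analytic_fun_on S f" "open T" "T <= S" using that unfolding aiff by blast
 show "analytic_fun_on S f" if "open S" "!!x. x:S ==> EX U. open U & x:U & analytic_fun_on U f"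
  using that unfolding aiff by blast
 show "analytic_fun_on S g" if S: "open S" and f: "analytic_fun_on S f" and fg: "!!x. x:S ==> f x = g x" unfolding aiff
 proof
  fix a assume a: "a:S"
  obtain ro where ro: "0 < ro" "ALL x. (ALL j. norm (disp a x j) <= ro) --> x:S" by (rule open_disp[OF S a])
  show "locan UNIV (disp a) g"
   proof (rule locan_local[OF _ ro(1)])
   show "locan UNIV (disp a) f" using f a by (simp add: aiff)
   show "f x = g x" if "ALL j. norm (disp a x j) <= ro" for x using fg ro(2) that by blast
  qed
 qed
 show "analytic_fun_on S (%x. c)" "analytic_fun_on S (%x. x$i)" unfolding aiff by (auto intro: locan_const locan_coord)
 show "analytic_fun_on S (%x. f x + g x)" "analytic_fun_on S (%x. f x*g x)" if "analytic_fun_on S f" "analytic_fun_on S g"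
  using that unfolding aiff by (auto intro: locan_add locan_mult)
 show "analytic_fun_on S (%x. inverse (f x))" if "analytic_fun_on S f" "!!x. x:S ==> f x ~= 0" unfolding aiff
 proof
  fix a assume a: "a:S"
  show "locan UNIV (disp a) (%x. inverse (f x))" by (rule locan_inverse[of _ _ _ a]) (use that a in \<open>auto simp: aiff\<close>)
 qed
 show "(f has_derivative (%h. SUM i:UNIV. pd i f x*h$i)) (at x)" if "analytic_fun_on S f" "x:S"
  by (rule locan_has_derivative) (use that in \<open>auto simp: aiff\<close>)
 show "analytic_fun_on S (pd i f)" if "analytic_fun_on S f" using that unfolding aiff by (auto intro: locan_pd)
 show "analytic_fun_on T (%x. f (u x))" if "analytic_fun_on S f" "!!i. analytic_fun_on T (%x. u x$i)"
  "!!x. x:T ==> u x:S" for u :: "'k^'n => 'k^'n" unfolding aiff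
 proof
  fix a assume a: "a:T"
  show "locan UNIV (disp a) (%x. f (u x))" by (rule locan_compose[of u a]) (use that a in \<open>auto simp: aiff\<close>)
 qed
 show "analytic_family_on V (%t x. f (ga t x))" if "analytic_fun_on S f" "!!i. analytic_family_on V (%t x. ga t x$i)"
  "!!t x. t:{0..1} ==> x:V ==> ga t x:S" for ga :: "real => 'k^'n => 'k^'n"
  unfolding analytic_family_on_def
 proof (intro ballI)
  fix t0 :: real and x0 assume tx: "t0:{0..1}" "x0:V"
  show "locan ({0..1} \<times> UNIV) (tdisp t0 x0) (%z. f (ga (fst z) (snd z)))"
  proof (rule locan_compose[of "%z. ga (fst z) (snd z)" "(t0, x0)"])
   show "locan UNIV (disp (ga (fst (t0, x0)) (snd (t0, x0)))) f" using that(1,3) tx by (simp add: aiff)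
   show "locan ({0..1} \<times> UNIV) (tdisp t0 x0) (%z. ga (fst z) (snd z)$i)" for i
    using that(2) tx unfolding analytic_family_on_def by blast
  qed (use tx in auto)
 qed
 show "analytic_fun_on V (h t)" if "analytic_family_on V h" "t:{0..1}"
  using that unfolding aiff analytic_family_on_def by (blast intro: analytic_family_slice)
 show "analytic_fun_on V (%x. integral {0..1} (%t. h t x))" if "analytic_family_on V h"
  unfolding aiff using analytic_family_integral[OF that] by blast
 show "continuous_on ({0..1} \<times> V) (%(t, x). h t x)" if "open V" "analytic_family_on V h" by (rule analytic_family_continuous[OF that])
 show "analytic_family_on U h" if "analytic_family_on V h" "U <= V" using that unfolding analytic_family_on_def by blast
 show "analytic_family_on V (%t x. of_real t*(x$i - p$i) + p$i)" unfolding analytic_family_on_def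
 proof (intro ballI)
  fix t0 :: real and x0 :: "'k^'n"
  have "locan ({0..1} \<times> UNIV) (tdisp t0 x0)
   (%z. (of_real t0 + tdisp t0 x0 z None)*((x0$i - p$i) + tdisp t0 x0 z (Some i)) + p$i)"
   by (intro locan_add locan_mult locan_const locan_disp)
  then show "locan ({0..1} \<times> UNIV) (tdisp t0 x0) (%z. of_real (fst z)*(snd z$i - p$i) + p$i)"
   by (rule locan_cong) (simp add: tdisp_def disp_def)
 qed
 show "EX ro>0. EX Ph. (ALL a. analytic_family_on (ball p ro) (%t x. Ph t x$a)) &
    (ALL x:ball p ro. Ph 1 x = x & (ALL t:{0..1}. Ph t x:S &
     ((%t. Ph t x) has_vector_derivative (\<chi> a. SUM i:I. (x$i - p$i)*Y i a (Ph t x)))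
      (at t within {0..1})))"
  if "open S" "p:S" "!!i a. analytic_fun_on S (Y i a)" for I :: "'n set" and Y :: "'n => 'n => 'k^'n => 'k"
  by (rule analytic_flow[OF that(1,2)]) (use that in \<open>auto simp: aiff\<close>)
qed

section \<open>Pairs of skew-symmetric forms of Kronecker type\<close>

lemma fscale_apply [simp]: "fscale c f x = c*f x" by (simp add: fscale_def)

lemma sum_fscale_apply: "(SUM p:I. fscale (x p) (w p)) v = (SUM p:I. x p*w p v)" by (induction I rule: infinite_finite_induct) auto

lemma independent_family_iff:
 fixes w :: "'i => 'x => 'k::field"
 assumes I: "finite I"
 shows "independent_family I w \<longleftrightarrow> (ALL x. (SUM p:I. fscale (x p) (w p)) = 0 --> (ALL p:I. x p = 0))"
proof
 assume *: "independent_family I w"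
 then have inj: "inj_on w I" and ind: "fs.independent (w ` I)" by (auto simp: independent_family_def)
 show "ALL x. (SUM p:I. fscale (x p) (w p)) = 0 --> (ALL p:I. x p = 0)"
 proof (intro allI impI ballI)
  fix x p assume x: "(SUM p:I. fscale (x p) (w p)) = 0" and p: "p:I"
  have "(SUM v:w ` I. fscale (x (inv_into I w v)) v) = (SUM p:I. fscale (x p) (w p))" using inj by (simp add: sum.reindex)
  then have "x (inv_into I w (w p)) = 0" using fs.independentD[OF ind _ order_refl, of "%v. x (inv_into I w v)" "w p"] I p x by simp
  then show "x p = 0" using inj p by simp
 qed
next
 assume *: "ALL x. (SUM p:I. fscale (x p) (w p)) = 0 --> (ALL p:I. x p = 0)"
 have inj: "inj_on w I"
 proof (rule inj_onI, rule ccontr)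
  fix p q assume pq: "p:I" "q:I" "w p = w q" "p ~= q"
  \<comment> \<open>Two equal members satisfy the relation with coefficients 1 and -1.\<close>
  define x :: "'i => 'k" where "x = (%r. (if r = p then 1 else 0) + (if r = q then -1 else 0))"
  have "(SUM r:I. fscale (x r) (w r)) v = 0" for v
   using I pq by (simp add: sum_fscale_apply x_def distrib_right sum.distrib if_distrib[of "%c. c*_"] cong: if_cong)
  then have "x p = 0" using*pq(1) by (metis (no_types) ext zero_fun_apply)
  then show False using pq(4) by (simp add: x_def)
 qed
 moreover have "fs.independent (w ` I)"
 proof
  assume "fs.dependent (w ` I)"
  then obtain u v where u: "v:w ` I" "u v ~= 0" "(SUM v:w ` I. fscale (u v) v) = 0" using fs.dependent_finite[of "w ` I"] I by auto
  then have "(SUM p:I. fscale (u (w p)) (w p)) = 0" using inj by (simp add: sum.reindex)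
  then show False using *[rule_format, of "%p. u (w p)"] u(1,2) by blast
 qed
 ultimately show "independent_family I w" by (simp add: independent_family_def)
qed

lemma span_family:
 fixes w :: "'i => 'x => 'k::field"
 assumes I: "finite I" and v: "v:fs.span (w ` I)"
 obtains x where "v = (SUM p:I. fscale (x p) (w p))"
proof -
 let ?T = "{v. EX x. v = (SUM p:I. fscale (x p) (w p))}"
 have "fs.subspace ?T"
 proof (rule fs.subspaceI)
  show "0:?T" by (auto intro!: exI[of _ "%_. 0"])
  show "a + b:?T" if ab: "a:?T" "b:?T" for a b
  proof -
   obtain x y where "a = (SUM p:I. fscale (x p) (w p))" "b = (SUM p:I. fscale (y p) (w p))" using ab by blast
   then have "a + b = (SUM p:I. fscale (x p + y p) (w p))" by (simp only: fs.scale_left_distrib sum.distrib)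
   then show ?thesis by (intro CollectI exI)
  qed
  show "fscale c a:?T" if a: "a:?T" for c a
  proof -
   obtain x where "a = (SUM p:I. fscale (x p) (w p))" using a by blast
   then have "fscale c a = (SUM p:I. fscale (c*x p) (w p))" by (simp only: fs.scale_sum_right fs.scale_scale)
   then show ?thesis by (intro CollectI exI)
  qed
 qed
 moreover have "w ` I <= ?T"
 proof
  fix v assume "v:w ` I"
  then obtain q where q: "q:I" "v = w q" by blast
  have "v = (SUM p:I. fscale (if p = q then 1 else 0) (w p))"
   using q I by (intro ext) (simp add: sum_fscale_apply if_distrib[of "%c. c*_"] cong: if_cong)
  then show "v:?T" by (intro CollectI exI)
 qed
 ultimately have "fs.span (w ` I) <= ?T" by (rule fs.span_minimal[rotated])
 then show thesis using v that by blast
qed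

lemma dim_span_family:
 "finite I ==> independent_family I w ==> fs.dim (fs.span (w ` I)) = card I"
 unfolding independent_family_def by (metis fs.dim_span_eq_card_independent card_image)

lemma independent_family_subset:
 "independent_family I w ==> J <= I ==> independent_family J w"
 unfolding independent_family_def using fs.independent_mono[of "w ` I" "w ` J"] inj_on_subset by blast

lemma independent_family_insert:
 assumes "independent_family I w" "w p ~: fs.span (w ` I)"
 shows "independent_family (insert p I) w" using assms fs.span_base[of "w p" "w ` I"] unfolding independent_family_def
 by (auto simp: fs.independent_insert inj_on_insert)

lemma card_independent_family_le:
 assumes "independent_family I w" "w ` I <= fs.span T" "finite T"
 shows "finite I" "card I <= card T"
proof -
 have "finite (w ` I) & card (w ` I) <= card T"
  using fs.independent_span_bound[OF assms(3) _ assms(2)] assms(1) by (simp add: independent_family_def)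
 then show "finite I" "card I <= card T" using assms(1) finite_image_iff[of w I] card_image[of w I] by (auto simp: independent_family_def)
qed

lemma independent_family_spans:
 fixes w :: "'i => 'x => 'k::field"
 assumes w: "independent_family I w" "w ` I <= fs.span T" and T: "finite T" "fs.dim (fs.span T) = card I"
 shows "fs.span (w ` I) = fs.span T"
proof -
 have fin: "finite I" by (rule card_independent_family_le(1)[OF w T(1)])
 obtain B where B: "B <= T" "fs.independent B" "fs.span B = fs.span T"
  using fs.maximal_independent_subset[of T] fs.span_minimal[of T "fs.span B" for B] by (metis fs.span_mono fs.span_eq fs.subspace_span subset_antisym)
 have fB: "finite B" using B(1) T(1) finite_subset by blast
 have cB: "card B = card I" using T(2) B fs.dim_span_eq_card_independent[OF B(2)] by simp
 have "v:fs.span (w ` I)" if v: "v:fs.span T" for v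
 proof (rule ccontr)
  assume nv: "v ~: fs.span (w ` I)"
  have "fs.independent (insert v (w ` I))" using w(1) nv by (intro fs.independent_insertI) (auto simp: independent_family_def)
  moreover have "insert v (w ` I) <= fs.span B" using v w(2) B(3) by simp
  ultimately have "card (insert v (w ` I)) <= card B" using fs.independent_span_bound[OF fB] by blast
  moreover have "v ~: w ` I" using nv fs.span_base by blast
  moreover have "card (w ` I) = card I" using w(1) by (simp add: independent_family_def card_image)
  ultimately show False using cB fin by simp
 qed
 moreover have "fs.span (w ` I) <= fs.span T" by (rule fs.span_minimal[OF w(2)]) simp
 ultimately show ?thesis by blast
qed

section \<open>Kernels of forms and of the pencil on single blocks\<close>

definition form_kernel :: "('x => complex) set => (('x => complex) => ('x => complex) => complex) => ('x => complex) set" where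
 "form_kernel V B = {v:V. ALL u:V. B v u = 0}"

lemma bilinear_on_sum:
 assumes V: "fs.subspace V" and B: "bilinear_on V B" and w: "!!p. p:I ==> w p:V" and u: "u:V"
 shows "B (SUM p:I. fscale (x p) (w p)) u = (SUM p:I. x p*B (w p) u)"
  and "B u (SUM p:I. fscale (x p) (w p)) = (SUM p:I. x p*B u (w p))"
proof -
 have "B 0 u = 0" "B u 0 = 0" using B u fs.subspace_0[OF V] unfolding bilinear_on_def by (metis fs.scale_zero_left mult_zero_left)+
 moreover have "(SUM p:J. fscale (x p) (w p)):V" if "J <= I" for J
  using that w by (intro fs.subspace_sum[OF V] fs.subspace_scale[OF V]) auto
 ultimately have "B (SUM p:I. fscale (x p) (w p)) u = (SUM p:I. x p*B (w p) u) &
  B u (SUM p:I. fscale (x p) (w p)) = (SUM p:I. x p*B u (w p))" using w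
 proof (induction I rule: infinite_finite_induct)
  case (insert p I)
  define S where "S = (SUM p:I. fscale (x p) (w p))"
  have m: "fscale (x p) (w p):V" "w p:V" using insert fs.subspace_scale[OF V] by auto
  have S: "S:V" using insert unfolding S_def by blast
  have "B S u = (SUM p:I. x p*B (w p) u) & B u S = (SUM p:I. x p*B u (w p))"
   unfolding S_def by (rule insert.IH) (use insert.prems in blast)+
  moreover have "B (fscale (x p) (w p) + S) u = x p*B (w p) u + B S u &
   B u (fscale (x p) (w p) + S) = x p*B u (w p) + B u S" using B u m S unfolding bilinear_on_def by metis
  ultimately show ?case by (simp only: sum.insert[OF insert.hyps(1,2)] S_def)
 qed auto
 then show "B (SUM p:I. fscale (x p) (w p)) u = (SUM p:I. x p*B (w p) u)"
  "B u (SUM p:I. fscale (x p) (w p)) = (SUM p:I. x p*B u (w p))" by auto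
qed

lemma form_kernel_subspace:
 assumes V: "fs.subspace V" and B: "bilinear_on V B"
 shows "fs.subspace (form_kernel V B)"
proof (rule fs.subspaceI)
 show "0:form_kernel V B" using fs.subspace_0[OF V] B unfolding form_kernel_def bilinear_on_def
  by (auto, metis fs.scale_zero_left mult_zero_left)
qed (use V B in \<open>auto simp: form_kernel_def bilinear_on_def fs.subspace_add fs.subspace_scale\<close>)

lemma gram_kernel:
 assumes I: "finite I" and B: "bilinear_on (fs.span (w ` I)) B"
 shows "(SUM p:I. fscale (x p) (w p)):form_kernel (fs.span (w ` I)) B \<longleftrightarrow> (ALL q:I. (SUM p:I. x p*B (w p) (w q)) = 0)"
proof -
 let ?V = "fs.span (w ` I)"
 have w: "w p:?V" if "p:I" for p using that fs.span_base by blast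
 note V = fs.subspace_span[of "w ` I"]
 have v: "(SUM p:I. fscale (x p) (w p)):?V" by (intro fs.span_sum fs.span_scale w)
 have "(ALL u:?V. B (SUM p:I. fscale (x p) (w p)) u = 0) \<longleftrightarrow> (ALL q:I. B (SUM p:I. fscale (x p) (w p)) (w q) = 0)"
 proof (intro iffI ballI)
  fix u assume h: "ALL q:I. B (SUM p:I. fscale (x p) (w p)) (w q) = 0" and u: "u:?V"
  obtain y where "u = (SUM p:I. fscale (y p) (w p))" by (rule span_family[OF I u])
  then have "B (SUM p:I. fscale (x p) (w p)) u = (SUM q:I. y q*B (SUM p:I. fscale (x p) (w p)) (w q))"
   using bilinear_on_sum(2)[where x=y, OF V B w v, of I] by simp
  then show "B (SUM p:I. fscale (x p) (w p)) u = 0" using h by simp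
 qed (use w in auto)
 then show ?thesis using v w bilinear_on_sum(1)[where x=x, OF V B w, of I] by (simp add: form_kernel_def)
qed

text \<open>\<open>N\<close> is upper bidiagonal with nonzero diagonal. The equations of the columns
  k + c give the first half of \<open>x\<close> by forward substitution, those of the columns below
  k the second half by backward substitution.\<close>

lemma off_diagonal_null:
 assumes al: "al ~= 0" and N: "!!a c. N a c = (if a = c then al else if c = Suc a then be else 0)"
  and x: "!!b. b < 2*k ==> (SUM a<2*k. x a * off_diagonal_form k N a b) = 0" and a: "a < 2*k"
 shows "x a = 0"
proof -
 have lo: "x c = 0" if "c < k" for c using that
 proof (induction c)
  case 0
  have "x a * off_diagonal_form k N a (k + 0) = (if a = 0 then al*x 0 else 0)" if "a < 2*k" for a
   using 0 by (auto simp: off_diagonal_form_def N)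
  then have "(SUM a<2*k. x a * off_diagonal_form k N a (k + 0)) = (SUM a<2*k. if a = 0 then al*x 0 else 0)" by (intro sum.cong) auto
  also have "... = al*x 0" using 0 by simp
  finally show ?case using x[of "k + 0"] 0 al by simp
 next
  case (Suc c)
  have "x a * off_diagonal_form k N a (k + Suc c) = (if a = Suc c then al*x (Suc c) else 0) + (if a = c then be*x c else 0)"
   if "a < 2*k" for a using Suc.prems by (auto simp: off_diagonal_form_def N)
  then have "(SUM a<2*k. x a * off_diagonal_form k N a (k + Suc c))
   = (SUM a<2*k. (if a = Suc c then al*x (Suc c) else 0) + (if a = c then be*x c else 0))" by (intro sum.cong) auto
  also have "... = al*x (Suc c) + be*x c" using Suc.prems by (simp add: sum.distrib)
  finally show ?case using x[of "k + Suc c"] Suc al by simp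
 qed
 have hi: "x (k + b) = 0" if "b < k" for b using that
 proof (induction "k - b" arbitrary: b rule: less_induct)
  case less
  have "x a * off_diagonal_form k N a b = (if a = k + b then - al*x (k + b) else 0) + (if a = Suc (k + b) then - be*x (Suc (k + b)) else 0)"
   if "a < 2*k" for a using less.prems that by (auto simp: off_diagonal_form_def N)
  then have "(SUM a<2*k. x a * off_diagonal_form k N a b)
   = (SUM a<2*k. (if a = k + b then - al*x (k + b) else 0) + (if a = Suc (k + b) then - be*x (Suc (k + b)) else 0))"
   by (intro sum.cong) auto
  also have "... = - al*x (k + b) + (if Suc (k + b) < 2*k then - be*x (Suc (k + b)) else 0)"
   using less.prems by (simp add: sum.distrib)
  also have "(if Suc (k + b) < 2*k then - be*x (Suc (k + b)) else 0) = 0"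
   using less.hyps[of "Suc b"] less.prems by (auto simp: diff_less_mono2)
  finally show ?case using x[of b] less.prems al by simp
 qed
 show ?thesis
 proof (cases "a < k")
  case False
  then have "x (k + (a - k)) = 0" using a by (intro hi) auto
  then show ?thesis using False by simp
 qed (rule lo)
qed

definition block_pencil :: "complex => block => nat => nat => complex" where
 "block_pencil mu b i j = block_form1 b i j - mu*block_form2 b i j"

lemma off_diagonal_form_linear:
 "off_diagonal_form k M a b - mu * off_diagonal_form k N a b = off_diagonal_form k (%a b. M a b - mu*N a b) a b"
 by (simp add: off_diagonal_form_def)

text \<open>On a Jordan block the pencil is bidiagonal with diagonal e - mu, or 1 for the infinite
  eigenvalue; in both cases the diagonal is nonzero.\<close>

lemma jordan_null:
 assumes "\<not> is_Kronecker b" "!!k. b ~= Jordan k mu"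
  and x: "!!j. j < block_dim b ==> (SUM i<block_dim b. x i*block_pencil mu b i j) = 0" and a: "a < block_dim b"
 shows "x a = 0"
proof (cases b)
 case (Jordan k e)
 then show ?thesis using assms(2)[of k] x a
  by (intro off_diagonal_null[of "e - mu" "%a c. jordan_matrix e a c - mu*identity_matrix a c" 1 k x a])
   (auto simp: block_pencil_def off_diagonal_form_linear jordan_matrix_def identity_matrix_def)
next
 case (Jordan_infinity k)
 then show ?thesis using x a by (intro off_diagonal_null[of 1 "%a c. identity_matrix a c - mu*jordan_matrix 0 a c" "- mu" k x a])
   (auto simp: block_pencil_def off_diagonal_form_linear jordan_matrix_def identity_matrix_def)
qed (use assms(1) in auto)

lemma kronecker_sum_odd:
 assumes "2*l + 1 < 2*k - 1"
 shows "(SUM a<2*k - 1. x a*block_pencil mu (Kronecker k) a (2*l + 1)) = x (2*l) + mu*x (2*l + 2)"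
proof -
 have "x a*block_pencil mu (Kronecker k) a (2*l + 1)
  = (if a = 2*l then x (2*l) else 0) + (if a = 2*l + 2 then mu*x (2*l + 2) else 0)" for a by (auto simp: block_pencil_def)
 then have "(SUM a<2*k - 1. x a*block_pencil mu (Kronecker k) a (2*l + 1))
  = (SUM a<2*k - 1. (if a = 2*l then x (2*l) else 0) + (if a = 2*l + 2 then mu*x (2*l + 2) else 0))" by (rule sum.cong[OF refl])
 also have "... = x (2*l) + mu*x (2*l + 2)"
 proof -
  have "2*l + 2 < 2*k - 1" "2*l < 2*k - 1" using assms by presburger+
  then show ?thesis by (simp add: sum.distrib)
 qed
 finally show ?thesis .
qed

lemma kronecker_sum_even:
 assumes "2*l < 2*k - 1"
 shows "(SUM a<2*k - 1. x a*block_pencil mu (Kronecker k) a (2*l))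
  = - (if 2*l + 1 < 2*k - 1 then x (2*l + 1) else 0) - (if l = 0 then 0 else mu*x (2*l - 1))"
proof -
 have "x a*block_pencil mu (Kronecker k) a (2*l)
  = (if a = 2*l + 1 then - x (2*l + 1) else 0) + (if a = 2*l - 1 then (if l = 0 then 0 else - mu*x (2*l - 1)) else 0)" for a
  by (auto simp: block_pencil_def)
 then have "(SUM a<2*k - 1. x a*block_pencil mu (Kronecker k) a (2*l))
  = (SUM a<2*k - 1. (if a = 2*l + 1 then - x (2*l + 1) else 0) + (if a = 2*l - 1 then (if l = 0 then 0 else - mu*x (2*l - 1)) else 0))"
  by (rule sum.cong[OF refl])
 also have "... = - (if 2*l + 1 < 2*k - 1 then x (2*l + 1) else 0) - (if l = 0 then 0 else mu*x (2*l - 1))"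
  using assms by (auto simp add: sum.distrib)
 finally show ?thesis .
qed

text \<open>The columns of even index kill the odd coefficients one after another; those of odd
  index read x_(2l) = - mu x_(2l+2). So the kernel is a line parametrised by the top coefficient
  x_(2(k-1)), and at mu = 0 it is spanned by the last basis vector.\<close>

lemma kronecker_null_iff:
 assumes k: "0 < k"
 shows "(ALL b<2*k - 1. (SUM a<2*k - 1. x a*block_pencil mu (Kronecker k) a b) = 0) \<longleftrightarrow>
  (ALL a<2*k - 1. x a = (if even a then (- mu)^(k - 1 - a div 2)*x (2*(k - 1)) else 0))"
  (is "?null \<longleftrightarrow> ?sol")
proof
 assume n: ?null
 have odd: "x (2*l + 1) = 0" if "2*l + 1 < 2*k - 1" for l using that
 proof (induction l)
  case 0
  then show ?case using n[rule_format, of "2*0"] kronecker_sum_even[of 0 k x mu] by simp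
 next
  case (Suc l)
  then show ?case using n[rule_format, of "2*Suc l"] kronecker_sum_even[of "Suc l" k x mu] by simp
 qed
 have even: "x (2*(k - 1 - j)) = (- mu)^j*x (2*(k - 1))" if "j <= k - 1" for j using that
 proof (induction j)
  case (Suc j)
  define l where "l = k - 1 - Suc j"
  have l: "k - 1 - j = l + 1" "2*l + 1 < 2*k - 1" using Suc.prems by (auto simp: l_def)
  have "x (2*l) + mu*x (2*l + 2) = 0" using kronecker_sum_odd[OF l(2), of x mu] n l(2) by simp
  moreover have "x (2*l + 2) = (- mu)^j*x (2*(k - 1))" using Suc l(1) by simp
  ultimately have "x (2*l) = (- mu)^Suc j*x (2*(k - 1))" by (simp add: add_eq_0_iff2)
  then show ?case by (simp add: l_def)
 qed simp
 show ?sol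
 proof (intro allI impI)
  fix a assume a: "a < 2*k - 1"
  show "x a = (if even a then (- mu)^(k - 1 - a div 2)*x (2*(k - 1)) else 0)"
  proof (cases "even a")
   case True
   then obtain l where l: "a = 2*l" by blast
   have "k - 1 - (k - 1 - l) = l" "k - 1 - l <= k - 1" using a l by auto
   then show ?thesis using even[of "k - 1 - l"] l by simp
  next
   case False
   then obtain l where "a = 2*l + 1" using oddE by blast
   then show ?thesis using odd a by simp
  qed
 qed
next
 assume s: ?sol
 show ?null
 proof (intro allI impI)
  fix b assume b: "b < 2*k - 1"
  show "(SUM a<2*k - 1. x a*block_pencil mu (Kronecker k) a b) = 0"
  proof (cases "even b")
   case True
   then obtain l where l: "b = 2*l" by blast
   have "x (2*l - 1) = 0" if "l ~= 0"
   proof -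
    have "2*l - 1 < 2*k - 1" "odd (2*l - 1)" using that b l by auto
    then show ?thesis using s by auto
   qed
   moreover have "x (2*l + 1) = 0" if "2*l + 1 < 2*k - 1" using s that by auto
   ultimately show ?thesis using kronecker_sum_even[of l k x mu] b l by auto
  next
   case False
   then obtain l where l: "b = 2*l + 1" using oddE by blast
   have "x (2*l) = (- mu)^(k - 1 - l)*x (2*(k - 1))" using s[rule_format, of "2*l"] b l by simp
   moreover have "x (2*l + 2) = (- mu)^(k - 1 - (l + 1))*x (2*(k - 1))"
   proof -
    have "2*l + 2 < 2*k - 1" using b l by presburger
    then show ?thesis using s[rule_format, of "2*l + 2"] by simp
   qed
   moreover have "k - 1 - l = Suc (k - 1 - (l + 1))" using b l by simp
   ultimately show ?thesis using kronecker_sum_odd[of l k x mu] b l by simp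
  qed
 qed
qed

section \<open>The kernel of the pencil and the number of Kronecker blocks\<close>

definition decomposition_index :: "block list => (nat \<times> nat) set" where
 "decomposition_index bs = (SIGMA i:{..<length bs}. {..<block_dim (bs ! i)})"

lemma finite_decomposition_index [simp]: "finite (decomposition_index bs)" by (simp add: decomposition_index_def)

lemma sum_decomposition_index:
 assumes "j < length bs"
 shows "(SUM p:decomposition_index bs. if fst p = j then F (snd p) else 0) = (SUM a<block_dim (bs ! j). F a :: 'a::comm_monoid_add)"
proof -
 have "(SUM p:decomposition_index bs. if fst p = j then F (snd p) else 0)
  = (SUM i<length bs. SUM a<block_dim (bs ! i). if i = j then F a else 0)"
  unfolding decomposition_index_def by (subst sum.Sigma) (auto intro!: sum.cong simp: case_prod_beta)
 also have "... = (SUM i<length bs. if i = j then SUM a<block_dim (bs ! j). F a else 0)" by (intro sum.cong) auto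
 finally show ?thesis using assms by simp
qed

definition pencil_kernel_coeff :: "complex => block list => nat => nat \<times> nat => complex" where
 "pencil_kernel_coeff mu bs i p =
   (if fst p = i & even (snd p) then (- mu)^(block_index (bs ! i) - 1 - snd p div 2) else 0)"

text \<open>The form is block diagonal, so its kernel is found block by block: a line in each
  Kronecker block, and nothing in a Jordan block whose eigenvalue is not \<open>mu\<close>.
  \<open>z i\<close> is the kernel vector of block i with top coefficient 1.\<close>

lemma pencil_kernel:
 assumes B: "bilinear_on V B1" "bilinear_on V B2" and bs: "ALL b:set bs. 0 < block_index b" "!!k. Jordan k mu ~: set bs"
  and w: "independent_family (decomposition_index bs) w" "fs.span (w ` decomposition_index bs) = V"
  and gram: "!!p q. p:decomposition_index bs ==> q:decomposition_index bs ==>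
   B1 (w p) (w q) - mu*B2 (w p) (w q) = (if fst p = fst q then block_pencil mu (bs ! fst p) (snd p) (snd q) else 0)"
 defines "z \<equiv> %i. SUM p:decomposition_index bs. fscale (pencil_kernel_coeff mu bs i p) (w p)"
 defines "J \<equiv> {i. i < length bs & is_Kronecker (bs ! i)}"
 shows "form_kernel V (%u v. B1 u v - mu*B2 u v) = fs.span (z ` J)" "independent_family J z"
proof -
 let ?I = "decomposition_index bs" and ?B = "%u v. B1 u v - mu*B2 u v"
 let ?ze = "pencil_kernel_coeff mu bs"
 have "bilinear_on V ?B" using B unfolding bilinear_on_def by (simp add: algebra_simps)
 then have BV: "bilinear_on (fs.span (w ` ?I)) ?B" by (simp add: w(2))
 have finJ: "finite J" by (simp add: J_def)
 have top: "(i, 2*(block_index (bs ! i) - 1)):?I" "block_dim (bs ! i) = 2*block_index (bs ! i) - 1"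
  "bs ! i = Kronecker (block_index (bs ! i))" "0 < block_index (bs ! i)" if "i:J" for i
 proof -
  have i: "i < length bs" "is_Kronecker (bs ! i)" using that by (auto simp: J_def)
  show 1: "0 < block_index (bs ! i)" using bs(1) i(1) by simp
  show 2: "bs ! i = Kronecker (block_index (bs ! i))" using i(2) by (cases "bs ! i") auto
  show 3: "block_dim (bs ! i) = 2*block_index (bs ! i) - 1" by (subst 2) simp
  show "(i, 2*(block_index (bs ! i) - 1)):?I" using i 1 3 by (auto simp: decomposition_index_def)
 qed
 have ker: "(SUM p:?I. fscale (x p) (w p)):form_kernel V ?B \<longleftrightarrow>
  (ALL j<length bs. ALL b<block_dim (bs ! j). (SUM a<block_dim (bs ! j). x (j, a)*block_pencil mu (bs ! j) a b) = 0)" for x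
 proof -
  have "(SUM p:?I. x p*(B1 (w p) (w (j, b)) - mu*B2 (w p) (w (j, b))))
   = (SUM a<block_dim (bs ! j). x (j, a)*block_pencil mu (bs ! j) a b)" if "(j, b):?I" for j b
  proof -
   have "(SUM p:?I. x p*(B1 (w p) (w (j, b)) - mu*B2 (w p) (w (j, b))))
    = (SUM p:?I. if fst p = j then x (j, snd p)*block_pencil mu (bs ! j) (snd p) b else 0)"
    by (rule sum.cong[OF refl]) (use gram that in auto)
   also have "... = (SUM a<block_dim (bs ! j). x (j, a)*block_pencil mu (bs ! j) a b)"
    by (rule sum_decomposition_index) (use that in \<open>simp add: decomposition_index_def\<close>)
   finally show ?thesis .
  qed
  then show ?thesis using gram_kernel[OF _ BV, of x] w(2) by (auto simp: decomposition_index_def)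
 qed
 have null: "(ALL b<block_dim (bs ! j). (SUM a<block_dim (bs ! j). x a*block_pencil mu (bs ! j) a b) = 0) \<longleftrightarrow>
  (ALL a<block_dim (bs ! j). x a = (if even a then (- mu)^(block_index (bs ! j) - 1 - a div 2)*x (2*(block_index (bs ! j) - 1)) else 0))"
  if j: "j:J" for j x
 proof -
  obtain k where k: "bs ! j = Kronecker k" using top(3)[OF j] by blast
  have "0 < k" using top(4)[OF j] k by simp
  from kronecker_null_iff[OF this, of x mu] show ?thesis by (simp only: k block_dim.simps block_index.simps)
 qed
 have zker: "z i:form_kernel V ?B" if i: "i:J" for i unfolding z_def
 proof (subst ker, intro allI impI)
  fix j b assume jb: "j < length bs" "b < block_dim (bs ! j)"
  show "(SUM a<block_dim (bs ! j). ?ze i (j, a)*block_pencil mu (bs ! j) a b) = 0"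
  proof (cases "i = j")
   case True
   have "ALL a<block_dim (bs ! j). ?ze i (j, a) = (if even a then (- mu)^(block_index (bs ! j) - 1 - a div 2)*?ze i (j, 2*(block_index (bs ! j) - 1)) else 0)"
    using True by (auto simp: pencil_kernel_coeff_def)
   then show ?thesis using null[of j "%a. ?ze i (j, a)"] i True jb by blast
  qed (simp add: pencil_kernel_coeff_def)
 qed
 have sumz: "(SUM i:J. fscale (y i) (z i)) = (SUM p:?I. fscale (SUM i:J. y i*?ze i p) (w p))" for y
 proof -
  have "(SUM i:J. fscale (y i) (z i)) = (SUM i:J. SUM p:?I. fscale (y i*?ze i p) (w p))"
   unfolding z_def by (simp only: fs.scale_sum_right fs.scale_scale)
  also have "... = (SUM p:?I. fscale (SUM i:J. y i*?ze i p) (w p))" by (subst sum.swap) (simp only: fs.scale_sum_left)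
  finally show ?thesis .
 qed
 have coef: "(SUM i:J. y i*?ze i (j, a)) = (if j:J & even a then y j*(- mu)^(block_index (bs ! j) - 1 - a div 2) else 0)" for y j a
 proof -
  have "(SUM i:J. y i*?ze i (j, a)) = (SUM i:J. if i = j then (if even a then y j*(- mu)^(block_index (bs ! j) - 1 - a div 2) else 0) else 0)"
   by (rule sum.cong) (auto simp: pencil_kernel_coeff_def)
  also have "... = (if j:J then (if even a then y j*(- mu)^(block_index (bs ! j) - 1 - a div 2) else 0) else 0)"
   by (rule sum.delta[OF finJ])
  finally show ?thesis by simp
 qed
 have "v:fs.span (z ` J)" if v: "v:form_kernel V ?B" for v
 proof -
  have "v:fs.span (w ` ?I)" using v w(2) by (simp add: form_kernel_def)
  then obtain x where x: "v = (SUM p:?I. fscale (x p) (w p))" by (rule span_family[rotated]) simp_all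
  define y where "y = (%i. x (i, 2*(block_index (bs ! i) - 1)))"
  have k: "ALL j<length bs. ALL b<block_dim (bs ! j). (SUM a<block_dim (bs ! j). x (j, a)*block_pencil mu (bs ! j) a b) = 0"
   using v unfolding x ker .
  have "x p = (SUM i:J. y i*?ze i p)" if p: "p:?I" for p
  proof -
   obtain j a where ja: "p = (j, a)" "j < length bs" "a < block_dim (bs ! j)" using p by (auto simp: decomposition_index_def)
   show ?thesis
   proof (cases "j:J")
    case True
    then have "x (j, a) = (if even a then (- mu)^(block_index (bs ! j) - 1 - a div 2)*y j else 0)"
     using null[OF True, of "%a. x (j, a)"] k ja unfolding y_def by blast
    then show ?thesis using True by (simp add: ja(1) coef)
   next
    case False
    have "bs ! j:set bs" using ja by simp
    then have "bs ! j ~= Jordan k mu" for k using bs(2)[of k] by auto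
    moreover have "\<not> is_Kronecker (bs ! j)" using False ja(2) by (simp add: J_def)
    ultimately have "x (j, a) = 0" using k ja(2,3) by (intro jordan_null[of "bs ! j" mu "%a. x (j, a)" a]) auto
    then show ?thesis using False by (simp add: ja(1) coef)
   qed
  qed
  then have "v = (SUM i:J. fscale (y i) (z i))" unfolding x sumz by (intro sum.cong) auto
  moreover have "(SUM i:J. fscale (y i) (z i)):fs.span (z ` J)" by (intro fs.span_sum fs.span_scale fs.span_base imageI)
  ultimately show ?thesis by simp
 qed
 moreover have "fs.subspace (form_kernel V ?B)" using form_kernel_subspace[OF fs.subspace_span BV] w(2) by simp
 then have "fs.span (z ` J) <= form_kernel V ?B" by (intro fs.span_minimal) (use zker in blast)+
 ultimately show "form_kernel V ?B = fs.span (z ` J)" by blast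
 show "independent_family J z" unfolding independent_family_iff[OF finJ]
 proof (intro allI impI ballI)
  fix y i assume y: "(SUM i:J. fscale (y i) (z i)) = 0" and i: "i:J"
  then have "(SUM p:?I. fscale (SUM i:J. y i*?ze i p) (w p)) = 0" by (simp only: sumz)
  then have "ALL p:?I. (SUM i:J. y i*?ze i p) = 0"
   using w(1)[unfolded independent_family_iff[OF finite_decomposition_index], rule_format, of "%p. SUM i:J. y i*?ze i p"] by blast
  from this[rule_format, OF top(1)[OF i]] show "y i = 0" using i by (simp add: coef)
 qed
qed

lemma block_decompositionE:
 assumes "block_decomposition V B1 B2 bs"
 obtains w where "ALL b:set bs. 0 < block_index b" "independent_family (decomposition_index bs) w"
  "fs.span (w ` decomposition_index bs) = V"
  "ALL p:decomposition_index bs. ALL q:decomposition_index bs.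
   B1 (w p) (w q) = (if fst p = fst q then block_form1 (bs ! fst p) (snd p) (snd q) else 0) &
   B2 (w p) (w q) = (if fst p = fst q then block_form2 (bs ! fst p) (snd p) (snd q) else 0)"
 using assms unfolding block_decomposition_def Let_def decomposition_index_def[symmetric] by (auto simp: case_prod_beta split_beta)

lemma dim_pencil_kernel:
 assumes B: "bilinear_on V B1" "bilinear_on V B2" and bs: "block_decomposition V B1 B2 bs" and mu: "!!k. Jordan k mu ~: set bs"
 shows "fs.dim (form_kernel V (%u v. B1 u v - mu*B2 u v)) = length (filter is_Kronecker bs)"
proof -
 obtain w where w: "ALL b:set bs. 0 < block_index b" "independent_family (decomposition_index bs) w"
  "fs.span (w ` decomposition_index bs) = V"
  "ALL p:decomposition_index bs. ALL q:decomposition_index bs.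
   B1 (w p) (w q) = (if fst p = fst q then block_form1 (bs ! fst p) (snd p) (snd q) else 0) &
   B2 (w p) (w q) = (if fst p = fst q then block_form2 (bs ! fst p) (snd p) (snd q) else 0)" by (rule block_decompositionE[OF bs])
 have g: "B1 (w p) (w q) - mu*B2 (w p) (w q) = (if fst p = fst q then block_pencil mu (bs ! fst p) (snd p) (snd q) else 0)"
  if "p:decomposition_index bs" "q:decomposition_index bs" for p q using w(4) that by (simp add: block_pencil_def)
 define z where "z = (%i. SUM p:decomposition_index bs. fscale (pencil_kernel_coeff mu bs i p) (w p))"
 define J where "J = {i. i < length bs & is_Kronecker (bs ! i)}"
 have "form_kernel V (%u v. B1 u v - mu*B2 u v) = fs.span (z ` J)" "independent_family J z" unfolding z_def J_def
  by (rule pencil_kernel[where ?B1.0=B1 and ?B2.0=B2 and bs=bs and w=w and mu=mu, OF B w(1) mu w(2,3)], fact g)+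
 moreover have "finite J" by (simp add: J_def)
 ultimately show ?thesis using dim_span_family[of J z] by (simp only: length_filter_conv_card J_def)
qed

text \<open>For \<open>mu\<close> away from the finitely many eigenvalues of two decompositions, the
  dimension of the kernel of the pencil is the number of Kronecker blocks of either. On this much
  uniqueness rests the \<open>THE\<close> in \<open>kronecker_count\<close>.\<close>

lemma kronecker_count_eq:
 assumes B: "bilinear_on V B1" "bilinear_on V B2" and bs: "block_decomposition V B1 B2 bs"
 shows "kronecker_count V B1 B2 = length (filter is_Kronecker bs)" unfolding kronecker_count_def
proof (rule the_equality)
 show "EX bs'. block_decomposition V B1 B2 bs' & length (filter is_Kronecker bs) = length (filter is_Kronecker bs')" using bs by blast
next
 fix s assume "EX bs'. block_decomposition V B1 B2 bs' & s = length (filter is_Kronecker bs')"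
 then obtain bs' where bs': "block_decomposition V B1 B2 bs'" "s = length (filter is_Kronecker bs')" by blast
 \<comment> \<open>The value 0 for the other blocks excludes at most one more
   \<open>mu\<close>.\<close>
 define E where "E = (%b. case b of Jordan k e => e | _ => 0) ` (set bs \<union> set bs')"
 obtain mu where "mu ~: E" using ex_new_if_finite[of E] infinite_UNIV_char_0 by (auto simp: E_def)
 then have "Jordan k mu ~: set bs" "Jordan k mu ~: set bs'" for k by (force simp: E_def)+
 then show "s = length (filter is_Kronecker bs)" using dim_pencil_kernel[OF B bs, of mu] dim_pencil_kernel[OF B bs'(1), of mu] bs'(2) by simp
qed

lemma bilinear_on_diff:
 assumes V: "fs.subspace V" and B: "bilinear_on V B" and m: "a:V" "b:V" "u:V"
 shows "B (a - b) u = B a u - B b u"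
proof -
 have "B (a - b + b) u = B (a - b) u + B b u" using B m fs.subspace_diff[OF V m(1,2)] unfolding bilinear_on_def by blast
 then show ?thesis by simp
qed

text \<open>W is the span of the vectors with even index in all Kronecker blocks, and N its dimension.\<close>
locale lenard_space =
 fixes V :: "('x => complex) set" and B1 B2 :: "('x => complex) => ('x => complex) => complex"
  and W T K :: "('x => complex) set" and s N :: nat
 assumes V: "fs.subspace V" and B: "bilinear_on V B1" "bilinear_on V B2" and W: "finite T" "W = fs.span T" "fs.dim W = N" "W <= V"
  and K: "finite K" "form_kernel V B1 = fs.span K" "fs.dim (fs.span K) = s" "form_kernel V B1 <= W"
  and shift: "!!u. u:W ==> EX u':W. ALL v:V. B2 u v = - B1 u' v"
  and isotropic: "!!u v. u:W ==> v:W ==> B2 u v = 0"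
  and minimal: "!!S. fs.subspace S ==> form_kernel V B1 <= S ==>
   (!!x x'. x:S ==> x':V ==> ALL v:V. B2 x v = - B1 x' v ==> x':S) ==> W <= S"
begin

text \<open>A shift is unique up to the kernel of \<open>B1\<close>, which lies in \<open>W\<close>;
  so every shift of a vector of \<open>W\<close> stays in \<open>W\<close>, not just the one
  provided by \<open>shift\<close>.\<close>

lemma shift_mem:
 assumes u: "u:W" and x: "x:V" "ALL v:V. B2 u v = - B1 x v"
 shows "x:W"
proof -
 obtain u' where u': "u':W" "ALL v:V. B2 u v = - B1 u' v" using shift[OF u] by blast
 have "u':V" using u' W(4) by blast
 then have "x - u':form_kernel V B1" using bilinear_on_diff[OF V B(1) x(1), of u'] x u' fs.subspace_diff[OF V x(1)]
  by (simp add: form_kernel_def)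
 then have "x - u' + u':W" using K(4) u'(1) fs.span_add[of _ T] by (auto simp only: W(2))
 then show ?thesis by simp
qed

lemma chain_mem:
 assumes "u 0:form_kernel V B1" "!!i. u i:V" "!!i. i < p ==> ALL v:V. B2 (u i) v = - B1 (u (Suc i)) v"
 shows "i <= p ==> u i:W"
proof (induction i)
 case 0
 then show ?case using assms(1) K(4) by blast
next
 case (Suc i)
 then show ?case using shift_mem[of "u i" "u (Suc i)"] assms by simp
qed

lemma spans:
 assumes "independent_family I w" "w ` I <= W" "card I = N"
 shows "fs.span (w ` I) = W" using independent_family_spans[of I w T] assms W by simp

text \<open>Take lengths \<open>k\<close> with independent members and greatest total. Prolonging
  any chain by one member then gives a dependent family, so the span contains all next members and
  is closed under shifts; minimality of \<open>W\<close> gives equality.\<close>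

lemma select:
 fixes u :: "nat => nat => 'x => complex"
 assumes u0: "!!t. t < s ==> u t 0:form_kernel V B1" "independent_family {..<s} (%t. u t 0)"
  and uV: "!!t i. t < s ==> u t i:V"
  and us: "!!t i. t < s ==> ALL v:V. B2 (u t i) v = - B1 (u t (Suc i)) v"
 shows "EX k. independent_family (SIGMA t:{..<s}. {..k t}) (%(t, i). u t i) & (SUM t<s. k t + 1) = N"
proof -
 define I where "I = (%k::nat => nat. SIGMA t:{..<s}. {..k t})"
 define U where "U = (%(t, i). u t i)"
 have finI: "finite (I k)" for k by (simp add: I_def)
 have cardI: "card (I k) = (SUM t<s. k t + 1)" for k by (simp add: I_def)
 have UW: "U ` I k <= W" for k using chain_mem[of "u t" i i for t i] u0(1) uV us by (auto simp: I_def U_def)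
 have UV: "U p:V" if "p:I k" for p k using UW[of k] W(4) that by blast
 have "independent_family (I (%_. 0)) U"
 proof -
  have "U (t, 0) = u t 0" for t by (simp add: U_def)
  moreover have "I (%_. 0) = (%t. (t, 0)) ` {..<s}" by (auto simp: I_def)
  moreover have "inj_on U ((%t. (t, 0)) ` {..<s})" using u0(2) unfolding independent_family_def inj_on_def by (auto simp: U_def)
  ultimately show ?thesis using u0(2) unfolding independent_family_def by (simp add: image_image)
 qed
 moreover have bnd: "(SUM t<s. k t + 1) <= card T" if "independent_family (I k) U" for k
  using card_independent_family_le(2)[OF that _ W(1)] UW[of k] W(2) by (simp only: cardI)
 ultimately have "EX k. independent_family (I k) U & (ALL k'. independent_family (I k') U --> (SUM t<s. k' t + 1) <= (SUM t<s. k t + 1))"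
  by (intro ex_has_greatest_nat[where b="Suc (card T)"]) (auto intro: le_imp_less_Suc)
 then obtain k where k: "independent_family (I k) U"
  and mx: "!!k'. independent_family (I k') U ==> (SUM t<s. k' t + 1) <= (SUM t<s. k t + 1)" by blast
 define S where "S = fs.span (U ` I k)"
 have SW: "S <= W" unfolding S_def W(2) by (rule fs.span_minimal) (use UW[of k] W(2) in auto)
 have next_mem: "u t (Suc i):S" if ti: "(t, i):I k" for t i
 proof (cases "i < k t")
  case True
  then have "(t, Suc i):I k" using ti by (auto simp: I_def)
  then have "U (t, Suc i):S" unfolding S_def by (intro fs.span_base imageI)
  then show ?thesis by (simp add: U_def)
 next
  case False
  then have i: "i = k t" "t < s" using ti by (auto simp: I_def)
  define k' where "k' = k(t := Suc (k t))"
  have "I k' = insert (t, Suc i) (I k)" using i by (auto simp: I_def k'_def split: if_splits)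
  moreover have "(SUM t<s. k t + 1) < (SUM t<s. k' t + 1)" by (rule sum_strict_mono_ex1) (use i in \<open>auto simp: k'_def\<close>)
  then have "\<not> independent_family (I k') U" using mx[of k'] by auto
  ultimately have "U (t, Suc i):S" unfolding S_def using independent_family_insert[OF k, of "(t, Suc i)"] by auto
  then show ?thesis by (simp add: U_def)
 qed
 have kerS: "form_kernel V B1 <= S"
 proof -
  have "fs.span ((%t. u t 0) ` {..<s}) = form_kernel V B1" using independent_family_spans[OF u0(2), of K] u0(1) K by auto
  moreover have "u t 0:S" if "t < s" for t
  proof -
   have "(t, 0):I k" using that by (simp add: I_def)
   then have "U (t, 0):S" unfolding S_def by (intro fs.span_base imageI)
   then show ?thesis by (simp add: U_def)
  qed
  then have "fs.span ((%t. u t 0) ` {..<s}) <= S" by (intro fs.span_minimal) (auto simp: S_def)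
  ultimately show ?thesis by simp
 qed
 have "W <= S"
 proof (rule minimal[OF _ kerS])
  show "fs.subspace S" by (simp add: S_def)
  fix x x' assume x: "x:S" "x':V" "ALL v:V. B2 x v = - B1 x' v"
  obtain c where c: "x = (SUM p:I k. fscale (c p) (U p))" using x(1) unfolding S_def by (rule span_family[OF finI])
  \<comment> \<open>A shift of a combination is, up to the kernel, the combination of the next
    members of the chains.\<close>
  define y where "y = (SUM p:I k. fscale (c p) (u (fst p) (Suc (snd p))))"
  have yS: "y:S" unfolding y_def
  proof (rule fs.subspace_sum)
   show "fs.subspace S" by (simp add: S_def)
   show "fscale (c p) (u (fst p) (Suc (snd p))):S" if "p:I k" for p
    using next_mem[of "fst p" "snd p"] that unfolding S_def by (intro fs.span_scale) simp
  qed
  then have yV: "y:V" using SW W(4) by blast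
  have "B1 y v = B1 x' v" if v: "v:V" for v
  proof -
   have "B1 y v = (SUM p:I k. c p*B1 (u (fst p) (Suc (snd p))) v)"
    unfolding y_def by (rule bilinear_on_sum(1)[OF V B(1) _ v]) (auto simp: I_def intro: uV)
   also have "... = (SUM p:I k. - (c p*B2 (U p) v))" by (rule sum.cong[OF refl]) (use us v in \<open>auto simp: I_def U_def\<close>)
   also have "... = - B2 x v" unfolding c using bilinear_on_sum(1)[where x=c and w=U and I="I k", OF V B(2) UV v] by (simp add: sum_negf)
   finally show ?thesis using x(3) v by simp
  qed
  then have "x' - y:form_kernel V B1" using bilinear_on_diff[OF V B(1) x(2) yV] fs.subspace_diff[OF V x(2) yV] by (simp add: form_kernel_def)
  then have "x' - y + y:S" using kerS yS unfolding S_def by (intro fs.span_add) auto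
  then show "x':S" by simp
 qed
 then have "S = W" using SW by blast
 then have "card (I k) = N" using dim_span_family[OF finI k] W(3) by (simp add: S_def)
 then show ?thesis using k unfolding I_def U_def cardI by auto
qed

end

text \<open>A shift lowers the even index by 2: w_(2l+2) goes to w_(2l), and w_0 to 0 since it lies
  in the kernel of the second form. The kernel of the first form is spanned by the top vectors, so
  repeated shifts from it reach every vector of even index, which is minimality.\<close>

lemma kronecker_lenard_space:
 assumes B: "bilinear_on V B1" "bilinear_on V B2" and ks: "block_decomposition V B1 B2 (map Kronecker ks)"
 obtains W T K where "lenard_space V B1 B2 W T K (length ks) (sum_list ks)"
proof -
 let ?bs = "map Kronecker ks"
 let ?I = "decomposition_index ?bs"
 obtain w where w: "ALL b:set ?bs. 0 < block_index b" "independent_family ?I w" "fs.span (w ` ?I) = V"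
  "ALL p:?I. ALL q:?I.
   B1 (w p) (w q) = (if fst p = fst q then block_form1 (?bs ! fst p) (snd p) (snd q) else 0) &
   B2 (w p) (w q) = (if fst p = fst q then block_form2 (?bs ! fst p) (snd p) (snd q) else 0)" by (rule block_decompositionE[OF ks])
 have mem: "(i, a):?I \<longleftrightarrow> i < length ks & a < 2*ks ! i - 1" for i a by (auto simp: decomposition_index_def)
 have pos: "0 < ks ! i" if "i < length ks" for i using w(1) that by auto
 have gram: "B1 (w (i, a)) (w (j, b)) = (if i = j then if even a & b = Suc a then 1 else if even b & a = Suc b then -1 else 0 else 0)"
  "B2 (w (i, a)) (w (j, b)) = (if i = j then if odd a & b = Suc a then 1 else if odd b & a = Suc b then -1 else 0 else 0)"
  if "(i, a):?I" "(j, b):?I" for i a j b using w(4)[rule_format, OF that] that by (auto simp: mem)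
 have V: "fs.subspace V" using w(3) fs.subspace_span by metis
 have wV: "w p:V" if "p:?I" for p using that w(3) fs.span_base by blast
 have on_basis: "ALL v:V. F v = G v" if F: "!!j b. (j, b):?I ==> F (w (j, b)) = G (w (j, b))"
  and F1: "!!x. F (SUM p:?I. fscale (x p) (w p)) = (SUM p:?I. x p*F (w p))"
  and G1: "!!x. G (SUM p:?I. fscale (x p) (w p)) = (SUM p:?I. x p*G (w p))" for F G :: "('a => complex) => complex"
 proof
  fix v assume "v:V"
  then have "v:fs.span (w ` ?I)" by (simp only: w(3))
  then obtain x where x: "v = (SUM p:?I. fscale (x p) (w p))" by (rule span_family[rotated]) simp_all
  show "F v = G v" unfolding x F1 G1 by (rule sum.cong[OF refl]) (use F in auto)
 qed
 \<comment> \<open>Both sides are linear in \<open>v\<close>, so they need only be compared on the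
   basis.\<close>
 have rel: "ALL v:V. B2 (w (i, a)) v = - B1 u v"
  if a: "(i, a):?I" and u: "u:V" and g: "!!j b. (j, b):?I ==> B2 (w (i, a)) (w (j, b)) = - B1 u (w (j, b))" for i a u
  by (rule on_basis[where F="B2 (w (i, a))" and G="%v. - B1 u v", OF g])
   (simp_all add: bilinear_on_sum(2)[OF V B(2) wV wV[OF a]] bilinear_on_sum(2)[OF V B(1) wV u] sum_negf)
 have B10: "B1 0 v = 0" if "v:V" for v using form_kernel_subspace[OF V B(1)] fs.subspace_0 that by (fastforce simp: form_kernel_def)
 have zero: "ALL v:V. B2 (w (i, 0)) v = - B1 0 v" if i: "(i, 0):?I" for i
  by (rule rel[OF i fs.subspace_0[OF V]]) (use gram(2)[OF i] B10 wV in auto)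
 have lower: "ALL v:V. B2 (w (i, 2*Suc l)) v = - B1 (w (i, 2*l)) v" if i: "(i, 2*Suc l):?I" for i l
 proof (rule rel[OF i])
  have i': "(i, 2*l):?I" using i by (simp add: mem)
  show "w (i, 2*l):V" by (rule wV[OF i'])
  show "B2 (w (i, 2*Suc l)) (w (j, b)) = - B1 (w (i, 2*l)) (w (j, b))" if "(j, b):?I" for j b
   unfolding gram(1)[OF i' that] gram(2)[OF i that] by (auto; presburger)
 qed
 \<comment> \<open>A block of dimension 2k - 1 has k vectors of even index, which makes the
   dimension of \<open>W\<close> equal to \<open>sum_list ks\<close>.\<close>
 define E where "E = (SIGMA i:{..<length ks}. {..<ks ! i})"
 define f :: "nat \<times> nat => nat \<times> nat" where "f = (%(i, l). (i, 2*l))"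
 have fE: "f ` E <= ?I" by (auto simp: E_def f_def mem)
 have fin: "finite E" by (simp add: E_def)
 define T where "T = w ` f ` E"
 define W where "W = fs.span T"
 have TV: "T <= V" using fE wV by (auto simp: T_def)
 have WV: "W <= V" unfolding W_def by (rule fs.span_minimal[OF TV V])
 have wW: "w (i, 2*l):W" if "i < length ks" "l < ks ! i" for i l
 proof -
  have "f (i, l):f ` E" using that by (intro imageI) (simp add: E_def)
  then show ?thesis unfolding W_def T_def by (intro fs.span_base) (auto simp: f_def)
 qed
 have dimW: "fs.dim W = sum_list ks"
 proof -
  have "inj_on f E" by (auto simp: inj_on_def f_def)
  then have "card (f ` E) = sum_list ks" by (simp add: card_image E_def sum_list_sum_nth atLeast0LessThan)
  then show ?thesis unfolding W_def T_def using dim_span_family[OF finite_imageI[OF fin] independent_family_subset[OF w(2) fE]] by simp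
 qed
 define z where "z = (%i. SUM p:?I. fscale (pencil_kernel_coeff 0 ?bs i p) (w p))"
 define J where "J = {i. i < length ?bs & is_Kronecker (?bs ! i)}"
 have J: "J = {..<length ks}" by (auto simp: J_def)
 have ker: "form_kernel V (%u v. B1 u v - 0*B2 u v) = fs.span (z ` J)" "independent_family J z" unfolding z_def J_def
  by (rule pencil_kernel[where ?B1.0=B1 and ?B2.0=B2 and bs="?bs" and w=w and mu=0, OF B w(1) _ w(2,3)];
   use w(4) in \<open>auto simp: block_pencil_def\<close>)+
 have z: "z i = w (i, 2*(ks ! i - 1))" if i: "i < length ks" for i
 proof -
  let ?q = "(i, 2*(ks ! i - 1))"
  have q: "?q:?I" using i pos[OF i] by (auto simp: mem)
  have "fscale (pencil_kernel_coeff 0 ?bs i p) (w p) = (if p = ?q then w ?q else 0)" if p: "p:?I" for p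
  proof (cases "p = ?q")
   case True
   then show ?thesis using i by (simp add: pencil_kernel_coeff_def)
  next
   case False
   then have "\<not> (fst p = i & even (snd p) & ks ! i - 1 - snd p div 2 = 0)" using p by (cases p) (auto simp: mem elim!: evenE)
   then have "pencil_kernel_coeff 0 ?bs i p = 0" using i by (auto simp: pencil_kernel_coeff_def)
   then show ?thesis using False by simp
  qed
  then have "z i = (SUM p:?I. if p = ?q then w ?q else 0)" unfolding z_def by (rule sum.cong[OF refl])
  also have "... = w ?q" using sum.delta[OF finite_decomposition_index, of ?q "%_. w ?q"] q by simp
  finally show ?thesis .
 qed
 have ker': "form_kernel V B1 = fs.span (z ` J)" using ker(1) by simp
 have zW: "z i:W" if "i:J" for i using that z wW pos by (simp add: J)
 have kerW: "form_kernel V B1 <= W" unfolding ker' W_def by (rule fs.span_minimal) (use zW W_def in auto)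
 have "lenard_space V B1 B2 W T (z ` J) (length ks) (sum_list ks)"
 proof
  show "fs.subspace V" "bilinear_on V B1" "bilinear_on V B2" "W = fs.span T" "fs.dim W = sum_list ks" "W <= V"
   "form_kernel V B1 = fs.span (z ` J)" "form_kernel V B1 <= W" by (rule V B W_def dimW WV ker' kerW)+
  show "finite T" "finite (z ` J)" using fin by (auto simp: T_def J)
  show "fs.dim (fs.span (z ` J)) = length ks" using dim_span_family[OF _ ker(2)] by (simp add: J del: fs.dim_span)
  have "u:V & (EX u':W. ALL v:V. B2 u v = - B1 u' v)" if u: "u:W" for u using u unfolding W_def
  proof (induction u rule: fs.span_induct_alt)
   case base
   have "ALL v:V. B2 0 v = - B1 0 v" using B10 form_kernel_subspace[OF V B(2)] fs.subspace_0 by (fastforce simp: form_kernel_def)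
   then show ?case using fs.span_zero fs.subspace_0[OF V] by blast
  next
   case (step c x y)
   then obtain y' where y': "y':fs.span T" "ALL v:V. B2 y v = - B1 y' v" by blast
   obtain i l where il: "x = w (i, 2*l)" "i < length ks" "l < ks ! i" using step(1) by (auto simp: T_def E_def f_def)
   have "EX x':W. ALL v:V. B2 x v = - B1 x' v"
   proof (cases l)
    case 0
    then have "ALL v:V. B2 x v = - B1 0 v" using zero[of i] il by (simp add: mem)
    then show ?thesis using fs.span_zero unfolding W_def by blast
   next
    case (Suc m)
    then have "ALL v:V. B2 x v = - B1 (w (i, 2*m)) v" using lower[of i m] il by (simp add: mem)
    then show ?thesis using wW[of i m] il Suc by (intro bexI[of _ "w (i, 2*m)"]) auto
   qed
   then obtain x' where x': "x':fs.span T" "ALL v:V. B2 x v = - B1 x' v" unfolding W_def by blast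
   have m: "x:V" "y:V" "x':V" "y':V" using step x' y' TV WV[unfolded W_def] by blast+
   have "B2 (fscale c x + y) v = - B1 (fscale c x' + y') v" if v: "v:V" for v
   proof -
    have "B2 (fscale c x + y) v = c*B2 x v + B2 y v" "B1 (fscale c x' + y') v = c*B1 x' v + B1 y' v"
     using B m v fs.subspace_scale[OF V m(1), of c] fs.subspace_scale[OF V m(3), of c] unfolding bilinear_on_def by metis+
    then show ?thesis using x'(2) y'(2) v by (simp add: algebra_simps)
   qed
   moreover have "fscale c x' + y':fs.span T" by (intro fs.span_add fs.span_scale x' y')
   moreover have "fscale c x + y:V" by (intro fs.subspace_add[OF V] fs.subspace_scale[OF V] m)
   ultimately show ?case by blast
  qed
  then show "EX u':W. ALL v:V. B2 u v = - B1 u' v" if "u:W" for u using that by blast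
  show "B2 u v = 0" if uv: "u:W" "v:W" for u v
  proof -
   have WE: "W = fs.span ((w \<circ> f) ` E)" by (simp add: W_def T_def image_comp)
   obtain x where x: "u = (SUM p:E. fscale (x p) ((w \<circ> f) p))" using uv(1) unfolding WE by (rule span_family[OF fin])
   obtain y where y: "v = (SUM p:E. fscale (y p) ((w \<circ> f) p))" using uv(2) unfolding WE by (rule span_family[OF fin])
   have wf: "(w \<circ> f) p:V" if "p:E" for p unfolding o_apply by (rule wV) (use fE that in blast)
   have "B2 ((w \<circ> f) p) ((w \<circ> f) q) = 0" if "p:E" "q:E" for p q
   proof -
    have "(fst p, 2 * snd p):?I" "(fst q, 2 * snd q):?I" using that by (auto simp: mem E_def)
    from gram(2)[OF this] show ?thesis by (simp add: f_def case_prod_beta)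
   qed
   then have "B2 ((w \<circ> f) p) v = 0" if "p:E" for p
    unfolding y using bilinear_on_sum(2)[where x=y and w="w \<circ> f" and I=E, OF V B(2) wf wf[OF that]] that by simp
   then show ?thesis unfolding x using bilinear_on_sum(1)[where x=x and w="w \<circ> f" and I=E, OF V B(2) wf, of v] uv WV by auto
  qed
  show "W <= S" if S: "fs.subspace S" "form_kernel V B1 <= S"
   "!!x x'. x:S ==> x':V ==> ALL v:V. B2 x v = - B1 x' v ==> x':S" for S
   unfolding W_def
  proof (rule fs.span_minimal[OF _ S(1)])
   \<comment> \<open>Descend from the kernel vector at the top by \<open>lower\<close>, two indices
     at a time.\<close>
   have top_down: "w (i, 2*(ks ! i - 1 - j)):S" if i: "i < length ks" and j: "j <= ks ! i - 1" for i j using j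
   proof (induction j)
    case 0
    have "z i:form_kernel V B1" unfolding ker' using i by (intro fs.span_base imageI) (simp add: J)
    then show ?case using S(2) z[OF i] by auto
   next
    case (Suc j)
    define l where "l = ks ! i - 1 - Suc j"
    have l: "ks ! i - 1 - j = Suc l" using Suc.prems by (simp add: l_def)
    have m: "(i, 2*Suc l):?I" "(i, 2*l):?I" using i l Suc.prems by (auto simp: mem)
    have "w (i, 2*Suc l):S" using Suc l by simp
    then have "w (i, 2*l):S" by (rule S(3)[OF _ wV[OF m(2)] lower[OF m(1)]])
    then show ?case by (simp only: l_def)
   qed
   have "w (i, 2*l):S" if "i < length ks" "l < ks ! i" for i l
   proof -
    have "ks ! i - 1 - (ks ! i - 1 - l) = l" using that by auto
    then show ?thesis using top_down[OF that(1), of "ks ! i - 1 - l"] by simp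
   qed
   then show "T <= S" by (auto simp: T_def E_def f_def)
  qed
 qed
 then show thesis by (rule that)
qed

text \<open>Each block contributes ((2k - 1) + 1)/2 = k.\<close>

lemma kronecker_action_dimension:
 assumes B: "bilinear_on V B1" "bilinear_on V B2" and ks: "block_decomposition V B1 B2 (map Kronecker ks)"
 shows "fs.dim V = (\<Sum>k\<leftarrow>ks. 2*k - 1)" "action_dimension V B1 B2 = real (sum_list ks)"
proof -
 let ?bs = "map Kronecker ks"
 obtain w where w: "ALL b:set ?bs. 0 < block_index b" "independent_family (decomposition_index ?bs) w"
  "fs.span (w ` decomposition_index ?bs) = V" by (rule block_decompositionE[OF ks])
 have "fs.dim V = card (decomposition_index ?bs)" using dim_span_family[OF _ w(2)] w(3) by simp
 also have "... = (\<Sum>k\<leftarrow>ks. 2*k - 1)" by (simp add: decomposition_index_def sum_list_sum_nth atLeast0LessThan)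
 finally show d: "fs.dim V = (\<Sum>k\<leftarrow>ks. 2*k - 1)" .
 have "(\<Sum>k\<leftarrow>ks. 2*k - 1) + length ks = 2 * sum_list ks" using w(1) by (induction ks) auto
 moreover have "kronecker_count V B1 B2 = length ks" using kronecker_count_eq[OF B ks] by (simp add: filter_map o_def)
 ultimately show "action_dimension V B1 B2 = real (sum_list ks)" unfolding action_dimension_def d by (simp flip: of_nat_add)
qed

section \<open>Compatible Poisson tensors in coordinates\<close>

context regularity
begin

definition br :: "('n => 'n => 'k^'n => 'k) => ('k^'n => 'k) => ('k^'n => 'k) => 'k^'n => 'k" where
 "br be f g x = (SUM a:UNIV. pd a f x*Yop be a g x)"

lemma R_br: "open S ==> (!!a b. R S (be a b)) ==> R S f ==> R S g ==> R S (br be f g)"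
 unfolding br_def by (intro R_sum R_mult R_pd R_Yop)

text \<open>\<open>Yop be b\<close> thus has two roles: derivation along row b of the tensor, and
  bracket with coordinate b.\<close>

lemma br_coord: "br be (%x. x$b) f x = Yop be b f x"
 by (simp add: br_def pd_coord if_distrib[of "%u. u*_"] cong: if_cong)

lemma br_coord_fun: "br be (%x. x$b) f = Yop be b f" by (rule ext) (rule br_coord)

lemma br_cong:
 assumes "open S" "x:S" "!!y. y:S ==> f y = f' y" "!!y. y:S ==> g y = g' y"
 shows "br be f g x = br be f' g' x" unfolding br_def using pd_cong[of S x f f'] Yop_cong[of S x g g'] assms by simp

lemma br_skew:
 assumes "!!a b. be a b x = - be b a x"
 shows "br be f g x = - br be g f x"
proof -
 have "br be f g x = (SUM a:UNIV. SUM b:UNIV. pd a f x*be a b x*pd b g x)"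
  by (simp add: br_def Yop_def sum_distrib_left algebra_simps)
 also have "... = (SUM b:UNIV. SUM a:UNIV. pd a f x*be a b x*pd b g x)" by (rule sum.swap)
 also have "... = (SUM b:UNIV. SUM a:UNIV. - (pd b g x*be b a x*pd a f x))" by (intro sum.cong refl) (subst assms, simp)
 also have "... = - br be g f x" by (simp add: br_def Yop_def sum_distrib_left sum_negf algebra_simps)
 finally show ?thesis .
qed

lemma br_add_right:
 assumes "open S" "R S g" "R S h" "x:S"
 shows "br be f (%x. g x + h x) x = br be f g x + br be f h x"
 using assms by (simp add: br_def Yop_add algebra_simps sum.distrib)

lemma br_uminus_right:
 assumes "open S" "R S g" "x:S"
 shows "br be f (%x. - g x) x = - br be f g x"
proof -
 have "Yop be a (%x. - g x) x = - Yop be a g x" for a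
  using Yop_mult[OF assms(1) R_const[OF assms(1), of "-1"] assms(2,3), of be a] by simp
 then show ?thesis by (simp add: br_def sum_negf)
qed

lemma br_tensor_add: "br (%a b x. be a b x + be' a b x) f g x = br be f g x + br be' f g x"
 by (simp add: br_def Yop_def algebra_simps sum.distrib)

definition poisson_tensor :: "('k^'n) set => ('n => 'n => 'k^'n => 'k) => bool" where
 "poisson_tensor S be \<longleftrightarrow> (ALL a b. R S (be a b)) & (ALL a b. ALL x:S. be a b x = - be b a x) &
   (ALL T f g h. open T --> T <= S --> R T f --> R T g --> R T h -->
    (ALL x:T. br be f (br be g h) x + br be g (br be h f) x + br be h (br be f g) x = 0))"

lemma poisson_tensorD:
 assumes "poisson_tensor S be"
 shows "R S (be a b)" "x:S ==> be a b x = - be b a x"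
  "open T ==> T <= S ==> R T f ==> R T g ==> R T h ==> x:T ==>
    br be f (br be g h) x + br be g (br be h f) x + br be h (br be f g) x = 0"
 using assms unfolding poisson_tensor_def by blast+

lemma poisson_tensor_skew:
 assumes P: "poisson_tensor S be" and x: "x:S"
 shows "br be f g x = - br be g f x" by (rule br_skew) (rule poisson_tensorD(2)[OF P x])

lemma poisson_tensor_subset:
 assumes "poisson_tensor S be" "open S" "open T" "T <= S"
 shows "poisson_tensor T be" unfolding poisson_tensor_def
proof (intro conjI allI ballI impI)
 show "R T (be a b)" for a b using R_subset[OF assms(2) poisson_tensorD(1)[OF assms(1)] assms(3,4)] .
 show "be a b x = - be b a x" if "x:T" for a b x using poisson_tensorD(2)[OF assms(1)] that assms(4) by blast
 show "br be f (br be g h) x + br be g (br be h f) x + br be h (br be f g) x = 0"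
  if "open T'" "T' <= T" "R T' f" "R T' g" "R T' h" "x:T'" for T' f g h x
  using poisson_tensorD(3)[OF assms(1) that(1) _ that(3-6)] that(2) assms(4) by blast
qed

text \<open>Polarisation: expand the Jacobi identity of the sum and subtract those of the two
  tensors.\<close>

lemma mixed_jacobi:
 assumes 1: "poisson_tensor S be1" and 2: "poisson_tensor S be2"
  and 12: "poisson_tensor S (%a b x. be1 a b x + be2 a b x)"
  and T: "open T" "T <= S" "R T f" "R T g" "R T h" "x:T" and S: "open S"
 shows "br be1 f (br be2 g h) x + br be1 g (br be2 h f) x + br be1 h (br be2 f g) x
  + (br be2 f (br be1 g h) x + br be2 g (br be1 h f) x + br be2 h (br be1 f g) x) = 0"
proof -
 let ?be = "%a b x. be1 a b x + be2 a b x"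
 have R12: "R T (be1 a b)" "R T (be2 a b)" for a b using R_subset[OF S _ T(1,2)] poisson_tensorD(1) 1 2 by blast+
 have e: "br ?be f (br ?be g h) x = br be1 f (br be1 g h) x + br be1 f (br be2 g h) x
  + br be2 f (br be1 g h) x + br be2 f (br be2 g h) x" if "R T g" "R T h" for f g h
 proof -
  have "br ?be f (br ?be g h) x = br ?be f (%x. br be1 g h x + br be2 g h x) x"
   by (rule br_cong[OF T(1,6)]) (auto simp: br_tensor_add)
  then show ?thesis using br_add_right[OF T(1) R_br[OF T(1) R12(1) that] R_br[OF T(1) R12(2) that] T(6)] by (simp add: br_tensor_add)
 qed
 have arith: "G = 0" if "A = 0" "B = 0" "C = 0" "G = C - A - B" for A B C G :: 'k using that by simp
 show ?thesis by (rule arith[OF poisson_tensorD(3)[OF 1 T(1-6)] poisson_tensorD(3)[OF 2 T(1-6)]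
    poisson_tensorD(3)[OF 12 T(1-6), unfolded e[OF T(4,5)] e[OF T(5,3)] e[OF T(3,4)]]])
   (simp add: algebra_simps)
qed

text \<open>The Jacobi identity with two coordinate functions: the commutator of two Hamiltonian
  fields is the Hamiltonian field of the bracket \<open>be b c\<close>, expanded by the chain
  rule.\<close>

lemma hamiltonian_commutator:
 assumes P: "poisson_tensor S be" and S: "open S" and f: "R S f" and x: "x:S"
 shows "Yop be b (Yop be c f) x - Yop be c (Yop be b f) x = (SUM e:UNIV. pd e (be b c) x*Yop be e f x)"
proof -
 note P1 = poisson_tensorD(1)[OF P] and P2 = poisson_tensorD(2)[OF P]
 have "br be (%x. x$b) (br be (%x. x$c) f) x + br be (%x. x$c) (br be f (%x. x$b)) x
  + br be f (br be (%x. x$b) (%x. x$c)) x = 0"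
  by (rule poisson_tensorD(3)[OF P S order_refl R_coord[OF S] R_coord[OF S] f x])
 moreover have "br be (%x. x$b) (br be (%x. x$c) f) x = Yop be b (Yop be c f) x" by (simp only: br_coord_fun)
 moreover have "br be (%x. x$c) (br be f (%x. x$b)) x = - Yop be c (Yop be b f) x"
 proof -
  have "br be (%x. x$c) (br be f (%x. x$b)) x = br be (%x. x$c) (%x. - Yop be b f x) x"
  proof (rule br_cong[OF S x refl])
   show "br be f (%x. x$b) y = - Yop be b f y" if "y:S" for y
    using poisson_tensor_skew[OF P that, of f "%x. x$b"] by (simp add: br_coord)
  qed
  then show ?thesis using br_uminus_right[OF S R_Yop[where C=be and i=b, OF S P1 f] x, of be "%x. x$c"] by (simp add: br_coord)
 qed
 moreover have "br be f (br be (%x. x$b) (%x. x$c)) x = - (SUM e:UNIV. pd e (be b c) x*Yop be e f x)"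
 proof -
  have "br be f (br be (%x. x$b) (%x. x$c)) x = br be f (be b c) x"
   by (rule br_cong[OF S x refl]) (simp add: br_coord Yop_coord)
  also have "... = - br be (be b c) f x" by (rule poisson_tensor_skew[OF P x])
  finally show ?thesis by (simp add: br_def)
 qed
 ultimately have "Yop be b (Yop be c f) x + - Yop be c (Yop be b f) x + - (SUM e:UNIV. pd e (be b c) x*Yop be e f x) = 0"
  by (simp only:)
 then show ?thesis by (simp add: add_eq_0_iff2)
qed

text \<open>In the mixed Jacobi identity for F and two coordinates, the three terms in which F
  enters a \<open>be1\<close> bracket are, by the relation with F', minus the Jacobi identity of
  \<open>be2\<close> for F', and drop out. The rest has the shape of
  \<open>hamiltonian_commutator\<close> with \<open>Yop be2 e F\<close> in place of the Hamiltonian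
  fields applied to a function; this is the closedness of the data for the next step.\<close>

lemma chain_derivation:
 assumes 1: "poisson_tensor S be1" and 2: "poisson_tensor S be2"
  and 12: "poisson_tensor S (%a b x. be1 a b x + be2 a b x)" and S: "open S"
  and F: "R S F'" "R S F" and chain: "!!x b. x:S ==> Yop be2 b F' x = - Yop be1 b F x" and x: "x:S"
 shows "Yop be1 a (Yop be2 b F) x - Yop be1 b (Yop be2 a F) x = (SUM e:UNIV. pd e (be1 a b) x*Yop be2 e F x)"
proof -
 note P11 = poisson_tensorD(1)[OF 1] and P12 = poisson_tensorD(2)[OF 1]
 note P21 = poisson_tensorD(1)[OF 2] and P22 = poisson_tensorD(2)[OF 2]
 have chain_br: "br be2 g F' y = - br be1 g F y" "br be2 F' g y = - br be1 F g y" if y: "y:S" for y g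
 proof -
  show *: "br be2 g F' y = - br be1 g F y" unfolding br_def chain[OF y] by (simp add: sum_negf)
  show "br be2 F' g y = - br be1 F g y" using*poisson_tensor_skew[OF 2 y, of F' g] poisson_tensor_skew[OF 1 y, of F g] by simp
 qed
 let ?a = "%x::'k^'n. x$a" and ?b = "%x::'k^'n. x$b"
 note ca = R_coord[OF S, of a] and cb = R_coord[OF S, of b]
 have arith: "b + c + f = 0" if "- a + - d + - e = 0" "a + b + c + (f + d + e) = 0" for a b c d e f :: 'k
 proof -
  have "b + c + f = (a + b + c + (f + d + e)) + (- a + - d + - e)" by (simp add: algebra_simps)
  then show ?thesis using that by simp
 qed
 have mj: "br be1 F (br be2 ?a ?b) x + br be1 ?a (br be2 ?b F) x + br be1 ?b (br be2 F ?a) x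
  + (br be2 F (br be1 ?a ?b) x + br be2 ?a (br be1 ?b F) x + br be2 ?b (br be1 F ?a) x) = 0"
  by (rule mixed_jacobi[OF 1 2 12 S order_refl F(2) ca cb x S])
 have "br be2 F' (br be2 ?a ?b) x + br be2 ?a (br be2 ?b F') x + br be2 ?b (br be2 F' ?a) x = 0"
  by (rule poisson_tensorD(3)[OF 2 S order_refl F(1) ca cb x])
 moreover have "br be2 F' (br be2 ?a ?b) x = - br be1 F (br be2 ?a ?b) x" by (rule chain_br(2)[OF x])
 moreover have "br be2 ?a (br be2 ?b F') x = - br be2 ?a (br be1 ?b F) x"
 proof -
  have "br be2 ?a (br be2 ?b F') x = br be2 ?a (%x. - br be1 ?b F x) x" by (rule br_cong[OF S x refl]) (rule chain_br(1))
  then show ?thesis using br_uminus_right[OF S R_br[OF S P11 cb F(2)] x] by simp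
 qed
 moreover have "br be2 ?b (br be2 F' ?a) x = - br be2 ?b (br be1 F ?a) x"
 proof -
  have "br be2 ?b (br be2 F' ?a) x = br be2 ?b (%x. - br be1 F ?a x) x" by (rule br_cong[OF S x refl]) (rule chain_br(2))
  then show ?thesis using br_uminus_right[OF S R_br[OF S P11 F(2) ca] x] by simp
 qed
 ultimately have "- br be1 F (br be2 ?a ?b) x + - br be2 ?a (br be1 ?b F) x + - br be2 ?b (br be1 F ?a) x = 0"
  by (simp only:)
 from arith[OF this mj] have *: "br be1 ?a (br be2 ?b F) x + br be1 ?b (br be2 F ?a) x + br be2 F (br be1 ?a ?b) x = 0" .
 have "br be1 ?a (br be2 ?b F) x = Yop be1 a (Yop be2 b F) x" by (simp only: br_coord_fun)
 moreover have "br be1 ?b (br be2 F ?a) x = - Yop be1 b (Yop be2 a F) x"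
 proof -
  have "br be1 ?b (br be2 F ?a) x = br be1 ?b (%x. - Yop be2 a F x) x"
  proof (rule br_cong[OF S x refl])
   show "br be2 F ?a y = - Yop be2 a F y" if "y:S" for y using poisson_tensor_skew[OF 2 that, of F ?a] by (simp add: br_coord)
  qed
  then show ?thesis using br_uminus_right[OF S R_Yop[where C=be2 and i=a, OF S P21 F(2)] x, of be1 ?b] by (simp add: br_coord)
 qed
 moreover have "br be2 F (br be1 ?a ?b) x = - (SUM e:UNIV. pd e (be1 a b) x*Yop be2 e F x)"
 proof -
  have "br be2 F (br be1 ?a ?b) x = br be2 F (be1 a b) x" by (rule br_cong[OF S x refl]) (simp add: br_coord Yop_coord)
  also have "... = - br be2 (be1 a b) F x" by (rule poisson_tensor_skew[OF 2 x])
  finally show ?thesis by (simp add: br_def)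
 qed
 ultimately have "Yop be1 a (Yop be2 b F) x + - Yop be1 b (Yop be2 a F) x + - (SUM e:UNIV. pd e (be1 a b) x*Yop be2 e F x) = 0"
  using*by (simp only:)
 then show ?thesis by (simp add: add_eq_0_iff2)
qed

end

section \<open>Scalars inside the complex numbers\<close>

lemma to_complex_0 [simp]: "to_complex 0 = 0" by (metis norm_to_complex norm_zero norm_eq_zero)

lemma to_complex_eq_0 [simp]: "to_complex x = 0 \<longleftrightarrow> x = 0" by (metis norm_to_complex norm_eq_zero)

lemma to_complex_minus [simp]: "to_complex (- x) = - to_complex x" by (metis to_complex_0 to_complex_add add_eq_0_iff add.right_inverse)

lemma to_complex_1 [simp]: "to_complex 1 = 1"
proof -
 have "to_complex (1::'a)*to_complex (1::'a) = to_complex (1::'a)*1" by (simp flip: to_complex_mult)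
 then show ?thesis using to_complex_eq_0[of "1::'a"] by (metis mult_cancel_left one_neq_zero)
qed

lemma to_complex_sum: "to_complex (SUM i:A. f i) = (SUM i:A. to_complex (f i))"
 by (induction A rule: infinite_finite_induct) (auto simp: to_complex_add)

lemma to_complex_inject [simp]: "to_complex x = to_complex y \<longleftrightarrow> x = y"
proof -
 have "to_complex (x + - y) = to_complex x - to_complex y" by (simp only: to_complex_add to_complex_minus diff_conv_add_uminus)
 then show ?thesis using to_complex_eq_0[of "x + - y"] by (metis add.right_neutral add_eq_0_iff2 diff_self right_minus_eq to_complex_eq_0 uminus_add_conv_diff add.commute)
qed

text \<open>A linear system in reduced echelon form with pivots \<open>I\<close>: the coordinates
  outside \<open>I\<close> are free, and \<open>g a\<close> is the solution whose free coordinate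
  \<open>a\<close> is 1 and whose other free coordinates are 0.\<close>

lemma annihilator:
 fixes c :: "'n::finite => 'n => complex"
 assumes c: "!!i l. i:I ==> l:I ==> c i l = (if i = l then 1 else 0)"
 defines "g \<equiv> %a j. if j:I then - c j a else if j = a then 1 else 0"
 shows "{u. ALL i:I. (SUM a:UNIV. c i a*u a) = 0} = fs.span (g ` (- I))" "independent_family (- I) g"
proof -
 have split: "(SUM a:UNIV. c i a*u a) = u i + (SUM a:- I. c i a*u a)" if i: "i:I" for i and u :: "'n => complex"
 proof -
  have "(SUM a:UNIV. c i a*u a) = (SUM a:I. c i a*u a) + (SUM a:- I. c i a*u a)"
   by (metis sum.subset_diff[of I UNIV] Compl_eq_Diff_UNIV add.commute finite subset_UNIV)
  also have "(SUM a:I. c i a*u a) = (SUM a:I. if a = i then u i else 0)" by (rule sum.cong) (use c i in auto)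
  finally show ?thesis using i by simp
 qed
 have coord: "(SUM a:- I. fscale (x a) (g a)) j = (if j:I then - (SUM a:- I. c j a*x a) else x j)" for x j
  unfolding sum_fscale_apply g_def by (auto simp: sum_negf algebra_simps if_distrib[of "%c. _*c"] cong: if_cong)
 show "independent_family (- I) g" unfolding independent_family_iff[OF finite]
 proof (intro allI impI ballI)
  fix x a assume x: "(SUM a:- I. fscale (x a) (g a)) = 0" and a: "a:- I"
  show "x a = 0" using coord[of x a] a unfolding x by simp
 qed
 show "{u. ALL i:I. (SUM a:UNIV. c i a*u a) = 0} = fs.span (g ` (- I))"
 proof (intro set_eqI iffI)
  fix u assume "u:{u. ALL i:I. (SUM a:UNIV. c i a*u a) = 0}"
  then have u: "u i = - (SUM a:- I. c i a*u a)" if "i:I" for i using split[OF that, of u] that by (simp add: add_eq_0_iff2)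
  have "u = (SUM a:- I. fscale (u a) (g a))" by (rule ext) (use u coord in simp)
  moreover have "(SUM a:- I. fscale (u a) (g a)):fs.span (g ` (- I))" by (intro fs.span_sum fs.span_scale fs.span_base imageI)
  ultimately show "u:fs.span (g ` (- I))" by simp
 next
  fix u assume "u:fs.span (g ` (- I))"
  then obtain x where x: "u = (SUM a:- I. fscale (x a) (g a))" by (rule span_family[OF finite])
  have "(SUM a:UNIV. c i a*u a) = 0" if "i:I" for i
  proof -
   have "(SUM a:- I. c i a*u a) = (SUM a:- I. c i a*x a)" by (rule sum.cong) (auto simp: x coord)
   then show ?thesis using split[OF that, of u] that by (simp add: x coord)
  qed
  then show "u:{u. ALL i:I. (SUM a:UNIV. c i a*u a) = 0}" by simp
 qed
qed

context regularity
begin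

definition form :: "('n => 'n => 'k^'n => 'k) => 'k^'n => ('n => complex) => ('n => complex) => complex" where
 "form be x u v = (SUM a:UNIV. SUM b:UNIV. u a*to_complex (be a b x) * v b)"

lemma bilinear_form: "bilinear_on V (form be x)" unfolding bilinear_on_def form_def by (simp add: algebra_simps sum.distrib sum_distrib_left)

lemma form_basis: "form be x u (%c. if c = b then 1 else 0) = (SUM a:UNIV. u a*to_complex (be a b x))"
 unfolding form_def by (simp add: if_distrib[of "%c. _*c"] cong: if_cong)

lemma form_eqI:
 assumes "!!b. (SUM a:UNIV. u a*to_complex (be a b x)) = r*(SUM a:UNIV. u' a*to_complex (be' a b x))"
 shows "form be x u v = r*form be' x u' v"
proof -
 have e: "form be x u v = (SUM b:UNIV. (SUM a:UNIV. u a*to_complex (be a b x)) * v b)" for be u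
  unfolding form_def sum_distrib_right by (rule sum.swap)
 show ?thesis
  unfolding e assms sum_distrib_left[of r "%b. (SUM a:UNIV. u' a*to_complex (be' a b x)) * v b"] by (simp only: mult.assoc)
qed

lemma form_kernel_iff:
 assumes skew: "!!a b. be a b x = - be b a x"
 shows "u:form_kernel UNIV (form be x) \<longleftrightarrow> (ALL b. (SUM a:UNIV. to_complex (be b a x)*u a) = 0)"
proof -
 have e: "(SUM a:UNIV. u a*to_complex (be a b x)) = - (SUM a:UNIV. to_complex (be b a x)*u a)" for b
  unfolding sum_negf[symmetric] by (rule sum.cong[OF refl]) (subst skew, simp)
 have "u:form_kernel UNIV (form be x) \<longleftrightarrow> (ALL b. (SUM a:UNIV. u a*to_complex (be a b x)) = 0)"
 proof
  assume "u:form_kernel UNIV (form be x)"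
  then have "form be x u (%c. if c = b then 1 else 0) = 0" for b by (simp add: form_kernel_def)
  then show "ALL b. (SUM a:UNIV. u a*to_complex (be a b x)) = 0" by (simp add: form_basis)
 next
  assume h: "ALL b. (SUM a:UNIV. u a*to_complex (be a b x)) = 0"
  have "form be x u v = 0*form be x u v" for v by (rule form_eqI) (simp only: h[rule_format] mult_zero_left)
  then show "u:form_kernel UNIV (form be x)" by (simp add: form_kernel_def)
 qed
 then show ?thesis unfolding e by simp
qed

section \<open>Frames along the symplectic leaves\<close>

definition frm :: "('n => 'n => 'k^'n => 'k) => ('n => 'n => 'k^'n => 'k) => 'n => 'n => 'k^'n => 'k" where
 "frm be M i a x = (SUM b:UNIV. M i b x*be b a x)"

text \<open>The fields are combinations of the Hamiltonian fields of the coordinates, with the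
  coefficients \<open>M\<close> recorded so that the Jacobi identity can be used. Being the identity
  matrix on the columns \<open>I\<close> is what forces them to commute.\<close>

definition frame :: "('n => 'n => 'k^'n => 'k) => ('k^'n) set => 'n set => ('n => 'n => 'k^'n => 'k) => bool" where
 "frame be S I M \<longleftrightarrow> (ALL i b. R S (M i b)) & (ALL i:I. ALL l:I. ALL x:S. frm be M i l x = (if i = l then 1 else 0))"

lemma R_frm: "open S ==> (!!a b. R S (be a b)) ==> (!!i b. R S (M i b)) ==> R S (frm be M i a)"
 unfolding frm_def by (intro R_sum R_mult)

text \<open>One step of Gauss-Jordan elimination with regular coefficients: row e is reduced by the
  frame, divided by its entry in column l where this is nonzero, and used to clear column l in the
  other fields.\<close>

lemma frame_extend:
 assumes S: "open S" "p:S" and be: "!!a b. R S (be a b)" and fr: "frame be S I M" and l: "l ~: I"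
  and nz: "be e l p ~= (SUM i:I. be e i p*frm be M i l p)"
 shows "EX S' M'. open S' & p:S' & S' <= S & frame be S' (insert l I) M'"
proof -
 have M: "R S (M i b)" and C: "i:I ==> j:I ==> x:S ==> frm be M i j x = (if i = j then 1 else 0)" for i j b x
  using fr by (auto simp: frame_def)
 \<comment> \<open>\<open>Z\<close> is the reduced row, and \<open>N\<close> holds its coefficients
   in terms of the rows of the tensor.\<close>
 define N where "N = (%b x. (if b = e then 1 else 0) - (SUM i:I. be e i x*M i b x))"
 define Z where "Z = (%a x. be e a x - (SUM i:I. be e i x*frm be M i a x))"
 have Z: "(SUM b:UNIV. N b x*be b a x) = Z a x" for a x
 proof -
  have "(SUM b:UNIV. N b x*be b a x) = (SUM b:UNIV. (if b = e then be e a x else 0)) - (SUM b:UNIV. SUM i:I. be e i x*M i b x*be b a x)"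
   unfolding sum_subtractf[symmetric] by (rule sum.cong) (auto simp: N_def left_diff_distrib sum_distrib_right)
  also have "(SUM b:UNIV. SUM i:I. be e i x*M i b x*be b a x) = (SUM i:I. be e i x*frm be M i a x)"
   unfolding frm_def sum_distrib_left by (subst sum.swap) (simp add: algebra_simps)
  finally show ?thesis by (simp add: Z_def)
 qed
 have ZI: "Z j x = 0" if "j:I" "x:S" for j x
 proof -
  have "(SUM i:I. be e i x*frm be M i j x) = (SUM i:I. if i = j then be e j x else 0)"
   by (rule sum.cong) (use C that in auto)
  then show ?thesis using that by (simp add: Z_def)
 qed
 have RN: "R S (N b)" for b unfolding N_def by (intro R_diff S(1) R_const R_sum R_mult be M)
 have RZ: "R S (Z a)" for a unfolding Z_def by (intro R_diff S(1) R_sum R_mult be R_frm M)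
 define S' where "S' = {x:S. Z l x ~= 0}"
 have "continuous_on S (Z l)" by (intro continuous_at_imp_continuous_on ballI) (rule R_isCont[OF S(1) RZ])
 then have "open (S \<inter> Z l -` (- {0}))" using S(1) by (intro continuous_open_preimage) auto
 then have S': "open S'" "S' <= S" "p:S'" using S(2) nz by (auto simp: S'_def Z_def vimage_def Int_def)
 have Znz: "Z l x ~= 0" if "x:S'" for x using that by (simp add: S'_def)
 define M' where "M' = (%i b x. if i = l then N b x*inverse (Z l x) else M i b x - frm be M i l x*(N b x*inverse (Z l x)))"
 have inv: "R S' (%x. inverse (Z l x))" by (rule R_inverse[OF S'(1) R_subset[OF S(1) RZ S'(1,2)] Znz])
 have RM': "R S' (M' i b)" for i b
 proof -
  have n: "R S' (%x. N b x*inverse (Z l x))" by (intro R_mult S'(1) R_subset[OF S(1) RN S'(1,2)] inv)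
  show ?thesis
  proof (cases "i = l")
   case True
   then show ?thesis using n by (simp add: M'_def)
  next
   case False
   have "R S' (%x. M i b x - frm be M i l x*(N b x*inverse (Z l x)))"
    by (intro R_diff R_mult S'(1) n R_subset[OF S(1) M S'(1,2)] R_subset[OF S(1) R_frm[OF S(1) be M] S'(1,2)])
   then show ?thesis using False by (simp add: M'_def)
  qed
 qed
 have l': "frm be M' l a x = Z a x*inverse (Z l x)" for a x
 proof -
  have "frm be M' l a x = (SUM b:UNIV. N b x*be b a x)*inverse (Z l x)"
   by (simp add: frm_def M'_def sum_distrib_left sum_distrib_right algebra_simps)
  then show ?thesis by (simp only: Z)
 qed
 have i': "frm be M' i a x = frm be M i a x - frm be M i l x*(Z a x*inverse (Z l x))" if "i ~= l" for i a x
 proof -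
  have "frm be M' i a x = (SUM b:UNIV. M i b x*be b a x - (frm be M i l x*inverse (Z l x))*(N b x*be b a x))"
   unfolding frm_def[of be M'] using that by (simp add: M'_def algebra_simps)
  also have "... = frm be M i a x - (frm be M i l x*inverse (Z l x))*Z a x"
   by (simp add: sum_subtractf frm_def Z flip: sum_distrib_left)
  finally show ?thesis by (simp add: algebra_simps)
 qed
 have "frm be M' i j x = (if i = j then 1 else 0)" if ij: "i:insert l I" "j:insert l I" and x: "x:S'" for i j x
 proof (cases "i = l")
  case True
  then show ?thesis using ij x Znz[OF x] ZI[of j x] S'(2) l by (auto simp: l')
 next
  case False
  then show ?thesis using ij x Znz[OF x] ZI[of j x] S'(2) l C[of i j x] by (auto simp: i')
 qed
 then have "frame be S' (insert l I) M'" using RM' by (auto simp: frame_def)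
 then show ?thesis using S' by blast
qed

text \<open>The fields of the frame are combinations of rows, so they annihilate the kernel and
  bound its dimension. If conversely all rows are combinations of the frame, the kernel is the whole
  annihilator.\<close>

lemma frame_kernel:
 assumes fr: "frame be S I M" and x: "x:S" and skew: "!!a b. be a b x = - be b a x"
 shows "fs.dim (form_kernel UNIV (form be x)) <= card (- I)"
  and "(!!e a. be e a x = (SUM i:I. be e i x*frm be M i a x)) ==> fs.dim (form_kernel UNIV (form be x)) = card (- I)"
proof -
 let ?A = "{u. ALL i:I. (SUM a:UNIV. to_complex (frm be M i a x)*u a) = 0}"
 define g where "g = (%a j. if j:I then - to_complex (frm be M j a x) else if j = a then 1 else 0)"
 have ann: "?A = fs.span (g ` (- I))" "independent_family (- I) g"
  unfolding g_def by (rule annihilator; use fr x in \<open>auto simp: frame_def\<close>)+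
 have comb: "(SUM a:UNIV. to_complex (SUM b:A. m b*w b a)*u a)
   = (SUM b:A. to_complex (m b)*(SUM a:UNIV. to_complex (w b a)*u a))"
  for m :: "'n => 'k" and w :: "'n => 'n => 'k" and A and u :: "'n => complex"
  unfolding to_complex_sum to_complex_mult sum_distrib_left sum_distrib_right by (subst sum.swap) (simp add: algebra_simps)
 have sub: "form_kernel UNIV (form be x) <= ?A"
 proof
  fix u assume "u:form_kernel UNIV (form be x)"
  then have "(SUM a:UNIV. to_complex (be b a x)*u a) = 0" for b using form_kernel_iff[of be x u] skew by blast
  then show "u:?A" unfolding frm_def by (simp add: comb)
 qed
 have "card (g ` (- I)) <= card (- I)" by (rule card_image_le) simp
 then show "fs.dim (form_kernel UNIV (form be x)) <= card (- I)"
  using fs.dim_le_card[of "form_kernel UNIV (form be x)" "g ` (- I)"] sub ann(1) by fastforce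
 assume all: "!!e a. be e a x = (SUM i:I. be e i x*frm be M i a x)"
 have "?A <= form_kernel UNIV (form be x)"
 proof
  fix u assume u: "u:?A"
  have "(SUM a:UNIV. to_complex (be b a x)*u a) = 0" for b
  proof -
   have "(SUM a:UNIV. to_complex (be b a x)*u a) = (SUM a:UNIV. to_complex (SUM i:I. be b i x*frm be M i a x)*u a)"
    by (simp only: all[symmetric])
   also have "... = 0" unfolding comb using u by simp
   finally show ?thesis .
  qed
  then show "u:form_kernel UNIV (form be x)" using form_kernel_iff[of be x u] skew by blast
 qed
 then have "form_kernel UNIV (form be x) = fs.span (g ` (- I))" using sub ann(1) by blast
 then show "fs.dim (form_kernel UNIV (form be x)) = card (- I)" using dim_span_family[OF _ ann(2)] by (simp del: fs.dim_span)
qed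

text \<open>A frame around \<open>p\<close> with \<open>I\<close> as large as possible spans all
  rows at \<open>p\<close>, so \<open>I\<close> has as many elements as the rank. If a row left the
  span at a nearby point, the frame could be extended there and the rank would exceed its constant
  value.\<close>

theorem frame_exists:
 assumes S: "open S" "p:S" and be: "!!a b. R S (be a b)" and skew: "!!a b x. x:S ==> be a b x = - be b a x"
  and rank: "!!x. x:S ==> fs.dim (form_kernel UNIV (form be x)) = s"
 obtains V I M where "open V" "p:V" "V <= S" "frame be V I M" "card (- I) = s"
  "ALL x:V. ALL e a. be e a x = (SUM i:I. be e i x*frm be M i a x)"
proof -
 define Q where "Q = (%I. EX V M. open V & p:V & V <= S & frame be V I M)"
 have "Q {}" unfolding Q_def frame_def using S R_const[OF S(1), of 0] by (intro exI[of _ S] exI[of _ "%i b x. 0"]) auto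
 moreover have "ALL I. Q I --> card I < Suc CARD('n)" by (simp add: card_mono less_Suc_eq_le)
 ultimately obtain I where I: "Q I" "!!I'. Q I' ==> card I' <= card I" using ex_has_greatest_nat[of Q "{}" card] by blast
 obtain V M where V: "open V" "p:V" "V <= S" and fr: "frame be V I M" using I(1) unfolding Q_def by blast
 note beV = R_subset[OF S(1) be V(1,3)]
 have inI: "be e l x = (SUM i:I. be e i x*frm be M i l x)" if "l:I" "x:V" for e l x
 proof -
  have "(SUM i:I. be e i x*frm be M i l x) = (SUM i:I. if i = l then be e l x else 0)"
   by (rule sum.cong) (use fr that in \<open>auto simp: frame_def\<close>)
  then show ?thesis using that by simp
 qed
 have atp: "be e l p = (SUM i:I. be e i p*frm be M i l p)" for e l
 proof (cases "l:I")
  case False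
  show ?thesis
  proof (rule ccontr)
   assume "be e l p ~= (SUM i:I. be e i p*frm be M i l p)"
   from frame_extend[OF V(1,2) beV fr False this] have "Q (insert l I)" unfolding Q_def using V(3) by blast
   from I(2)[OF this] False show False by simp
  qed
 qed (rule inI[OF _ V(2)])
 have s: "card (- I) = s" using frame_kernel(2)[OF fr V(2) skew[OF S(2)] atp] rank[OF S(2)] by simp
 have "be e l x = (SUM i:I. be e i x*frm be M i l x)" if x: "x:V" for e l x
 proof (cases "l:I")
  case False
  show ?thesis
  proof (rule ccontr)
   assume "be e l x ~= (SUM i:I. be e i x*frm be M i l x)"
   from frame_extend[OF V(1) x beV fr False this] obtain S' M' where S': "x:S'" "S' <= V" "frame be S' (insert l I) M'" by blast
   have xS: "x:S" using x V(3) by blast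
   have "s <= card (- insert l I)" using frame_kernel(1)[OF S'(3,1) skew[OF xS]] rank[OF xS] by simp
   also have "- insert l I = - I - {l}" by blast
   also have "card (- I - {l}) < card (- I)" using False by (intro card_Diff1_less) auto
   finally show False using s by simp
  qed
 qed (rule inI[OF _ x])
 then show thesis using that[OF V fr s] by blast
qed

end

context regularity
begin

section \<open>Commuting frames and one step of the scheme\<close>

lemma Yop_frm: "Yop (frm be M) i f x = (SUM b:UNIV. M i b x*Yop be b f x)"
 unfolding Yop_def frm_def sum_distrib_right sum_distrib_left by (subst sum.swap) (simp add: algebra_simps)

text \<open>The coefficients of the commutator of the fields i and j in terms of the Hamiltonian
  fields of the coordinates: the double sum comes from the Poisson bracket, the rest from
  differentiating the coefficients \<open>M\<close>.\<close>

definition frame_bracket :: "('n => 'n => 'k^'n => 'k) => ('n => 'n => 'k^'n => 'k) => 'n => 'n => 'n => 'k^'n => 'k" where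
 "frame_bracket be M i j e x = (SUM b:UNIV. SUM c:UNIV. M i b x*M j c x*pd e (be b c) x)
   + (Yop (frm be M) i (M j e) x - Yop (frm be M) j (M i e) x)"

text \<open>Stated for any family \<open>z\<close> with the commutation rule of Hamiltonian fields,
  since it serves both for fields acting on a function and for the right-hand sides of a Lenard
  step.\<close>

lemma frame_commutator:
 assumes T: "open T" "x:T" and M: "!!i b. R T (M i b)" and z: "!!b. R T (z b)"
  and comm: "!!b c. Yop be b (z c) x - Yop be c (z b) x = (SUM e:UNIV. pd e (be b c) x*z e x)"
 shows "Yop (frm be M) i (%x. SUM b:UNIV. M j b x*z b x) x - Yop (frm be M) j (%x. SUM b:UNIV. M i b x*z b x) x
  = (SUM e:UNIV. frame_bracket be M i j e x*z e x)"
proof -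
 let ?C = "frm be M"
 have 1: "Yop ?C i (%x. SUM b:UNIV. M j b x*z b x) x
  = (SUM c:UNIV. SUM b:UNIV. M j c x*M i b x*Yop be b (z c) x) + (SUM c:UNIV. Yop ?C i (M j c) x*z c x)" for i j
 proof -
  have "Yop ?C i (%x. SUM b:UNIV. M j b x*z b x) x = (SUM c:UNIV. Yop ?C i (%x. M j c x*z c x) x)"
   by (rule Yop_sum[OF T(1) R_mult[OF T(1) M z] T(2)])
  also have "... = (SUM c:UNIV. M j c x*Yop ?C i (z c) x + Yop ?C i (M j c) x*z c x)"
   by (intro sum.cong refl Yop_mult[OF T(1) M z T(2)])
  finally show ?thesis by (simp add: sum.distrib Yop_frm[of _ _ i "z c" for c] sum_distrib_left mult.assoc)
 qed
 have 2: "(SUM c:UNIV. SUM b:UNIV. M j c x*M i b x*Yop be b (z c) x)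
   - (SUM c:UNIV. SUM b:UNIV. M i c x*M j b x*Yop be b (z c) x)
   = (SUM e:UNIV. (SUM b:UNIV. SUM c:UNIV. M i b x*M j c x*pd e (be b c) x)*z e x)"
 proof -
  have "(SUM c:UNIV. SUM b:UNIV. M j c x*M i b x*Yop be b (z c) x) = (SUM b:UNIV. SUM c:UNIV. M i b x*M j c x*Yop be b (z c) x)"
   by (subst sum.swap) (simp add: mult.commute)
  then have "(SUM c:UNIV. SUM b:UNIV. M j c x*M i b x*Yop be b (z c) x)
   - (SUM c:UNIV. SUM b:UNIV. M i c x*M j b x*Yop be b (z c) x)
   = (SUM b:UNIV. SUM c:UNIV. M i b x*M j c x*(Yop be b (z c) x - Yop be c (z b) x))"
   by (simp add: sum_subtractf right_diff_distrib)
  also have "... = (SUM b:UNIV. SUM c:UNIV. SUM e:UNIV. M i b x*M j c x*pd e (be b c) x*z e x)"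
   unfolding comm sum_distrib_left by (simp add: mult.assoc)
  also have "... = (SUM b:UNIV. SUM e:UNIV. SUM c:UNIV. M i b x*M j c x*pd e (be b c) x*z e x)"
   by (rule sum.cong[OF refl]) (rule sum.swap)
  also have "... = (SUM e:UNIV. SUM b:UNIV. SUM c:UNIV. M i b x*M j c x*pd e (be b c) x*z e x)" by (rule sum.swap)
  finally show ?thesis by (simp only: sum_distrib_right)
 qed
 have "(SUM e:UNIV. frame_bracket be M i j e x*z e x)
  = (SUM e:UNIV. (SUM b:UNIV. SUM c:UNIV. M i b x*M j c x*pd e (be b c) x)*z e x)
   + ((SUM c:UNIV. Yop ?C i (M j c) x*z c x) - (SUM c:UNIV. Yop ?C j (M i c) x*z c x))"
  unfolding frame_bracket_def by (simp only: distrib_right left_diff_distrib sum.distrib sum_subtractf)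
 then show ?thesis unfolding 1 2[symmetric] by simp
qed

text \<open>The fields of a frame have constant components on \<open>I\<close>, so their commutator
  has zero components there. Being a combination of rows, it is determined by these components
  (\<open>rows\<close>) and vanishes.\<close>

lemma frame_bracket_kernel:
 assumes P: "poisson_tensor V be" and V: "open V" and fr: "frame be V I M"
  and rows: "ALL x:V. ALL e a. be e a x = (SUM i:I. be e i x*frm be M i a x)"
  and ij: "i:I" "j:I" and x: "x:V"
 shows "(SUM e:UNIV. frame_bracket be M i j e x*be e a x) = 0"
proof -
 note P1 = poisson_tensorD(1)[OF P]
 have M: "R V (M i b)" for i b using fr by (simp add: frame_def)
 have inI: "(SUM e:UNIV. frame_bracket be M i j e x*be e l x) = 0" if l: "l:I" for l
 proof -
  have co: "Yop be b (%x. x$l) = be b l" for b by (rule ext) (rule Yop_coord)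
  have "Yop (frm be M) i (%x. SUM b:UNIV. M j b x*be b l x) x - Yop (frm be M) j (%x. SUM b:UNIV. M i b x*be b l x) x
   = (SUM e:UNIV. frame_bracket be M i j e x*be e l x)"
  proof (rule frame_commutator[OF V x M P1])
   show "Yop be b (be c l) x - Yop be c (be b l) x = (SUM e:UNIV. pd e (be b c) x*be e l x)" for b c
    using hamiltonian_commutator[OF P V R_coord[OF V, of l] x, of b c] unfolding co .
  qed
  moreover have "Yop (frm be M) i (%x. SUM b:UNIV. M j b x*be b l x) x = 0" if "j:I" for i j
  proof -
   have "Yop (frm be M) i (%x. SUM b:UNIV. M j b x*be b l x) x = Yop (frm be M) i (%x. if j = l then 1 else 0) x"
    by (rule Yop_cong[OF V x]) (use fr that l in \<open>simp add: frame_def flip: frm_def\<close>)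
   then show ?thesis by simp
  qed
  ultimately show ?thesis using ij by simp
 qed
 have "(SUM e:UNIV. frame_bracket be M i j e x*be e a x)
  = (SUM e:UNIV. SUM l:I. frame_bracket be M i j e x*(be e l x*frm be M l a x))"
  by (simp only: sum_distrib_left[symmetric] rows[rule_format, OF x, symmetric])
 also have "... = (SUM l:I. (SUM e:UNIV. frame_bracket be M i j e x*be e l x)*frm be M l a x)"
  by (subst sum.swap) (simp add: sum_distrib_right mult.assoc)
 also have "... = 0" using inI by simp
 finally show ?thesis .
qed

lemma frame_commutes:
 assumes P: "poisson_tensor V be" and V: "open V" and fr: "frame be V I M"
  and rows: "ALL x:V. ALL e a. be e a x = (SUM i:I. be e i x*frm be M i a x)"
  and T: "open T" "T <= V" "R T f" and ij: "i:I" "j:I" and x: "x:T"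
 shows "Yop (frm be M) i (Yop (frm be M) j f) x = Yop (frm be M) j (Yop (frm be M) i f) x"
proof -
 have PT: "poisson_tensor T be" by (rule poisson_tensor_subset[OF P V T(1,2)])
 note PT1 = poisson_tensorD(1)[OF PT]
 have M: "R T (M i b)" for i b using fr R_subset[OF V _ T(1,2)] by (simp add: frame_def)
 have e: "Yop (frm be M) i f = (%x. SUM b:UNIV. M i b x*Yop be b f x)" for i by (rule ext) (rule Yop_frm)
 have "Yop (frm be M) i (Yop (frm be M) j f) x - Yop (frm be M) j (Yop (frm be M) i f) x
  = (SUM e:UNIV. frame_bracket be M i j e x*Yop be e f x)"
  unfolding e by (rule frame_commutator[OF T(1) x M R_Yop[OF T(1) PT1 T(3)] hamiltonian_commutator[OF PT T(1,3) x]])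
 also have "... = (SUM a:UNIV. (SUM e:UNIV. frame_bracket be M i j e x*be e a x)*pd a f x)"
  unfolding Yop_def sum_distrib_left sum_distrib_right by (subst sum.swap) (simp add: mult.assoc)
 also have "... = 0" using frame_bracket_kernel[OF P V fr rows ij] x T(2) by (simp add: subset_iff)
 finally show ?thesis by simp
qed

text \<open>By \<open>range\<close> the numbers \<open>Yop be2 b F x\<close> form a vector in the
  range of \<open>be1\<close>, so a combination of them depends only on the same combination of the
  rows of \<open>be1\<close> (\<open>range'\<close>). Combinations of rows that vanish thus give
  closedness along the frame, and solving along the frame gives the equation for every b.\<close>

lemma lenard_local_step:
 assumes P: "poisson_tensor V be1" "poisson_tensor V be2" "poisson_tensor V (%a b x. be1 a b x + be2 a b x)"
  and V: "open V" and fr: "frame be1 V I M"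
  and rows: "ALL x:V. ALL e a. be1 e a x = (SUM i:I. be1 e i x*frm be1 M i a x)"
  and solve: "!!g. ALL i:I. R V (g i) ==>
   ALL i:I. ALL j:I. ALL x:V. Yop (frm be1 M) i (g j) x = Yop (frm be1 M) j (g i) x ==>
   EX G. R V G & (ALL i:I. ALL x:V. Yop (frm be1 M) i G x = g i x)"
  and F: "R V F'" "R V F" and chain: "!!x b. x:V ==> Yop be2 b F' x = - Yop be1 b F x"
  and range: "!!x. x:V ==> EX u. ALL b. to_complex (Yop be2 b F x) = (SUM a:UNIV. to_complex (be1 b a x)*u a)"
 shows "EX G. R V G & (ALL x:V. ALL b. Yop be2 b F x = - Yop be1 b G x)"
proof -
 note P11 = poisson_tensorD(1)[OF P(1)] and P21 = poisson_tensorD(1)[OF P(2)]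
 have M: "R V (M i b)" for i b using fr by (simp add: frame_def)
 have z: "R V (Yop be2 b F)" for b by (rule R_Yop[OF V P21 F(2)])
 define g where "g = (%i x. SUM b:UNIV. M i b x*Yop be2 b F x)"
 have Rg: "R V (g i)" for i unfolding g_def by (intro R_sum R_mult V M z)
 have range': "(SUM e:UNIV. m e*Yop be2 e F x) = (SUM e:UNIV. m' e*Yop be2 e F x)"
  if x: "x:V" and m: "!!a. (SUM e:UNIV. m e*be1 e a x) = (SUM e:UNIV. m' e*be1 e a x)" for m m' x
 proof -
  obtain u where u: "ALL b. to_complex (Yop be2 b F x) = (SUM a:UNIV. to_complex (be1 b a x)*u a)" using range[OF x] by blast
  have "to_complex (SUM e:UNIV. m e*Yop be2 e F x) = (SUM a:UNIV. to_complex (SUM e:UNIV. m e*be1 e a x)*u a)" for m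
   unfolding to_complex_sum to_complex_mult u[rule_format] sum_distrib_left sum_distrib_right by (subst sum.swap) (simp add: mult.assoc)
  then have "to_complex (SUM e:UNIV. m e*Yop be2 e F x) = to_complex (SUM e:UNIV. m' e*Yop be2 e F x)" by (simp only: m)
  then show ?thesis by simp
 qed
 have closed: "Yop (frm be1 M) i (g j) x = Yop (frm be1 M) j (g i) x" if ij: "i:I" "j:I" and x: "x:V" for i j x
 proof -
  have "Yop (frm be1 M) i (g j) x - Yop (frm be1 M) j (g i) x
   = (SUM e:UNIV. frame_bracket be1 M i j e x*Yop be2 e F x)"
   unfolding g_def by (rule frame_commutator[OF V x M z chain_derivation[OF P V F chain x]])
  also have "... = (SUM e:UNIV. 0*Yop be2 e F x)" by (rule range'[OF x]) (simp add: frame_bracket_kernel[OF P(1) V fr rows ij x])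
  finally show ?thesis by simp
 qed
 obtain G where G: "R V G" "ALL i:I. ALL x:V. Yop (frm be1 M) i G x = g i x" using solve[of g] Rg closed by blast
 \<comment> \<open>The recurrence carries a minus sign, so the next function is - G.\<close>
 have "Yop be2 b F x = - Yop be1 b (%x. - G x) x" if x: "x:V" for x b
 proof -
  have "Yop be1 b G x = (SUM a:UNIV. SUM i:I. be1 b i x*frm be1 M i a x*pd a G x)"
   unfolding Yop_def by (simp only: sum_distrib_right[symmetric] rows[rule_format, OF x, symmetric])
  also have "... = (SUM i:I. be1 b i x*Yop (frm be1 M) i G x)"
   unfolding Yop_def sum_distrib_left by (subst sum.swap) (simp add: mult.assoc)
  also have "... = (SUM i:I. be1 b i x*g i x)" using G(2) x by simp
  also have "... = (SUM e:UNIV. (SUM i:I. be1 b i x*M i e x)*Yop be2 e F x)"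
   unfolding g_def sum_distrib_left sum_distrib_right by (subst sum.swap) (simp add: mult.assoc)
  also have "... = (SUM e:UNIV. (if e = b then 1 else 0)*Yop be2 e F x)"
  proof (rule range'[OF x])
   fix a
   have "(SUM e:UNIV. (SUM i:I. be1 b i x*M i e x)*be1 e a x) = (SUM i:I. be1 b i x*frm be1 M i a x)"
    unfolding frm_def sum_distrib_left sum_distrib_right by (subst sum.swap) (simp add: mult.assoc)
   also have "... = be1 b a x" by (rule rows[rule_format, OF x, symmetric])
   also have "... = (SUM e:UNIV. (if e = b then 1 else 0)*be1 e a x)" by (simp add: if_distrib[of "%c. c*_"] cong: if_cong)
   finally show "(SUM e:UNIV. (SUM i:I. be1 b i x*M i e x)*be1 e a x) = (SUM e:UNIV. (if e = b then 1 else 0)*be1 e a x)" .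
  qed
  also have "... = Yop be2 b F x" by (simp add: if_distrib[of "%c. c*_"] cong: if_cong)
  finally have "Yop be1 b G x = Yop be2 b F x" .
  moreover have "Yop be1 b (%x. - G x) x = - Yop be1 b G x"
   using Yop_mult[OF V R_const[OF V, of "-1"] G(1) x, of be1 b] by simp
  ultimately show ?thesis by simp
 qed
 moreover have "R V (%x. - G x)" using R_mult[OF V R_const[OF V, of "-1"] G(1)] by simp
 ultimately show ?thesis by blast
qed

end

section \<open>Independence as an open condition\<close>

lemma dual_family:
 fixes w :: "'i => 'n::finite => complex"
 assumes w: "independent_family I w"
 obtains d where "ALL i:I. ALL j:I. (SUM a:UNIV. d i a*w j a) = (if i = j then 1 else 0)"
proof -
 interpret vp: vector_space_pair "fscale :: complex => ('n => complex) => _" "times :: complex => complex => complex"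
  by standard (auto simp: algebra_simps)
 have inj: "inj_on w I" and ind: "fs.independent (w ` I)" using w by (auto simp: independent_family_def)
 have "EX c. ALL j:I. (SUM a:UNIV. c a*w j a) = (if i = j then 1 else 0)" if i: "i:I" for i
 proof -
  obtain g where g: "Vector_Spaces.linear fscale times g" "ALL v:w ` I. g v = (if v = w i then 1 else 0)"
   using vp.linear_independent_extend[OF ind, of "%v. if v = w i then 1 else 0"] by blast
  define e where "e = (%(a::'n) c. if c = a then 1 else 0 :: complex)"
  have "(SUM a:UNIV. g (e a) * v a) = g v" for v
  proof -
   have "v = (SUM a:UNIV. fscale (v a) (e a))" by (rule ext) (simp add: sum_fscale_apply e_def if_distrib[of "%c. _*c"] cong: if_cong)
   then have "g v = g (SUM a:UNIV. fscale (v a) (e a))" by simp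
   also have "... = (SUM a:UNIV. v a*g (e a))" by (simp only: vp.linear_sum[OF g(1)] vp.linear_scale[OF g(1)])
   finally show ?thesis by (simp add: mult.commute)
  qed
  then have "(SUM a:UNIV. g (e a)*w j a) = (if i = j then 1 else 0)" if j: "j:I" for j using g(2) j inj_on_eq_iff[OF inj j i] by auto
  then show ?thesis by (intro exI[of _ "%a. g (e a)"]) blast
 qed
 then have "ALL i:I. EX c. ALL j:I. (SUM a:UNIV. c a*w j a) = (if i = j then 1 else 0)" by blast
 from bchoice[OF this] show thesis using that by blast
qed

text \<open>Look at an index where the coefficient of a relation is largest: the pairings with
  \<open>d\<close> are so close to the identity matrix that the remaining terms cannot cancel this
  coefficient.\<close>

lemma diagonal_dominant_independent:
 fixes w d :: "'i => 'n::finite => complex"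
 assumes I: "finite I"
  and dom: "!!i j. i:I ==> j:I ==> norm ((SUM a:UNIV. d i a*w j a) - (if i = j then 1 else 0)) < 1/(real (card I) + 1)"
 shows "independent_family I w" unfolding independent_family_iff[OF I]
proof (intro allI impI ballI, rule ccontr)
 fix c k assume c: "(SUM j:I. fscale (c j) (w j)) = 0" and k: "k:I" "c k ~= 0"
 have "Max ((%j. norm (c j)) ` I):(%j. norm (c j)) ` I" using I k(1) by (intro Max_in) auto
 then obtain i where i': "i:I" "Max ((%j. norm (c j)) ` I) = norm (c i)" by blast
 have i: "norm (c j) <= norm (c i)" if "j:I" for j
  using Max_ge[of "(%j. norm (c j)) ` I" "norm (c j)"] I that unfolding i'(2) by auto
 have pos: "0 < norm (c i)" using i[OF k(1)] k(2) by (meson less_le_trans zero_less_norm_iff)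
 define G where "G = (%j. (SUM a:UNIV. d i a*w j a))"
 have "(SUM j:I. c j*G j) = (SUM a:UNIV. d i a*(SUM j:I. c j*w j a))"
  unfolding G_def sum_distrib_left by (subst sum.swap) (simp add: algebra_simps)
 also have "... = 0" using c by (simp flip: sum_fscale_apply)
 finally have z: "(SUM j:I. c j*G j) = 0" .
 have "c i = (SUM j:I. c j*(if i = j then 1 else 0))" using I i'(1) by (simp add: if_distrib[of "%u. _*u"] cong: if_cong)
 also have "... = - (SUM j:I. c j*(G j - (if i = j then 1 else 0)))" using z by (simp only: right_diff_distrib sum_subtractf) simp
 finally have "norm (c i) = norm (SUM j:I. c j*(G j - (if i = j then 1 else 0)))" by (metis norm_minus_cancel)
 also have "... <= (SUM j:I. norm (c j*(G j - (if i = j then 1 else 0))))" by (rule norm_sum)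
 also have "... <= (SUM j:I. norm (c i)*(1/(real (card I) + 1)))" unfolding norm_mult G_def
  by (intro sum_mono mult_mono i less_imp_le[OF dom[OF i'(1)]]) auto
 also have "... = norm (c i)*(real (card I)/(real (card I) + 1))" by simp
 also have "... < norm (c i)*1" using pos by (intro mult_strict_left_mono) auto
 finally show False by simp
qed

text \<open>The matrix of pairings with the dual family is the identity at \<open>p\<close> and
  continuous there, so near \<open>p\<close> it stays close enough to the identity.\<close>

lemma independent_near:
 fixes w :: "'i => 'p::t2_space => 'n::finite => complex"
 assumes I: "finite I" and w: "independent_family I (%i. w i p)" and cont: "!!i a. i:I ==> isCont (%x. w i x a) p"
 obtains U where "open U" "p:U" "ALL x:U. independent_family I (%i. w i x)"
proof -
 obtain d where d: "ALL i:I. ALL j:I. (SUM a:UNIV. d i a*w j p a) = (if i = j then 1 else 0)" by (rule dual_family[OF w])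
 have "\<forall>\<^sub>F x in nhds p. ALL i:I. ALL j:I. norm ((SUM a:UNIV. d i a*w j x a) - (if i = j then 1 else 0)) < 1/(real (card I) + 1)"
 proof (intro eventually_ball_finite I ballI)
  fix i j assume ij: "i:I" "j:I"
  have "isCont (%x. SUM a:UNIV. d i a*w j x a) p" by (intro continuous_intros cont ij)
  then have "((%x. SUM a:UNIV. d i a*w j x a) \<longlongrightarrow> (if i = j then 1 else 0)) (nhds p)"
   using d ij by (simp add: continuous_within tendsto_nhds_iff)
  then have "\<forall>\<^sub>F x in nhds p. dist (SUM a:UNIV. d i a*w j x a) (if i = j then 1 else 0) < 1/(real (card I) + 1)"
   by (rule tendstoD) simp
  then show "\<forall>\<^sub>F x in nhds p. norm ((SUM a:UNIV. d i a*w j x a) - (if i = j then 1 else 0)) < 1/(real (card I) + 1)"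
   by (simp add: dist_norm)
 qed
 then obtain U where U: "open U" "p:U"
  "ALL x:U. ALL i:I. ALL j:I. norm ((SUM a:UNIV. d i a*w j x a) - (if i = j then 1 else 0)) < 1/(real (card I) + 1)"
  unfolding eventually_nhds by blast
 have "independent_family I (%i. w i x)" if "x:U" for x by (rule diagonal_dominant_independent[OF I, of d]) (use U(3) that in blast)
 then show thesis using that U by blast
qed

context regularity
begin

section \<open>Gradients and the local Lenard scheme\<close>

definition grad :: "('k^'n => 'k) => 'k^'n => 'n => complex" where
 "grad f x = (%a. to_complex (pd a f x))"

lemma sum_grad: "(SUM a:UNIV. to_complex (be b a x)*grad f x a) = to_complex (Yop be b f x)"
 by (simp add: grad_def Yop_def to_complex_sum to_complex_mult)

lemma skew_sum:
 assumes "!!a b. be a b x = - be b a x"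
 shows "(SUM a:UNIV. u a*to_complex (be a b x)) = - (SUM a:UNIV. to_complex (be b a x)*u a)"
 unfolding sum_negf[symmetric] by (rule sum.cong[OF refl]) (subst assms, simp)

lemma grad_kernel:
 assumes "!!a b. be a b x = - be b a x"
 shows "grad f x:form_kernel UNIV (form be x) \<longleftrightarrow> (ALL b. Yop be b f x = 0)"
 unfolding form_kernel_iff[where be=be and x=x, OF assms] sum_grad by simp

lemma grad_form:
 assumes skew: "!!a b. be a b x = - be b a x" "!!a b. be' a b x = - be' b a x"
  and eq: "!!b. Yop be b f x = - Yop be' b g x"
 shows "form be x (grad f x) v = - form be' x (grad g x) v"
proof -
 have "form be x (grad f x) v = -1*form be' x (grad g x) v"
  by (rule form_eqI) (simp add: skew_sum[where be=be and x=x, OF skew(1)] skew_sum[where be=be' and x=x, OF skew(2)] sum_grad eq)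
 then show ?thesis by simp
qed

lemma rows_Yop:
 assumes "!!a. be b a x = (SUM i:I. be b i x*frm be M i a x)"
 shows "Yop be b G x = (SUM i:I. be b i x*Yop (frm be M) i G x)"
proof -
 have "Yop be b G x = (SUM a:UNIV. (SUM i:I. be b i x*frm be M i a x)*pd a G x)"
  unfolding Yop_def by (simp only: assms[symmetric])
 also have "... = (SUM i:I. be b i x*Yop (frm be M) i G x)"
  unfolding Yop_def sum_distrib_left sum_distrib_right by (subst sum.swap) (simp add: mult.assoc)
 finally show ?thesis .
qed

lemma coordinate_independent:
 assumes "!!t t'. t:T ==> t':T ==> w t (e t') = (if t = t' then 1 else 0 :: complex)" "finite T"
 shows "independent_family T w" unfolding independent_family_iff[OF assms(2)]
proof (intro allI impI ballI)
 fix c t assume c: "(SUM t:T. fscale (c t) (w t)) = 0" and t: "t:T"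
 have "(SUM t:T. fscale (c t) (w t)) (e t) = (SUM t':T. if t' = t then c t else 0)"
  unfolding sum_fscale_apply by (rule sum.cong) (use assms(1) t in auto)
 then show "c t = 0" using c t assms(2) by simp
qed

theorem local_lenard_scheme:
 assumes S: "open S" "p:S"
  and P: "poisson_tensor S be1" "poisson_tensor S be2" "poisson_tensor S (%a b x. be1 a b x + be2 a b x)"
  and L: "!!x. x:S ==> lenard_space UNIV (form be1 x) (form be2 x) (W x) (T x) (K x) s N"
 shows "EX V k H. open V & p:V & V <= S & (ALL t<s. ALL i. R V (H t i)) &
  (ALL t<s. ALL x:V. ALL b. Yop be1 b (H t 0) x = 0) &
  (ALL t<s. ALL i. ALL x:V. ALL b. Yop be2 b (H t i) x = - Yop be1 b (H t (Suc i)) x) &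
  (ALL x:V. independent_family (SIGMA t:{..<s}. {..k t}) (%(t, i). grad (H t i) x)) &
  (SUM t<s. k t + 1) = N"
proof -
 have skew: "be1 a b x = - be1 b a x" "be2 a b x = - be2 b a x" if "x:S" for a b x
  using poisson_tensorD(2) P(1,2) that by blast+
 have rank: "fs.dim (form_kernel UNIV (form be1 x)) = s" if "x:S" for x using lenard_space.K(2,3)[OF L[OF that]] by simp
 obtain V0 I M where V0: "open V0" "p:V0" "V0 <= S" and fr0: "frame be1 V0 I M" and cI: "card (- I) = s"
  and rows0: "ALL x:V0. ALL e a. be1 e a x = (SUM i:I. be1 e i x*frm be1 M i a x)"
  by (rule frame_exists[OF S poisson_tensorD(1)[OF P(1)] skew(1) rank])
 have P0: "poisson_tensor V0 be1" by (rule poisson_tensor_subset[OF P(1) S(1) V0(1,3)])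
 have M0: "R V0 (M i b)" for i b using fr0 by (simp add: frame_def)
 have C0: "R V0 (frm be1 M i a)" for i a by (rule R_frm[OF V0(1) poisson_tensorD(1)[OF P0] M0])
 have nl: "frm be1 M i l x = (if i = l then 1 else 0)" if "i:I" "l:I" "x:V0" for i l x using fr0 that by (simp add: frame_def)
 have "EX V f. open V & p:V & V <= V0 & (ALL a. R V (f a)) & (ALL a. ALL i:I. ALL x:V. Yop (frm be1 M) i (f a) x = 0) &
  (ALL a b. b ~: I --> pd b (f a) p = (if a = b then 1 else 0)) &
  (ALL g. (ALL i:I. R V (g i)) --> (ALL i:I. ALL j:I. ALL x:V. Yop (frm be1 M) i (g j) x = Yop (frm be1 M) j (g i) x) -->
   (EX G. R V G & (ALL i:I. ALL x:V. Yop (frm be1 M) i G x = g i x)))"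
 proof (rule frobenius[where C="frm be1 M", OF V0(1,2) C0 nl frame_commutes[OF P0 V0(1) fr0 rows0]])
  fix V f
  assume V: "open V" "p:V" "V <= V0" and f: "!!a. R V (f a)"
   "!!a i x. i:I ==> x:V ==> Yop (frm be1 M) i (f a) x = 0"
   "!!a b. b ~: I ==> pd b (f a) p = (if a = b then 1 else 0)"
   and solve: "!!g. (!!i. i:I ==> R V (g i)) ==>
    (!!i j x. i:I ==> j:I ==> x:V ==> Yop (frm be1 M) i (g j) x = Yop (frm be1 M) j (g i) x) ==>
    EX G. R V G & (ALL i:I. ALL x:V. Yop (frm be1 M) i G x = g i x)"
  show ?thesis
  proof (intro exI[of _ V] exI[of _ f] conjI allI impI ballI)
   fix g assume g: "ALL i:I. R V (g i)" "ALL i:I. ALL j:I. ALL x:V. Yop (frm be1 M) i (g j) x = Yop (frm be1 M) j (g i) x"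
   show "EX G. R V G & (ALL i:I. ALL x:V. Yop (frm be1 M) i G x = g i x)" by (rule solve) (use g in auto)
  qed (use V f in auto)
 qed
 then obtain V f where V: "open V" "p:V" "V <= V0" and f: "ALL a. R V (f a)" "ALL a. ALL i:I. ALL x:V. Yop (frm be1 M) i (f a) x = 0"
  "ALL a b. b ~: I --> pd b (f a) p = (if a = b then 1 else 0)"
  and solve: "ALL g. (ALL i:I. R V (g i)) --> (ALL i:I. ALL j:I. ALL x:V. Yop (frm be1 M) i (g j) x = Yop (frm be1 M) j (g i) x) -->
   (EX G. R V G & (ALL i:I. ALL x:V. Yop (frm be1 M) i G x = g i x))" by blast
 have VS: "V <= S" using V(3) V0(3) by blast
 have rows: "ALL x:V. ALL e a. be1 e a x = (SUM i:I. be1 e i x*frm be1 M i a x)" using rows0 V(3) by blast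
 have fr: "frame be1 V I M" using fr0 V(3) R_subset[OF V0(1) _ V(1,3)] by (auto simp: frame_def)
 note PV = poisson_tensor_subset[OF P(1) S(1) V(1) VS] poisson_tensor_subset[OF P(2) S(1) V(1) VS]
  poisson_tensor_subset[OF P(3) S(1) V(1) VS]
 have cas: "Yop be1 b (f a) x = 0" if x: "x:V" for a b x
 proof -
  have "Yop be1 b (f a) x = (SUM i:I. be1 b i x*Yop (frm be1 M) i (f a) x)" by (rule rows_Yop) (rule rows[rule_format, OF x])
  then show ?thesis using f(2) x by simp
 qed
 \<comment> \<open>What a function must satisfy to be continued: a predecessor makes the data of the
   next step closed, and a gradient in \<open>W\<close> puts them in the range of the first
   tensor.\<close>
 define St where "St = (%F. R V F & (EX F'. R V F' & (ALL x:V. ALL b. Yop be2 b F' x = - Yop be1 b F x)) & (ALL x:V. grad F x:W x))"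
 have step: "EX G. St G & (ALL x:V. ALL b. Yop be2 b F x = - Yop be1 b G x)" if F: "St F" for F
 proof -
  obtain F' where F': "R V F'" "ALL x:V. ALL b. Yop be2 b F' x = - Yop be1 b F x" using F unfolding St_def by blast
  have RF: "R V F" using F unfolding St_def by blast
  have range: "EX u. ALL b. to_complex (Yop be2 b F x) = (SUM a:UNIV. to_complex (be1 b a x)*u a)" if x: "x:V" for x
  proof -
   have xS: "x:S" using x VS by blast
   have "grad F x:W x" using F x unfolding St_def by blast
   then obtain u where u: "ALL v. form be2 x (grad F x) v = - form be1 x u v" using lenard_space.shift[OF L[OF xS]] by blast
   have "to_complex (Yop be2 b F x) = (SUM a:UNIV. to_complex (be1 b a x)*(- u a))" for b
   proof -
    have "form be2 x (grad F x) (%c. if c = b then 1 else 0) = - form be1 x u (%c. if c = b then 1 else 0)" using u by blast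
    then show ?thesis
     unfolding form_basis skew_sum[where be=be1 and x=x, OF skew(1)[OF xS]] skew_sum[where be=be2 and x=x, OF skew(2)[OF xS]] sum_grad
     by (simp only: neg_equal_iff_equal mult_minus_right sum_negf minus_minus minus_equation_iff) (metis minus_minus)
   qed
   then show ?thesis by (intro exI[of _ "%a. - u a"]) blast
  qed
  \<comment> \<open>The neighbourhood \<open>V\<close> was fixed beforehand and is not shrunk by the
    step, so infinitely many steps can follow on it.\<close>
  have "EX G. R V G & (ALL x:V. ALL b. Yop be2 b F x = - Yop be1 b G x)"
   by (rule lenard_local_step[OF PV V(1) fr rows solve[THEN spec, THEN mp, THEN mp] F'(1) RF F'(2)[rule_format] range])
  then obtain G where G: "R V G" "ALL x:V. ALL b. Yop be2 b F x = - Yop be1 b G x" by blast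
  have "grad G x:W x" if x: "x:V" for x
  proof -
   have xS: "x:S" using x VS by blast
   have "grad F x:W x" using F x unfolding St_def by blast
   moreover have "ALL v. form be2 x (grad F x) v = - form be1 x (grad G x) v"
    using grad_form[where be=be2 and be'=be1 and x=x and f=F and g=G, OF skew(2)[OF xS] skew(1)[OF xS]] G(2) x by blast
   ultimately show ?thesis using lenard_space.shift_mem[OF L[OF xS]] by blast
  qed
  then have "St G" unfolding St_def using G RF by blast
  then show ?thesis using G(2) by blast
 qed
 \<comment> \<open>The s Casimir functions are the first integrals \<open>f a\<close> with
   \<open>a\<close> outside \<open>I\<close>; at \<open>p\<close> their partial derivatives in these
   directions form the identity matrix.\<close>
 obtain h where h: "bij_betw h {0..<card (- I)} (- I)" using ex_bij_betw_nat_finite[of "- I"] by auto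
 have hI: "h t ~: I" if "t < s" for t using h that cI by (auto simp: bij_betw_def)
 have hinj: "h t = h t' \<longleftrightarrow> t = t'" if "t < s" "t' < s" for t t' using h that cI by (auto simp: bij_betw_def inj_on_def)
 have ker: "grad (f a) x:form_kernel UNIV (form be1 x)" if "x:V" for a x
  using grad_kernel[where be=be1 and x=x, OF skew(1)] cas that VS by blast
 have St0: "St (f a)" for a
 proof -
  \<comment> \<open>The constant 0 serves as the predecessor of a Casimir function.\<close>
  have "ALL x:V. ALL b. Yop be2 b (%x. 0) x = - Yop be1 b (f a) x" using cas by simp
  moreover have "grad (f a) x:W x" if "x:V" for x using lenard_space.K(4)[OF L] ker that VS by blast
  ultimately show ?thesis unfolding St_def using f(1) R_const[OF V(1), of 0] by blast
 qed
 have "EX H. ALL n. (St (H n) & (n = 0 --> H n = f a)) & (ALL x:V. ALL b. Yop be2 b (H n) x = - Yop be1 b (H (Suc n)) x)" for a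
  by (rule dependent_nat_choice) (use St0 step in auto)
 then obtain H' where H': "!!a n. St (H' a n)" "!!a. H' a 0 = f a" "!!a n. ALL x:V. ALL b. Yop be2 b (H' a n) x = - Yop be1 b (H' a (Suc n)) x"
  by metis
 define H where "H = (%t. H' (h t))"
 have RH: "R V (H t i)" for t i using H'(1) unfolding St_def H_def by blast
 have H0: "ALL x:V. ALL b. Yop be1 b (H t 0) x = 0" for t using cas H'(2) by (simp add: H_def)
 have HS: "ALL x:V. ALL b. Yop be2 b (H t i) x = - Yop be1 b (H t (Suc i)) x" for t i using H'(3) by (simp add: H_def)
 \<comment> \<open>The lengths are chosen at \<open>p\<close> alone; independence of the chosen
   gradients persists nearby.\<close>
 have "EX k. independent_family (SIGMA t:{..<s}. {..k t}) (%(t, i). grad (H t i) p) & (SUM t<s. k t + 1) = N"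
 proof (rule lenard_space.select[OF L[OF S(2)]])
  show "grad (H t 0) p:form_kernel UNIV (form be1 p)" for t using ker[OF V(2)] H'(2) by (simp add: H_def)
  show "independent_family {..<s} (%t. grad (H t 0) p)"
   by (rule coordinate_independent[of _ _ h]) (use f(3) hI hinj H'(2) in \<open>auto simp: grad_def H_def\<close>)
  show "ALL v:UNIV. form be2 p (grad (H t i) p) v = - form be1 p (grad (H t (Suc i)) p) v" for t i
   using grad_form[where be=be2 and be'=be1 and x=p, OF skew(2)[OF S(2)] skew(1)[OF S(2)]] HS V(2) by blast
 qed simp
 then obtain k where k: "independent_family (SIGMA t:{..<s}. {..k t}) (%q. case q of (t, i) => grad (H t i) p)"
  "(SUM t<s. k t + 1) = N" by blast
 obtain U where U: "open U" "p:U" "ALL x:U. independent_family (SIGMA t:{..<s}. {..k t}) (%q. case q of (t, i) => grad (H t i) x)"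
 proof (rule independent_near[where w="%q x. case q of (t, i) => grad (H t i) x", OF _ k(1)])
  fix q a
  have c: "isCont (pd a (H t i)) p" for t i by (rule R_isCont[OF V(1) R_pd[OF V(1) RH] V(2)])
  have tc: "isCont to_complex (x::'k)" for x unfolding isCont_def tendsto_iff
  proof (intro allI impI)
   fix e :: real assume "0 < e"
   then show "\<forall>\<^sub>F y in at x. dist (to_complex y) (to_complex x) < e"
   proof -
    have "dist (to_complex y) (to_complex x) = dist y x" for y :: 'k
    proof -
     have "to_complex y - to_complex x = to_complex (y - x)" by (metis to_complex_add diff_add_cancel add_diff_cancel)
     then show ?thesis by (simp add: dist_norm norm_to_complex)
    qed
    then show ?thesis using \<open>0 < e\<close> by (auto simp: eventually_at intro: exI[of _ e])
   qed
  qed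
  show "isCont (%x. (case q of (t, i) => grad (H t i) x) a) p" by (cases q) (auto simp: grad_def intro: isCont_o2[OF c tc])
 qed auto
 define V' where "V' = V \<inter> U"
 have V': "open V'" "p:V'" "V' <= V" "V' <= U" "V' <= S" using V U VS by (auto simp: V'_def)
 have "R V' (H t i)" for t i by (rule R_subset[OF V(1) RH V'(1,3)])
 moreover have "ALL x:V'. ALL b. Yop be1 b (H t 0) x = 0" for t using H0 V'(3) by blast
 moreover have "ALL x:V'. ALL b. Yop be2 b (H t i) x = - Yop be1 b (H t (Suc i)) x" for t i using HS V'(3) by blast
 moreover have "ALL x:V'. independent_family (SIGMA t:{..<s}. {..k t}) (%(t, i). grad (H t i) x)" using U(3) V'(4) by blast
 ultimately show ?thesis using V'(1,2,5) k(2) by (intro exI[of _ V'] exI[of _ k] exI[of _ H] conjI) auto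
qed

end

section \<open>Charts, tangent vectors and brackets\<close>

locale regular_manifold = manifold R X A + regularity R RT
 for R :: "('k::{ground_field,banach}^'n::finite) set => ('k^'n => 'k) => bool"
  and RT :: "('k^'n) set => (real => 'k^'n => 'k) => bool"
  and X :: "'a topology" and A :: "('a, 'k, 'n) chart set"
begin

section \<open>Regular functions and derivations on the manifold\<close>

lemma chart_inj: "(U, ph):A ==> inj_on ph U"
 using homeomorphic_imp_injective_map[OF chart_homeomorphic] openin_subset chart_open by (metis inf.absorb_iff2 topspace_subtopology)

lemma chart_image_open:
 assumes A: "(U, ph):A" and W: "openin X W" "W <= U"
 shows "open (ph ` W)"
proof -
 have U: "openin X U" "open (ph ` U)" using chart_open[OF A] by auto
 have "openin (subtopology X U) W" using W U(1) by (simp add: openin_open_subtopology)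
 then have "openin (top_of_set (ph ` U)) (ph ` W)" using homeomorphic_map_openness[OF chart_homeomorphic[OF A], of W] openin_subset by blast
 then show ?thesis using U(2) by (simp add: openin_open_eq)
qed

lemma chart_preimage_open:
 assumes A: "(U, ph):A" and S: "open S"
 shows "openin X {x:U. ph x:S}"
proof -
 have U: "openin X U" "open (ph ` U)" using chart_open[OF A] by auto
 have "continuous_map (subtopology X U) (top_of_set (ph ` U)) ph" by (rule homeomorphic_imp_continuous_map[OF chart_homeomorphic[OF A]])
 moreover have "openin (top_of_set (ph ` U)) (S \<inter> ph ` U)" using S U(2) by (simp add: openin_open_eq open_Int)
 ultimately have "openin (subtopology X U) {x:topspace (subtopology X U). ph x:S \<inter> ph ` U}"
  by (rule openin_continuous_map_preimage)
 moreover have "{x:topspace (subtopology X U). ph x:S \<inter> ph ` U} = {x:U. ph x:S}"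
  using openin_subset[OF U(1)] by auto
 ultimately show ?thesis using U(1) by (simp add: openin_open_subtopology)
qed

text \<open>One chart suffices, because the passage to any other is composition with a regular
  transition map.\<close>

lemma regular_on_chart:
 assumes A: "(U, ph):A" and W: "openin X W" "W <= U"
 shows "regular_on W f \<longleftrightarrow> R (ph ` W) (%y. f (inv_into U ph y))"
proof
 assume "regular_on W f"
 then have "R (ph ` (W \<inter> U)) (%y. f (inv_into U ph y))" using A unfolding regular_on_def by auto
 then show "R (ph ` W) (%y. f (inv_into U ph y))" using W(2) by (simp add: Int_absorb2)
next
 assume f: "R (ph ` W) (%y. f (inv_into U ph y))"
 have "R (ph' ` (W \<inter> W')) (%y. f (inv_into W' ph' y))" if A': "(W', ph'):A" for W' ph'
 proof -
  let ?ps' = "inv_into W' ph'"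
  have o: "openin X (W \<inter> W')" "openin X (W' \<inter> U)" using W chart_open A A' by blast+
  have O: "open (ph' ` (W \<inter> W'))" "open (ph' ` (W' \<inter> U))" using chart_image_open[OF A'] o by auto
  have inv: "?ps' y:W" "?ps' y:U" if y: "y:ph' ` (W \<inter> W')" for y
  proof -
   obtain x where "x:W" "x:W'" "y = ph' x" using y by blast
   then show "?ps' y:W" "?ps' y:U" using inv_into_f_f[OF chart_inj[OF A']] W(2) by auto
  qed
  have "R (ph' ` (W \<inter> W')) (%y. f (inv_into U ph (ph (?ps' y))))"
  proof (rule R_compose[OF chart_image_open[OF A W] O(1) f])
   show "R (ph' ` (W \<inter> W')) (%y. ph (?ps' y)$i)" for i
    by (rule R_subset[OF O(2) transition_regular[OF A' A] O(1)]) (use W(2) in blast)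
   show "ph (?ps' y):ph ` W" if "y:ph' ` (W \<inter> W')" for y using inv(1)[OF that] by blast
  qed
  then show ?thesis
  proof (rule R_cong[OF O(1)])
   show "f (inv_into U ph (ph (?ps' y))) = f (?ps' y)" if "y:ph' ` (W \<inter> W')" for y
    using inv_into_f_f[OF chart_inj[OF A] inv(2)[OF that]] by simp
  qed
 qed
 then show "regular_on W f" using W(1) unfolding regular_on_def by auto
qed

lemma regular_on_open: "regular_on W f ==> openin X W" by (simp add: regular_on_def)

lemma regular_on_chartwise:
 assumes "openin X W" "!!C ph. (C, ph):A ==> open (ph ` (W \<inter> C)) ==> R (ph ` (W \<inter> C)) (%y. f (inv_into C ph y))"
 shows "regular_on W f" unfolding regular_on_def
proof (intro conjI ballI)
 fix c assume c: "c:A"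
 obtain C ph where C: "c = (C, ph)" by (cases c)
 have "openin X (W \<inter> C)" using assms(1) chart_open[of C ph] c C by auto
 then have "open (ph ` (W \<inter> C))" using chart_image_open[of C ph "W \<inter> C"] c C by auto
 then show "case c of (C, ph) => R (ph ` (W \<inter> C)) (%y. f (inv_into C ph y))" using assms(2)[of C ph] c C by simp
qed (rule assms(1))

lemma regular_onD: "regular_on W f ==> (C, ph):A ==> R (ph ` (W \<inter> C)) (%y. f (inv_into C ph y))"
 by (auto simp: regular_on_def)

lemma regular_on_subset:
 assumes f: "regular_on W f" and W': "openin X W'" "W' <= W"
 shows "regular_on W' f"
proof (rule regular_on_chartwise[OF W'(1)])
 fix C ph assume C: "(C, ph):A" "open (ph ` (W' \<inter> C))"
 have "openin X (W \<inter> C)" using regular_on_open[OF f] chart_open[OF C(1)] by blast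
 then have "open (ph ` (W \<inter> C))" using chart_image_open[OF C(1)] by blast
 then show "R (ph ` (W' \<inter> C)) (%y. f (inv_into C ph y))"
  by (rule R_subset[OF _ regular_onD[OF f C(1)] C(2)]) (use W'(2) in blast)
qed

lemma regular_on_const: "openin X W ==> regular_on W (%x. c)" by (rule regular_on_chartwise) (auto intro: R_const)

lemma regular_on_add: "regular_on W f ==> regular_on W g ==> regular_on W (f + g)"
 by (rule regular_on_chartwise[OF regular_on_open], assumption) (auto intro: R_add regular_onD)

lemma regular_on_mult: "regular_on W f ==> regular_on W g ==> regular_on W (f*g)"
 by (rule regular_on_chartwise[OF regular_on_open], assumption) (auto intro: R_mult regular_onD)

lemma regular_on_fscale: "regular_on W f ==> regular_on W (fscale c f)"
 by (rule regular_on_chartwise[OF regular_on_open], assumption) (auto intro: R_mult R_const regular_onD)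

lemma regular_on_sum: "openin X W ==> (!!i. i:I ==> regular_on W (f i)) ==> regular_on W (SUM i:I. f i)"
proof (induction I rule: infinite_finite_induct)
 case (insert i I)
 have "regular_on W (f i + (SUM i:I. f i))" by (rule regular_on_add) (use insert in auto)
 then show ?case by (simp only: sum.insert[OF insert.hyps(1,2)])
qed (use regular_on_const[of W 0] in \<open>auto simp: zero_fun_def\<close>)

lemma regular_at_common:
 assumes "regular_at m f" "regular_at m g" "openin X U" "m:U"
 obtains W where "openin X W" "W <= U" "m:W" "regular_on W f" "regular_on W g"
proof -
 obtain W1 W2 where W: "m:W1" "regular_on W1 f" "m:W2" "regular_on W2 g" using assms(1,2) unfolding regular_at_def by blast
 have o: "openin X (W1 \<inter> W2 \<inter> U)" using W assms(3) regular_on_open by blast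
 show thesis by (rule that[OF o]) (use W assms(4) o in \<open>auto intro: regular_on_subset\<close>)
qed

lemma tangent_regular:
 assumes v: "v:tangent_space m"
 shows "m:U ==> regular_on U f ==> regular_on U g ==> (!!x. x:U ==> f x = g x) ==> v f = v g"
  "regular_at m f ==> regular_at m g ==> v (f + g) = v f + v g"
  "regular_at m f ==> v (fscale c f) = c * v f"
  "regular_at m f ==> regular_at m g ==> v (f*g) = v f*g m + f m * v g"
proof -
 show "m:U ==> regular_on U f ==> regular_on U g ==> (!!x. x:U ==> f x = g x) ==> v f = v g"
  using v unfolding tangent_space_def mem_Collect_eq by blast
 show "regular_at m f ==> regular_at m g ==> v (f + g) = v f + v g"
  "regular_at m f ==> regular_at m g ==> v (f*g) = v f*g m + f m * v g"
  using v unfolding tangent_space_def mem_Collect_eq by blast+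
 show "regular_at m f ==> v (fscale c f) = c * v f" using v unfolding tangent_space_def mem_Collect_eq by blast
qed

lemma tangent_const:
 assumes v: "v:tangent_space m" and m: "m:topspace X"
 shows "v (%x. c) = 0"
proof -
 have r: "regular_at m (%x. c)" for c unfolding regular_at_def using regular_on_const[of "topspace X" c] m by blast
 have "(%x. 1)*(%x::'a. 1::'k) = (%x. 1)" by (rule ext) simp
 then have "v (%x. 1) = v (%x. 1) + v (%x. 1)" using tangent_regular(4)[OF v r[of 1] r[of 1]] by simp
 then have "v (%x. 1) = 0" by simp
 moreover have "fscale c (%x. 1) = (%x::'a. c)" by (rule ext) simp
 ultimately show ?thesis using tangent_regular(3)[OF v r[of 1], of c] by simp
qed

lemma tangent_sum:
 assumes v: "v:tangent_space m" and W: "openin X W" "m:W" and f: "!!i. i:I ==> regular_on W (f i)"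
 shows "v (SUM i:I. f i) = (SUM i:I. v (f i))" using f
proof (induction I rule: infinite_finite_induct)
 case (insert i I)
 have "regular_at m (f i)" "regular_at m (SUM i:I. f i)"
  unfolding regular_at_def using insert.prems regular_on_sum[OF W(1), of I f] W(2) by auto
 then have "v (f i + (SUM i:I. f i)) = v (f i) + v (SUM i:I. f i)" by (rule tangent_regular(2)[OF v])
 also have "v (SUM i:I. f i) = (SUM i:I. v (f i))" by (rule insert.IH) (use insert.prems in blast)
 finally show ?case by (simp only: sum.insert[OF insert.hyps(1,2)])
qed (use tangent_const[OF v, of 0] W openin_subset[OF W(1)] in \<open>auto simp: zero_fun_def\<close>)

end

locale regular_chart = regular_manifold R RT X A
 for R :: "('k::{ground_field,banach}^'n::finite) set => ('k^'n => 'k) => bool"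
  and RT :: "('k^'n) set => (real => 'k^'n => 'k) => bool"
  and X :: "'a topology" and A :: "('a, 'k, 'n) chart set" +
 fixes U :: "'a set" and ph :: "'a => 'k^'n"
 assumes chart: "(U, ph):A"
begin

definition pull :: "('a => 'k) => 'k^'n => 'k" where
 "pull f y = f (inv_into U ph y)"

definition coord :: "'n => 'a => 'k" where
 "coord a x = ph x$a"

text \<open>The value 0 off the functions regular at \<open>m\<close> follows the convention of
  \<open>tangent_space\<close>.\<close>

definition partial :: "'a => 'n => ('a => 'k) => 'k" where
 "partial m a f = (if regular_at m f then pd a (pull f) (ph m) else 0)"

section \<open>Tangent and cotangent vectors in a chart\<close>

lemma U_open: "openin X U" and image_open: "open (ph ` U)" using chart_open[OF chart] by auto

lemma inverse_chart [simp]: "x:U ==> inv_into U ph (ph x) = x" by (rule inv_into_f_f[OF chart_inj[OF chart]])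

lemma pull_chart [simp]: "x:U ==> pull f (ph x) = f x" by (simp add: pull_def)

lemma regular_on_pull: "openin X W ==> W <= U ==> regular_on W f \<longleftrightarrow> R (ph ` W) (pull f)"
 using regular_on_chart[OF chart, of W f] by (simp add: pull_def[abs_def])

lemma W_image_open: "openin X W ==> W <= U ==> open (ph ` W)" by (rule chart_image_open[OF chart])

lemma preimage_open: "open S ==> openin X {x:U. ph x:S}" by (rule chart_preimage_open[OF chart])

lemma preimage_image: "S <= ph ` U ==> ph ` {x:U. ph x:S} = S" by auto

lemma regular_on_push:
 assumes "open S" "S <= ph ` U" "R S f"
 shows "regular_on {x:U. ph x:S} (%x. f (ph x))"
proof -
 have "R S (pull (%x. f (ph x)))" by (rule R_cong[OF assms(1,3)]) (use assms(2) in \<open>auto simp: pull_def\<close>)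
 then show ?thesis using regular_on_pull[OF preimage_open[OF assms(1)]] preimage_image[OF assms(2)] by auto
qed

lemma regular_on_coord: "regular_on U (coord a)"
proof -
 have "regular_on {x:U. ph x:ph ` U} (%x. ph x$a)"
  by (rule regular_on_push[OF image_open order_refl R_coord[OF image_open]])
 moreover have "{x:U. ph x:ph ` U} = U" by auto
 ultimately show ?thesis by (simp add: coord_def[abs_def])
qed

lemma regular_at_coord: "m:U ==> regular_at m (coord a)" unfolding regular_at_def using regular_on_coord by blast

lemma partial_eq: "regular_at m f ==> partial m a f = pd a (pull f) (ph m)" by (simp add: partial_def)

lemma partial_cong:
 assumes "openin X W" "m:W" "W <= U" "!!x. x:W ==> f x = g x"
 shows "pd a (pull f) (ph m) = pd a (pull g) (ph m)" by (rule pd_cong[OF W_image_open[OF assms(1,3)]]) (use assms in auto)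

lemma partial_tangent:
 assumes m: "m:U"
 shows "partial m a:tangent_space m" unfolding tangent_space_def mem_Collect_eq
proof (intro conjI allI impI)
 show "partial m a f = 0" if "\<not> regular_at m f" for f using that by (simp add: partial_def)
 show "partial m a f = partial m a g" if "m:W & regular_on W f & regular_on W g & (ALL x:W. f x = g x)" for W f g
 proof -
  have "regular_at m f" "regular_at m g" using that by (auto simp: regular_at_def)
  moreover have "pd a (pull f) (ph m) = pd a (pull g) (ph m)"
   by (rule partial_cong[of "W \<inter> U"]) (use that m U_open regular_on_open in auto)
  ultimately show ?thesis by (simp add: partial_eq)
 qed
 fix f g c assume fg: "regular_at m f & regular_at m g"
 then obtain W where W: "openin X W" "W <= U" "m:W" "regular_on W f" "regular_on W g" using regular_at_common[OF _ _ U_open m] by blast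
 have o: "open (ph ` W)" "ph m:ph ` W" using W W_image_open by auto
 have Rf: "R (ph ` W) (pull f)" "R (ph ` W) (pull g)" using W regular_on_pull by auto
 have r: "regular_at m (f + g)" "regular_at m (fscale c f)" "regular_at m (f*g)" unfolding regular_at_def
  using W(3) regular_on_add[OF W(4,5)] regular_on_fscale[OF W(4), of c] regular_on_mult[OF W(4,5)] by blast+
 have e: "pull (f + g) = (%y. pull f y + pull g y)" "pull (fscale c f) = (%y. c*pull f y)" "pull (f*g) = (%y. pull f y*pull g y)"
  by (auto simp: pull_def)
 show "partial m a (f + g) = partial m a f + partial m a g" using fg pd_add[OF o(1) Rf o(2), of a] by (simp add: partial_eq r e)
 show "partial m a (fscale c f) = c*partial m a f" using fg pd_mult[OF o(1) R_const[OF o(1), of c] Rf(1) o(2), of a] by (simp add: partial_eq r e)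
 show "partial m a (f*g) = partial m a f*g m + f m*partial m a g"
  using fg pd_mult[OF o(1) Rf o(2), of a] m by (simp add: partial_eq r e algebra_simps)
qed

lemma partial_coord: "m:U ==> partial m a (coord b) = (if a = b then 1 else 0)"
proof -
 assume m: "m:U"
 have "pd a (pull (coord b)) (ph m) = pd a (%y. y$b) (ph m)"
  by (rule pd_cong[OF image_open]) (use m in \<open>auto simp: coord_def\<close>)
 then show ?thesis by (simp add: partial_eq regular_at_coord m pd_coord)
qed

text \<open>By \<open>hadamard\<close>, \<open>f\<close> minus its value at m is a sum of centred
  coordinates times regular functions \<open>G i\<close>, and a derivation at m sees such a product
  as its value on the coordinate times \<open>G i m\<close>. Applying this to
  \<open>partial m a\<close> itself identifies \<open>G a m\<close> with the partial
  derivative.\<close>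

lemma tangent_expand:
 assumes m: "m:U" and f: "regular_at m f" and v: "v:tangent_space m"
 shows "v f = (SUM a:UNIV. partial m a f * v (coord a))"
proof -
 obtain W where W: "openin X W" "W <= U" "m:W" "regular_on W f" by (rule regular_at_common[OF f f U_open m])
 have o: "open (ph ` W)" "ph m:ph ` W" using W W_image_open by auto
 obtain r g where r: "r > 0" "ball (ph m) r <= ph ` W" and g: "!!i. R (ball (ph m) r) (g i)"
  and eq: "!!y. y:ball (ph m) r ==> pull f y = pull f (ph m) + (SUM i:UNIV. (y$i - ph m$i)*g i y)"
  using hadamard[OF o(1) _ o(2), of "pull f"] regular_on_pull[OF W(1,2)] W(4) by blast
 define W' where "W' = {x:U. ph x:ball (ph m) r}"
 have W': "openin X W'" "m:W'" "W' <= W"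
 proof -
  show "openin X W'" unfolding W'_def by (rule preimage_open) simp
  show "m:W'" using m r(1) by (simp add: W'_def)
  show "W' <= W"
  proof
   fix x assume x: "x:W'"
   then obtain w where "w:W" "ph x = ph w" using r(2) unfolding W'_def by blast
   then show "x:W" using x W(2) inj_onD[OF chart_inj[OF chart], of x w] by (auto simp: W'_def)
  qed
 qed
 have sub: "ball (ph m) r <= ph ` U" using r(2) W(2) by blast
 define G where "G = (%i x. g i (ph x))"
 have RG: "regular_on W' (G i)" for i unfolding W'_def G_def by (rule regular_on_push[OF _ sub g]) simp
 define D where "D = (%i. coord i + (%x. - (ph m$i)))"
 have RD: "regular_on W' (D i)" for i unfolding D_def
  by (rule regular_on_add[OF regular_on_subset[OF regular_on_coord W'(1)] regular_on_const[OF W'(1)]])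
   (use W' W in blast)
 define F where "F = (%x. f m) + (SUM i:UNIV. D i*G i)"
 have RDG: "regular_on W' (D i*G i)" for i by (rule regular_on_mult[OF RD RG])
 have RF: "regular_on W' F" unfolding F_def by (intro regular_on_add regular_on_const regular_on_sum RDG W')
 have sum_app: "(SUM i:J. h i) x = (SUM i:J. h i x)" for J :: "'n set" and h :: "'n => 'a => 'k" and x
  by (induction J rule: infinite_finite_induct) auto
 have fF: "f x = F x" if x: "x:W'" for x
 proof -
  have xU: "x:U" "ph x:ball (ph m) r" using x by (auto simp: W'_def)
  then show ?thesis using eq[OF xU(2)] m by (simp add: F_def D_def G_def coord_def sum_app)
 qed
 have rat: "regular_at m h" if "regular_on W' h" for h using that W'(2) unfolding regular_at_def by blast
 have mX: "m:topspace X" using m openin_subset[OF U_open] by blast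
 have main: "v f = (SUM i:UNIV. v (coord i)*G i m)" if v: "v:tangent_space m" for v
 proof -
  have "v f = v F" by (rule tangent_regular(1)[OF v W'(2) regular_on_subset[OF W(4) W'(1,3)] RF fF])
  also have "... = v (%x. f m) + v (SUM i:UNIV. D i*G i)"
   unfolding F_def by (rule tangent_regular(2)[OF v rat rat]) (intro regular_on_const regular_on_sum RDG W')+
  also have "... = (SUM i:UNIV. v (D i*G i))" using tangent_const[OF v mX] tangent_sum[where I=UNIV, OF v W'(1,2) RDG] by simp
  also have "... = (SUM i:UNIV. v (coord i)*G i m)"
  proof (rule sum.cong[OF refl])
   fix i
   have "v (D i) = v (coord i)"
    unfolding D_def using tangent_regular(2)[OF v regular_at_coord[OF m] rat[OF regular_on_const[OF W'(1)]], of i "- (ph m$i)"]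
     tangent_const[OF v mX] by simp
   moreover have "D i m = 0" by (simp add: D_def coord_def)
   ultimately show "v (D i*G i) = v (coord i)*G i m" using tangent_regular(4)[OF v rat[OF RD] rat[OF RG], of i i] by simp
  qed
  finally show ?thesis .
 qed
 have "partial m a f = G a m" for a
  using main[OF partial_tangent[OF m, of a]] by (simp add: partial_coord[OF m] if_distrib[of "%c. c*_"] cong: if_cong)
 then show ?thesis using main[OF v] by (simp add: mult.commute)
qed

lemma differential_expand:
 assumes "m:U" "regular_at m f"
 shows "differential m f = (SUM a:UNIV. fscale (partial m a f) (differential m (coord a)))"
 by (rule ext) (use tangent_expand[OF assms] in \<open>simp add: differential_def sum_fscale_apply\<close>)

lemma complex_differential_expand:
 assumes "m:U" "regular_at m f"
 shows "complex_differential m f = (SUM a:UNIV. fscale (to_complex (partial m a f)) (complex_differential m (coord a)))"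
 by (rule ext) (simp add: complex_differential_def sum_fscale_apply differential_expand[OF assms] to_complex_sum to_complex_mult)

lemma differential_partial: "m:U ==> differential m f (partial m a) = partial m a f"
 by (simp add: differential_def partial_tangent)

lemma complex_differential_partial:
 "m:U ==> complex_differential m (coord b) (partial m a) = (if a = b then 1 else 0)"
 by (simp add: complex_differential_def differential_partial partial_coord)

lemma complex_cotangent_span:
 assumes m: "m:U"
 shows "complex_cotangent_space m = fs.span (range (%a. complex_differential m (coord a)))"
proof
 show "complex_cotangent_space m <= fs.span (range (%a. complex_differential m (coord a)))" unfolding complex_cotangent_space_def
 proof (rule fs.span_minimal)
  show "{complex_differential m f |f. regular_at m f} <= fs.span (range (%a. complex_differential m (coord a)))"
  proof safe
   fix f assume f: "regular_at m f"
   show "complex_differential m f:fs.span (range (%a. complex_differential m (coord a)))"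
    unfolding complex_differential_expand[OF m f] by (intro fs.span_sum fs.span_scale fs.span_base rangeI)
  qed
 qed simp
 show "fs.span (range (%a. complex_differential m (coord a))) <= complex_cotangent_space m"
  unfolding complex_cotangent_space_def by (rule fs.span_mono) (use regular_at_coord[OF m] in blast)
qed

end

lemma block_decomposition_transfer:
 fixes io :: "('y => complex) => 'x => complex"
 assumes lin: "!!(I :: (nat \<times> nat) set) x w. io (SUM p:I. fscale (x p) (w p)) = (SUM p:I. fscale (x p) (io (w p)))"
  and inj: "inj io" and rng: "range io = V"
  and B: "!!u v. B1' u v = B1 (io u) (io v)" "!!u v. B2' u v = B2 (io u) (io v)" and bs: "block_decomposition V B1 B2 bs"
 shows "block_decomposition UNIV B1' B2' bs"
proof -
 let ?I = "decomposition_index bs"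
 obtain w where w: "ALL b:set bs. 0 < block_index b" "independent_family ?I w" "fs.span (w ` ?I) = V"
  "ALL p:?I. ALL q:?I.
   B1 (w p) (w q) = (if fst p = fst q then block_form1 (bs ! fst p) (snd p) (snd q) else 0) &
   B2 (w p) (w q) = (if fst p = fst q then block_form2 (bs ! fst p) (snd p) (snd q) else 0)" by (rule block_decompositionE[OF bs])
 have "EX u. io u = w p" if "p:?I" for p
 proof -
  have "w p:fs.span (w ` ?I)" by (rule fs.span_base[OF imageI[OF that]])
  then have "w p:range io" by (simp only: w(3) rng)
  then obtain u where "w p = io u" by (rule rangeE)
  then show ?thesis by (intro exI[of _ u]) (rule sym)
 qed
 then have "ALL p:?I. EX u. io u = w p" by blast
 from bchoice[OF this] obtain w' where w': "ALL p:?I. io (w' p) = w p" by blast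
 have io0: "io 0 = 0" using lin[of "%_. 0" "%_. 0" "{}"] by simp
 have sumw: "io (SUM p:?I. fscale (x p) (w' p)) = (SUM p:?I. fscale (x p) (w p))" for x
  unfolding lin[of x w' ?I] by (rule sum.cong[OF refl]) (simp only: w'[rule_format])
 have 1: "independent_family ?I w'" unfolding independent_family_iff[OF finite_decomposition_index]
 proof (intro allI impI)
  fix x assume "(SUM p:?I. fscale (x p) (w' p)) = 0"
  then have "(SUM p:?I. fscale (x p) (w p)) = 0" using sumw[of x] io0 by simp
  then show "ALL p:?I. x p = 0" using w(2)[unfolded independent_family_iff[OF finite_decomposition_index], rule_format, of x] by blast
 qed
 have 2: "fs.span (w' ` ?I) = UNIV"
 proof -
  have "u:fs.span (w' ` ?I)" for u
  proof -
   have "io u:fs.span (w ` ?I)" using rng w(3) by blast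
   then obtain x where "io u = (SUM p:?I. fscale (x p) (w p))" by (rule span_family[OF finite_decomposition_index])
   then have "io u = io (SUM p:?I. fscale (x p) (w' p))" using sumw[of x] by simp
   then have "u = (SUM p:?I. fscale (x p) (w' p))" by (rule injD[OF inj])
   moreover have "(SUM p:?I. fscale (x p) (w' p)):fs.span (w' ` ?I)" by (intro fs.span_sum fs.span_scale fs.span_base imageI)
   ultimately show ?thesis by simp
  qed
  then show ?thesis by blast
 qed
 have 3: "B1' (w' p) (w' q) = (if fst p = fst q then block_form1 (bs ! fst p) (snd p) (snd q) else 0) &
   B2' (w' p) (w' q) = (if fst p = fst q then block_form2 (bs ! fst p) (snd p) (snd q) else 0)" if "p:?I" "q:?I" for p q
  using w(4) w' that by (simp add: B)
 show ?thesis unfolding block_decomposition_def Let_def decomposition_index_def[symmetric]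
 proof (intro conjI exI[of _ w'])
  show "ALL b:set bs. 0 < block_index b" "independent_family ?I w'" "fs.span (w' ` ?I) = UNIV" by (fact w(1) 1 2)+
  show "ALL (i, a):?I. ALL (j, b):?I.
   B1' (w' (i, a)) (w' (j, b)) = (if i = j then block_form1 (bs ! i) a b else 0) &
   B2' (w' (i, a)) (w' (j, b)) = (if i = j then block_form2 (bs ! i) a b else 0)"
  proof (clarify)
   fix i a j b assume "(i, a):?I" "(j, b):?I"
   from 3[OF this] show "B1' (w' (i, a)) (w' (j, b)) = (if i = j then block_form1 (bs ! i) a b else 0) &
   B2' (w' (i, a)) (w' (j, b)) = (if i = j then block_form2 (bs ! i) a b else 0)" by (simp only: fst_conv snd_conv)
  qed
 qed
qed

context regular_chart
begin

section \<open>Brackets and pairings in a chart\<close>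

definition tensor :: "(('a => 'k) => ('a => 'k) => 'a => 'k) => 'n => 'n => 'k^'n => 'k" where
 "tensor P a b = pull (P (coord a) (coord b))"

lemma poisson_bracketD:
 assumes "poisson_bracket P"
 shows "regular_on W f ==> regular_on W g ==> regular_on W (P f g)"
  "regular_on W f ==> regular_on W f' ==> regular_on W g ==> regular_on W g' ==>
   (!!x. x:W ==> f x = f' x) ==> (!!x. x:W ==> g x = g' x) ==> x:W ==> P f g x = P f' g' x"
  "regular_on W f ==> regular_on W g ==> x:W ==> P f g x = - P g f x"
  "regular_on W f ==> regular_on W g ==> regular_on W h ==> x:W ==> P (f + g) h x = P f h x + P g h x"
  "regular_on W f ==> regular_on W g ==> x:W ==> P (fscale c f) g x = c*P f g x"
  "regular_on W f ==> regular_on W g ==> regular_on W h ==> x:W ==> P f (g*h) x = P f g x*h x + g x*P f h x"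
  "regular_on W f ==> regular_on W g ==> regular_on W h ==> x:W ==>
   P f (P g h) x + P g (P h f) x + P h (P f g) x = 0"
proof -
 note P = assms[unfolded poisson_bracket_def]
 show "regular_on W (P f g)" if "regular_on W f" "regular_on W g" using conjunct1[OF P, rule_format, of W f g] that by simp
 show "P f g x = P f' g' x" if "regular_on W f" "regular_on W f'" "regular_on W g" "regular_on W g'"
  "!!x. x:W ==> f x = f' x" "!!x. x:W ==> g x = g' x" "x:W"
  using conjunct1[OF conjunct2[OF P], THEN spec[of _ W], THEN spec[of _ f], THEN spec[of _ f'], THEN spec[of _ g], THEN spec[of _ g']] that by blast
 note P3 = conjunct2[OF conjunct2[OF P], THEN spec[of _ W], THEN spec[of _ f], THEN spec[of _ g]]
 have *: "P f g x = - P g f x & P (f + g) h x = P f h x + P g h x & P (fscale d f) g x = d*P f g x &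
   P f (g*h) x = P f g x*h x + g x*P f h x & P f (P g h) x + P g (P h f) x + P h (P f g) x = 0"
  if "regular_on W f" "regular_on W g" "regular_on W h" "x:W" for h d using P3[THEN spec[of _ h], THEN spec[of _ d], THEN mp] that by blast
 show "P f g x = - P g f x" if "regular_on W f" "regular_on W g" "x:W" using *[of f 0, OF that(1,2,1,3)] by (elim conjE)
 show "P (fscale c f) g x = c*P f g x" if "regular_on W f" "regular_on W g" "x:W" using *[of f c, OF that(1,2,1,3)] by (elim conjE)
 show "P (f + g) h x = P f h x + P g h x" if "regular_on W f" "regular_on W g" "regular_on W h" "x:W" using *[of h 0, OF that] by (elim conjE)
 show "P f (g*h) x = P f g x*h x + g x*P f h x" if "regular_on W f" "regular_on W g" "regular_on W h" "x:W"
  using *[of h 0, OF that] by (elim conjE)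
 show "P f (P g h) x + P g (P h f) x + P h (P f g) x = 0" if "regular_on W f" "regular_on W g" "regular_on W h" "x:W"
  using *[of h 0, OF that] by (elim conjE)
qed

lemma regular_atI: "regular_on W f ==> m:W ==> regular_at m f" unfolding regular_at_def by blast

text \<open>Bracketing with \<open>f\<close> is a derivation at \<open>m\<close>, so that
  \<open>tangent_expand\<close> expresses every bracket through those of the coordinates.\<close>

lemma hamiltonian_tangent:
 assumes P: "poisson_bracket P" and m: "m:U" and f: "regular_at m f"
 shows "(%g. if regular_at m g then P f g m else 0):tangent_space m" unfolding tangent_space_def mem_Collect_eq
proof (intro conjI allI impI)
 show "(if regular_at m g then P f g m else 0) = 0" if "\<not> regular_at m g" for g using that by simp
 show "(if regular_at m g then P f g m else 0) = (if regular_at m h then P f h m else 0)"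
  if h: "m:W & regular_on W g & regular_on W h & (ALL x:W. g x = h x)" for W g h
 proof -
  have hW: "m:W" "regular_on W g" "regular_on W h" "!!x. x:W ==> g x = h x" using h by auto
  obtain W' where W': "openin X W'" "W' <= W" "m:W'" "regular_on W' f"
   by (rule regular_at_common[OF f f regular_on_open[OF hW(2)] hW(1)])
  have "P f g m = P f h m" by (rule poisson_bracketD(2)[OF P W'(4,4) regular_on_subset[OF hW(2) W'(1,2)] regular_on_subset[OF hW(3) W'(1,2)]])
    (use hW(4) W' in auto)
  then show ?thesis using regular_atI[OF hW(2,1)] regular_atI[OF hW(3,1)] by simp
 qed
 fix g h c assume gh: "regular_at m g & regular_at m h"
 obtain W1 where W1: "openin X W1" "W1 <= U" "m:W1" "regular_on W1 g" "regular_on W1 h"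
  by (rule regular_at_common[OF conjunct1[OF gh] conjunct2[OF gh] U_open m])
 obtain W where W: "openin X W" "W <= W1" "m:W" "regular_on W f" by (rule regular_at_common[OF f f W1(1,3)])
 note r = regular_on_subset[OF W1(4) W(1,2)] regular_on_subset[OF W1(5) W(1,2)]
 note rs = regular_on_add[OF r] regular_on_fscale[OF r(1), of c] regular_on_mult[OF r]
 note rat = rs[THEN regular_atI, OF W(3)]
 have "P f (g + h) m = P f g m + P f h m" unfolding poisson_bracketD(3)[OF P W(4) rs(1) W(3)] poisson_bracketD(4)[OF P r W(4,3)]
   poisson_bracketD(3)[OF P r(1) W(4,3)] poisson_bracketD(3)[OF P r(2) W(4,3)] by simp
 then show "(if regular_at m (g + h) then P f (g + h) m else 0)
  = (if regular_at m g then P f g m else 0) + (if regular_at m h then P f h m else 0)" using gh rat by simp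
 have "P f (fscale c g) m = c*P f g m" unfolding poisson_bracketD(3)[OF P W(4) rs(2) W(3)] poisson_bracketD(5)[OF P r(1) W(4,3), of c]
   poisson_bracketD(3)[OF P r(1) W(4,3)] by simp
 then show "(if regular_at m (fscale c g) then P f (fscale c g) m else 0) = c*(if regular_at m g then P f g m else 0)" using gh rat by simp
 have "P f (g*h) m = P f g m*h m + g m*P f h m" by (rule poisson_bracketD(6)[OF P W(4) r W(3)])
 then show "(if regular_at m (g*h) then P f (g*h) m else 0)
  = (if regular_at m g then P f g m else 0)*h m + g m*(if regular_at m h then P f h m else 0)" using gh rat by simp
qed

lemma bracket_skew:
 assumes P: "poisson_bracket P" and "m:U" "regular_at m f" "regular_at m g"
 shows "P f g m = - P g f m"
proof -
 obtain W where "openin X W" "m:W" "regular_on W f" "regular_on W g" using regular_at_common[OF assms(3,4) U_open assms(2)] by blast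
 then show ?thesis using poisson_bracketD(3)[OF P, of W f g m] by blast
qed

lemma bracket_expand:
 assumes P: "poisson_bracket P" and m: "m:U" and f: "regular_at m f" and g: "regular_at m g"
 shows "P f g m = (SUM a:UNIV. partial m a g*P f (coord a) m)"
 using tangent_expand[OF m g hamiltonian_tangent[OF P m f]] g by (simp add: regular_at_coord[OF m])

lemma bracket_coord:
 assumes P: "poisson_bracket P" and m: "m:U" and g: "regular_at m g"
 shows "P (coord a) g m = Yop (tensor P) a (pull g) (ph m)" unfolding bracket_expand[OF P m regular_at_coord[OF m] g] Yop_def
 using m g by (simp add: tensor_def partial_eq mult.commute)

lemma bracket_br:
 assumes P: "poisson_bracket P" and m: "m:U" and f: "regular_at m f" and g: "regular_at m g"
 shows "P f g m = br (tensor P) (pull f) (pull g) (ph m)"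
proof -
 have "P f g m = - P g f m" by (rule bracket_skew[OF P m f g])
 also have "... = (SUM a:UNIV. partial m a f*(- P g (coord a) m))" unfolding bracket_expand[OF P m g f] by (simp add: sum_negf)
 also have "... = br (tensor P) (pull f) (pull g) (ph m)" unfolding br_def by (rule sum.cong[OF refl])
   (simp add: bracket_coord[OF P m g, symmetric] partial_eq[OF f] bracket_skew[OF P m g regular_at_coord[OF m]])
 finally show ?thesis .
qed

text \<open>Functions on an open set of coordinate space are lifted to the manifold, where the
  Jacobi identity holds; \<open>bb\<close> translates the double brackets back.\<close>

lemma tensor_poisson:
 assumes P: "poisson_bracket P"
 shows "poisson_tensor (ph ` U) (tensor P)" unfolding poisson_tensor_def
proof (intro conjI allI ballI impI)
 have RP: "R (ph ` U) (tensor P a b)" for a b unfolding tensor_def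
  using poisson_bracketD(1)[OF P regular_on_coord regular_on_coord] regular_on_pull[OF U_open order_refl] by blast
 show "R (ph ` U) (tensor P a b)" for a b by (rule RP)
 show "tensor P a b y = - tensor P b a y" if y: "y:ph ` U" for a b y
 proof -
  obtain x where x: "x:U" "y = ph x" using y by blast
  have "P (coord a) (coord b) x = - P (coord b) (coord a) x" by (rule bracket_skew[OF P x(1) regular_at_coord[OF x(1)] regular_at_coord[OF x(1)]])
  then show ?thesis unfolding tensor_def x(2) pull_chart[OF x(1)] .
 qed
 fix T f g h y assume T: "open T" "T <= ph ` U" and fgh: "R T f" "R T g" "R T h" and y: "y:T"
 define W where "W = {x:U. ph x:T}"
 define lift where "lift = (%f x. f (ph x) :: 'k)"
 have WU: "W <= U" by (auto simp: W_def)
 have rl: "regular_on W (lift f)" if "R T f" for f unfolding W_def lift_def by (rule regular_on_push[OF T that])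
 have pl: "pull (lift f) z = f z" if "z:T" for f z using that T(2) by (auto simp: lift_def)
 have RT': "R T (br (tensor P) f g)" if "R T f" "R T g" for f g by (rule R_br[OF T(1) R_subset[OF image_open RP T] that])
 have b: "P (lift f) (lift g) x = lift (br (tensor P) f g) x" if fg: "R T f" "R T g" and x: "x:W" for f g x
 proof -
  have "P (lift f) (lift g) x = br (tensor P) (pull (lift f)) (pull (lift g)) (ph x)"
   by (rule bracket_br[OF P _ regular_atI[OF rl[OF fg(1)] x] regular_atI[OF rl[OF fg(2)] x]]) (use x WU in blast)
  also have "... = br (tensor P) f g (ph x)" by (rule br_cong[OF T(1)]) (use x pl in \<open>auto simp: W_def\<close>)
  finally show ?thesis by (simp add: lift_def)
 qed
 have bb: "P (lift f) (P (lift g) (lift h)) x = br (tensor P) f (br (tensor P) g h) (ph x)"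
  if fgh: "R T f" "R T g" "R T h" and x: "x:W" for f g h x
 proof -
  have "P (lift f) (P (lift g) (lift h)) x = P (lift f) (lift (br (tensor P) g h)) x"
   by (rule poisson_bracketD(2)[OF P rl[OF fgh(1)] rl[OF fgh(1)] poisson_bracketD(1)[OF P rl[OF fgh(2)] rl[OF fgh(3)]] rl[OF RT'[OF fgh(2,3)]]])
    (use b[OF fgh(2,3)] x in auto)
  then show ?thesis using b[OF fgh(1) RT'[OF fgh(2,3)] x] by (simp add: lift_def)
 qed
 obtain x where x: "x:U" "y = ph x" using y T(2) by blast
 then have xW: "x:W" using y by (simp add: W_def)
 show "br (tensor P) f (br (tensor P) g h) y + br (tensor P) g (br (tensor P) h f) y + br (tensor P) h (br (tensor P) f g) y = 0"
  using poisson_bracketD(7)[OF P rl[OF fgh(1)] rl[OF fgh(2)] rl[OF fgh(3)] xW]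
  unfolding bb[OF fgh xW] bb[OF fgh(2,3,1) xW] bb[OF fgh(3,1,2) xW] x(2) .
qed

text \<open>The formula in coordinates exhibits a pairing of the required kind, so the
  \<open>SOME\<close> in the definition has its defining properties.\<close>

lemma induced_pairing:
 assumes P: "poisson_bracket P" and m: "m:U"
 shows "bilinear_on (complex_cotangent_space m) (induced_pairing P m)"
  "regular_at m f ==> regular_at m g ==>
   induced_pairing P m (complex_differential m f) (complex_differential m g) = to_complex (P f g m)"
proof -
 define B where "B = (%et ze :: (('a => 'k) => 'k) => complex. SUM a:UNIV. SUM b:UNIV.
  et (partial m a)*to_complex (P (coord a) (coord b) m)*ze (partial m b))"
 have "bilinear_on (complex_cotangent_space m) B" unfolding bilinear_on_def B_def by (simp add: algebra_simps sum.distrib sum_distrib_left)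
 moreover have "B (complex_differential m f) (complex_differential m g) = to_complex (P f g m)" if f: "regular_at m f" and g: "regular_at m g" for f g
 proof -
  have "P f g m = (SUM a:UNIV. SUM b:UNIV. partial m a f*P (coord a) (coord b) m*partial m b g)"
   unfolding bracket_br[OF P m f g] br_def Yop_def sum_distrib_left using m by (simp add: partial_eq[OF f] partial_eq[OF g] tensor_def mult.assoc)
  then show ?thesis by (simp add: B_def complex_differential_def differential_partial[OF m] to_complex_sum to_complex_mult)
 qed
 ultimately have "EX B. bilinear_on (complex_cotangent_space m) B &
   (ALL f g. regular_at m f & regular_at m g -->
    B (complex_differential m f) (complex_differential m g) = to_complex (P f g m))" by blast
 from someI_ex[OF this] show "bilinear_on (complex_cotangent_space m) (induced_pairing P m)"
  "regular_at m f ==> regular_at m g ==>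
   induced_pairing P m (complex_differential m f) (complex_differential m g) = to_complex (P f g m)" unfolding induced_pairing_def by blast+
qed

text \<open>\<open>io\<close> identifies coefficient vectors with covectors; evaluation at the
  tangent vectors \<open>partial m b\<close> reads the coefficients back, which gives
  injectivity.\<close>

lemma coordinate_decomposition:
 assumes P: "poisson_bracket P1" "poisson_bracket P2" and m: "m:U"
  and bs: "block_decomposition (complex_cotangent_space m) (induced_pairing P1 m) (induced_pairing P2 m) bs"
 shows "block_decomposition UNIV (form (tensor P1) (ph m)) (form (tensor P2) (ph m)) bs"
proof -
 define e where "e = (%a. complex_differential m (coord a))"
 define io where "io = (%u::'n => complex. SUM a:UNIV. fscale (u a) (e a))"
 have cot: "complex_cotangent_space m = fs.span (range e)" unfolding e_def by (rule complex_cotangent_span[OF m])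
 have eV: "e a:complex_cotangent_space m" for a unfolding cot by (intro fs.span_base rangeI)
 have Vs: "fs.subspace (complex_cotangent_space m)" unfolding cot by simp
 have io_app: "io u (partial m b) = u b" for u b
  by (simp add: io_def sum_fscale_apply e_def complex_differential_partial[OF m] if_distrib[of "%c. _*c"] cong: if_cong)
 have F: "form (tensor P) (ph m) u v = induced_pairing P m (io u) (io v)" if P: "poisson_bracket P" for P u v
 proof -
  note bil = induced_pairing(1)[OF P m]
  have ioV: "io v:complex_cotangent_space m" unfolding io_def by (intro fs.subspace_sum[OF Vs] fs.subspace_scale[OF Vs] eV)
  have "induced_pairing P m (io u) (io v) = (SUM a:UNIV. u a*induced_pairing P m (e a) (io v))"
   unfolding io_def[of ] by (rule bilinear_on_sum(1)[OF Vs bil eV]) (rule ioV[unfolded io_def])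
  also have "... = (SUM a:UNIV. u a*(SUM b:UNIV. v b*induced_pairing P m (e a) (e b)))"
   unfolding io_def bilinear_on_sum(2)[OF Vs bil eV eV] ..
  also have "... = form (tensor P) (ph m) u v" unfolding form_def sum_distrib_left
   using m by (simp add: e_def induced_pairing(2)[OF P m] regular_at_coord tensor_def algebra_simps)
  finally show ?thesis by simp
 qed
 show ?thesis
 proof (rule block_decomposition_transfer[where io=io, OF _ _ _ F[OF P(1)] F[OF P(2)] bs])
  show "io (SUM p:I. fscale (x p) (w p)) = (SUM p:I. fscale (x p) (io (w p)))" for I :: "(nat \<times> nat) set" and x w
  proof
   fix t
   show "io (SUM p:I. fscale (x p) (w p)) t = (SUM p:I. fscale (x p) (io (w p))) t"
    unfolding io_def sum_fscale_apply sum_distrib_left sum_distrib_right by (subst sum.swap) (simp add: mult.assoc)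
  qed
  show "inj io"
  proof (rule injI)
   fix u v assume "io u = io v"
   then show "u = v" using io_app by (metis ext)
  qed
  show "range io = complex_cotangent_space m"
  proof
   show "range io <= complex_cotangent_space m"
    unfolding io_def by (auto intro!: fs.subspace_sum[OF Vs] fs.subspace_scale[OF Vs] eV)
   show "complex_cotangent_space m <= range io"
   proof
    fix v assume "v:complex_cotangent_space m"
    then have "v:fs.span (e ` UNIV)" by (simp only: cot)
    then obtain x where "v = (SUM p:UNIV. fscale (x p) (e p))" by (rule span_family[OF finite])
    then have "v = io x" unfolding io_def .
    then show "v:range io" by blast
   qed
  qed
 qed
qed

lemma differential_independent:
 assumes m: "m:U" and I: "finite I" and F: "!!i. i:I ==> regular_at m (F i)"
  and ind: "independent_family I (%i. grad (pull (F i)) (ph m))"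
 shows "independent_family I (%i. differential m (F i))" unfolding independent_family_iff[OF I]
proof (intro allI impI)
 fix x assume x: "(SUM i:I. fscale (x i) (differential m (F i))) = 0"
 have "(SUM i:I. fscale (to_complex (x i)) (grad (pull (F i)) (ph m))) = 0"
 proof
  fix b
  have "(SUM i:I. x i*partial m b (F i)) = 0"
   using fun_cong[OF x, of "partial m b"] by (simp add: sum_fscale_apply differential_partial[OF m])
  moreover have "(SUM i:I. x i*partial m b (F i)) = (SUM i:I. x i*pd b (pull (F i)) (ph m))"
   by (rule sum.cong[OF refl]) (simp add: partial_eq[OF F])
  ultimately have "to_complex (SUM i:I. x i*pd b (pull (F i)) (ph m)) = 0" by simp
  then show "(SUM i:I. fscale (to_complex (x i)) (grad (pull (F i)) (ph m))) b = 0 b"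
   by (simp add: sum_fscale_apply grad_def to_complex_sum to_complex_mult)
 qed
 from ind[unfolded independent_family_iff[OF I], rule_format, OF this]
 show "ALL i:I. x i = 0" by simp
qed

end

section \<open>From the local scheme to Lenard integrability\<close>

lemma card_independent_family_le_dim:
 assumes w: "independent_family I w" "w ` I <= fs.span K" and K: "finite K"
 shows "card I <= fs.dim (fs.span K)"
proof -
 obtain B where B: "B <= fs.span K" "fs.independent B" "fs.span K <= fs.span B" "card B = fs.dim (fs.span K)"
  by (rule fs.basis_exists)
 have "finite B" using fs.independent_span_bound[OF K B(2,1)] by blast
 then show ?thesis using card_independent_family_le(2)[OF w(1) _ \<open>finite B\<close>] w(2) B(3,4) by auto
qed

text \<open>\<open>ro\<close> is a left inverse of \<open>to_complex\<close>, linear over the ground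
  field: \<open>Re\<close> for real scalars, the identity for complex ones. It carries complex
  linear relations between gradients to relations with coefficients in the ground field.\<close>

locale lenard_chart = regular_chart R RT X A U ph + bihamiltonian R X A P1 P2
 for R :: "('k::{ground_field,banach}^'n::finite) set => ('k^'n => 'k) => bool"
  and RT :: "('k^'n) set => (real => 'k^'n => 'k) => bool"
  and X :: "'a topology" and A :: "('a, 'k, 'n) chart set" and U :: "'a set" and ph :: "'a => 'k^'n" and P1 P2 +
 fixes ro :: "complex => 'k"
 assumes ro_add: "ro (x + y) = ro x + ro y" and ro_mult: "ro (x*to_complex a) = ro x*a" and ro_1: "ro 1 = 1"
begin

lemma ro_0: "ro 0 = 0" using ro_mult[of 0 0] by simp

lemma ro_to_complex: "ro (to_complex a) = a" using ro_mult[of 1 a] by (simp add: ro_1)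

lemma ro_sum: "ro (SUM i:I. x i) = (SUM i:I. ro (x i))"
 by (induction I rule: infinite_finite_induct) (auto simp: ro_0 ro_add)

lemma ro_combination:
 assumes m: "m:U" and F: "!!i. i:I ==> regular_at m (F i)"
 shows "ro ((SUM i:I. fscale (c i) (grad (pull (F i)) (ph m))) b) = (SUM i:I. ro (c i)*partial m b (F i))"
 unfolding sum_fscale_apply ro_sum grad_def ro_mult by (rule sum.cong[OF refl]) (simp add: partial_eq[OF F])

lemma differential_combination:
 assumes m: "m:U" and I: "finite I" and F: "!!i. i:I ==> regular_at m (F i)"
 shows "(SUM i:I. fscale (c i) (differential m (F i))) = (SUM b:UNIV. fscale (SUM i:I. c i*partial m b (F i)) (differential m (coord b)))"
proof
 fix v
 have "(SUM i:I. fscale (c i) (differential m (F i))) v = (SUM i:I. c i*(SUM b:UNIV. partial m b (F i)*differential m (coord b) v))"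
  unfolding sum_fscale_apply by (rule sum.cong[OF refl]) (simp only: differential_expand[OF m F] sum_fscale_apply)
 also have "... = (SUM b:UNIV. fscale (SUM i:I. c i*partial m b (F i)) (differential m (coord b))) v"
  unfolding sum_fscale_apply sum_distrib_left sum_distrib_right by (subst sum.swap) (simp add: mult.assoc)
 finally show "(SUM i:I. fscale (c i) (differential m (F i))) v
  = (SUM b:UNIV. fscale (SUM i:I. c i*partial m b (F i)) (differential m (coord b))) v" .
qed

lemma grad_independent:
 assumes m: "m:U" and I: "finite I" and F: "!!i. i:I ==> regular_at m (F i)"
  and ind: "independent_family I (%i. differential m (F i))"
 shows "independent_family I (%i. grad (pull (F i)) (ph m))" unfolding independent_family_iff[OF I]
proof (intro allI impI ballI, rule ccontr)
 fix c k assume c: "(SUM i:I. fscale (c i) (grad (pull (F i)) (ph m))) = 0" and k: "k:I" "c k ~= 0"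
 \<comment> \<open>Scaling the relation to \<open>d k = 1\<close> first ensures that
   \<open>ro\<close> does not send this coefficient to 0.\<close>
 define d where "d = (%i. inverse (c k)*c i)"
 have d: "(SUM i:I. fscale (d i) (grad (pull (F i)) (ph m))) b = 0" for b
 proof -
  have "(SUM i:I. fscale (d i) (grad (pull (F i)) (ph m))) b = inverse (c k)*(SUM i:I. fscale (c i) (grad (pull (F i)) (ph m))) b"
   unfolding sum_fscale_apply sum_distrib_left d_def by (simp add: mult.assoc)
  then show ?thesis using c by simp
 qed
 have z: "(SUM i:I. ro (d i)*partial m b (F i)) = 0" for b
  using ro_combination[where c=d and b=b and I=I and F=F, OF m F] d[of b] ro_0 by simp
 have "(SUM i:I. fscale (ro (d i)) (differential m (F i))) = (SUM b:UNIV. fscale 0 (differential m (coord b)))"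
  by (simp only: differential_combination[where c="%i. ro (d i)" and I=I and F=F, OF m I F] z)
 also have "... = 0" by (simp only: fs.scale_zero_left sum.neutral_const)
 finally have "(SUM i:I. fscale (ro (d i)) (differential m (F i))) = 0" .
 from ind[unfolded independent_family_iff[OF I], rule_format, OF this k(1)]
 show False using k(2) ro_1 by (simp add: d_def)
qed

lemma differential_span:
 assumes m: "m:U" and I: "finite I" and F: "!!i. i:I ==> regular_at m (F i)" and G: "regular_at m G"
  and sp: "grad (pull G) (ph m):fs.span ((%i. grad (pull (F i)) (ph m)) ` I)"
 shows "differential m G:fs.span ((%i. differential m (F i)) ` I)"
proof -
 obtain c where c: "grad (pull G) (ph m) = (SUM i:I. fscale (c i) (grad (pull (F i)) (ph m)))" by (rule span_family[OF I sp])
 have pG: "(SUM i:I. ro (c i)*partial m b (F i)) = partial m b G" for b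
 proof -
  have "ro (grad (pull G) (ph m) b) = (SUM i:I. ro (c i)*partial m b (F i))" unfolding c by (rule ro_combination[OF m F])
  then show ?thesis by (simp add: grad_def ro_to_complex partial_eq[OF G])
 qed
 have "differential m G = (SUM i:I. fscale (ro (c i)) (differential m (F i)))"
  by (simp only: differential_combination[where c="%i. ro (c i)" and I=I and F=F, OF m I F] pG differential_expand[OF m G])
 also have "...:fs.span ((%i. differential m (F i)) ` I)" by (intro fs.span_sum fs.span_scale fs.span_base imageI)
 finally show ?thesis .
qed

lemma bracket_Yop:
 assumes P: "poisson_bracket P" and m: "m:U" and F: "regular_at m F" and f: "regular_at m f"
 shows "P F f m = - (SUM b:UNIV. pd b (pull f) (ph m)*Yop (tensor P) b (pull F) (ph m))"
 unfolding bracket_skew[OF P m F f] bracket_br[OF P m f F] br_def ..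

text \<open>A bracket depends on its second argument through first derivatives, so testing against
  the coordinate functions suffices.\<close>

lemma casimir_on_iff:
 assumes P: "poisson_bracket P" and V: "V <= U" and F: "regular_on V F"
 shows "casimir_on P V F \<longleftrightarrow> (ALL x:V. ALL b. Yop (tensor P) b (pull F) (ph x) = 0)"
proof
 assume c: "casimir_on P V F"
 show "ALL x:V. ALL b. Yop (tensor P) b (pull F) (ph x) = 0"
 proof (intro ballI allI)
  fix x b assume x: "x:V"
  have xU: "x:U" using x V by blast
  have "regular_on V (coord b)" by (rule regular_on_subset[OF regular_on_coord regular_on_open[OF F] V])
  then have "P F (coord b) x = 0" using c x unfolding casimir_on_def by blast
  then have "P (coord b) F x = 0" using bracket_skew[OF P xU regular_at_coord[OF xU] regular_atI[OF F x], of b] by simp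
  then show "Yop (tensor P) b (pull F) (ph x) = 0" by (simp only: bracket_coord[OF P xU regular_atI[OF F x]])
 qed
next
 assume Y: "ALL x:V. ALL b. Yop (tensor P) b (pull F) (ph x) = 0"
 show "casimir_on P V F" unfolding casimir_on_def
 proof (intro conjI allI impI ballI F)
  fix W f x assume W: "W <= V & regular_on W f" and x: "x:W"
  have xV: "x:V" "x:U" using W x V by auto
  have rf: "regular_at x f" using W x regular_atI by blast
  show "P F f x = 0" unfolding bracket_Yop[OF P xV(2) regular_atI[OF F xV(1)] rf] using Y xV(1) by simp
 qed
qed

lemma lenard_step_iff:
 assumes V: "V <= U" and F: "regular_on V F" and G: "regular_on V G"
 shows "lenard_step V F G \<longleftrightarrow> (ALL x:V. ALL b. Yop (tensor P2) b (pull F) (ph x) = - Yop (tensor P1) b (pull G) (ph x))"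
proof
 assume c: "lenard_step V F G"
 show "ALL x:V. ALL b. Yop (tensor P2) b (pull F) (ph x) = - Yop (tensor P1) b (pull G) (ph x)"
 proof (intro ballI allI)
  fix x b assume x: "x:V"
  have xU: "x:U" using x V by blast
  have "regular_on V (coord b)" by (rule regular_on_subset[OF regular_on_coord regular_on_open[OF F] V])
  then have "P2 F (coord b) x = - P1 G (coord b) x" using c x unfolding lenard_step_def by blast
  moreover have "P2 (coord b) F x = - P2 F (coord b) x" "P1 (coord b) G x = - P1 G (coord b) x"
   by (rule bracket_skew[OF poisson2 xU regular_at_coord[OF xU] regular_atI[OF F x]]
    bracket_skew[OF poisson1 xU regular_at_coord[OF xU] regular_atI[OF G x]])+
  ultimately have "P2 (coord b) F x = - P1 (coord b) G x" by simp
  then show "Yop (tensor P2) b (pull F) (ph x) = - Yop (tensor P1) b (pull G) (ph x)"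
   by (simp only: bracket_coord[OF poisson2 xU regular_atI[OF F x]] bracket_coord[OF poisson1 xU regular_atI[OF G x]])
 qed
next
 assume Y: "ALL x:V. ALL b. Yop (tensor P2) b (pull F) (ph x) = - Yop (tensor P1) b (pull G) (ph x)"
 show "lenard_step V F G" unfolding lenard_step_def
 proof (intro conjI allI impI ballI F G)
  fix W f x assume W: "W <= V & regular_on W f" and x: "x:W"
  have xV: "x:V" "x:U" using W x V by auto
  have rf: "regular_at x f" using W x regular_atI by blast
  show "P2 F f x = - P1 G f x"
   unfolding bracket_Yop[OF poisson2 xV(2) regular_atI[OF F xV(1)] rf] bracket_Yop[OF poisson1 xV(2) regular_atI[OF G xV(1)] rf]
   using Y xV(1) by (simp add: sum_negf)
 qed
qed

lemma open_dense_self: "openin X V ==> open_dense_in V V" unfolding open_dense_in_def using closure_of_subset[OF openin_subset] by blast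

text \<open>A chart has positive dimension, so its points are not isolated; over the trivial filter
  the lower limit of a constant would not be that constant.\<close>

lemma atin_nontrivial:
 assumes m: "m:U"
 shows "atin X m ~= bot"
proof
 assume "atin X m = bot"
 then have "eventually (%_. False) (atin X m)" by simp
 moreover have "m:topspace X" using m openin_subset[OF U_open] by blast
 ultimately obtain W where W: "openin X W" "m:W" "W - {m} = {}" unfolding eventually_atin by blast
 have WU: "openin X (W \<inter> U)" "W \<inter> U = {m}" using W m U_open by auto
 have "open (ph ` (W \<inter> U))" by (rule W_image_open[OF WU(1)]) blast
 then show False using WU(2) not_open_singleton[of "ph m"] by simp
qed

lemma action_dimension_at_eq:
 assumes m: "m0:U" and ks: "ALL m:topspace X. block_decomposition (complex_cotangent_space m)
    (induced_pairing P1 m) (induced_pairing P2 m) (map Kronecker ks)"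
 shows "action_dimension_at m0 = ereal (real (sum_list ks))"
proof -
 have "action_dimension (complex_cotangent_space m) (induced_pairing P1 m) (induced_pairing P2 m) = real (sum_list ks)" if "m:U" for m
  using kronecker_action_dimension(2)[OF induced_pairing(1)[OF poisson1 that] induced_pairing(1)[OF poisson2 that]]
   ks that openin_subset[OF U_open] by blast
 then have "eventually (%m. ereal (action_dimension (complex_cotangent_space m)
   (induced_pairing P1 m) (induced_pairing P2 m)) = ereal (real (sum_list ks))) (atin X m0)" unfolding eventually_atin using m U_open by auto
 then have "action_dimension_at m0 = Liminf (atin X m0) (%_. ereal (real (sum_list ks)))"
  unfolding action_dimension_at_def by (rule Liminf_eq)
 then show ?thesis using Liminf_const[OF atin_nontrivial[OF m]] by simp
qed

text \<open>The chosen gradients form a basis of W at every point of one neighbourhood, so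
  dependence and independence can be checked there pointwise, with the whole neighbourhood as the
  open dense set.\<close>

theorem homogeneous_strictly_lenard_integrable:
 assumes hom: homogeneous and m0: "m0:U"
 shows "strictly_lenard_integrable m0"
proof -
 let ?b1 = "tensor P1" and ?b2 = "tensor P2"
 obtain ks where ks: "ALL m:topspace X. block_decomposition (complex_cotangent_space m)
    (induced_pairing P1 m) (induced_pairing P2 m) (map Kronecker ks)" using hom unfolding homogeneous_def by blast
 define s N where "s = length ks" and "N = sum_list ks"
 have "EX w. lenard_space UNIV (form ?b1 y) (form ?b2 y) (fst w) (fst (snd w)) (snd (snd w)) s N" if y: "y:ph ` U" for y
 proof -
  obtain m where m: "m:U" "y = ph m" using y by blast
  have "block_decomposition UNIV (form ?b1 y) (form ?b2 y) (map Kronecker ks)"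
   unfolding m(2) by (rule coordinate_decomposition[OF poisson1 poisson2 m(1)])
    (use ks m(1) openin_subset[OF U_open] in blast)
  from kronecker_lenard_space[OF bilinear_form bilinear_form this]
  obtain W T K where "lenard_space UNIV (form ?b1 y) (form ?b2 y) W T K s N" unfolding s_def N_def by blast
  then show ?thesis by (intro exI[of _ "(W, T, K)"]) simp
 qed
 then have "ALL y:ph ` U. EX w. lenard_space UNIV (form ?b1 y) (form ?b2 y) (fst w) (fst (snd w)) (snd (snd w)) s N" by blast
 from bchoice[OF this] obtain w where
  LS: "ALL y:ph ` U. lenard_space UNIV (form ?b1 y) (form ?b2 y) (fst (w y)) (fst (snd (w y))) (snd (snd (w y))) s N" by blast
 have T12: "poisson_tensor (ph ` U) (%a b x. ?b1 a b x + ?b2 a b x)"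
 proof -
  have pb: "poisson_bracket (%f g x. P1 f g x + P2 f g x)" using compatible[of 1 1] by simp
  have e: "tensor (%f g x. P1 f g x + P2 f g x) = (%a b x. ?b1 a b x + ?b2 a b x)" by (intro ext) (simp add: tensor_def pull_def)
  show ?thesis using tensor_poisson[OF pb] unfolding e .
 qed
 have m0': "ph m0:ph ` U" using m0 by blast
 obtain V k H where V: "open V" "ph m0:V" "V <= ph ` U" and RH: "ALL t<s. ALL i. R V (H t i)"
  and H0: "ALL t<s. ALL x:V. ALL b. Yop ?b1 b (H t 0) x = 0"
  and HS: "ALL t<s. ALL i. ALL x:V. ALL b. Yop ?b2 b (H t i) x = - Yop ?b1 b (H t (Suc i)) x"
  and ind: "ALL x:V. independent_family (SIGMA t:{..<s}. {..k t}) (%(t, i). grad (H t i) x)" and kN: "(SUM t<s. k t + 1) = N"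
  by (rule exE[OF local_lenard_scheme[OF image_open m0' tensor_poisson[OF poisson1] tensor_poisson[OF poisson2] T12 LS[rule_format]]],
    assumption, elim exE conjE, rule that; assumption)
 define V' where "V' = {x:U. ph x:V}"
 define H' where "H' = (%t i x. H t i (ph x))"
 define I where "I = (SIGMA t:{..<s}. {..k t})"
 have finI: "finite I" by (simp add: I_def)
 have cardI: "card I = N" using kN by (simp add: I_def)
 have V': "openin X V'" "V' <= U" "m0:V'" "!!x. x:V' ==> ph x:V" "!!x. x:V' ==> x:U"
  using preimage_open[OF V(1)] m0 V(2) by (auto simp: V'_def)
 have rH: "regular_on V' (H' t i)" if "t < s" for t i unfolding V'_def H'_def by (rule regular_on_push[OF V(1,3)]) (use RH that in blast)
 have pullH: "pull (H' t i) y = H t i y" if "y:V" for t i y using that V(3) by (auto simp: H'_def)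
 have gradH: "grad (pull (H' t i)) (ph x) = grad (H t i) (ph x)" if "x:V'" for t i x
  unfolding grad_def using pd_cong[OF V(1) V'(4)[OF that] pullH] by simp
 have YopH: "Yop C b (pull (H' t i)) (ph x) = Yop C b (H t i) (ph x)" if "x:V'" for C b t i x
  by (rule Yop_cong[OF V(1) V'(4)[OF that] pullH])
 have LSx: "lenard_space UNIV (form ?b1 (ph x)) (form ?b2 (ph x)) (fst (w (ph x))) (fst (snd (w (ph x)))) (snd (snd (w (ph x)))) s N"
  if "x:V'" for x using LS V'(5)[OF that] by blast
 have skew: "?b1 a b (ph x) = - ?b1 b a (ph x)" "?b2 a b (ph x) = - ?b2 b a (ph x)" if "x:V'" for a b x
  using poisson_tensorD(2)[OF tensor_poisson[OF poisson1]] poisson_tensorD(2)[OF tensor_poisson[OF poisson2]] V'(5)[OF that] by blast+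
 have step: "lenard_step V' (H' t i) (H' t (Suc i))" if "t < s" for t i unfolding lenard_step_iff[OF V'(2) rH[OF that] rH[OF that]]
  using HS that V'(4) by (simp add: YopH)
 have cas: "casimir_on P1 V' (H' t 0)" if "t < s" for t
  unfolding casimir_on_iff[OF poisson1 V'(2) rH[OF that]] using H0 that V'(4) by (simp add: YopH)
 have ind': "independent_family I (%q. differential x (case q of (t, i) => H' t i))" if x: "x:V'" for x
 proof (rule differential_independent[OF V'(5)[OF x] finI])
  show "regular_at x (case q of (t, i) => H' t i)" if "q:I" for q using that rH regular_atI[OF _ x] by (auto simp: I_def)
  have "(%q. grad (pull (case q of (t, i) => H' t i)) (ph x)) = (%(t, i). grad (H t i) (ph x))"
   using gradH[OF x] by (auto simp: fun_eq_iff)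
  then show "independent_family I (%q. grad (pull (case q of (t, i) => H' t i)) (ph x))"
   using ind V'(4)[OF x] by (simp add: I_def)
 qed
 have chain_W: "grad (pull (H' t i)) (ph x):fst (w (ph x))" if x: "x:V'" and t: "t < s" for t i x unfolding gradH[OF x]
 proof (rule lenard_space.chain_mem[OF LSx[OF x], of "%i. grad (H t i) (ph x)" i])
  show "grad (H t 0) (ph x):form_kernel UNIV (form ?b1 (ph x))"
   unfolding grad_kernel[where be="?b1" and x="ph x", OF skew(1)[OF x]] using H0 t V'(4)[OF x] by blast
  show "ALL v:UNIV. form ?b2 (ph x) (grad (H t i) (ph x)) v = - form ?b1 (ph x) (grad (H t (Suc i)) (ph x)) v" for i
   using grad_form[where be="?b2" and be'="?b1" and x="ph x", OF skew(2)[OF x] skew(1)[OF x]] HS t V'(4)[OF x] by blast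
 qed auto
 \<comment> \<open>At every point the chosen gradients are N independent vectors in the
   N-dimensional W, hence span it.\<close>
 have dependent: "functionally_dependent_on V' G I (%(t, i). H' t i)"
  if G: "regular_on V' G" "!!x. x:V' ==> grad (pull G) (ph x):fst (w (ph x))" for G
  unfolding functionally_dependent_on_def
 proof (intro exI[of _ V'] conjI open_dense_self V'(1) ballI)
  fix x assume x: "x:V'"
  show "differential x G:fs.span ((%q. differential x (case q of (t, i) => H' t i)) ` I)"
  proof (rule differential_span[OF V'(5)[OF x] finI _ regular_atI[OF G(1) x]])
   show "regular_at x (case q of (t, i) => H' t i)" if "q:I" for q using that rH regular_atI[OF _ x] by (auto simp: I_def)
   let ?g = "%q. grad (pull (case q of (t, i) => H' t i)) (ph x)"
   have "?g = (%(t, i). grad (H t i) (ph x))" using gradH[OF x] by (auto simp: fun_eq_iff)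
   then have "independent_family I ?g" using ind V'(4)[OF x] by (simp add: I_def)
   moreover have "?g ` I <= fst (w (ph x))" using chain_W[OF x] by (auto simp: I_def)
   ultimately have "fs.span (?g ` I) = fst (w (ph x))" using lenard_space.spans[OF LSx[OF x] _ _ cardI] by blast
   then show "grad (pull G) (ph x):fs.span (?g ` I)" using G(2)[OF x] by simp
  qed
 qed
 have "anchored_lenard_scheme V' s k H'" unfolding anchored_lenard_scheme_def I_def[symmetric]
 proof (intro conjI allI impI)
  show "casimir_on P1 V' (H' t 0)" if "t < s" for t by (rule cas[OF that])
  show "lenard_step V' (H' t i) (H' t (Suc i))" if "t < s" for t i by (rule step[OF that])
  show "functionally_independent V' {..<s} (%t. H' t 0)" unfolding functionally_independent_def
  proof (intro exI[of _ V'] conjI open_dense_self V'(1) ballI)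
   fix x assume x: "x:V'"
   have sub: "(%t. (t, 0)) ` {..<s} <= I" by (auto simp: I_def)
   from independent_family_subset[OF ind'[OF x] this]
   show "independent_family {..<s} (%t. differential x (H' t 0))" unfolding independent_family_def by (auto simp: inj_on_def image_image)
  qed
  show "functionally_independent V' I (%(t, i). H' t i)" unfolding functionally_independent_def
   by (intro exI[of _ V'] conjI open_dense_self V'(1) ballI ind')
  \<comment> \<open>At a point of the dense set, which is nonempty because \<open>m0\<close> lies in
    its closure, s + 1 independent Casimir gradients would lie in a kernel of dimension s.\<close>
  show "\<not> functionally_independent V' {..<Suc s} ((%t. H' t 0)(s := F))" if F: "casimir_on P1 V' F" for F
  proof
   let ?G = "(%t. H' t 0)(s := F)"
   assume "functionally_independent V' {..<Suc s} ?G"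
   then obtain D where D: "open_dense_in V' D" "ALL x:D. independent_family {..<Suc s} (%i. differential x (?G i))"
    unfolding functionally_independent_def by blast
   have "D ~= {}" using D(1) V'(3) unfolding open_dense_in_def by (auto simp: closure_of_empty)
   then obtain x where x: "x:D" by blast
   then have xV: "x:V'" using D(1) unfolding open_dense_in_def by blast
   have G: "regular_on V' (?G i)" "casimir_on P1 V' (?G i)" if "i < Suc s" for i using that rH cas F by (auto simp: casimir_on_def less_Suc_eq)
   have i: "independent_family {..<Suc s} (%i. grad (pull (?G i)) (ph x))"
    by (rule grad_independent[OF V'(5)[OF xV]]) (use regular_atI[OF G(1) xV] D(2) x in auto)
   have "grad (pull (?G i)) (ph x):form_kernel UNIV (form ?b1 (ph x))" if "i < Suc s" for i
    unfolding grad_kernel[where be="?b1" and x="ph x", OF skew(1)[OF xV]]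
    using G(2)[OF that] casimir_on_iff[OF poisson1 V'(2) G(1)[OF that]] xV by blast
   then have "(%i. grad (pull (?G i)) (ph x)) ` {..<Suc s} <= fs.span (snd (snd (w (ph x))))"
    using lenard_space.K(2)[OF LSx[OF xV]] by blast
   from card_independent_family_le_dim[OF i this lenard_space.K(1)[OF LSx[OF xV]]]
   show False using lenard_space.K(3)[OF LSx[OF xV]] by simp
  qed
  fix t p j and G :: "nat => 'a => 'k"
  assume t: "t < s" and G: "G 0 = H' t (k t) & (ALL i<p. lenard_step V' (G i) (G (Suc i)))" and j: "j <= p"
  \<comment> \<open>Any continuation, not just the constructed one, keeps its gradient in W by
    \<open>shift_mem\<close>.\<close>
  have "regular_on V' (G j) & (ALL x:V'. grad (pull (G j)) (ph x):fst (w (ph x)))" using j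
  proof (induction j)
   case 0
   then show ?case using G rH[OF t] chain_W[OF _ t] by simp
  next
   case (Suc j)
   then have IH: "regular_on V' (G j)" "ALL x:V'. grad (pull (G j)) (ph x):fst (w (ph x))" by auto
   have st: "lenard_step V' (G j) (G (Suc j))" using G Suc.prems by auto
   then have r: "regular_on V' (G (Suc j))" by (simp add: lenard_step_def)
   have "grad (pull (G (Suc j))) (ph x):fst (w (ph x))" if x: "x:V'" for x
   proof (rule lenard_space.shift_mem[OF LSx[OF x]])
    show "grad (pull (G j)) (ph x):fst (w (ph x))" using IH(2) x by blast
    show "ALL v:UNIV. form ?b2 (ph x) (grad (pull (G j)) (ph x)) v = - form ?b1 (ph x) (grad (pull (G (Suc j))) (ph x)) v"
     using grad_form[where be="?b2" and be'="?b1" and x="ph x", OF skew(2)[OF x] skew(1)[OF x]]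
      st[unfolded lenard_step_iff[OF V'(2) IH(1) r]] x by blast
   qed simp
   then show ?case using r by blast
  qed
  then show "functionally_dependent_on V' (G j) I (%(t, i). H' t i)" using dependent by blast
 qed
 then have "lenard_integrable_by m0 V' s k H'" unfolding lenard_integrable_by_def using V' action_dimension_at_eq[OF m0 ks] kN by (simp add: N_def)
 then show ?thesis unfolding strictly_lenard_integrable_def using step by blast
qed

end

lemma regular_strictly_lenard_integrable:
 fixes R :: "('k::{ground_field,banach}^'n::finite) set => ('k^'n => 'k) => bool"
 assumes RT: "regularity R RT"
  and ro: "!!x y. ro (x + y) = ro x + ro y" "!!x a. ro (x*to_complex a) = ro x*(a :: 'k)" "ro 1 = 1"
  and b: "bihamiltonian R X A P1 P2" "bihamiltonian.homogeneous R X A P1 P2" "m0:topspace X"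
 shows "bihamiltonian.strictly_lenard_integrable R X A P1 P2 m0"
proof -
 interpret bh: bihamiltonian R X A P1 P2 by (rule b(1))
 have "m0:(UN (U, ph):A. U)" using b(3) bh.charts_cover by simp
 then obtain U ph where U: "(U, ph):A" "m0:U" by auto
 interpret rg: regularity R RT by (rule RT)
 interpret lenard_chart R RT X A U ph P1 P2 ro by unfold_locales (use U(1) ro in auto)
 show ?thesis by (rule homogeneous_strictly_lenard_integrable[OF b(2) U(2)])
qed

theorem proposition11p7:
  shows
    "(\<forall>(R :: (real ^ 'n::finite) set \<Rightarrow> (real ^ 'n \<Rightarrow> real) \<Rightarrow> bool)
        (X :: 'a topology) (A :: ('a, real, 'n) chart set) P1 P2.
        R \<in> {smooth_fun_on, analytic_fun_on} \<longrightarrow>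
        bihamiltonian R X A P1 P2 \<longrightarrow>
        bihamiltonian.homogeneous R X A P1 P2 \<longrightarrow>
        (\<forall>m0\<in>topspace X. bihamiltonian.strictly_lenard_integrable R X A P1 P2 m0)) \<and>
     (\<forall>(X :: 'a topology) (A :: ('a, complex, 'n) chart set) P1 P2.
        bihamiltonian analytic_fun_on X A P1 P2 \<longrightarrow>
        bihamiltonian.homogeneous analytic_fun_on X A P1 P2 \<longrightarrow>
        (\<forall>m0\<in>topspace X. bihamiltonian.strictly_lenard_integrable analytic_fun_on X A P1 P2 m0))"
proof (intro conjI allI impI ballI)
  fix R :: "(real ^ 'n::finite) set \<Rightarrow> (real ^ 'n \<Rightarrow> real) \<Rightarrow> bool" and X :: "'a topology" and A P1 P2 m0
  assume R: "R \<in> {smooth_fun_on, analytic_fun_on}" and b: "bihamiltonian R X A P1 P2"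
    "bihamiltonian.homogeneous R X A P1 P2" "m0 \<in> topspace X"
  have "regularity R smooth_family_on \<or> regularity R analytic_family_on"
    using R smooth_regularity analytic_regularity by auto
  then obtain RT where RT: "regularity R RT" by blast
  show "bihamiltonian.strictly_lenard_integrable R X A P1 P2 m0"
    by (rule regular_strictly_lenard_integrable[OF RT _ _ _ b, of Re]) (simp_all add: to_complex_real_def)
next
  fix X :: "'a topology" and A :: "('a, complex, 'n) chart set" and P1 P2 m0
  assume b: "bihamiltonian analytic_fun_on X A P1 P2"
    "bihamiltonian.homogeneous analytic_fun_on X A P1 P2" "m0 \<in> topspace X"
  show "bihamiltonian.strictly_lenard_integrable analytic_fun_on X A P1 P2 m0"
    by (rule regular_strictly_lenard_integrable[OF analytic_regularity _ _ _ b, of id]) (simp_all add: to_complex_complex_def)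
qed

end
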